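(* Let $L$ be a non-splittable link which admits a $\mathbb{Z}$-coloring $\gamma$ with exactly five colors (i.e., some diagram of $L$ carries a $\mathbb{Z}$-coloring whose image has cardinality $5$). Then $\mathrm{mincol}_{\mathbb{Z}}(L)=4$.
   Context: An arc of a regular link diagram $D$ is a maximal unbroken piece of the diagram. A $\mathbb{Z}$-coloring on $D$ is a map $\gamma:\{\text{arcs of } D\}\to\mathbb{Z}$ such that at each crossing with over arc $a$ and under arcs $b,c$ one has $2\gamma(a)=\gamma(b)+\gamma(c)$; it is trivial if all arcs get the same color. A link is $\mathbb{Z}$-colorable if some diagram of it admits a non-trivial $\mathbb{Z}$-coloring. For a $\mathbb{Z}$-colorable link $L$, $\mathrm{mincol}_{\mathbb{Z}}(L)$ is the minimum of $|\mathrm{Im}(\gamma)|$ over all non-trivial $\mathbb{Z}$-colorings $\gamma$ on all diagrams of $L$. *)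

theory Defs
  imports "HOL-Analysis.Analysis"
begin

(* Points of R^3, written (x, y, z).  Diagrams are projections to the (x,y)-plane,
   viewed from above: larger z means "over". *)
type_synonym pt = "real \<times> real \<times> real"

definition proj :: "pt \<Rightarrow> real \<times> real" where
  "proj p = (fst p, fst (snd p))"

definition height :: "pt \<Rightarrow> real" where
  "height p = snd (snd p)"

definition edge_pairs :: "pt list \<Rightarrow> (pt \<times> pt) list" where
  "edge_pairs ps = map (\<lambda>i. (ps ! i, ps ! (Suc i mod length ps))) [0..<length ps]"

definition edge_seg :: "pt list \<Rightarrow> nat \<Rightarrow> pt set" where
  "edge_seg ps i = closed_segment (ps ! i) (ps ! (Suc i mod length ps))"

definition simple_polygon :: "pt list \<Rightarrow> bool" where
  "simple_polygon ps \<longleftrightarrow> length ps \<ge> 3 \<and> distinct ps \<and>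
     (\<forall>i<length ps. \<forall>j<length ps. i \<noteq> j \<longrightarrow>
        edge_seg ps i \<inter> edge_seg ps j =
          (if j = Suc i mod length ps then {ps ! j}
           else if i = Suc j mod length ps then {ps ! i} else {}))"

definition polygon_set :: "pt list \<Rightarrow> pt set" where
  "polygon_set ps = (\<Union>i<length ps. edge_seg ps i)"

definition link_rep :: "pt list list \<Rightarrow> bool" where
  "link_rep Ps \<longleftrightarrow> Ps \<noteq> [] \<and> (\<forall>P\<in>set Ps. simple_polygon P) \<and>
     (\<forall>i<length Ps. \<forall>j<length Ps. i \<noteq> j \<longrightarrow> polygon_set (Ps ! i) \<inter> polygon_set (Ps ! j) = {})"

definition link_set :: "pt list list \<Rightarrow> pt set" where
  "link_set Ps = (\<Union>P\<in>set Ps. polygon_set P)"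

definition polygonal_link :: "pt set \<Rightarrow> bool" where
  "polygonal_link L \<longleftrightarrow> (\<exists>Ps. link_rep Ps \<and> L = link_set Ps)"

(* Reidemeister's elementary (Delta-) move; link type = equivalence under Delta-moves
   and their inverses (equivalent to ambient isotopy for tame links) *)
definition delta_move :: "pt set \<Rightarrow> pt set \<Rightarrow> bool" where
  "delta_move L L' \<longleftrightarrow> (\<exists>p q r. \<not> collinear {p, q, r} \<and>
      L \<inter> convex hull {p, q, r} = closed_segment p q \<and>
      L' = (L - open_segment p q) \<union> closed_segment p r \<union> closed_segment r q)"

definition link_equiv :: "pt set \<Rightarrow> pt set \<Rightarrow> bool" where
  "link_equiv L L' \<longleftrightarrow> (\<lambda>A B. delta_move A B \<or> delta_move B A)\<^sup>*\<^sup>* L L'"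

definition regular_rep :: "pt list list \<Rightarrow> bool" where
  "regular_rep Ps \<longleftrightarrow> link_rep Ps \<and>
     (let L = link_set Ps; V = (\<Union>P\<in>set Ps. set P); E = concat (map edge_pairs Ps) in
      (\<forall>a\<in>L. \<forall>b\<in>L. \<forall>c\<in>L. proj a = proj b \<and> proj b = proj c \<longrightarrow> a = b \<or> b = c \<or> a = c) \<and>
      (\<forall>a\<in>L. \<forall>b\<in>L. a \<noteq> b \<and> proj a = proj b \<longrightarrow>
          a \<notin> V \<and> b \<notin> V \<and>
          (\<forall>e1\<in>set E. \<forall>e2\<in>set E. a \<in> closed_segment (fst e1) (snd e1) \<and>
               b \<in> closed_segment (fst e2) (snd e2) \<longrightarrow>
             (let d1 = proj (snd e1) - proj (fst e1); d2 = proj (snd e2) - proj (fst e2) in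
              fst d1 * snd d2 - snd d1 * fst d2 \<noteq> 0))))"

definition regular_link :: "pt set \<Rightarrow> bool" where
  "regular_link D \<longleftrightarrow> (\<exists>Ps. regular_rep Ps \<and> D = link_set Ps)"

definition diagram_of :: "pt set \<Rightarrow> pt set \<Rightarrow> bool" where
  "diagram_of L D \<longleftrightarrow> link_equiv L D \<and> regular_link D"

definition under_points :: "pt set \<Rightarrow> pt set" where
  "under_points D = {u\<in>D. \<exists>w\<in>D. proj w = proj u \<and> height u < height w}"

definition arcs :: "pt set \<Rightarrow> pt set set" where
  "arcs D = components (D - under_points D)"

(* Z-coloring: at each crossing with over point w and under point u, the arc through w
   is a, the (one or two) arcs ending at u are b, c, and 2 gamma(a) = gamma(b) + gamma(c) *)
definition Zcoloring :: "pt set \<Rightarrow> (pt set \<Rightarrow> int) \<Rightarrow> bool" where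
  "Zcoloring D \<gamma> \<longleftrightarrow>
     (\<forall>w\<in>D. \<forall>u\<in>D. proj w = proj u \<and> height u < height w \<longrightarrow>
        (\<forall>a\<in>arcs D. w \<in> a \<longrightarrow>
           (\<exists>b c. 2 * \<gamma> a = b + c \<and> {b, c} = \<gamma> ` {B\<in>arcs D. u \<in> closure B})))"

definition nontrivial_coloring :: "pt set \<Rightarrow> (pt set \<Rightarrow> int) \<Rightarrow> bool" where
  "nontrivial_coloring D \<gamma> \<longleftrightarrow> (\<exists>a\<in>arcs D. \<exists>a'\<in>arcs D. \<gamma> a \<noteq> \<gamma> a')"

definition Zcolorable :: "pt set \<Rightarrow> bool" where
  "Zcolorable L \<longleftrightarrow> (\<exists>D \<gamma>. diagram_of L D \<and> Zcoloring D \<gamma> \<and> nontrivial_coloring D \<gamma>)"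

definition mincol_Z :: "pt set \<Rightarrow> nat" where
  "mincol_Z L = (LEAST n. \<exists>D \<gamma>. diagram_of L D \<and> Zcoloring D \<gamma> \<and>
                    nontrivial_coloring D \<gamma> \<and> card (\<gamma> ` arcs D) = n)"

definition splittable :: "pt set \<Rightarrow> bool" where
  "splittable L \<longleftrightarrow> (\<exists>L'. link_equiv L L' \<and> (\<forall>a\<in>L'. height a \<noteq> 0) \<and>
       (\<exists>a\<in>L'. height a < 0) \<and> (\<exists>a\<in>L'. height a > 0))"

end

(* A colouring is treated as a locally constant integer function on the non-under points of a
regular polygonal link.

Lower bound: with at most three colours, these are k - d, k, k + d, and the over strand at every
crossing with two or more colours is coloured k. Hence the strands coloured k lie above all
others and the link splits.

Upper bound: a "finger" pushes a steep triangle of a strand of colour k over the diagram and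
reflects the colours below it, x |-> 2k - x. Take a coloured diagram with a crossing of least
positive difference d. Fingers along a ray are Hurwitz moves on the colours that it meets, and
bring a strand of any congruent colour where it is wanted; minimality then forces all colours to
be congruent mod d, and one rescales to d = 1. As long as the colours span m..M with M - m >= 4,
fingers of colours M - 1 and M - 2 remove M, first at vertices and over points, then at
under points with over colour other than M - 1, then on the remaining straight pieces. A crossing
of difference 1 persists, so the colouring stays non-trivial. *)
theory Submission
  imports Defs
begin

text \<open>A finger is a single Delta-move, since a steep enough triangle has no part of the link
  above it. The result is coloured because x |-> 2k - x preserves 2a = b + c, and a change from x to
  2k - x is what the rule demands under a side of colour k. The span 4 comes from the colours used:
  reflection in M - 1 takes M to M - 2, reflection in M - 2 takes M to M - 4, which must be at least
  m. The difficulty is to have a strand of the right colour at the right place, as strands on the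
  way may be reflected out of the range. Two neighbours whose colours differ by the least difference
  d can be recoloured within their class mod d, and minimality of d passes this property on to the
  next strand in front. Pushing an over strand along its under strand erases their crossing. A
  crossing of difference 1 may be the last of its kind; so where M ends under M - 1, another strand,
  of colour M - 2, is pushed. Colours belong to points and not to arcs, since a move rearranges the
  arcs but changes the colours of points only within its triangle.\<close>

abbreviation cseg :: "'a::real_vector => 'a => 'a set" where "cseg \<equiv> closed_segment"

notation scaleR (infixr \<open>*.\<close> 75)

section \<open>Diagrams as sets of directed edges\<close>

definition cr :: "real \<times> real => real \<times> real => real" where
 "cr u v = fst u * snd v - snd u * fst v"

definition seg :: "pt \<times> pt => pt set" where
 "seg e = cseg (fst e) (snd e)"

definition lk :: "(pt \<times> pt) set => pt set" where
 "lk E = (\<Union>e\<in>E. seg e)"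

definition edges :: "pt list list => (pt \<times> pt) set" where
 "edges Ps = (\<Union>P\<in>set Ps. set (edge_pairs P))"

definition dir :: "pt \<times> pt => real \<times> real" where
 "dir e = proj (snd e) - proj (fst e)"

abbreviation ends :: "pt \<times> pt => pt set" where
 "ends e \<equiv> {fst e, snd e}"

text \<open>The conditions of \<open>regular_rep\<close> that depend on the edge set alone. Edges of
  the same and of different polygons are treated alike, and no cyclic order is mentioned, so a local
  change of the link can be checked edge by edge.\<close>

definition gen :: "(pt \<times> pt) set => bool" where
 "gen E \<longleftrightarrow>
 (\<forall>e\<in>E. \<forall>f\<in>E. e ~= f --> seg e \<inter> seg f \<subseteq> ends e \<inter> ends f) \<and>
 (\<forall>a\<in>lk E. \<forall>b\<in>lk E. \<forall>c\<in>lk E. proj a = proj b \<and> proj b = proj c --> a = b \<or> b = c \<or> a = c) \<and>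
 (\<forall>a\<in>lk E. \<forall>b\<in>lk E. a ~= b \<and> proj a = proj b --> a \<notin> fst ` E \<and> b \<notin> fst ` E \<and>
   (\<forall>e\<in>E. \<forall>f\<in>E. a \<in> seg e \<and> b \<in> seg f --> cr (dir e) (dir f) ~= 0))"

definition reg :: "(pt \<times> pt) set => bool" where
 "reg E \<longleftrightarrow> (\<exists>Ps. regular_rep Ps \<and> E = edges Ps)"

lemma edge_pairs_zip: "edge_pairs ps = zip ps (rotate1 ps)"
by (rule nth_equalityI) (auto simp: edge_pairs_def nth_rotate1)

lemma fst_edge_pairs: "fst ` set (edge_pairs ps) = set ps"
by (metis edge_pairs_zip length_rotate1 list.set_map map_fst_zip)

lemma snd_edge_pairs: "snd ` set (edge_pairs ps) = set ps"
by (metis edge_pairs_zip length_rotate1 list.set_map map_snd_zip set_rotate1)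

lemma inj_fst_edge_pairs: "distinct ps ==> inj_on fst (set (edge_pairs ps))"
by (metis distinct_map edge_pairs_zip length_rotate1 map_fst_zip)

lemma inj_snd_edge_pairs: "distinct ps ==> inj_on snd (set (edge_pairs ps))"
by (metis distinct_map edge_pairs_zip length_rotate1 map_snd_zip distinct1_rotate)

lemma polygon_set_edges: "polygon_set P = (\<Union>e\<in>set (edge_pairs P). seg e)"
by (auto simp: polygon_set_def edge_pairs_def seg_def edge_seg_def)

lemma link_set_edges: "link_set Ps = lk (edges Ps)"
by (auto simp: link_set_def lk_def edges_def polygon_set_edges)

text \<open>A 2-gon would be the exception; this is where the three vertices of a polygon
  matter.\<close>

lemma Suc_mod_Suc_mod_neq: "3 \<le> n ==> i < n ==> Suc (Suc i mod n) mod n ~= i"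
by (cases "Suc i < n"; cases "Suc (Suc i) < n") (auto simp: mod_if)

lemma pair_Int_pair:
 assumes "a ~= c" "b ~= d" "a = d \<longleftrightarrow> P" "b = c \<longleftrightarrow> Q" "Q ==> \<not> P"
 shows "{a, b} \<inter> {c, d} = (if Q then {c} else if P then {a} else {})"
using assms by auto

lemma pairs_disjoint: "a \<in> S ==> b \<in> S ==> c \<in> T ==> d \<in> T ==> S \<inter> T = {} ==> {a, b} \<inter> {c, d} = {}"
by auto

text \<open>With at least three distinct vertices, the exact intersections listed in
  \<open>simple_polygon\<close> by adjacency of indices are the sets of common end points. End
  points always lie on their edges, so one inclusion suffices.\<close>

lemma simple_polygon_iff:
 "simple_polygon P \<longleftrightarrow> 3 \<le> length P \<and> distinct P \<and>
 (\<forall>e\<in>set (edge_pairs P). \<forall>f\<in>set (edge_pairs P). e ~= f --> seg e \<inter> seg f \<subseteq> ends e \<inter> ends f)"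
proof (cases "3 \<le> length P \<and> distinct P")
case True
let ?n = "length P"
have n3: "3 \<le> ?n" and dP: "distinct P" using True by auto
note two = Suc_mod_Suc_mod_neq[OF n3]
have eq: "(edge_seg P i \<inter> edge_seg P j =
    (if j = Suc i mod ?n then {P ! j} else if i = Suc j mod ?n then {P ! i} else {})) \<longleftrightarrow>
  seg (P!i, P!(Suc i mod ?n)) \<inter> seg (P!j, P!(Suc j mod ?n)) \<subseteq> {P!i, P!(Suc i mod ?n)} \<inter> {P!j, P!(Suc j mod ?n)}"
 if ij: "i < ?n" "j < ?n" "i ~= j" for i j
proof -
 have lt: "Suc i mod ?n < ?n" "Suc j mod ?n < ?n" using n3 by (auto intro: mod_less_divisor)
 have ii: "Suc i mod ?n ~= i" "Suc j mod ?n ~= j" using ij n3 by (auto simp: mod_Suc split: if_splits)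
 have ne: "Suc i mod ?n ~= Suc j mod ?n" using ij by (auto simp: mod_Suc split: if_splits)
 have ds: "\<And>a b. a < ?n ==> b < ?n ==> P!a = P!b \<longleftrightarrow> a = b" using dP by (simp add: nth_eq_iff_index_eq)
 have in1: "P!i \<in> edge_seg P i" "P!j \<in> edge_seg P j" "P!(Suc i mod ?n) \<in> edge_seg P i" "P!(Suc j mod ?n) \<in> edge_seg P j"
  by (auto simp: edge_seg_def)
 have set: "{P!i, P!(Suc i mod ?n)} \<inter> {P!j, P!(Suc j mod ?n)} =
   (if j = Suc i mod ?n then {P ! j} else if i = Suc j mod ?n then {P ! i} else {})"
 proof -
  have "P!i ~= P!j" "P!(Suc i mod ?n) ~= P!(Suc j mod ?n)" "P!i = P!(Suc j mod ?n) \<longleftrightarrow> i = Suc j mod ?n"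
   "P!(Suc i mod ?n) = P!j \<longleftrightarrow> j = Suc i mod ?n" using ds ij lt ne by auto
  moreover have "j = Suc i mod ?n ==> i ~= Suc j mod ?n" using two[OF ij(1)] by metis
  ultimately show ?thesis by (rule pair_Int_pair)
 qed
 show ?thesis unfolding seg_def fst_conv snd_conv edge_seg_def[symmetric] set
  using in1 by (auto split: if_splits)
qed
have ep: "set (edge_pairs P) = (\<lambda>i. (P!i, P!(Suc i mod ?n))) ` {..<?n}" by (auto simp: edge_pairs_def)
have inj: "\<And>i j. i < ?n ==> j < ?n ==> (P!i, P!(Suc i mod ?n)) ~= (P!j, P!(Suc j mod ?n)) \<longleftrightarrow> i ~= j"
 using dP by (auto simp: nth_eq_iff_index_eq)
have "(\<forall>i<?n. \<forall>j<?n. i ~= j -->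
   edge_seg P i \<inter> edge_seg P j =
    (if j = Suc i mod ?n then {P ! j}
     else if i = Suc j mod ?n then {P ! i} else {})) \<longleftrightarrow>
  (\<forall>i<?n. \<forall>j<?n. i ~= j --> seg (P!i, P!(Suc i mod ?n)) \<inter> seg (P!j, P!(Suc j mod ?n)) \<subseteq> {P!i, P!(Suc i mod ?n)} \<inter> {P!j, P!(Suc j mod ?n)})"
 using eq by blast
also have "\<dots> \<longleftrightarrow> (\<forall>e\<in>set (edge_pairs P). \<forall>f\<in>set (edge_pairs P). e ~= f --> seg e \<inter> seg f \<subseteq> ends e \<inter> ends f)"
proof -
 have "(\<forall>e\<in>F ` {..<n}. \<forall>f\<in>F ` {..<n}. e ~= f --> S e f) \<longleftrightarrow> (\<forall>i<n. \<forall>j<n. i ~= j --> S (F i) (F j))"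
  if "\<And>i j. i < n ==> j < n ==> F i ~= F j \<longleftrightarrow> i ~= j" for F :: "nat => pt \<times> pt" and n S
  using that by auto
 from this[OF inj, where S="\<lambda>e f. seg e \<inter> seg f \<subseteq> ends e \<inter> ends f"] show ?thesis unfolding ep by simp
qed
finally show ?thesis using True unfolding simple_polygon_def by blast
qed (auto simp: simple_polygon_def)

text \<open>Disjoint polygons become distinct vertices of the concatenated list: edges meet only in
  common end points, so polygons without a common vertex do not meet at all.\<close>

lemma regular_rep_gen:
 "regular_rep Ps \<longleftrightarrow> Ps ~= [] \<and> (\<forall>P\<in>set Ps. 3 \<le> length P) \<and> distinct (concat Ps) \<and> gen (edges Ps)"
proof -
have V: "(\<Union>P\<in>set Ps. set P) = fst ` edges Ps"
 by (auto simp: edges_def image_UN fst_edge_pairs)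
have cc: "set (concat (map edge_pairs Ps)) = edges Ps" by (auto simp: edges_def)
have A: "regular_rep Ps \<longleftrightarrow> link_rep Ps \<and>
  (\<forall>a\<in>lk (edges Ps). \<forall>b\<in>lk (edges Ps). \<forall>c\<in>lk (edges Ps). proj a = proj b \<and> proj b = proj c --> a = b \<or> b = c \<or> a = c) \<and>
 (\<forall>a\<in>lk (edges Ps). \<forall>b\<in>lk (edges Ps). a ~= b \<and> proj a = proj b --> a \<notin> fst ` edges Ps \<and> b \<notin> fst ` edges Ps \<and>
   (\<forall>e\<in>edges Ps. \<forall>f\<in>edges Ps. a \<in> seg e \<and> b \<in> seg f --> cr (dir e) (dir f) ~= 0))"
 unfolding regular_rep_def Let_def V cc link_set_edges seg_def[symmetric] dir_def[symmetric] cr_def[symmetric] ..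
have B: "link_rep Ps \<longleftrightarrow> Ps ~= [] \<and> (\<forall>P\<in>set Ps. 3 \<le> length P) \<and> distinct (concat Ps) \<and>
  (\<forall>e\<in>edges Ps. \<forall>f\<in>edges Ps. e ~= f --> seg e \<inter> seg f \<subseteq> ends e \<inter> ends f)" (is "?L = ?R")
proof
 assume L: ?L
 have sp: "\<And>P. P \<in> set Ps ==> simple_polygon P" using L by (auto simp: link_rep_def)
 have dj: "polygon_set P \<inter> polygon_set Q = {}" if "P \<in> set Ps" "Q \<in> set Ps" "P ~= Q" for P Q
 proof -
  obtain i j where "i < length Ps" "j < length Ps" "P = Ps!i" "Q = Ps!j" using \<open>P \<in> set Ps\<close> \<open>Q \<in> set Ps\<close>
   unfolding in_set_conv_nth by blast
  thus ?thesis using L \<open>P ~= Q\<close> unfolding link_rep_def by blast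
 qed
 have sub: "set P \<subseteq> polygon_set P" for P
  unfolding polygon_set_edges fst_edge_pairs[symmetric] by (auto simp: seg_def)
 have "i = j" if "i < length Ps" "j < length Ps" "Ps!i = Ps!j" for i j
 proof (rule ccontr)
  assume "i ~= j"
  hence "polygon_set (Ps!i) = {}" using L that unfolding link_rep_def by (metis Int_absorb)
  moreover have "set (Ps!i) ~= {}" using sp[of "Ps!i"] that by (auto simp: simple_polygon_def)
  ultimately show False using sub[of "Ps!i"] by auto
 qed
 hence "distinct Ps" by (auto simp: distinct_conv_nth)
 moreover have "\<And>P Q. P \<in> set Ps ==> Q \<in> set Ps ==> P ~= Q ==> set P \<inter> set Q = {}" using dj sub by blast
 ultimately have "distinct (concat Ps)" using sp by (intro distinct_concat) (auto simp: simple_polygon_def)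
 moreover have "seg e \<inter> seg f \<subseteq> ends e \<inter> ends f" if ef: "e \<in> edges Ps" "f \<in> edges Ps" "e ~= f" for e f
 proof -
  obtain P Q where PQ: "P \<in> set Ps" "e \<in> set (edge_pairs P)" "Q \<in> set Ps" "f \<in> set (edge_pairs Q)"
   using ef by (auto simp: edges_def)
  show ?thesis
  proof (cases "P = Q")
   case True thus ?thesis using sp[OF PQ(1)] PQ ef(3) unfolding simple_polygon_iff by blast
  next
   case False
   hence "seg e \<inter> seg f = {}" using dj[OF PQ(1,3) False] PQ unfolding polygon_set_edges by blast
   thus ?thesis by blast
  qed
 qed
 ultimately show ?R using L sp by (auto simp: link_rep_def simple_polygon_def)
next
 assume R: ?R
 have R4: "\<And>e f. e \<in> edges Ps ==> f \<in> edges Ps ==> e ~= f ==> seg e \<inter> seg f \<subseteq> ends e \<inter> ends f"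
  using R by auto
 have dc: "distinct (concat Ps)" and l3: "\<And>P. P \<in> set Ps ==> 3 \<le> length P" using R by auto
 have sp: "simple_polygon P" if "P \<in> set Ps" for P
  unfolding simple_polygon_iff using R that l3[OF that] dc
  by (auto simp: distinct_concat_iff edges_def)
 have dj: "polygon_set (Ps!i) \<inter> polygon_set (Ps!j) = {}" if ij: "i < length Ps" "j < length Ps" "i ~= j" for i j
 proof -
  have ne: "[] \<notin> set Ps" using l3 by fastforce
  have "distinct Ps" using dc ne by (simp add: distinct_concat_iff)
  hence "Ps!i ~= Ps!j" using ij by (simp add: nth_eq_iff_index_eq)
  hence dd: "set (Ps!i) \<inter> set (Ps!j) = {}" using dc ij by (metis distinct_concat_iff nth_mem)
  have "seg e \<inter> seg f = {}" if "e \<in> set (edge_pairs (Ps!i))" "f \<in> set (edge_pairs (Ps!j))" for e f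
  proof -
   have m: "e \<in> edges Ps" "f \<in> edges Ps" using that ij by (auto simp: edges_def)
   have "fst e \<in> set (Ps!i)" "snd e \<in> set (Ps!i)" "fst f \<in> set (Ps!j)" "snd f \<in> set (Ps!j)"
    using that fst_edge_pairs snd_edge_pairs by blast+
   from pairs_disjoint[OF this dd] have "ends e \<inter> ends f = {}" .
   moreover have "e ~= f" using calculation by (metis Int_absorb insert_not_empty)
   ultimately show ?thesis using R4[OF m] by blast
  qed
  thus ?thesis unfolding polygon_set_edges by blast
 qed
 show ?L unfolding link_rep_def using sp dj R by blast
qed
show ?thesis unfolding A B gen_def by blast
qed

lemma reg_finite: "reg E ==> finite E"
 and reg_gen: "reg E ==> gen E"
by (auto simp: reg_def edges_def regular_rep_gen[of Ps for Ps])

lemma regular_link_reg: "regular_link D \<longleftrightarrow> (\<exists>E. reg E \<and> D = lk E)"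
by (auto simp: reg_def regular_link_def link_set_edges)

text \<open>What the cyclic lists contribute beyond \<open>gen\<close>. Apart from
  \<open>reg_detour\<close>, everything later works with the edge set, through these facts,
  \<open>gen\<close> and finiteness.\<close>

lemma reg_verts:
 assumes "reg E"
 shows "E ~= {}" "inj_on fst E" "inj_on snd E" "snd ` E = fst ` E" "\<And>e. e \<in> E ==> fst e ~= snd e"
 "\<And>e. e \<in> E ==> prod.swap e \<notin> E"
proof -
obtain Ps where Ps: "regular_rep Ps" and E: "E = edges Ps" using assms by (auto simp: reg_def)
have R: "Ps ~= []" "\<And>P. P \<in> set Ps ==> 3 \<le> length P" "distinct (concat Ps)"
 using Ps by (auto simp: regular_rep_gen)
have d: "\<And>P. P \<in> set Ps ==> distinct P" and dd: "\<And>P Q. P \<in> set Ps ==> Q \<in> set Ps ==> P ~= Q ==> set P \<inter> set Q = {}"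
 using R(3) by (auto simp: distinct_concat_iff)
have fi: "\<And>e P. e \<in> set (edge_pairs P) ==> fst e \<in> set P \<and> snd e \<in> set P" using fst_edge_pairs snd_edge_pairs by blast
show "E ~= {}" using R(1,2) unfolding E edges_def edge_pairs_def by (cases Ps) force+
show "snd ` E = fst ` E" unfolding E edges_def image_UN fst_edge_pairs snd_edge_pairs ..
show "inj_on fst E"
proof (rule inj_onI)
 fix e f assume "e \<in> E" "f \<in> E" "fst e = fst f"
 thus "e = f" unfolding E edges_def using fi dd inj_fst_edge_pairs[OF d] by (smt (verit, best) UN_E disjoint_iff inj_onD)
qed
show "inj_on snd E"
proof (rule inj_onI)
 fix e f assume "e \<in> E" "f \<in> E" "snd e = snd f"
 thus "e = f" unfolding E edges_def using fi dd inj_snd_edge_pairs[OF d] by (smt (verit, best) UN_E disjoint_iff inj_onD)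
qed
have idx: "\<exists>P\<in>set Ps. \<exists>i<length P. e = (P!i, P!(Suc i mod length P))" if "e \<in> E" for e
proof -
 have "\<exists>P\<in>set Ps. e \<in> set (edge_pairs P)" using that E unfolding edges_def by blast
 then obtain P where P: "P \<in> set Ps" "e \<in> set (edge_pairs P)" by blast
 hence "\<exists>i<length P. e = (P!i, P!(Suc i mod length P))" by (auto simp: edge_pairs_def)
 thus ?thesis using P by blast
qed
show "fst e ~= snd e" if e: "e \<in> E" for e
proof -
 obtain P i where P: "P \<in> set Ps" "i < length P" "e = (P!i, P!(Suc i mod length P))" using idx[OF e] by blast
 have "Suc i mod length P ~= i" "Suc i mod length P < length P" using P R(2)[OF P(1)] by (auto simp: mod_if split: if_splits)
 thus ?thesis using P d[OF P(1)] by (auto simp: nth_eq_iff_index_eq)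
qed
show "prod.swap e \<notin> E" if e: "e \<in> E" for e
proof
 assume s: "prod.swap e \<in> E"
 obtain P i where P: "P \<in> set Ps" "i < length P" "e = (P!i, P!(Suc i mod length P))" using idx[OF e] by blast
 obtain Q j where Q: "Q \<in> set Ps" "j < length Q" "prod.swap e = (Q!j, Q!(Suc j mod length Q))" using idx[OF s] by blast
 have l: "3 \<le> length P" using R(2) P by auto
 have m: "Suc i mod length P < length P" using P l by (auto intro: mod_less_divisor)
 have "P!(Suc i mod length P) = Q!j" using P Q by auto
 hence PQ: "P = Q" using dd P Q m by (metis disjoint_iff nth_mem)
 hence j: "j = Suc i mod length P" using P Q m d[OF P(1)] by (auto simp: nth_eq_iff_index_eq)
 have m2: "Suc j mod length P < length P" using P l by (auto intro: mod_less_divisor)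
 have "P!(Suc j mod length P) = P!i" using P(3) Q(3) PQ by simp
 hence "Suc j mod length P = i" using P(2) m2 d[OF P(1)] by (simp add: nth_eq_iff_index_eq)
 thus False using j Suc_mod_Suc_mod_neq[OF l P(2)] by simp
qed
qed

definition detour :: "(pt \<times> pt) set => pt => pt => pt => pt => pt => (pt \<times> pt) set" where
 "detour E A B p r q = (E - {(A, B)}) \<union> {(A, p), (p, r), (r, q), (q, B)}"

lemma zip_rotate1: "length xs = length ys ==> zip (rotate1 xs) (rotate1 ys) = rotate1 (zip xs ys)"
by (cases xs; cases ys) auto

lemma edge_pairs_rotate: "set (edge_pairs (rotate n ps)) = set (edge_pairs ps)"
proof (induction n)
case (Suc n)
have "set (edge_pairs (rotate1 xs)) = set (edge_pairs xs)" for xs :: "pt list"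
 using zip_rotate1[of xs "rotate1 xs"] by (simp add: edge_pairs_zip)
thus ?case using Suc by simp
qed simp

lemma edge_pairs_append:
 assumes d: "distinct (xs @ [p, r, q])" and ne: "2 \<le> length xs"
 shows "set (edge_pairs (xs @ [p, r, q])) = detour (set (edge_pairs xs)) (last xs) (hd xs) p r q"
proof -
obtain ys A where xs: "xs = ys @ [A]" using ne by (cases xs rule: rev_cases) auto
obtain B zs where ys: "ys = B # zs" using ne xs by (cases ys) auto
have z: "zip (xs @ w) (rotate1 (xs @ w)) = zip ys (zs @ [A]) @ zip (A # w) (w @ [B])" for w
 using zip_append[of "B # zs" "zs @ [A]" "A # w" "w @ [B]"] unfolding xs ys by simp
have 1: "edge_pairs xs = zip ys (zs @ [A]) @ [(A, B)]" using z[of "[]"] by (simp add: edge_pairs_zip)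
have 2: "edge_pairs (xs @ [p, r, q]) = zip ys (zs @ [A]) @ [(A, p), (p, r), (r, q), (q, B)]"
 using z[of "[p, r, q]"] by (simp add: edge_pairs_zip)
have "(A, B) \<notin> set (zip ys (zs @ [A]))" using d xs by (auto dest: set_zip_leftD)
thus ?thesis unfolding 1 2 detour_def by (auto simp: xs ys)
qed

text \<open>A cyclic list may be rotated so that \<open>B\<close> comes first and \<open>A\<close>
  last; then the detour just appends \<open>p\<close>, \<open>r\<close>, \<open>q\<close> to it.
  General position of the new edges has to be supplied by the caller.\<close>

lemma reg_detour:
 assumes r: "reg E" and AB: "(A, B) \<in> E" and d: "distinct [p, r, q]" "p \<notin> fst ` E" "r \<notin> fst ` E" "q \<notin> fst ` E"
 and g: "gen (detour E A B p r q)"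
 shows "reg (detour E A B p r q)"
proof -
obtain Ps where Ps: "regular_rep Ps" and E: "E = edges Ps" using r by (auto simp: reg_def)
have R: "Ps ~= []" "\<And>P. P \<in> set Ps ==> 3 \<le> length P" "distinct (concat Ps)"
 using Ps by (auto simp: regular_rep_gen)
obtain P where P: "P \<in> set Ps" "(A, B) \<in> set (edge_pairs P)" using AB E by (auto simp: edges_def)
obtain i where i: "i < length P" "A = P!i" "B = P!(Suc i mod length P)" using P by (auto simp: edge_pairs_def)
obtain us ws where Psu: "Ps = us @ P # ws" using P(1) by (meson split_list)
define xs where "xs = rotate (Suc i) P"
have lx: "3 \<le> length xs" using R(2)[OF P(1)] by (simp add: xs_def)
have nx: "xs ! j = P ! ((Suc i + j) mod length P)" if "j < length P" for j using that unfolding xs_def using nth_rotate[OF that, of "Suc i"] by (simp add: add.commute)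
have P0: "P ~= []" using i by auto
have B: "hd xs = B" using nx[of 0] i lx P0 by (simp add: hd_conv_nth xs_def)
have "Suc i + (length P - 1) = i + length P" using P0 by (cases P) auto
hence "(Suc i + (length P - 1)) mod length P = i" using i by simp
hence A: "last xs = A" using nx[of "length P - 1"] i P0 by (simp add: last_conv_nth xs_def)
have dP: "distinct xs" using R(3) P(1) by (auto simp: xs_def distinct_concat_iff)
have sx: "set xs = set P" by (simp add: xs_def)
have Vn: "x \<notin> fst ` E ==> Q \<in> set Ps ==> x \<notin> set Q" for x Q
 unfolding E edges_def by (metis UN_I fst_edge_pairs image_UN)
have dx: "distinct (xs @ [p, r, q])" using dP d Vn[OF _ P(1)] sx by auto
have ex: "set (edge_pairs (xs @ [p, r, q])) = detour (set (edge_pairs P)) A B p r q"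
 using edge_pairs_append[OF dx] lx A B edge_pairs_rotate[of "Suc i" P, folded xs_def] by simp
let ?Qs = "us @ (xs @ [p, r, q]) # ws"
have un: "Q \<in> set us \<union> set ws ==> (A, B) \<notin> set (edge_pairs Q)" for Q
proof
 assume Q: "Q \<in> set us \<union> set ws" "(A, B) \<in> set (edge_pairs Q)"
 hence "A \<in> set Q" by (metis fst_conv fst_edge_pairs image_eqI)
 moreover have "A \<in> set P" using i by simp
 ultimately show False using R(3) Q(1) unfolding Psu by auto
qed
have "edges ?Qs = detour E A B p r q"
 unfolding E edges_def Psu using un ex by (auto simp: detour_def)
moreover have "distinct (concat ?Qs)"
 using R(3) dx sx Vn d unfolding Psu by (auto simp: xs_def)
moreover have "\<forall>Q\<in>set ?Qs. 3 \<le> length Q" using R(2) lx unfolding Psu by auto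
ultimately show ?thesis unfolding reg_def using g regular_rep_gen[of ?Qs] by (metis append_is_Nil_conv list.discI)
qed

section \<open>Projection to the plane and the shape of the link near a point\<close>

abbreviation "simple E x \<equiv> \<forall>y\<in>lk E. proj y = proj x --> y = x"

abbreviation "along x v \<equiv> filtermap (\<lambda>t::real. x + t *. v) (at 0)"

abbreviation "und E \<equiv> under_points (lk E)"

lemma proj_simps [simp]:
 "proj (a + b) = proj a + proj b" "proj (a - b) = proj a - proj b" "proj (s *. a) = s *. proj a" "proj (- a) = - proj a" "proj 0 = 0"
 "height (a + b) = height a + height b" "height (a - b) = height a - height b" "height (s *. a) = s * height a"
by (simp_all add: proj_def height_def zero_prod_def)

lemma pt_eq_iff: "x = y \<longleftrightarrow> proj x = proj y \<and> height x = height y"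
by (auto simp: proj_def height_def prod_eq_iff)

lemma continuous_on_proj [continuous_intros]: "continuous_on S f ==> continuous_on S (\<lambda>x. proj (f x))"
unfolding proj_def by (intro continuous_intros)

lemma continuous_on_height [continuous_intros]: "continuous_on S f ==> continuous_on S (\<lambda>x. height (f x))"
unfolding height_def by (intro continuous_intros)

lemma tendsto_proj [tendsto_intros]: "(f \<longlongrightarrow> l) F ==> ((\<lambda>x. proj (f x)) \<longlongrightarrow> proj l) F"
unfolding proj_def by (intro tendsto_intros)

lemma cr_simps [simp]:
 "cr (a + b) c = cr a c + cr b c" "cr (a - b) c = cr a c - cr b c" "cr (s *. a) c = s * cr a c" "cr (- a) c = - cr a c"
 "cr c (a + b) = cr c a + cr c b" "cr c (a - b) = cr c a - cr c b" "cr c (s *. a) = s * cr c a" "cr c (- a) = - cr c a"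
 "cr a a = 0" "cr 0 a = 0" "cr a 0 = 0"
by (simp_all add: cr_def algebra_simps)

lemma cr_swap: "cr a b = - cr b a" by (simp add: cr_def)

lemma cr_eq0_iff: "v ~= 0 ==> cr u v = 0 \<longleftrightarrow> (\<exists>s. u = s *. v)"
proof
assume v: "v ~= 0" and c: "cr u v = 0"
\<comment> \<open>The coefficient of the orthogonal projection of \<open>u\<close> to the line of
  \<open>v\<close>.\<close>
let ?s = "(fst u * fst v + snd u * snd v) / (fst v * fst v + snd v * snd v)"
have n: "fst v * fst v + snd v * snd v ~= 0" using v by (auto simp: prod_eq_iff sum_squares_eq_zero_iff)
have "u = ?s *. v" using c n
 by (simp add: prod_eq_iff cr_def field_simps)
thus "\<exists>s. u = s *. v" ..
qed auto

definition at_edge :: "pt \<times> pt => real => pt" where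
 "at_edge e s = fst e + s *. (snd e - fst e)"

lemma seg_at_edge: "seg e = at_edge e ` {0..1}"
unfolding seg_def at_edge_def closed_segment_def
by (auto simp: algebra_simps image_iff intro!: bexI)

lemma in_seg_iff: "x \<in> seg e \<longleftrightarrow> (\<exists>s. 0 \<le> s \<and> s \<le> 1 \<and> x = at_edge e s)"
unfolding seg_at_edge by auto

lemma proj_at_edge: "proj (at_edge e s) = proj (fst e) + s *. dir e"
by (simp add: at_edge_def dir_def)

lemma at_edge_01 [simp]: "at_edge e 0 = fst e" "at_edge e 1 = snd e"
by (simp_all add: at_edge_def)

lemma ends_in_seg [simp]: "fst e \<in> seg e" "snd e \<in> seg e"
by (auto simp: seg_def)

lemma seg_lk: "e \<in> E ==> x \<in> seg e ==> x \<in> lk E"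
by (auto simp: lk_def)

lemma lkE: "x \<in> lk E ==> (\<And>e. e \<in> E ==> x \<in> seg e ==> P) ==> P"
by (auto simp: lk_def)

lemma compact_lk: "reg E ==> compact (lk E)"
unfolding lk_def seg_def by (auto intro!: compact_UN reg_finite)

lemma closed_lk: "reg E ==> closed (lk E)"
using compact_lk compact_imp_closed by blast

context
 fixes E assumes R: "reg E"
begin

lemma ends_V: "e \<in> E ==> fst e \<in> fst ` E" "e \<in> E ==> snd e \<in> fst ` E"
using reg_verts(4)[OF R] by blast+

lemma gen_seg: "e \<in> E ==> f \<in> E ==> e ~= f ==> x \<in> seg e ==> x \<in> seg f ==> x \<in> ends e \<and> x \<in> ends f"
using reg_gen[OF R] unfolding gen_def by blast

lemma gen_triple: "a \<in> lk E ==> b \<in> lk E ==> c \<in> lk E ==> proj a = proj b ==> proj b = proj c ==> a = b \<or> b = c \<or> a = c"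
using reg_gen[OF R] unfolding gen_def by blast

lemma gen_cross: "a \<in> lk E ==> b \<in> lk E ==> a ~= b ==> proj a = proj b ==> a \<notin> fst ` E \<and> b \<notin> fst ` E"
using reg_gen[OF R] unfolding gen_def by blast

lemma gen_trans: "a ~= b ==> proj a = proj b ==> e \<in> E ==> f \<in> E ==> a \<in> seg e ==> b \<in> seg f ==> cr (dir e) (dir f) ~= 0"
using reg_gen[OF R] seg_lk unfolding gen_def by blast

lemma dir_nz: assumes e: "e \<in> E" shows "dir e ~= 0"
proof
assume "dir e = 0"
hence "proj (fst e) = proj (snd e)" by (simp add: dir_def)
thus False using gen_cross[of "fst e" "snd e"] e seg_lk ends_in_seg ends_V reg_verts(5)[OF R] by blast
qed

lemma edge_vec_nz: "e \<in> E ==> snd e - fst e ~= 0"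
using dir_nz[of e] by (auto simp: dir_def)

lemma at_edge_inj: "e \<in> E ==> proj (at_edge e s) = proj (at_edge e t) ==> s = t"
using dir_nz[of e] by (simp add: proj_at_edge)

lemma seg_proj_inj: "e \<in> E ==> x \<in> seg e ==> y \<in> seg e ==> proj x = proj y ==> x = y"
unfolding in_seg_iff using at_edge_inj by metis

lemma nonvertex_edge: "x \<in> lk E ==> x \<notin> fst ` E ==> \<exists>!e. e \<in> E \<and> x \<in> seg e"
proof -
assume x: "x \<in> lk E" "x \<notin> fst ` E"
obtain e where e: "e \<in> E" "x \<in> seg e" using x(1) by (rule lkE)
have "f = e" if f: "f \<in> E" "x \<in> seg f" for f
proof (rule ccontr)
 assume "f ~= e"
 hence "x \<in> ends e" using gen_seg[OF f(1) e(1)] f(2) e(2) by blast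
 thus False using x(2) ends_V[OF e(1)] by (metis insertE singletonD)
qed
thus ?thesis using e by blast
qed

lemma nonvertex_param:
 assumes "e \<in> E" "x \<in> seg e" "x \<notin> fst ` E" obtains s where "0 < s" "s < 1" "x = at_edge e s"
proof -
obtain s where s: "0 \<le> s" "s \<le> 1" "x = at_edge e s" using assms(2) in_seg_iff by blast
have "s ~= 0" "s ~= 1" using s assms ends_V[OF assms(1)] by (metis at_edge_01)+
thus ?thesis using s that[of s] by simp
qed

text \<open>Finitely many edges miss \<open>x\<close>, and being closed they miss a neighbourhood of
  it.\<close>

lemma star_near:
 assumes "x \<in> lk E" shows "\<forall>\<^sub>F y in nhds x. y \<in> lk E --> (\<exists>e\<in>E. x \<in> seg e \<and> y \<in> seg e)"
proof -
have "\<forall>\<^sub>F y in nhds x. \<forall>e\<in>{e\<in>E. x \<notin> seg e}. y \<notin> seg e"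
proof (rule eventually_ball_finite)
 show "finite {e\<in>E. x \<notin> seg e}" using reg_finite[OF R] by simp
 have "\<forall>\<^sub>F y in nhds x. y \<in> - seg e" if "x \<notin> seg e" for e
  by (rule eventually_nhds_in_open) (use that in \<open>auto simp: seg_def\<close>)
 thus "\<forall>e\<in>{e\<in>E. x \<notin> seg e}. \<forall>\<^sub>F y in nhds x. y \<notin> seg e" by simp
qed
thus ?thesis
proof eventually_elim
 case (elim y)
 show ?case by (metis (mono_tags, lifting) elim lkE mem_Collect_eq)
qed
qed

text \<open>Near an interior point of an edge the link is that edge. Local statements about colours
  thereby become statements about a real parameter tending to 0.\<close>

lemma at_within_edge:
 assumes e: "e \<in> E" "x \<in> seg e" and nv: "x \<notin> fst ` E"
 shows "at x within lk E = along x (snd e - fst e)"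
proof -
define v where "v = snd e - fst e"
have v: "v ~= 0" using edge_vec_nz e by (simp add: v_def)
obtain s where s: "0 < s" "s < 1" "x = at_edge e s" using nonvertex_param e nv by blast
have xt: "x + t *. v = at_edge e (s + t)" for t by (simp add: s at_edge_def v_def algebra_simps)
have "filterlim (\<lambda>t. x + t *. v) (at x within lk E) (at 0)"
 unfolding filterlim_at
proof
 have "\<forall>\<^sub>F t in at 0. t \<in> {-s<..<1-s}"
  by (rule eventually_at_in_open') (use s in auto)
 moreover have "\<forall>\<^sub>F t in at (0::real). t ~= 0" by (simp add: eventually_at_filter)
 ultimately show "\<forall>\<^sub>F t in at 0. x + t *. v \<in> lk E \<and> x + t *. v ~= x"
 proof eventually_elim
  case (elim t)
  have "at_edge e (s + t) \<in> seg e" unfolding seg_at_edge using elim by auto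
  thus ?case using elim v seg_lk[OF e(1)] unfolding xt[symmetric] by auto
 qed
 show "((\<lambda>t. x + t *. v) \<longlongrightarrow> x) (at 0)" by (auto intro!: tendsto_eq_intros)
qed
hence 1: "along x v \<le> at x within lk E" by (simp add: filterlim_def)
have 2: "at x within lk E \<le> along x v"
proof (rule filter_leI)
 fix P assume "\<forall>\<^sub>F y in along x v. P y"
 then obtain d where d: "d > 0" "\<And>t. t ~= 0 ==> \<bar>t\<bar> < d ==> P (x + t *. v)"
  unfolding eventually_filtermap eventually_at by (auto simp: dist_real_def)
 have "\<forall>\<^sub>F y in nhds x. y \<in> ball x (d * norm v)" by (rule eventually_nhds_in_open) (use d v in auto)
 hence "\<forall>\<^sub>F y in nhds x. y ~= x --> y \<in> lk E --> P y"
  using star_near[OF seg_lk[OF e]]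
 proof eventually_elim
  case (elim y)
  show ?case
  proof (intro impI)
   assume y: "y ~= x" "y \<in> lk E"
   then obtain f where f: "f \<in> E" "x \<in> seg f" "y \<in> seg f" using elim by auto
   hence "f = e" using nonvertex_edge[of x] nv e seg_lk by blast
   then obtain t where t: "y = at_edge e t" using f in_seg_iff by blast
   have yx: "y = x + (t - s) *. v" unfolding xt t by simp
   have "dist x y = \<bar>t - s\<bar> * norm v" unfolding yx by (simp add: dist_norm)
   hence "\<bar>t - s\<bar> < d" using elim v by simp
   moreover have "t - s ~= 0" using y yx by auto
   ultimately show "P y" using d yx by simp
  qed
 qed
 thus "\<forall>\<^sub>F y in at x within lk E. P y" unfolding eventually_at_filter .
qed
show ?thesis unfolding v_def[symmetric] using 1 2 by (rule antisym[rotated])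
qed

text \<open>Transversality: the lines of two crossing edges meet in one point of the plane, so each
  of the finitely many pairs of edges has at most one crossing.\<close>

lemma finite_double: "finite {x \<in> lk E. \<exists>y\<in>lk E. y ~= x \<and> proj y = proj x}"
proof -
have "finite {x \<in> seg e. \<exists>y\<in>seg f. y ~= x \<and> proj y = proj x}" (is "finite ?S") if ef: "e \<in> E" "f \<in> E" for e f
proof -
 have "x = x'" if xx: "x \<in> ?S" "x' \<in> ?S" for x x'
 proof -
  obtain y y' where y: "y \<in> seg f" "y ~= x" "proj y = proj x" "y' \<in> seg f" "y' ~= x'" "proj y' = proj x'" using xx by blast
  have c: "cr (dir e) (dir f) ~= 0" using gen_trans[of x y e f] y xx ef by fastforce
  obtain s s' where s: "x = at_edge e s" "x' = at_edge e s'" using xx in_seg_iff by blast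
  obtain t t' where t: "y = at_edge f t" "y' = at_edge f t'" using y in_seg_iff by blast
  have "(s - s') *. dir e = proj y - proj y'" using y(3,6) s by (simp add: proj_at_edge algebra_simps)
  also have "\<dots> = (t - t') *. dir f" using t by (simp add: proj_at_edge algebra_simps)
  finally have "(s - s') *. dir e = (t - t') *. dir f" .
  hence "cr ((s - s') *. dir e) (dir f) = cr ((t - t') *. dir f) (dir f)" by simp
  hence "s = s'" using c by simp
  thus "x = x'" using s by simp
 qed
 hence "?S \<subseteq> {SOME x. x \<in> ?S}" by (metis (no_types, lifting) singletonI someI_ex subsetI)
 thus ?thesis using finite_subset by blast
qed
hence "finite (\<Union>e\<in>E. \<Union>f\<in>E. {x \<in> seg e. \<exists>y\<in>seg f. y ~= x \<and> proj y = proj x})"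
 using reg_finite[OF R] by blast
moreover have "{x \<in> lk E. \<exists>y\<in>lk E. y ~= x \<and> proj y = proj x} \<subseteq> (\<Union>e\<in>E. \<Union>f\<in>E. {x \<in> seg e. \<exists>y\<in>seg f. y ~= x \<and> proj y = proj x})"
 unfolding lk_def by blast
ultimately show ?thesis using finite_subset by blast
qed

lemma finite_under: "finite (und E)"
proof (rule finite_subset[OF _ finite_double], rule subsetI)
fix u assume "u \<in> und E"
then obtain w where "u \<in> lk E" "w \<in> lk E" "proj w = proj u" "height u < height w" unfolding under_points_def by blast
moreover from this have "w ~= u" by blast
ultimately show "u \<in> {x \<in> lk E. \<exists>y\<in>lk E. y ~= x \<and> proj y = proj x}" by blast
qed

lemma under_nonvertex: "u \<in> und E ==> u \<notin> fst ` E"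
using gen_cross[of u] unfolding under_points_def by fastforce

end

section \<open>Colourings of points versus colourings of arcs\<close>

definition ov :: "pt set => pt => pt => bool" where
 "ov D u w \<longleftrightarrow> u \<in> D \<and> w \<in> D \<and> proj w = proj u \<and> height u < height w"

lemma under_ov: "under_points D = {u. \<exists>w. ov D u w}"
by (auto simp: under_points_def ov_def)

lemma ov_not_under: "reg E ==> ov (lk E) u w ==> w \<notin> und E"
using gen_triple[of E u w] unfolding under_points_def ov_def by fastforce

lemma ov_unique: "reg E ==> ov (lk E) u w ==> ov (lk E) u w' ==> w = w'"
using gen_triple[of E u w w'] unfolding ov_def by fastforce

text \<open>The values of a colouring at under points carry no information.\<close>

definition jump :: "pt set => (pt => int) => pt => int => int => bool" where
 "jump D c u k a \<longleftrightarrow> (\<exists>v. v ~= 0 \<and> at u within D = along u v \<and>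
  (\<forall>\<^sub>F t in at_right 0. c (u + t *. v) = a \<and> c (u - t *. v) = 2 * k - a))"

text \<open>The two branches of the link at an under point stand for the one or two arcs that end
  there. No arc has to be identified, and the condition can be checked locally after a move.\<close>

definition pcol :: "pt set => (pt => int) => bool" where
 "pcol D c \<longleftrightarrow> (\<forall>x\<in>D - under_points D. \<forall>\<^sub>F y in at x within D. c y = c x) \<and>
  (\<forall>u w. ov D u w --> (\<exists>a. jump D c u (c w) a))"

lemma pcol_const:
 assumes "pcol D c" "connected S" "S \<subseteq> D - under_points D" "x \<in> S" "y \<in> S"
 shows "c x = c y"
proof (rule connected_local_const[OF assms(2,4,5)])
show "\<forall>a\<in>S. \<forall>\<^sub>F b in at a within S. c a = c b"
proof
 fix a assume "a \<in> S"
 hence "\<forall>\<^sub>F b in at a within D. c b = c a" using assms(1,3) unfolding pcol_def by blast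
 moreover have "at a within S \<le> at a within D" using assms(3) by (intro at_le) auto
 ultimately have "\<forall>\<^sub>F b in at a within S. c b = c a" using filter_leD by blast
 thus "\<forall>\<^sub>F b in at a within S. c a = c b" by (simp add: eq_commute)
qed
qed

lemma open_seg_not_under:
 assumes R: "reg E" and u: "u \<in> lk E" "u \<notin> fst ` E" "e \<in> E" "u \<in> seg e"
 obtains d where "d > 0" "\<And>t. t ~= 0 ==> \<bar>t\<bar> < d ==> u + t *. (snd e - fst e) \<in> lk E - und E"
proof -
have "\<forall>\<^sub>F y in nhds u. y \<in> - (und E - {u})"
 using finite_under[OF R] by (intro eventually_nhds_in_open open_Compl finite_imp_closed) auto
hence "\<forall>\<^sub>F y in at u within lk E. y \<in> lk E - und E"
 unfolding eventually_at_filter by eventually_elim auto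
hence "\<forall>\<^sub>F t in at 0. u + t *. (snd e - fst e) \<in> lk E - und E"
 unfolding at_within_edge[OF R u(3,4,2)] eventually_filtermap .
thus ?thesis using that unfolding eventually_at by (auto simp: dist_real_def)
qed

text \<open>Points close to \<open>u\<close> on its two sides give the arcs \<open>A\<close> and
  \<open>B\<close>, possibly equal. Any arc with \<open>u\<close> in its closure has points near
  \<open>u\<close>, hence meets one of them and coincides with it.\<close>

lemma arcs_at_under:
 assumes R: "reg E" and u: "u \<in> und E"
 obtains v A B where "v ~= 0" "at u within lk E = along u v"
 "{X \<in> arcs (lk E). u \<in> closure X} = {A, B}" "\<forall>\<^sub>F t in at_right 0. u + t *. v \<in> A \<and> u - t *. v \<in> B"
proof -
let ?D = "lk E - und E"
have uD: "u \<in> lk E" using u by (simp add: under_points_def)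
have nv: "u \<notin> fst ` E" using under_nonvertex[OF R u] .
obtain e where e: "e \<in> E" "u \<in> seg e" using uD lkE by blast
define v where "v = snd e - fst e"
have v: "v ~= 0" using edge_vec_nz[OF R e(1)] by (simp add: v_def)
note aw = at_within_edge[OF R e nv, folded v_def]
obtain d where d: "d > 0" "\<And>t. t ~= 0 ==> \<bar>t\<bar> < d ==> u + t *. v \<in> ?D"
 using open_seg_not_under[OF R uD nv e] unfolding v_def by blast
define A where "A = connected_component_set ?D (u + (d/2) *. v)"
define B where "B = connected_component_set ?D (u - (d/2) *. v)"
have m: "u + (d/2) *. v \<in> ?D" "u - (d/2) *. v \<in> ?D" using d(2)[of "d/2"] d(2)[of "-d/2"] d(1) by auto
have arcs: "A \<in> arcs (lk E)" "B \<in> arcs (lk E)" unfolding A_def B_def arcs_def components_def using m by auto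
have inA: "u + t *. v \<in> A" if "0 < t" "t < d" for t
proof -
 have "connected ((\<lambda>t. u + t *. v) ` {0<..<d})" by (intro connected_continuous_image continuous_intros) auto
 moreover have "(\<lambda>t. u + t *. v) ` {0<..<d} \<subseteq> ?D" using d by auto
 ultimately show ?thesis unfolding A_def mem_Collect_eq connected_component_def using that d(1)
  by (intro exI[of _ "(\<lambda>t. u + t *. v) ` {0<..<d}"] conjI) (auto intro!: image_eqI)
qed
have inB: "u - t *. v \<in> B" if "0 < t" "t < d" for t
proof -
 have "connected ((\<lambda>t. u - t *. v) ` {0<..<d})" by (intro connected_continuous_image continuous_intros) auto
 moreover have "(\<lambda>t. u - t *. v) ` {0<..<d} \<subseteq> ?D" using d(2)[of "- _"] d(1) by auto
 ultimately show ?thesis unfolding B_def mem_Collect_eq connected_component_def using that d(1)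
  by (intro exI[of _ "(\<lambda>t. u - t *. v) ` {0<..<d}"] conjI) (auto intro!: image_eqI)
qed
have evr: "\<forall>\<^sub>F t in at_right 0. 0 < t \<and> t < d" using d(1) eventually_at_right_real[OF d(1)] by (simp add: greaterThanLessThan_def greaterThan_def lessThan_def)
hence ev: "\<forall>\<^sub>F t in at_right 0. u + t *. v \<in> A \<and> u - t *. v \<in> B" by eventually_elim (use inA inB in auto)
have cl: "u \<in> closure A" "u \<in> closure B"
proof -
 have "((\<lambda>t. u + t *. v) \<longlongrightarrow> u) (at_right 0)" "((\<lambda>t. u - t *. v) \<longlongrightarrow> u) (at_right 0)" by (auto intro!: tendsto_eq_intros)
 moreover have "\<forall>\<^sub>F t in at_right 0. u + t *. v \<in> closure A" "\<forall>\<^sub>F t in at_right 0. u - t *. v \<in> closure B"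
  using ev by (eventually_elim, use closure_subset in blast)+
 ultimately show "u \<in> closure A" "u \<in> closure B" by (auto intro: Lim_in_closed_set simp: trivial_limit_at_right_real)
qed
have eq: "X = A \<or> X = B" if X: "X \<in> arcs (lk E)" "u \<in> closure X" for X
proof -
 have XD: "X \<subseteq> ?D" using X(1) unfolding arcs_def by (rule in_components_subset)
 have "\<forall>\<^sub>F y in at u within lk E. y \<in> A \<union> B"
 proof -
  have "\<forall>\<^sub>F t in at 0. t \<in> {-d<..<d}" by (rule eventually_at_in_open') (use d in auto)
  moreover have "\<forall>\<^sub>F t in at (0::real). t ~= 0" by (simp add: eventually_at_filter)
  ultimately have "\<forall>\<^sub>F t in at 0. u + t *. v \<in> A \<union> B"
  proof eventually_elim
   case (elim t) thus ?case using inA[of t] inB[of "-t"] by (cases "t > 0") auto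
  qed
  thus ?thesis unfolding aw eventually_filtermap .
 qed
 then obtain S where S: "open S" "u \<in> S" "\<And>y. y \<in> S ==> y ~= u ==> y \<in> lk E ==> y \<in> A \<union> B"
  unfolding eventually_at_topological by blast
 obtain y where y: "y \<in> X" "y \<in> S" using X(2) S closure_iff_nhds_not_empty[of u X] by blast
 have "y ~= u" using y XD u by blast
 hence "y \<in> A \<union> B" using S(3)[OF y(2)] y XD by blast
 thus ?thesis using arcs X(1) y unfolding arcs_def by (metis UnE components_eq disjoint_iff)
qed
show ?thesis by (rule that[OF v aw _ ev]) (use eq arcs cl in blast)
qed

lemma Zcoloring_pcol:
 assumes R: "reg E" and Z: "Zcoloring (lk E) \<gamma>"
 shows "\<exists>c. pcol (lk E) c \<and> c ` (lk E - und E) = \<gamma> ` arcs (lk E)"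
proof (intro exI conjI)
let ?D = "lk E - und E"
\<comment> \<open>At an under point the component is empty, so \<open>c\<close> takes the irrelevant
  value \<open>\<gamma> {}\<close> there.\<close>
define c where "c x = \<gamma> (connected_component_set ?D x)" for x
have cA: "c x = \<gamma> A" if "A \<in> arcs (lk E)" "x \<in> A" for x A
 using that unfolding c_def arcs_def components_def by (metis (no_types, lifting) connected_component_eq imageE)
have xin: "x \<in> ?D ==> connected_component_set ?D x \<in> arcs (lk E) \<and> x \<in> connected_component_set ?D x" for x
 by (auto simp: arcs_def components_def)
show "c ` ?D = \<gamma> ` arcs (lk E)" unfolding arcs_def components_def c_def image_image ..
show "pcol (lk E) c" unfolding pcol_def
proof (intro conjI ballI allI impI)
 fix x assume x: "x \<in> ?D"
 have "\<forall>\<^sub>F y in nhds x. y \<in> - und E"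
  by (rule eventually_nhds_in_open) (use finite_under[OF R] x in \<open>auto intro!: finite_imp_closed\<close>)
 then obtain r where r: "r > 0" "ball x r \<subseteq> - und E" unfolding eventually_nhds
  by (metis open_contains_ball subset_eq)
 have "\<forall>\<^sub>F y in nhds x. y \<in> ball x r" by (rule eventually_nhds_in_open) (use r in auto)
 thus "\<forall>\<^sub>F y in at x within lk E. c y = c x"
  using star_near[OF R DiffD1[OF x]] unfolding eventually_at_filter
 proof eventually_elim
  case (elim y)
  show ?case
  proof (intro impI)
   assume y: "y ~= x" "y \<in> lk E"
   then obtain e where e: "e \<in> E" "x \<in> seg e" "y \<in> seg e" using elim by auto
   have "cseg x y \<subseteq> seg e" using e by (simp add: seg_def closed_segment_subset)
   moreover have "cseg x y \<subseteq> ball x r" using elim r by (simp add: closed_segment_subset)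
   ultimately have "cseg x y \<subseteq> ?D" using e(1) r(2) seg_lk by blast
   hence "connected_component ?D x y" unfolding connected_component_def by (intro exI[of _ "cseg x y"]) auto
   thus "c y = c x" unfolding c_def by (metis connected_component_eq mem_Collect_eq)
  qed
 qed
next
 fix u w assume o: "ov (lk E) u w"
 hence u: "u \<in> und E" unfolding under_ov by blast
 have w: "w \<in> ?D" using o ov_not_under[OF R o] by (auto simp: ov_def)
 obtain v A B where v: "v ~= 0" "at u within lk E = along u v"
  "{X \<in> arcs (lk E). u \<in> closure X} = {A, B}" "\<forall>\<^sub>F t in at_right 0. u + t *. v \<in> A \<and> u - t *. v \<in> B"
  using arcs_at_under[OF R u] .
 have AB: "A \<in> arcs (lk E)" "B \<in> arcs (lk E)" using v(3) by blast+
 obtain b b' where "2 * c w = b + b'" "{b, b'} = \<gamma> ` {A, B}"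
 proof -
  have "w \<in> lk E" "u \<in> lk E" "proj w = proj u \<and> height u < height w" using o by (auto simp: ov_def)
  from Z[unfolded Zcoloring_def, rule_format, OF this, of "connected_component_set ?D w"] xin[OF w]
  show ?thesis using that unfolding v(3) c_def by blast
 qed
 hence s: "2 * c w = \<gamma> A + \<gamma> B" by (auto simp: doubleton_eq_iff)
 show "\<exists>a. jump (lk E) c u (c w) a" unfolding jump_def
 proof (intro exI conjI, rule v(1), rule v(2))
  show "\<forall>\<^sub>F t in at_right 0. c (u + t *. v) = \<gamma> A \<and> c (u - t *. v) = 2 * c w - \<gamma> A"
   using v(4) by eventually_elim (use s cA[OF AB(1)] cA[OF AB(2)] in auto)
 qed
qed
qed

text \<open>Two linear parametrisations of the same branch have parallel directions. This compares
  the direction hidden in \<open>jump\<close> with that of the edge.\<close>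

lemma filtermap_line_within:
 assumes "at u within D = along u v" "at u within D = along u v'"
 "\<forall>\<^sub>F y in at u within D. \<exists>t. y = u + t *. v"
 shows "\<exists>s. v' = s *. (v :: pt)"
proof -
have "\<forall>\<^sub>F t in at (0::real). (\<exists>s. u + t *. v' = u + s *. v) \<and> t ~= 0"
 using assms(3) unfolding assms(2) eventually_filtermap by (auto simp: eventually_at_filter elim: eventually_mono)
hence "\<exists>t. (\<exists>s. u + t *. v' = u + s *. v) \<and> t ~= 0" by (rule eventually_happens'[OF at_neq_bot])
then obtain t s where t: "t ~= 0" "t *. v' = s *. v" by (metis add_left_cancel)
hence "v' = (s / t) *. v" by (metis divideR_right real_vector.scale_scale divide_inverse_commute)
thus ?thesis by blast
qed

text \<open>An arc gets the value at any of its points, which is the same for all of them. The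
  direction in \<open>jump\<close> is known only up to a nonzero factor of either sign, so
  \<open>2 * c w\<close> is compared with the sum over both branches, which is symmetric.\<close>

lemma pcol_Zcoloring:
 assumes R: "reg E" and P: "pcol (lk E) c"
 shows "\<exists>\<gamma>. Zcoloring (lk E) \<gamma> \<and> \<gamma> ` arcs (lk E) = c ` (lk E - und E)"
proof -
let ?D = "lk E - und E"
define \<gamma> where "\<gamma> A = c (SOME x. x \<in> A)" for A
have cA: "\<gamma> A = c x" if A: "A \<in> arcs (lk E)" "x \<in> A" for x A
proof -
 have "(SOME x. x \<in> A) \<in> A" using A(2) by (rule someI)
 thus ?thesis unfolding \<gamma>_def using A unfolding arcs_def
  by (intro pcol_const[OF P in_components_connected in_components_subset])
qed
have xin: "x \<in> ?D ==> connected_component_set ?D x \<in> arcs (lk E) \<and> x \<in> connected_component_set ?D x" for x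
 by (auto simp: arcs_def components_def)
have "Zcoloring (lk E) \<gamma>" unfolding Zcoloring_def
proof (intro ballI impI)
 fix w u a assume wu: "w \<in> lk E" "u \<in> lk E" "proj w = proj u \<and> height u < height w" "a \<in> arcs (lk E)" "w \<in> a"
 hence o: "ov (lk E) u w" by (simp add: ov_def)
 hence u: "u \<in> und E" unfolding under_ov by blast
 obtain v A B where v: "v ~= 0" "at u within lk E = along u v"
  "{X \<in> arcs (lk E). u \<in> closure X} = {A, B}" "\<forall>\<^sub>F t in at_right 0. u + t *. v \<in> A \<and> u - t *. v \<in> B"
  using arcs_at_under[OF R u] .
 have AB: "A \<in> arcs (lk E)" "B \<in> arcs (lk E)" using v(3) by blast+
 have ev: "\<forall>\<^sub>F t in at 0. c (u + t *. v) = (if t > 0 then \<gamma> A else \<gamma> B)"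
 proof -
  have "\<forall>\<^sub>F t in at_right 0. c (u + t *. v) = (if t > 0 then \<gamma> A else \<gamma> B)"
   using v(4) eventually_at_right_less by eventually_elim (metis cA[OF AB(1)])
  moreover have "\<forall>\<^sub>F t in at_right 0. c (u - t *. v) = (if - t > 0 then \<gamma> A else \<gamma> B)"
   using v(4) eventually_at_right_less[of "0::real"] by eventually_elim (metis cA[OF AB(2)] less_minus_iff less_asym neg_0_less_iff_less minus_zero)
  hence "\<forall>\<^sub>F t in at_left 0. c (u + t *. v) = (if t > 0 then \<gamma> A else \<gamma> B)"
   by (subst at_left_minus) (simp add: eventually_filtermap)
  ultimately show ?thesis by (simp add: eventually_at_split)
 qed
 obtain v' k where v': "v' ~= 0" "at u within lk E = along u v'"
  "\<forall>\<^sub>F t in at_right 0. c (u + t *. v') = k \<and> c (u - t *. v') = 2 * c w - k"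
  using P o unfolding pcol_def jump_def by blast
 have "\<exists>s. v' = s *. v"
  by (rule filtermap_line_within[OF v(2) v'(2)]) (unfold v(2), auto simp: eventually_filtermap)
 then obtain s where s: "v' = s *. v" by blast
 have s0: "s ~= 0" using s v' by auto
 have lim: "filterlim (\<lambda>t. t * s) (at 0) (at_right 0)" "filterlim (\<lambda>t. - (t * s)) (at 0) (at_right 0)"
  using s0 eventually_at_right_less[of "0::real"] by (auto simp: filterlim_at intro!: tendsto_eq_intros elim!: eventually_mono)
 have "\<forall>\<^sub>F t in at_right (0::real). 2 * c w = \<gamma> A + \<gamma> B"
  using v'(3) eventually_compose_filterlim[OF ev lim(1)] eventually_compose_filterlim[OF ev lim(2)] eventually_at_right_less
 proof eventually_elim
  case (elim t)
  have "0 < t * s \<longleftrightarrow> \<not> 0 < - (t * s)" using s0 elim(4) by (auto simp: zero_less_mult_iff mult_less_0_iff)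
  thus ?case using elim(1-3) by (auto simp: s split: if_splits)
 qed
 hence "2 * c w = \<gamma> A + \<gamma> B" by (simp add: eventually_const)
 moreover have "\<gamma> a = c w" using cA wu by simp
 ultimately show "\<exists>b b'. 2 * \<gamma> a = b + b' \<and> {b, b'} = \<gamma> ` {B \<in> arcs (lk E). u \<in> closure B}"
  unfolding v(3) by (intro exI[of _ "\<gamma> A"] exI[of _ "\<gamma> B"]) auto
qed
moreover have "\<gamma> ` arcs (lk E) = c ` ?D"
proof
 show "\<gamma> ` arcs (lk E) \<subseteq> c ` ?D"
 proof
  fix k assume "k \<in> \<gamma> ` arcs (lk E)"
  then obtain A where A: "A \<in> arcs (lk E)" "k = \<gamma> A" by blast
  then obtain x where "x \<in> A" unfolding arcs_def using in_components_nonempty by blast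
  moreover have "A \<subseteq> ?D" using A unfolding arcs_def by (intro in_components_subset) simp
  ultimately show "k \<in> c ` ?D" using A cA by blast
 qed
 show "c ` ?D \<subseteq> \<gamma> ` arcs (lk E)"
 proof
  fix k assume "k \<in> c ` ?D"
  then obtain x where x: "x \<in> ?D" "k = c x" by blast
  hence "k = \<gamma> (connected_component_set ?D x)" using cA[of "connected_component_set ?D x" x] xin[OF x(1)] by metis
  thus "k \<in> \<gamma> ` arcs (lk E)" using xin[OF x(1)] by blast
 qed
qed
ultimately show ?thesis by blast
qed

section \<open>Vertical deformation of a link and splitting\<close>

definition lift :: "(pt => real) => pt => pt" where
 "lift f v = (fst v, fst (snd v), f v)"

definition ledge :: "(pt => real) => pt \<times> pt => pt \<times> pt" where
 "ledge f e = (lift f (fst e), lift f (snd e))"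

definition hgt :: "(pt => real) => pt \<times> pt => real => real" where
 "hgt f e s = (1 - s) * f (fst e) + s * f (snd e)"

definition lifted :: "(pt \<times> pt) set => (pt => real) => pt set" where
 "lifted E f = (\<Union>e\<in>E. seg (ledge f e))"

lemma lift_simps [simp]: "proj (lift f v) = proj v" "height (lift f v) = f v"
by (simp_all add: lift_def proj_def height_def)

lemma lifted_height: "lifted E height = lk E"
proof -
have "lift height v = v" for v by (simp add: pt_eq_iff)
thus ?thesis by (simp add: lifted_def lk_def ledge_def)
qed

lemma at_ledge: "proj (at_edge (ledge f e) s) = proj (at_edge e s)" "height (at_edge (ledge f e) s) = hgt f e s"
by (simp_all add: at_edge_def ledge_def hgt_def algebra_simps)

lemma hgt_height: "hgt height e s = height (at_edge e s)"
by (simp add: at_edge_def hgt_def algebra_simps)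

lemma in_ledge: "x \<in> seg (ledge f e) \<longleftrightarrow> (\<exists>s. 0 \<le> s \<and> s \<le> 1 \<and> proj x = proj (at_edge e s) \<and> height x = hgt f e s)"
by (simp add: in_seg_iff pt_eq_iff at_ledge)

text \<open>Heights are interpolated along edges, so the order at a crossing is compared at
  parameters and not at vertices. Keeping it at every crossing is what makes a vertical move of a
  vertex free of collisions.\<close>

definition faithful :: "(pt \<times> pt) set => (pt => real) => bool" where
 "faithful E f \<longleftrightarrow> (\<forall>e\<in>E. \<forall>g\<in>E. \<forall>s\<in>{0..1}. \<forall>t\<in>{0..1}. proj (at_edge e s) = proj (at_edge g t) -->
  height (at_edge e s) < height (at_edge g t) --> hgt f e s < hgt f g t)"

lemma link_equiv_refl: "link_equiv L L"
by (simp add: link_equiv_def)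

lemma link_equiv_trans: "link_equiv A B ==> link_equiv B C ==> link_equiv A C"
unfolding link_equiv_def by (rule rtranclp_trans)

lemma delta_link_equiv: "delta_move A B ==> link_equiv A B"
by (auto simp: link_equiv_def)

lemma link_equiv_sym: "link_equiv A B ==> link_equiv B A"
unfolding link_equiv_def
proof (induction rule: rtranclp_induct)
case (step y z) thus ?case by (metis (no_types, lifting) converse_rtranclp_into_rtranclp)
qed simp

context
 fixes E assumes R: "reg E"
begin

text \<open>Points of two edges over one point of the plane form a common vertex or a crossing.
  Edges that cross have no common end: their lines are transversal and meet only once.\<close>

lemma two_edges:
 assumes "e \<in> E" "g \<in> E" "e ~= g" "s \<in> {0..1}" "t \<in> {0..1}" "proj (at_edge e s) = proj (at_edge g t)"
 shows "(\<exists>w\<in>ends e \<inter> ends g. at_edge e s = w \<and> at_edge g t = w \<and> (\<forall>f. hgt f e s = f w \<and> hgt f g t = f w)) \<or>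
  (at_edge e s ~= at_edge g t \<and> ends e \<inter> ends g = {})"
proof -
have m: "at_edge e s \<in> seg e" "at_edge g t \<in> seg g" using assms by (auto simp: seg_at_edge)
show ?thesis
proof (cases "at_edge e s = at_edge g t")
 case True
 define w where "w = at_edge e s"
 have w: "w \<in> ends e" "w \<in> ends g" using gen_seg[OF R assms(1-3)] m True unfolding w_def by metis+
 have h: "hgt f e' s' = f w" if "e' \<in> E" "w \<in> ends e'" "at_edge e' s' = w" for f e' s'
 proof -
  have "s' = 0 \<and> w = fst e' \<or> s' = 1 \<and> w = snd e'"
   using that at_edge_inj[OF R that(1), of s' 0] at_edge_inj[OF R that(1), of s' 1] by auto
  thus ?thesis by (auto simp: hgt_def)
 qed
 have "hgt f e s = f w \<and> hgt f g t = f w" for f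
  using h[OF assms(1) w(1) w_def[symmetric]] h[OF assms(2) w(2)] True w_def by metis
 thus ?thesis using w True w_def by (intro disjI1 bexI[of _ w]) auto
next
 case False
 have c: "cr (dir e) (dir g) ~= 0" using gen_trans[OF R False assms(6,1,2)] m by blast
 have nv: "at_edge e s \<notin> fst ` E" using gen_cross[OF R _ _ False assms(6)] m seg_lk assms(1,2) by blast
 have "ends e \<inter> ends g = {}"
 proof (rule ccontr)
  assume "ends e \<inter> ends g ~= {}"
  then obtain w where w: "w \<in> ends e" "w \<in> ends g" by blast
  obtain s' where s': "w = at_edge e s'" using w by (metis at_edge_01 insertE singletonD)
  obtain t' where t': "w = at_edge g t'" using w by (metis at_edge_01 insertE singletonD)
  have "(s - s') *. dir e = proj (at_edge e s) - proj w" unfolding s' proj_at_edge by (simp add: algebra_simps)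
  also have "\<dots> = (t - t') *. dir g" unfolding assms(6) by (subst t') (simp add: proj_at_edge algebra_simps)
  finally have "cr ((s - s') *. dir e) (dir g) = 0" by simp
  hence "s = s'" using c by simp
  thus False using nv s' w ends_V[OF R assms(1)] by (metis insertE singletonD)
 qed
 thus ?thesis using False by blast
qed
qed

text \<open>An edge \<open>g\<close> that crosses \<open>e\<close> does not end in \<open>v\<close>,
  so its height is the same for \<open>f\<close> and \<open>f'\<close>. Both put it on the same side
  of \<open>e\<close>, hence it cannot enter the vertical strip swept by \<open>e\<close>.\<close>

lemma ledge_meet:
 assumes f: "faithful E f" "faithful E f'" "\<And>x. x ~= v ==> f' x = f x" and e: "e \<in> E" "v \<in> ends e"
 and g: "g \<in> E" "g ~= e" "x \<in> seg (ledge f g)"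
 and s: "s \<in> {0..1}" "proj x = proj (at_edge e s)" "height x \<in> cseg (hgt f e s) (hgt f' e s)"
 shows "\<exists>w\<in>ends e. x = lift f w"
proof -
obtain t where t: "t \<in> {0..1}" "proj x = proj (at_edge g t)" "height x = hgt f g t" using g(3) in_ledge by auto
have p: "proj (at_edge e s) = proj (at_edge g t)" using s t by simp
from two_edges[OF e(1) g(1) g(2)[symmetric] s(1) t(1) p]
show ?thesis
proof (elim disjE bexE conjE)
 fix w assume w: "w \<in> ends e \<inter> ends g" "at_edge e s = w" "\<forall>f. hgt f e s = f w \<and> hgt f g t = f w"
 have "x = lift f w" using s(2) t(3) w by (simp add: pt_eq_iff)
 thus ?thesis using w by blast
next
 assume ne: "at_edge e s ~= at_edge g t" and d: "ends e \<inter> ends g = {}"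
 have "v \<notin> ends g" using d e by blast
 hence g': "hgt f' g t = hgt f g t" unfolding hgt_def using f(3) by (metis insertI1 insertI2)
 have "height (at_edge e s) ~= height (at_edge g t)" using ne p pt_eq_iff by blast
 hence "(hgt f e s < hgt f g t \<and> hgt f' e s < hgt f' g t) \<or> (hgt f e s > hgt f g t \<and> hgt f' e s > hgt f' g t)"
  using f(1,2) e(1) g(1) s(1) t(1) p unfolding faithful_def by (metis linorder_neqE_linordered_idom)
 thus ?thesis using s(3) g' unfolding t(3) closed_segment_eq_real_ivl by (auto split: if_splits)
qed
qed

text \<open>The Delta-move across the vertical triangle swept by the edge from \<open>w\<close> to
  \<open>v\<close>. The result contains the vertical segment between the two positions of
  \<open>v\<close>, so it is not of the form \<open>lifted\<close>; it is an intermediate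
  stage.\<close>

lemma delta_lift:
 assumes f: "faithful E f" "faithful E f'" "\<And>x. x ~= v ==> f' x = f x" "f' v ~= f v"
 and e: "e \<in> E" "ends e = {w, v}" and g: "g \<in> E" "g ~= e" "v \<in> ends g"
 shows "delta_move (lifted E f)
 ((\<Union>g\<in>E - {e}. seg (ledge f g)) \<union> cseg (lift f w) (lift f' v) \<union> cseg (lift f' v) (lift f v))"
proof -
let ?p = "lift f w" and ?q = "lift f v" and ?r = "lift f' v"
define O' where "O' = (\<Union>g\<in>E - {e}. seg (ledge f g))"
have ve: "v \<in> ends e" unfolding e(2) by (rule insertI2) (rule singletonI)
have wv: "proj w ~= proj v" using dir_nz[OF R e(1)] e(2) by (auto simp: dir_def doubleton_eq_iff)
have fw: "f' w = f w" using wv f(3) by metis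
have se: "seg (ledge f e) = cseg ?p ?q"
 using e(2) by (auto simp: seg_def ledge_def doubleton_eq_iff closed_segment_commute)
\<comment> \<open>Every point of the vertical triangle lies over the edge, between its old and its
  new height.\<close>
have hull: "\<exists>s\<in>{0..1}. proj x = proj (at_edge e s) \<and> height x \<in> cseg (hgt f e s) (hgt f' e s)"
 if x: "x \<in> convex hull {?p, ?q, ?r}" for x
proof -
 obtain \<alpha> \<beta> \<gamma> where c: "0 \<le> \<alpha>" "0 \<le> \<beta>" "0 \<le> \<gamma>" "\<alpha> + \<beta> + \<gamma> = 1" "x = \<alpha> *. ?p + \<beta> *. ?q + \<gamma> *. ?r"
  using x unfolding convex_hull_3 by blast
 define s where "s = (if fst e = w then \<beta> + \<gamma> else \<alpha>)"
 have we: "fst e = w \<and> snd e = v \<or> fst e ~= w \<and> fst e = v \<and> snd e = w" using e(2) wv by (auto simp: doubleton_eq_iff)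
 have al: "\<alpha> = 1 - (\<beta> + \<gamma>)" using c by simp
 have pr: "proj x = proj (at_edge e s)" using we unfolding c(5) s_def
  by (auto simp: proj_at_edge dir_def al algebra_simps)
 have hs: "hgt f e s = \<alpha> * f w + (\<beta> + \<gamma>) * f v" "hgt f' e s = \<alpha> * f w + (\<beta> + \<gamma>) * f' v"
  using we fw unfolding s_def by (auto simp: hgt_def al algebra_simps)
 have hx: "height x = \<alpha> * f w + \<beta> * f v + \<gamma> * f' v" by (simp add: c(5))
 have "height x \<in> cseg (hgt f e s) (hgt f' e s)"
 proof (cases "f v \<le> f' v")
  case True
  hence "\<beta> * f v \<le> \<beta> * f' v" "\<gamma> * f v \<le> \<gamma> * f' v" using c(2,3) by (auto intro: mult_left_mono)
  thus ?thesis unfolding closed_segment_eq_real_ivl hs hx by (auto simp: algebra_simps)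
 next
  case False
  hence "\<beta> * f' v \<le> \<beta> * f v" "\<gamma> * f' v \<le> \<gamma> * f v" using c(2,3) by (auto intro: mult_left_mono)
  thus ?thesis unfolding closed_segment_eq_real_ivl hs hx by (auto simp: algebra_simps)
 qed
 moreover have "s \<in> {0..1}" using c unfolding s_def by auto
 ultimately show ?thesis using pr by blast
qed
have vq: "?q \<in> O'" unfolding O'_def using g by (auto simp: ledge_def seg_def intro!: bexI[of _ g])
have meet: "x \<in> cseg ?p ?q" if xl: "x \<in> lifted E f" and xh: "x \<in> convex hull {?p, ?q, ?r}" for x
proof -
 obtain h where h: "h \<in> E" "x \<in> seg (ledge f h)" using xl unfolding lifted_def by blast
 obtain s where s: "s\<in>{0..1}" "proj x = proj (at_edge e s)" "height x \<in> cseg (hgt f e s) (hgt f' e s)" using hull[OF xh] by blast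
 show ?thesis
 proof (cases "h = e")
  case True thus ?thesis using h se by simp
 next
  case False
  have "\<exists>w\<in>ends e. x = lift f w"
   by (rule ledge_meet[OF f(1-3) e(1) ve h(1) False h(2) s])
  thus ?thesis using e(2) by auto
 qed
qed
have disj: "O' \<inter> open_segment ?p ?q = {}"
proof -
 have "x \<in> {?p, ?q}" if x: "x \<in> seg (ledge f h)" "h \<in> E" "h ~= e" "x \<in> cseg ?p ?q" for x h
 proof -
  obtain s where s: "s \<in> {0..1}" "proj x = proj (at_edge e s)" "height x = hgt f e s" using x(4) unfolding se[symmetric] in_ledge by auto
  have "\<exists>w\<in>ends e. x = lift f w"
   by (rule ledge_meet[OF f(1) f(1) refl e(1) ve x(2,3,1) s(1,2)]) (simp add: s(3))
  thus ?thesis using e(2) by auto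
 qed
 thus ?thesis unfolding O'_def open_segment_def by blast
qed
have lE: "lifted E f = O' \<union> cseg ?p ?q" unfolding lifted_def O'_def se[symmetric] using e(1) by blast
have "\<not> collinear {?p, ?q, ?r}"
proof
 assume "collinear {?p, ?q, ?r}"
 then obtain u where u: "\<And>x y. x \<in> {?p, ?q, ?r} ==> y \<in> {?p, ?q, ?r} ==> \<exists>c. x - y = c *. u" unfolding collinear_def by blast
 obtain a where a: "?p - ?q = a *. u" using u[of ?p ?q] by auto
 obtain b where b: "?r - ?q = b *. u" using u[of ?r ?q] by auto
 have "proj (?p - ?q) = a *. proj u" "proj (?r - ?q) = b *. proj u" "height (?r - ?q) = b * height u" unfolding a b by simp_all
 hence "proj w - proj v = a *. proj u" "0 = b *. proj u" "f' v - f v = b * height u" by simp_all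
 thus False using wv f(4) by (cases "b = 0") auto
qed
moreover have "lifted E f \<inter> convex hull {?p, ?q, ?r} = cseg ?p ?q"
proof
 show "cseg ?p ?q \<subseteq> lifted E f \<inter> convex hull {?p, ?q, ?r}"
  using lE by (auto intro!: subsetD[OF hull_mono[of "{?p, ?q}" "{?p, ?q, ?r}"]] simp: segment_convex_hull)
qed (use meet in blast)
moreover have "(lifted E f - open_segment ?p ?q) = O' \<union> {?p}"
 unfolding lE using disj vq by (auto simp: open_segment_def)
moreover have "O' \<union> cseg ?p ?r \<union> cseg ?r ?q = (O' \<union> {?p}) \<union> cseg ?p ?r \<union> cseg ?r ?q"
 using ends_in_segment(1)[of ?p ?r] by blast
ultimately show ?thesis unfolding delta_move_def O'_def[symmetric] by metis
qed

text \<open>The vertical move of \<open>v\<close> passes through a link with a vertical segment at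
  \<open>v\<close>. This is reached from \<open>lifted E f\<close> through one edge at
  \<open>v\<close> and from \<open>lifted E f'\<close> through the other, so one Delta-move and one
  inverse suffice.\<close>

lemma lift_vertex:
 assumes f: "faithful E f" "faithful E f'" "\<And>x. x ~= v ==> f' x = f x" and v: "v \<in> fst ` E"
 shows "link_equiv (lifted E f) (lifted E f')"
proof (cases "f' v = f v")
case True
hence "f' = f" using f(3) by (metis ext)
thus ?thesis by (simp add: link_equiv_refl)
next
case False
obtain eb where eb: "eb \<in> E" "fst eb = v" using v by (metis imageE)
obtain ea where ea: "ea \<in> E" "snd ea = v" using v reg_verts(4)[OF R] by (metis imageE)
define a b where "a = fst ea" and "b = snd eb"
have "a ~= v" "b ~= v" using reg_verts(5)[OF R] ea eb unfolding a_def b_def by metis+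
have ne: "ea ~= eb" using \<open>a ~= v\<close> eb by (auto simp: a_def)
have ie: "ends ea = {a, v}" "ends eb = {b, v}" using ea eb by (auto simp: a_def b_def)
have only: "v \<notin> ends h" if h: "h \<in> E" "h ~= ea" "h ~= eb" for h
proof -
 have "fst h ~= v" using h eb inj_onD[OF reg_verts(2)[OF R], of h eb] by metis
 moreover have "snd h ~= v" using h ea inj_onD[OF reg_verts(3)[OF R], of h ea] by metis
 ultimately show ?thesis by blast
qed
have same: "ledge f' h = ledge f h" if "h \<in> E" "h ~= ea" "h ~= eb" for h
proof -
 have "fst h ~= v" "snd h ~= v" using only[OF that] by blast+
 thus ?thesis using f(3) by (simp add: ledge_def lift_def)
qed
define M where "M = (\<Union>h\<in>E - {ea, eb}. seg (ledge f h))"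
have fa: "lift f' a = lift f a" "lift f' b = lift f b" using f(3) \<open>a ~= v\<close> \<open>b ~= v\<close> by (simp_all add: lift_def)
have sb: "seg (ledge f eb) = cseg (lift f v) (lift f b)" using eb by (simp add: seg_def ledge_def b_def)
have sa: "seg (ledge f' ea) = cseg (lift f a) (lift f' v)" using ea fa by (simp add: seg_def ledge_def a_def)
have 1: "delta_move (lifted E f)
 ((\<Union>g\<in>E - {ea}. seg (ledge f g)) \<union> cseg (lift f a) (lift f' v) \<union> cseg (lift f' v) (lift f v))"
 by (rule delta_lift[OF f False ea(1) ie(1) eb(1) ne[symmetric]]) (assumption, unfold ie, rule insertI2, rule singletonI)
have 2: "delta_move (lifted E f')
 ((\<Union>g\<in>E - {eb}. seg (ledge f' g)) \<union> cseg (lift f' b) (lift f v) \<union> cseg (lift f v) (lift f' v))"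
proof (rule delta_lift[OF f(2,1) _ _ eb(1) ie(2) ea(1) ne])
 show "v \<in> ends ea" unfolding ie by (rule insertI2) (rule singletonI)
qed (use f(3) False in metis)+
have "(\<Union>g\<in>E - {ea}. seg (ledge f g)) = M \<union> cseg (lift f v) (lift f b)"
 unfolding M_def sb[symmetric] using eb(1) ne by blast
moreover have "(\<Union>g\<in>E - {eb}. seg (ledge f' g)) = M \<union> cseg (lift f a) (lift f' v)"
proof -
 have "(\<Union>g\<in>E - {eb}. seg (ledge f' g)) = (\<Union>g\<in>E - {ea, eb}. seg (ledge f' g)) \<union> seg (ledge f' ea)" using ea(1) ne by blast
 also have "(\<Union>g\<in>E - {ea, eb}. seg (ledge f' g)) = M" unfolding M_def using same by simp
 finally show ?thesis using sa by simp
qed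
ultimately have l: "link_equiv (lifted E f) (M \<union> cseg (lift f v) (lift f b) \<union> cseg (lift f a) (lift f' v) \<union> cseg (lift f' v) (lift f v))"
 "link_equiv (lifted E f') (M \<union> cseg (lift f a) (lift f' v) \<union> cseg (lift f b) (lift f v) \<union> cseg (lift f v) (lift f' v))"
 using delta_link_equiv[OF 1] delta_link_equiv[OF 2] unfolding fa by metis+
have M: "M \<union> cseg (lift f a) (lift f' v) \<union> cseg (lift f b) (lift f v) \<union> cseg (lift f v) (lift f' v)
  = M \<union> cseg (lift f v) (lift f b) \<union> cseg (lift f a) (lift f' v) \<union> cseg (lift f' v) (lift f v)"
 unfolding closed_segment_commute[of "lift f b"] closed_segment_commute[of "lift f v" "lift f' v"] by blast
show ?thesis by (rule link_equiv_trans[OF l(1) link_equiv_sym[OF l(2)[unfolded M]]])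
qed

text \<open>The vertices move one after the other, so every partly executed move has to be faithful
  as well.\<close>

lemma lift_vertices:
 assumes "finite W" "W \<subseteq> fst ` E" "\<And>X. X \<subseteq> W ==> faithful E (\<lambda>v. if v \<in> X then f' v else f v)"
 shows "link_equiv (lifted E f) (lifted E (\<lambda>v. if v \<in> W then f' v else f v))"
using assms
proof (induction W)
case empty thus ?case by (simp add: link_equiv_refl)
next
case (insert w W)
have "link_equiv (lifted E f) (lifted E (\<lambda>v. if v \<in> W then f' v else f v))"
 using insert.prems by (intro insert.IH) (auto intro: subset_insertI2)
moreover have "link_equiv (lifted E (\<lambda>v. if v \<in> W then f' v else f v)) (lifted E (\<lambda>v. if v \<in> insert w W then f' v else f v))"
 by (rule lift_vertex[OF insert.prems(2)[OF subset_insertI] insert.prems(2)[OF order_refl], of w]) (use insert.prems(1) in auto)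
ultimately show ?case by (rule link_equiv_trans)
qed

lemma crossing_gap: "\<exists>\<epsilon>>0. \<forall>x\<in>lk E. \<forall>y\<in>lk E. proj x = proj y --> height x < height y --> \<epsilon> < height y - height x"
proof -
let ?X = "{x \<in> lk E. \<exists>y\<in>lk E. y ~= x \<and> proj y = proj x}"
\<comment> \<open>The element 1 covers the case without crossings; halving the minimum below makes
  the inequality strict.\<close>
let ?H = "insert 1 ((\<lambda>(x, y). height y - height x) ` {(x, y). x \<in> ?X \<and> y \<in> ?X \<and> height x < height y})"
have "finite {(x, y). x \<in> ?X \<and> y \<in> ?X \<and> height x < height y}"
 by (rule finite_subset[of _ "?X \<times> ?X"]) (use finite_double[OF R] in blast)+
hence fin: "finite ?H" by blast
have pos: "0 < Min ?H" using fin by (subst Min_gr_iff) auto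
show ?thesis
proof (intro exI[of _ "Min ?H / 2"] conjI ballI impI)
 fix x y assume xy: "x \<in> lk E" "y \<in> lk E" "proj x = proj y" "height x < height y"
 have "x \<in> ?X" "y \<in> ?X" using xy by fastforce+
 hence "height y - height x \<in> ?H" using xy(4) by (intro insertI2 image_eqI[of _ _ "(x, y)"]) simp_all
 hence "Min ?H \<le> height y - height x" using fin by (rule Min_le[rotated])
 thus "Min ?H / 2 < height y - height x" using pos by linarith
qed (use pos in simp)
qed

text \<open>The components of sign 1 rise and the others sink, in steps smaller than every height
  gap at a crossing. A partly executed step then cannot exchange two strands of equal sign, and by
  \<open>over\<close> strands of opposite signs only move apart. Finally height 0 separates
  them.\<close>

theorem split_by_sign:
 fixes \<sigma> :: "pt => real"
 assumes \<sigma>: "\<And>v. v \<in> fst ` E ==> \<sigma> v = 1 \<or> \<sigma> v = - 1" "\<And>e. e \<in> E ==> \<sigma> (fst e) = \<sigma> (snd e)"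
 and over: "\<And>x y e g. e \<in> E ==> g \<in> E ==> x \<in> seg e ==> y \<in> seg g ==> proj x = proj y ==> height x < height y ==> \<sigma> (fst e) \<le> \<sigma> (fst g)"
 and ex: "v1 \<in> fst ` E" "\<sigma> v1 = 1" "v2 \<in> fst ` E" "\<sigma> v2 = - 1"
 shows "splittable (lk E)"
proof -
obtain \<epsilon> where eps: "\<epsilon> > 0" "\<And>x y. x \<in> lk E ==> y \<in> lk E ==> proj x = proj y ==> height x < height y ==> \<epsilon> < height y - height x"
 using crossing_gap by blast
define F where "F n v = height v + real n * \<epsilon> * \<sigma> v" for n v
have V: "finite (fst ` E)" using reg_finite[OF R] by blast
have resp: "faithful E (\<lambda>v. if v \<in> X then F (Suc n) v else F n v)" for X n
 unfolding faithful_def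
proof (intro ballI impI)
 fix e g and s t :: real
 assume eg: "e \<in> E" "g \<in> E" "s \<in> {0..1}" "t \<in> {0..1}" "proj (at_edge e s) = proj (at_edge g t)" "height (at_edge e s) < height (at_edge g t)"
 have m: "at_edge e s \<in> seg e" "at_edge g t \<in> seg g" using eg by (auto simp: seg_at_edge)
 have gap: "\<epsilon> < height (at_edge g t) - height (at_edge e s)" using eps(2)[OF seg_lk[OF eg(1) m(1)] seg_lk[OF eg(2) m(2)] eg(5,6)] .
 have ov: "\<sigma> (fst e) \<le> \<sigma> (fst g)" using over[OF eg(1,2) m eg(5,6)] .
 \<comment> \<open>The part of the current step already carried out at parameter \<open>r\<close>,
   when only the vertices in \<open>X\<close> have been moved.\<close>
 define \<theta> where "\<theta> h r = (1 - r) * (if fst h \<in> X then 1 else 0) + r * (if snd h \<in> X then 1 else (0::real))" for h r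
 have th: "0 \<le> \<theta> h r" "\<theta> h r \<le> 1" if "r \<in> {0..1}" for h r using that by (auto simp: \<theta>_def)
 have H: "hgt (\<lambda>v. if v \<in> X then F (Suc n) v else F n v) h r = height (at_edge h r) + real n * \<epsilon> * \<sigma> (fst h) + \<epsilon> * \<sigma> (fst h) * \<theta> h r"
  if "h \<in> E" for h r
  using \<sigma>(2)[OF that] unfolding hgt_height[symmetric] by (simp add: hgt_def F_def \<theta>_def algebra_simps)
 have "fst e \<in> fst ` E" "fst g \<in> fst ` E" using eg by blast+
 then consider "\<sigma> (fst e) = \<sigma> (fst g)" | "\<sigma> (fst e) = -1" "\<sigma> (fst g) = 1" using \<sigma>(1)[of "fst e"] \<sigma>(1)[of "fst g"] ov by fastforce
 thus "hgt (\<lambda>v. if v \<in> X then F (Suc n) v else F n v) e s < hgt (\<lambda>v. if v \<in> X then F (Suc n) v else F n v) g t"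
  unfolding H[OF eg(1)] H[OF eg(2)]
 proof cases
  case 1
  have "\<bar>\<sigma> (fst g) * (\<theta> e s - \<theta> g t)\<bar> \<le> 1" using th[OF eg(3), of e] th[OF eg(4), of g] \<sigma>(1)[OF \<open>fst g \<in> fst ` E\<close>] by auto
  hence "\<epsilon> * (\<sigma> (fst g) * (\<theta> e s - \<theta> g t)) \<le> \<epsilon> * 1" using eps(1) by (intro mult_left_mono) auto
  thus "height (at_edge e s) + real n * \<epsilon> * \<sigma> (fst e) + \<epsilon> * \<sigma> (fst e) * \<theta> e s < height (at_edge g t) + real n * \<epsilon> * \<sigma> (fst g) + \<epsilon> * \<sigma> (fst g) * \<theta> g t"
   using gap 1 by (simp add: algebra_simps)
 next
  case 2
  have "0 \<le> \<epsilon> * real n" "0 \<le> \<epsilon> * \<theta> e s" "0 \<le> \<epsilon> * \<theta> g t" using eps(1) th[OF eg(3), of e] th[OF eg(4), of g] by auto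
  thus "height (at_edge e s) + real n * \<epsilon> * \<sigma> (fst e) + \<epsilon> * \<sigma> (fst e) * \<theta> e s < height (at_edge g t) + real n * \<epsilon> * \<sigma> (fst g) + \<epsilon> * \<sigma> (fst g) * \<theta> g t"
   unfolding 2 mult.commute[of "real n"] using gap eps(1) by linarith
 qed
qed
have lift_cong: "lifted E f = lifted E g" if "\<And>v. v \<in> fst ` E ==> f v = g v" for f g
proof -
 have "ledge f e = ledge g e" if "e \<in> E" for e using \<open>\<And>v. v \<in> fst ` E ==> f v = g v\<close> ends_V[OF R that] by (simp add: ledge_def lift_def)
 thus ?thesis by (simp add: lifted_def)
qed
have chain: "link_equiv (lk E) (lifted E (F n))" for n
proof (induction n)
 case 0
 have "F 0 = height" by (simp add: F_def fun_eq_iff)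
 thus ?case by (simp add: lifted_height link_equiv_refl)
next
 case (Suc n)
 have "lifted E (F (Suc n)) = lifted E (\<lambda>v. if v \<in> fst ` E then F (Suc n) v else F n v)" by (rule lift_cong) simp
 hence "link_equiv (lifted E (F n)) (lifted E (F (Suc n)))"
  using lift_vertices[OF V order_refl resp, of n] by metis
 thus ?case by (rule link_equiv_trans[OF Suc])
qed
obtain B where B: "\<And>x. x \<in> lk E ==> \<bar>height x\<bar> \<le> B"
proof -
 have "compact (height ` lk E)" by (intro compact_continuous_image compact_lk[OF R] continuous_intros)
 hence "bounded (height ` lk E)" by (rule compact_imp_bounded)
 then obtain b where "\<forall>y\<in>height ` lk E. norm y \<le> b" unfolding bounded_iff by blast
 thus ?thesis using that[of b] by simp
qed
obtain n where n: "B < real n * \<epsilon>" using reals_Archimedean3[OF eps(1)] by blast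
have hx: "\<exists>e\<in>E. height x \<ge> real n * \<epsilon> * \<sigma> (fst e) - B \<and> height x \<le> real n * \<epsilon> * \<sigma> (fst e) + B" if x: "x \<in> lifted E (F n)" for x
proof -
 obtain e where e: "e \<in> E" "x \<in> seg (ledge (F n) e)" using x unfolding lifted_def by blast
 obtain s where s: "0 \<le> s" "s \<le> 1" "height x = hgt (F n) e s" using e(2) in_ledge by blast
 have "at_edge e s \<in> lk E" using s(1,2) e(1) by (intro seg_lk[OF e(1)]) (auto simp: seg_at_edge)
 moreover have "height x = height (at_edge e s) + real n * \<epsilon> * \<sigma> (fst e)"
  using \<sigma>(2)[OF e(1)] unfolding s(3) hgt_height[symmetric] by (simp add: hgt_def F_def algebra_simps)
 ultimately show ?thesis using B e(1) by (intro bexI[of _ e]) (auto simp: abs_le_iff dest!: B)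
qed
have "height x ~= 0" if xl: "x \<in> lifted E (F n)" for x
proof -
 obtain e where e: "e \<in> E" "height x \<ge> real n * \<epsilon> * \<sigma> (fst e) - B" "height x \<le> real n * \<epsilon> * \<sigma> (fst e) + B" using hx[OF xl] by blast
 have "\<sigma> (fst e) = 1 \<or> \<sigma> (fst e) = -1" using \<sigma>(1) e by blast
 thus ?thesis using e n by auto
qed
moreover have "\<exists>x\<in>lifted E (F n). 0 < height x" "\<exists>x\<in>lifted E (F n). height x < 0"
proof -
 have l: "lift (F n) v \<in> lifted E (F n)" if v: "v \<in> fst ` E" for v
 proof -
  obtain e where "e \<in> E" "v = fst e" using v by blast
  thus ?thesis unfolding lifted_def by (intro UN_I[of e]) (auto simp: seg_def ledge_def)
 qed
 have vb: "\<bar>height v\<bar> \<le> B" if v: "v \<in> fst ` E" for v using B v seg_lk by (metis ends_in_seg(1) imageE)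
 have "0 < height (lift (F n) v1)" "height (lift (F n) v2) < 0" using vb[OF ex(1)] vb[OF ex(3)] ex n by (auto simp: F_def abs_le_iff)
 thus "\<exists>x\<in>lifted E (F n). 0 < height x" "\<exists>x\<in>lifted E (F n). height x < 0" using l ex by blast+
qed
ultimately show ?thesis unfolding splittable_def using chain by blast
qed

end

section \<open>At least four colours on a non-splittable link\<close>

abbreviation vis :: "pt set => pt set" where
 "vis D \<equiv> D - under_points D"

lemma at_lk_neq_bot: assumes R: "reg E" and x: "x \<in> lk E" shows "at x within lk E ~= bot"
proof -
obtain e where e: "e \<in> E" "x \<in> seg e" using x lkE by blast
have "seg e ~= {z}" for z using reg_verts(5)[OF R e(1)] ends_in_seg by (metis singletonD)
moreover have "connected (seg e)" by (simp add: seg_def)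
ultimately have "x islimpt seg e" using connected_imp_perfect[of "seg e" x] e(2) by blast
hence "x islimpt lk E" by (rule islimpt_subset) (use e(1) in \<open>auto simp: lk_def\<close>)
thus ?thesis by (simp add: trivial_limit_within)
qed

lemma eventually_contra: "F ~= bot ==> eventually P F ==> eventually (\<lambda>x. \<not> P x) F ==> False"
using eventually_conj[of P F "\<lambda>x. \<not> P x"] by simp

lemma jump_at:
 assumes J: "jump D c u k a"
 shows "\<forall>\<^sub>F y in at u within D. c y = a \<or> c y = 2 * k - a"
 "\<exists>\<^sub>F y in at u within D. c y = a" "\<exists>\<^sub>F y in at u within D. c y = 2 * k - a"
proof -
obtain v where v: "at u within D = along u v"
 "\<forall>\<^sub>F t in at_right 0. c (u + t *. v) = a \<and> c (u - t *. v) = 2 * k - a"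
 using J unfolding jump_def by blast
have r: "\<forall>\<^sub>F t in at_right 0. c (u + t *. v) = a" using v(2) by eventually_elim blast
have "\<forall>\<^sub>F t in at_right 0. c (u + (- t) *. v) = 2 * k - a" using v(2) by eventually_elim simp
hence l: "\<forall>\<^sub>F t in at_left 0. c (u + t *. v) = 2 * k - a"
 by (subst at_left_minus) (simp add: eventually_filtermap)
show "\<forall>\<^sub>F y in at u within D. c y = a \<or> c y = 2 * k - a"
 unfolding v(1) eventually_filtermap eventually_at_split
 using r l by (auto elim: eventually_mono)
show "\<exists>\<^sub>F y in at u within D. c y = a"
 unfolding v(1) frequently_def eventually_filtermap eventually_at_split
proof
 assume "(\<forall>\<^sub>F t in at_left 0. c (u + t *. v) ~= a) \<and> (\<forall>\<^sub>F t in at_right 0. c (u + t *. v) ~= a)"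
 thus False using eventually_contra[OF trivial_limit_at_right_real r] by blast
qed
show "\<exists>\<^sub>F y in at u within D. c y = 2 * k - a"
 unfolding v(1) frequently_def eventually_filtermap eventually_at_split
proof
 assume "(\<forall>\<^sub>F t in at_left 0. c (u + t *. v) ~= 2 * k - a) \<and> (\<forall>\<^sub>F t in at_right 0. c (u + t *. v) ~= 2 * k - a)"
 thus False using eventually_contra[OF trivial_limit_at_left_real l] by blast
qed
qed

lemma eventually_vis:
 assumes R: "reg E" and x: "x \<in> lk E" shows "\<forall>\<^sub>F y in at x within lk E. y \<in> vis (lk E)"
proof -
have "\<forall>\<^sub>F y in nhds x. y \<in> - (und E - {x})"
 using finite_under[OF R] by (intro eventually_nhds_in_open open_Compl finite_imp_closed) auto
thus ?thesis unfolding eventually_at_filter by eventually_elim auto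
qed

text \<open>The branch values at a crossing are attained at points near it that are not under
  points, so they count as colours.\<close>

lemma jump_colors:
 assumes R: "reg E" and o: "ov (lk E) u w" and J: "jump (lk E) c u (c w) a"
 shows "a \<in> c ` vis (lk E)" "2 * c w - a \<in> c ` vis (lk E)" "c w \<in> c ` vis (lk E)"
proof -
have u: "u \<in> lk E" using o by (simp add: ov_def)
have fr: "\<exists>\<^sub>F y in at u within lk E. c y = a \<and> y \<in> vis (lk E)" "\<exists>\<^sub>F y in at u within lk E. c y = 2 * c w - a \<and> y \<in> vis (lk E)"
 using frequently_eventually_conj[OF jump_at(2)[OF J] eventually_vis[OF R u]]
  frequently_eventually_conj[OF jump_at(3)[OF J] eventually_vis[OF R u]] by (simp_all add: conj_commute)
show "a \<in> c ` vis (lk E)" using frequently_ex[OF fr(1)] by blast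
show "2 * c w - a \<in> c ` vis (lk E)" using frequently_ex[OF fr(2)] by (metis imageI)
show "c w \<in> c ` vis (lk E)" using ov_not_under[OF R o] o by (auto simp: ov_def)
qed

text \<open>Every point has a neighbourhood with at most two colours besides its own value, and the
  link is compact.\<close>

lemma finite_colors:
 assumes R: "reg E" and P: "pcol (lk E) c" shows "finite (c ` vis (lk E))"
proof -
have "\<exists>S. open S \<and> x \<in> S \<and> finite (c ` (S \<inter> vis (lk E)))" if x: "x \<in> lk E" for x
proof -
 have "\<exists>A. finite A \<and> (\<forall>\<^sub>F y in at x within lk E. c y \<in> A)"
 proof (cases "x \<in> und E")
  case True
  then obtain w a where "jump (lk E) c x (c w) a" using P unfolding pcol_def under_ov by blast
  from jump_at(1)[OF this] show ?thesis by (intro exI[of _ "{a, 2 * c w - a}"]) auto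
 next
  case False
  hence "\<forall>\<^sub>F y in at x within lk E. c y = c x" using P x unfolding pcol_def by blast
  thus ?thesis by (intro exI[of _ "{c x}"]) auto
 qed
 then obtain A S where A: "finite A" "open S" "x \<in> S" "\<And>y. y \<in> S ==> y ~= x ==> y \<in> lk E ==> c y \<in> A"
  unfolding eventually_at_topological by blast
 have "c ` (S \<inter> vis (lk E)) \<subseteq> insert (c x) A" using A(4) by blast
 hence "finite (c ` (S \<inter> vis (lk E)))" by (rule finite_subset) (simp add: A(1))
 thus ?thesis using A(2,3) by blast
qed
then obtain S where S: "\<And>x. x \<in> lk E ==> open (S x) \<and> x \<in> S x \<and> finite (c ` (S x \<inter> vis (lk E)))" by metis
have cov: "lk E \<subseteq> (\<Union>x\<in>lk E. S x)" using S by blast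
obtain F where F: "F \<subseteq> lk E" "finite F" "lk E \<subseteq> (\<Union>x\<in>F. S x)"
 using compactE_image[OF compact_lk[OF R] _ cov] S by blast
have "c ` vis (lk E) \<subseteq> (\<Union>x\<in>F. c ` (S x \<inter> vis (lk E)))" using F(3) by blast
moreover have "finite (\<Union>x\<in>F. c ` (S x \<inter> vis (lk E)))" using F S by blast
ultimately show ?thesis using finite_subset by blast
qed

text \<open>If the under strand never leaves a class \<open>Q\<close> of colours, and the over strand is in \<open>Q\<close>
whenever the under strand is, then the strands in \<open>Q\<close> lie over all others.\<close>

lemma nonsplit_all_or_none:
 assumes R: "reg E" and P: "pcol (lk E) c" and ns: "\<not> splittable (lk E)"
 and Q1: "\<And>u w a. ov (lk E) u w ==> jump (lk E) c u (c w) a ==> Q a = Q (2 * c w - a)"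
 and Q2: "\<And>u w a. ov (lk E) u w ==> jump (lk E) c u (c w) a ==> Q a ==> Q (c w)"
 and xy: "x \<in> vis (lk E)" "y \<in> vis (lk E)"
 shows "Q (c x) = Q (c y)"
proof -
\<comment> \<open>Membership in \<open>Q\<close> carried over to under points, where both branches
  agree by \<open>Q1\<close>. This makes it constant along edges, so that it defines signs for
  \<open>split_by_sign\<close>.\<close>
define q where "q x \<longleftrightarrow> (\<forall>\<^sub>F y in at x within lk E. Q (c y))" for x
have qev: "q x = b" if "x \<in> lk E" "\<forall>\<^sub>F y in at x within lk E. Q (c y) = b" for x b
proof (cases b)
 case True thus ?thesis using that(2) by (simp add: q_def)
next
 case False
 hence "\<forall>\<^sub>F y in at x within lk E. \<not> Q (c y)" using that(2) by simp
 hence "\<not> q x" unfolding q_def using eventually_contra[OF at_lk_neq_bot[OF R that(1)]] by blast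
 thus ?thesis using False by simp
qed
have qv: "q x = Q (c x)" if "x \<in> vis (lk E)" for x
proof (rule qev)
 have "\<forall>\<^sub>F y in at x within lk E. c y = c x" using P that unfolding pcol_def by blast
 thus "\<forall>\<^sub>F y in at x within lk E. Q (c y) = Q (c x)" by eventually_elim simp
qed (use that in blast)
have qu: "\<forall>\<^sub>F y in at u within lk E. Q (c y) = Q a" "q u = Q a" if "ov (lk E) u w" "jump (lk E) c u (c w) a" for u w a
proof -
 show *: "\<forall>\<^sub>F y in at u within lk E. Q (c y) = Q a"
  using jump_at(1)[OF that(2)] by eventually_elim (use Q1[OF that] in auto)
 show "q u = Q a" by (rule qev[OF _ *]) (use that in \<open>simp add: ov_def\<close>)
qed
have loc: "\<forall>\<^sub>F y in at x within lk E. q x = q y" if x: "x \<in> lk E" for x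
proof -
 have "\<exists>b. q x = b \<and> (\<forall>\<^sub>F y in at x within lk E. Q (c y) = b)"
 proof (cases "x \<in> und E")
  case True
  then obtain w a where wa: "ov (lk E) x w" "jump (lk E) c x (c w) a" using P unfolding pcol_def under_ov by blast
  show ?thesis using qu[OF wa] by (intro exI[of _ "Q a"]) simp
 next
  case False
  have "\<forall>\<^sub>F y in at x within lk E. c y = c x" using P x False unfolding pcol_def by blast
  hence "\<forall>\<^sub>F y in at x within lk E. Q (c y) = Q (c x)" by eventually_elim simp
  thus ?thesis using qv x False by blast
 qed
 then obtain b where b: "q x = b" "\<forall>\<^sub>F y in at x within lk E. Q (c y) = b" by blast
 show ?thesis using b(2) eventually_vis[OF R x] by eventually_elim (use qv b(1) in metis)
qed
have seg_const: "q x = q y" if e: "e \<in> E" "x \<in> seg e" "y \<in> seg e" for e x y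
proof (rule connected_local_const[of "seg e"])
 show "\<forall>x\<in>seg e. \<forall>\<^sub>F y in at x within seg e. q x = q y"
 proof
  fix x assume x: "x \<in> seg e"
  have "at x within seg e \<le> at x within lk E" using e(1) by (intro at_le) (auto simp: lk_def)
  thus "\<forall>\<^sub>F y in at x within seg e. q x = q y" using loc[OF seg_lk[OF e(1) x]] filter_leD by blast
 qed
qed (use e in \<open>simp_all add: seg_def\<close>)
define \<sigma> where "\<sigma> v = (if q v then 1 else (- 1 :: real))" for v
have "(\<forall>v\<in>fst ` E. q v) \<or> (\<forall>v\<in>fst ` E. \<not> q v)"
proof (rule ccontr)
 assume "\<not> ((\<forall>v\<in>fst ` E. q v) \<or> (\<forall>v\<in>fst ` E. \<not> q v))"
 then obtain v1 v2 where v: "v1 \<in> fst ` E" "q v1" "v2 \<in> fst ` E" "\<not> q v2" by blast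
 have "splittable (lk E)"
 proof (rule split_by_sign[OF R, of \<sigma>])
  show "\<sigma> (fst e) = \<sigma> (snd e)" if "e \<in> E" for e
   using seg_const[OF that, of "fst e" "snd e"] by (simp add: \<sigma>_def)
  show "\<sigma> (fst e) \<le> \<sigma> (fst g)" if "e \<in> E" "g \<in> E" "x \<in> seg e" "y \<in> seg g" "proj x = proj y" "height x < height y" for x y e g
  proof -
   have o: "ov (lk E) x y" using that seg_lk by (simp add: ov_def)
   then obtain a where a: "jump (lk E) c x (c y) a" using P unfolding pcol_def by blast
   have "y \<in> vis (lk E)" using ov_not_under[OF R o] o by (simp add: ov_def)
   hence "q x --> q y" using qu(2)[OF o a] qv Q2[OF o a] by blast
   thus ?thesis using seg_const[OF that(1), of "fst e" x] seg_const[OF that(2), of "fst g" y] that(3,4)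
    by (simp add: \<sigma>_def)
  qed
 qed (use v in \<open>auto simp: \<sigma>_def\<close>)
 thus False using ns by blast
qed
moreover have "\<exists>v\<in>fst ` E. q x = q v" if "x \<in> lk E" for x
 using that seg_const ends_in_seg(1) by (metis imageI lkE)
ultimately have "q x = q y" using xy by blast
thus ?thesis using qv xy by blast
qed

text \<open>\<open>\<bar>a - c w\<bar>\<close> is the same for both branches \<open>a\<close> and
  \<open>2 * c w - a\<close>, so it is a well-defined difference of the crossing.\<close>

definition xdif :: "pt set => (pt => int) => int => bool" where
 "xdif D c n \<longleftrightarrow> (\<exists>u w a. ov D u w \<and> jump D c u (c w) a \<and> \<bar>a - c w\<bar> = n)"

text \<open>Otherwise only strands of equal colour cross each other, and the points with the colour
  of \<open>x\<close> form components that can be split off.\<close>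

lemma exists_xdif:
 assumes R: "reg E" and P: "pcol (lk E) c" and ns: "\<not> splittable (lk E)"
 and xy: "x \<in> vis (lk E)" "y \<in> vis (lk E)" "c x ~= c y"
 shows "\<exists>n>0. xdif (lk E) c n"
proof (rule ccontr)
assume "\<not> ?thesis"
hence "a = c w" if "ov (lk E) u w" "jump (lk E) c u (c w) a" for u w a
 using that unfolding xdif_def by (metis abs_le_zero_iff eq_iff_diff_eq_0 not_le)
hence "(c x = c x) = (c y = c x)"
 by (intro nonsplit_all_or_none[OF R P ns, of "\<lambda>k. k = c x"] xy) fastforce+
thus False using xy by simp
qed

lemma at_least_four_colors:
 assumes R: "reg E" and P: "pcol (lk E) c" and ns: "\<not> splittable (lk E)"
 and xy: "x \<in> vis (lk E)" "y \<in> vis (lk E)" "c x ~= c y"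
 shows "4 \<le> card (c ` vis (lk E))"
proof (rule ccontr)
let ?C = "c ` vis (lk E)"
assume "\<not> ?thesis"
hence c3: "card ?C \<le> 3" by simp
obtain n u w a where n: "n > 0" "ov (lk E) u w" "jump (lk E) c u (c w) a" "\<bar>a - c w\<bar> = n"
 using exists_xdif[OF assms] unfolding xdif_def by blast
define k where "k = c w"
have sub: "{a, k, 2 * k - a} \<subseteq> ?C" using jump_colors[OF R n(2,3)] by (simp add: k_def)
have ak: "a ~= k" using n by (simp add: k_def)
hence "card {a, k, 2 * k - a} = 3" by (auto simp: card_insert_if)
hence C: "?C = {a, k, 2 * k - a}" using card_seteq[OF finite_colors[OF R P] sub] c3 by simp
\<comment> \<open>Three different colours in arithmetic progression exhaust
  \<open>{a, k, 2 * k - a}\<close>, so \<open>k\<close> must be the middle one.\<close>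
have mid: "k' = k \<and> a' ~= k \<and> 2 * k' - a' ~= k" if "ov (lk E) u' w'" "jump (lk E) c u' (c w') a'" "k' = c w'" "a' ~= k'" for u' w' a' k'
proof -
 have "a' \<in> {a, k, 2 * k - a}" "k' \<in> {a, k, 2 * k - a}" "2 * k' - a' \<in> {a, k, 2 * k - a}"
  using jump_colors[OF R that(1,2)] unfolding C that(3) by blast+
 thus ?thesis using that(4) ak by (auto; presburger)
qed
have Q1: "(a' = k) = (2 * c w' - a' = k)" if "ov (lk E) u' w'" "jump (lk E) c u' (c w') a'" for u' w' a'
 using mid[OF that refl] by (cases "a' = c w'") auto
have Q2: "c w' = k" if "ov (lk E) u' w'" "jump (lk E) c u' (c w') a'" "a' = k" for u' w' a'
 using mid[OF that(1,2) refl] that(3) by (cases "a' = c w'") auto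
obtain z where z: "z \<in> vis (lk E)" "c z = a" using sub by blast
obtain z' where z': "z' \<in> vis (lk E)" "c z' = k" using sub by blast
have "(c z = k) = (c z' = k)" by (rule nonsplit_all_or_none[OF R P ns Q1 Q2 z(1) z'(1)])
thus False using z z' ak by simp
qed

section \<open>Barycentric coordinates\<close>

definition bary :: "real \<times> real => real \<times> real => real \<times> real => real \<times> real => real" where
 "bary P Q R x = cr (Q - x) (R - x) / cr (Q - P) (R - P)"

text \<open>The coordinates are quotients of signed areas, so the orientation of the triangle does
  not matter.\<close>

definition tri :: "real \<times> real => real \<times> real => real \<times> real => (real \<times> real) set" where
 "tri P Q R = {x. 0 \<le> bary P Q R x \<and> 0 \<le> bary Q R P x \<and> 0 \<le> bary R P Q x}"

definition itri :: "real \<times> real => real \<times> real => real \<times> real => (real \<times> real) set" where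
 "itri P Q R = {x. 0 < bary P Q R x \<and> 0 < bary Q R P x \<and> 0 < bary R P Q x}"

lemma cr_cycle: "cr (R - Q) (P - Q) = cr (Q - P) (R - P)" "cr (P - R) (Q - R) = cr (Q - P) (R - P)"
by (simp_all add: cr_def algebra_simps)

text \<open>Coordinates are affine along lines. Where a line enters or leaves a triangle is
  therefore read off from the sign of one slope.\<close>

lemma bary_move: "bary P Q R (x + t *. v) = bary P Q R x + t * (cr v (Q - R) / cr (Q - P) (R - P))"
proof -
have "cr (Q - (x + t *. v)) (R - (x + t *. v)) = cr (Q - x) (R - x) + t * cr v (Q - R)"
 by (simp add: cr_def algebra_simps)
thus ?thesis by (simp only: bary_def add_divide_distrib times_divide_eq_right)
qed

lemma continuous_on_bary [continuous_intros]: "continuous_on S f ==> continuous_on S (\<lambda>x. bary P Q R (f x))"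
unfolding bary_def cr_def divide_inverse by (intro continuous_intros)

lemma open_itri: "open (itri P Q R)"
unfolding itri_def by (intro open_Collect_conj open_Collect_less continuous_intros)

lemma closed_tri: "closed (tri P Q R)"
unfolding tri_def by (intro closed_Collect_conj closed_Collect_le continuous_intros)

lemma itri_subset: "itri P Q R \<subseteq> tri P Q R"
by (auto simp: itri_def tri_def)

context
 fixes P Q R :: "real \<times> real" assumes nd: "cr (Q - P) (R - P) ~= 0"
begin

lemma bary_sum: "bary P Q R x + bary Q R P x + bary R P Q x = 1"
proof -
have "cr (Q - x) (R - x) + cr (R - x) (P - x) + cr (P - x) (Q - x) = cr (Q - P) (R - P)"
 by (simp add: cr_def algebra_simps)
thus ?thesis unfolding bary_def cr_cycle[where P=P and Q=Q and R=R] by (simp only: add_divide_distrib[symmetric] divide_self[OF nd])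
qed

lemma bary_of: "a + b + g = 1 ==> bary P Q R (a *. P + b *. Q + g *. R) = a \<and>
 bary Q R P (a *. P + b *. Q + g *. R) = b \<and> bary R P Q (a *. P + b *. Q + g *. R) = g"
proof -
assume s: "a + b + g = 1"
let ?x = "a *. P + b *. Q + g *. R"
have a: "a = 1 - b - g" using s by simp
have "cr (Q - ?x) (R - ?x) = a * cr (Q - P) (R - P)" "cr (R - ?x) (P - ?x) = b * cr (Q - P) (R - P)"
 "cr (P - ?x) (Q - ?x) = g * cr (Q - P) (R - P)" unfolding a by (simp_all add: cr_def algebra_simps)
thus ?thesis unfolding bary_def cr_cycle[where P=P and Q=Q and R=R] by (simp only: nonzero_mult_div_cancel_right[OF nd] simp_thms)
qed

lemma bary_comb: "x = bary P Q R x *. P + bary Q R P x *. Q + bary R P Q x *. R"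
proof -
let ?D = "cr (Q - P) (R - P)"
have "?D *. x = cr (Q - x) (R - x) *. P + cr (R - x) (P - x) *. Q + cr (P - x) (Q - x) *. R"
 by (simp add: prod_eq_iff cr_def algebra_simps)
hence "(1 / ?D) *. ?D *. x = (1 / ?D) *. (cr (Q - x) (R - x) *. P + cr (R - x) (P - x) *. Q + cr (P - x) (Q - x) *. R)"
 by (rule arg_cong)
thus ?thesis using nd by (simp add: bary_def cr_cycle scaleR_add_right del: cr_simps)
qed

lemma in_closed_side: "x \<in> cseg P R \<longleftrightarrow> x \<in> tri P Q R \<and> bary Q R P x = 0"
proof
assume "x \<in> cseg P R"
then obtain t where t: "0 \<le> t" "t \<le> 1" "x = (1 - t) *. P + 0 *. Q + t *. R" by (auto simp: closed_segment_def)
thus "x \<in> tri P Q R \<and> bary Q R P x = 0" using bary_of[of "1 - t" 0 t] by (auto simp: tri_def)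
next
assume x: "x \<in> tri P Q R \<and> bary Q R P x = 0"
hence "bary P Q R x = 1 - bary R P Q x" using bary_sum[of x] by simp
hence "x = (1 - bary R P Q x) *. P + bary R P Q x *. R" using bary_comb[of x] x by simp
moreover have "0 \<le> bary R P Q x" "bary R P Q x \<le> 1" using x bary_sum[of x] by (auto simp: tri_def)
ultimately show "x \<in> cseg P R" unfolding closed_segment_def by blast
qed

lemma bary_vertices: "bary P Q R P = 1" "bary Q R P P = 0" "bary R P Q P = 0"
 "bary P Q R Q = 0" "bary Q R P Q = 1" "bary R P Q Q = 0" "bary P Q R R = 0" "bary Q R P R = 0" "bary R P Q R = 1"
using bary_of[of 1 0 0] bary_of[of 0 1 0] bary_of[of 0 0 1] by simp_all

lemma eq_vertex: "bary Q R P x = 0 ==> bary R P Q x = 0 ==> x = P" "bary P Q R x = 0 ==> bary R P Q x = 0 ==> x = Q"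
 "bary P Q R x = 0 ==> bary Q R P x = 0 ==> x = R"
using bary_sum[of x] bary_comb[of x] by simp_all

end

section \<open>Fingers: the Delta-move and the new diagram\<close>

lemma eventually_within_cong:
 assumes "\<forall>\<^sub>F y in nhds x. y \<in> S \<longleftrightarrow> y \<in> T" shows "at x within S = at x within T"
proof (rule filter_eqI)
fix P
show "eventually P (at x within S) = eventually P (at x within T)"
 unfolding eventually_at_filter
 by (rule eventually_subst) (use assms in eventually_elim, simp)
qed

text \<open>The basic move: the part \<open>p q\<close> of the edge \<open>(A, B)\<close> is replaced by the two sides \<open>p r\<close>, \<open>r q\<close> of a steep
triangle that lies above the rest of the link.  Everything below the triangle is reflected in the
colour of \<open>(A, B)\<close>.  Strands may pass under the base \<open>p q\<close>, but not over it.\<close>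

locale finger =
 fixes E c A B \<alpha> \<beta> Z H p q r P Q
 assumes R: "reg E" and col: "pcol (lk E) c" and AB: "(A, B) \<in> E" and ab: "0 < \<alpha>" "\<alpha> < \<beta>" "\<beta> < 1"
 and p_def: "p = at_edge (A, B) \<alpha>" and q_def: "q = at_edge (A, B) \<beta>" and P_def: "P = proj p" and Q_def: "Q = proj q"
 and r_def: "r = (fst Z, snd Z, H)"
 and top: "\<And>x. x \<in> cseg p q ==> x \<notin> und E"
 and simp_p: "\<And>y. y \<in> lk E ==> proj y = P ==> y = p"
 and simp_q: "\<And>y. y \<in> lk E ==> proj y = Q ==> y = q"
 and Zoff: "cr (Z - proj A) (dir (A, B)) ~= 0"
 and side: "\<And>x. x \<in> lk E ==> proj x \<in> cseg P Z \<union> cseg Q Z ==> x ~= p ==> x ~= q ==>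
   x \<notin> fst ` E \<and> proj x ~= Z \<and> simple E x"
 and trP: "\<And>x e. e \<in> E ==> x \<in> seg e ==> proj x \<in> cseg P Z ==> x ~= p ==> cr (dir e) (Z - P) ~= 0"
 and trQ: "\<And>x e. e \<in> E ==> x \<in> seg e ==> proj x \<in> cseg Q Z ==> x ~= q ==> cr (dir e) (Z - Q) ~= 0"
 and below: "\<And>y. y \<in> lk E ==> proj y \<in> tri P Q Z ==> y \<in> cseg p q \<or>
   height y < bary P Q Z (proj y) * height p + bary Q Z P (proj y) * height q + bary Z P Q (proj y) * H"
begin

abbreviation "bs \<equiv> cseg p q"
abbreviation "sides \<equiv> cseg P Z \<union> cseg Q Z"
abbreviation "bp \<equiv> \<lambda>x. bary P Q Z (proj x)"
abbreviation "bq \<equiv> \<lambda>x. bary Q Z P (proj x)"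
abbreviation "bz \<equiv> \<lambda>x. bary Z P Q (proj x)"
definition "plane x = bp x * height p + bq x * height q + bz x * H"
definition "F = cseg p r \<union> cseg r q"
definition "k = c p"
abbreviation "D \<equiv> lk E"
definition "E' = detour E A B p r q"
abbreviation "D' \<equiv> lk E'"

lemma proj_r: "proj r = Z" "height r = H" by (simp_all add: r_def proj_def height_def)

lemma PQ: "P = proj A + \<alpha> *. dir (A, B)" "Q = proj A + \<beta> *. dir (A, B)"
by (simp_all add: P_def Q_def p_def q_def proj_at_edge)

lemma PQ_diff: "Q - P = (\<beta> - \<alpha>) *. dir (A, B)" by (simp add: PQ algebra_simps)

lemma nd: "cr (Q - P) (Z - P) ~= 0"
proof -
have ZP: "Z - P = (Z - proj A) - \<alpha> *. dir (A, B)" by (simp add: PQ)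
have "cr (Q - P) (Z - P) = (\<beta> - \<alpha>) * cr (dir (A, B)) (Z - proj A)" unfolding PQ_diff ZP by (simp add: algebra_simps)
thus ?thesis using Zoff ab cr_swap[of "dir (A, B)" "Z - proj A"] by simp
qed

lemmas bsum = bary_sum[OF nd] and bcomb = bary_comb[OF nd] and bvert = bary_vertices[OF nd] and bof = bary_of[OF nd]

lemma side_iff: "x \<in> cseg P Z \<longleftrightarrow> x \<in> tri P Q Z \<and> bary Q Z P x = 0"
 "x \<in> cseg Q Z \<longleftrightarrow> x \<in> tri P Q Z \<and> bary P Q Z x = 0" "x \<in> cseg P Q \<longleftrightarrow> x \<in> tri P Q Z \<and> bary Z P Q x = 0"
proof -
have 1: "cr (Z - Q) (P - Q) ~= 0" "cr (P - Z) (Q - Z) ~= 0" unfolding cr_cycle[where P=P and Q=Q and R=Z] by (rule nd)+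
have 2: "tri Q Z P = tri P Q Z" "tri Z P Q = tri P Q Z" by (auto simp: tri_def)
show "x \<in> cseg P Z \<longleftrightarrow> x \<in> tri P Q Z \<and> bary Q Z P x = 0" by (rule in_closed_side[OF nd])
show "x \<in> cseg Q Z \<longleftrightarrow> x \<in> tri P Q Z \<and> bary P Q Z x = 0"
 using in_closed_side[OF 1(2), of x] 2 by (simp add: closed_segment_commute)
show "x \<in> cseg P Q \<longleftrightarrow> x \<in> tri P Q Z \<and> bary Z P Q x = 0"
 using in_closed_side[OF 1(1), of x] 2 by (simp add: closed_segment_commute)
qed

lemma tri_cases: "x \<in> tri P Q Z ==> x \<in> itri P Q Z \<or> x \<in> sides \<or> x \<in> cseg P Q"
unfolding Un_iff side_iff by (auto simp: tri_def itri_def)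

lemma itri_not_side: "x \<in> itri P Q Z ==> x \<notin> sides \<and> x \<notin> cseg P Q"
unfolding Un_iff side_iff by (auto simp: itri_def)

lemma pq_ne: "p ~= q" "P ~= Q"
using nd by (auto simp: P_def Q_def)

lemma p_edge: "p \<in> seg (A, B)" "q \<in> seg (A, B)" "p \<in> D" "q \<in> D" "p \<notin> fst ` E" "q \<notin> fst ` E"
proof -
show "p \<in> seg (A, B)" "q \<in> seg (A, B)" using ab by (auto simp: p_def q_def seg_at_edge)
thus "p \<in> D" "q \<in> D" using seg_lk[OF AB] by auto
have "at_edge (A, B) s \<notin> fst ` E" if s: "0 < s" "s < 1" for s
proof
 assume "at_edge (A, B) s \<in> fst ` E"
 then obtain f where f: "f \<in> E" "fst f = at_edge (A, B) s" by (metis imageE)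
 have m: "at_edge (A, B) s \<in> seg (A, B)" using s by (auto simp: seg_at_edge)
 have "at_edge (A, B) s \<in> ends (A, B)"
 proof (cases "f = (A, B)")
  case True thus ?thesis using f(2)[symmetric] by simp
 next
  case False
  have "at_edge (A, B) s \<in> seg f" using f(2) ends_in_seg(1)[of f] by simp
  thus ?thesis using gen_seg[OF R AB f(1) False[symmetric] m] by blast
 qed
 hence "at_edge (A, B) s = at_edge (A, B) 0 \<or> at_edge (A, B) s = at_edge (A, B) 1" unfolding at_edge_01 by (metis insertE singletonD)
 thus False using at_edge_inj[OF R AB, of s 0] at_edge_inj[OF R AB, of s 1] s by (metis less_irrefl)
qed
thus "p \<notin> fst ` E" "q \<notin> fst ` E" using ab by (simp_all add: p_def q_def)
qed

lemma bs_iff: "x \<in> bs \<longleftrightarrow> (\<exists>s. \<alpha> \<le> s \<and> s \<le> \<beta> \<and> x = at_edge (A, B) s)"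
proof
assume "x \<in> bs"
then obtain t where t: "0 \<le> t" "t \<le> 1" "x = (1 - t) *. p + t *. q" by (auto simp: closed_segment_def)
have "x = at_edge (A, B) (\<alpha> + t * (\<beta> - \<alpha>))" unfolding t(3) p_def q_def at_edge_def by (simp add: algebra_simps)
moreover have "t * (\<beta> - \<alpha>) \<le> 1 * (\<beta> - \<alpha>)" "0 \<le> t * (\<beta> - \<alpha>)" using t ab by (intro mult_right_mono mult_nonneg_nonneg; simp)+
ultimately show "\<exists>s. \<alpha> \<le> s \<and> s \<le> \<beta> \<and> x = at_edge (A, B) s" by (intro exI[of _ "\<alpha> + t * (\<beta> - \<alpha>)"]) simp
next
assume "\<exists>s. \<alpha> \<le> s \<and> s \<le> \<beta> \<and> x = at_edge (A, B) s"
then obtain s where s: "\<alpha> \<le> s" "s \<le> \<beta>" "x = at_edge (A, B) s" by blast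
define t where "t = (s - \<alpha>) / (\<beta> - \<alpha>)"
have ts: "s = \<alpha> + t * (\<beta> - \<alpha>)" using ab by (simp add: t_def)
have "x = (1 - t) *. p + t *. q" unfolding s(3) ts p_def q_def at_edge_def by (simp add: algebra_simps)
moreover have "0 \<le> t" "t \<le> 1" using s ab by (auto simp: t_def)
ultimately show "x \<in> bs" unfolding closed_segment_def by blast
qed

lemma bs_sub: "bs \<subseteq> seg (A, B)" "bs \<subseteq> D"
proof -
show 1: "bs \<subseteq> seg (A, B)" using p_edge(1,2) by (simp add: seg_def closed_segment_subset)
show "bs \<subseteq> D" using 1 seg_lk[OF AB] by blast
qed

lemma bs_proj: "x \<in> bs ==> proj x \<in> cseg P Q"
unfolding P_def Q_def closed_segment_def by auto

lemma bs_over: "x \<in> cseg P Q ==> \<exists>y\<in>bs. proj y = x"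
proof -
assume "x \<in> cseg P Q"
then obtain t where t: "0 \<le> t" "t \<le> 1" "x = (1 - t) *. P + t *. Q" unfolding closed_segment_def by blast
have "(1 - t) *. p + t *. q \<in> bs" unfolding closed_segment_def using t by blast
thus ?thesis using t(3) by (intro bexI[of _ "(1 - t) *. p + t *. q"]) (simp_all add: P_def Q_def)
qed

lemma edge_bz: "x \<in> seg (A, B) ==> bz x = 0"
proof -
assume "x \<in> seg (A, B)"
then obtain s where "x = at_edge (A, B) s" using in_seg_iff by blast
hence "proj x = P + (s - \<alpha>) *. dir (A, B)" by (simp add: proj_at_edge PQ algebra_simps)
also have "dir (A, B) = (1 / (\<beta> - \<alpha>)) *. (Q - P)" using ab by (simp add: PQ_diff)
finally have "proj x = P + ((s - \<alpha>) / (\<beta> - \<alpha>)) *. (Q - P)" by simp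
thus ?thesis using bvert by (simp add: bary_move cr_swap[of "Q - P" "P - Q"]) (simp add: cr_def algebra_simps)
qed

lemma F_comb:
 assumes "z \<in> F" obtains a b g where "0 \<le> a" "0 \<le> b" "0 \<le> g" "a + b + g = 1" "a = 0 \<or> b = 0" "z = a *. p + b *. q + g *. r"
proof -
from assms consider t where "0 \<le> t" "t \<le> 1" "z = (1 - t) *. p + t *. r" | t where "0 \<le> t" "t \<le> 1" "z = (1 - t) *. r + t *. q"
 unfolding F_def closed_segment_def by blast
thus ?thesis
proof cases
 case 1 thus ?thesis using that[of "1 - t" 0 t] by simp
next
 case 2 thus ?thesis using that[of 0 t "1 - t"] by simp
qed
qed

lemma F_plane:
 assumes "z \<in> F" shows "proj z \<in> sides" "proj z \<in> tri P Q Z" "height z = plane z"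
proof -
obtain a b g where z: "0 \<le> a" "0 \<le> b" "0 \<le> g" "a + b + g = 1" "a = 0 \<or> b = 0" "z = a *. p + b *. q + g *. r"
 using F_comb[OF assms] by blast
have pz: "proj z = a *. P + b *. Q + g *. Z" by (simp add: z(6) P_def Q_def proj_r)
have bb: "bp z = a" "bq z = b" "bz z = g" using bof[OF z(4)] unfolding pz by auto
show "height z = plane z" unfolding plane_def bb by (simp add: z(6) proj_r)
show "proj z \<in> tri P Q Z" "proj z \<in> sides" unfolding Un_iff side_iff tri_def mem_Collect_eq bb using z by auto
qed

lemma side_F: assumes "x \<in> sides" shows "\<exists>z\<in>F. proj z = x"
proof -
from assms consider t where "0 \<le> t" "t \<le> 1" "x = (1 - t) *. P + t *. Z" | t where "0 \<le> t" "t \<le> 1" "x = (1 - t) *. Q + t *. Z"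
 unfolding closed_segment_def by blast
thus ?thesis
proof cases
 case 1
 have "(1 - t) *. p + t *. r \<in> cseg p r" unfolding closed_segment_def using 1 by blast
 thus ?thesis using 1(3) by (intro bexI[of _ "(1 - t) *. p + t *. r"]) (simp_all add: F_def P_def proj_r)
next
 case 2
 have "(1 - t) *. q + t *. r \<in> cseg q r" unfolding closed_segment_def using 2 by blast
 thus ?thesis using 2(3)
  by (intro bexI[of _ "(1 - t) *. q + t *. r"]) (simp_all add: F_def Q_def proj_r closed_segment_commute[of r q])
qed
qed

lemma F_inj: "z \<in> F ==> z' \<in> F ==> proj z = proj z' ==> z = z'"
using F_plane(3) by (simp add: pt_eq_iff plane_def)

lemma F_ends: "p \<in> F" "q \<in> F" "r \<in> F" by (simp_all add: F_def)

text \<open>By \<open>below\<close> the link reaches the height of the new sides only on the base,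
  and the base meets them only in \<open>p\<close> and \<open>q\<close>.\<close>

lemma F_D: assumes "y \<in> D" "y \<in> F" shows "y = p \<or> y = q"
proof -
have y: "proj y \<in> sides" "height y = plane y" "proj y \<in> tri P Q Z" using F_plane[OF assms(2)] by auto
have b: "y \<in> bs" using below[OF assms(1) y(3)] y(2) unfolding plane_def by force
hence "bz y = 0" using bs_proj side_iff(3) by blast
moreover have "bp y = 0 \<or> bq y = 0" using y(1) unfolding Un_iff side_iff by blast
ultimately have "proj y = P \<or> proj y = Q" using eq_vertex[OF nd] by blast
thus ?thesis using simp_p simp_q assms(1) by blast
qed

lemma r_D: "r \<notin> D"
proof
assume "r \<in> D"
hence "Z = P \<or> Z = Q" using F_D[OF _ F_ends(3)] proj_r(1) unfolding P_def Q_def by metis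
thus False using nd by (elim disjE) (simp_all add: cr_def)
qed

lemma over_side:
 assumes "x \<in> D" "proj x \<in> sides" "x ~= p" "x ~= q"
 shows "x \<notin> F" "x \<notin> fst ` E" "proj x ~= Z" "\<And>y. y \<in> D ==> proj y = proj x ==> y = x" "x \<notin> bs"
 "\<And>z. z \<in> F ==> proj z = proj x ==> height x < height z \<and> z \<notin> D"
proof -
show F: "x \<notin> F" using F_D assms by blast
show "x \<notin> fst ` E" "proj x ~= Z" and one: "\<And>y. y \<in> D ==> proj y = proj x ==> y = x"
 using side[OF assms] by auto
show nb: "x \<notin> bs"
proof
 assume "x \<in> bs"
 hence "bz x = 0" using bs_proj side_iff(3) by blast
 moreover have "bp x = 0 \<or> bq x = 0" using assms(2) unfolding Un_iff side_iff by blast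
 ultimately have "proj x = P \<or> proj x = Q" using eq_vertex[OF nd] by blast
 thus False using simp_p simp_q assms by blast
qed
fix z assume z: "z \<in> F" "proj z = proj x"
have "height x < plane x" using below[OF assms(1)] F_plane(2)[OF z(1)] z(2) nb unfolding plane_def by auto
moreover have "z \<notin> D" using one z F by blast
ultimately show "height x < height z \<and> z \<notin> D" using F_plane(3)[OF z(1)] z(2) by (simp add: plane_def)
qed

lemma seg_Ap: "x \<in> seg (A, p) \<longleftrightarrow> (\<exists>s. 0 \<le> s \<and> s \<le> \<alpha> \<and> x = at_edge (A, B) s)"
 and seg_qB: "x \<in> seg (q, B) \<longleftrightarrow> (\<exists>s. \<beta> \<le> s \<and> s \<le> 1 \<and> x = at_edge (A, B) s)"
proof -
have 1: "at_edge (A, p) t = at_edge (A, B) (t * \<alpha>)" for t by (simp add: at_edge_def p_def)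
have 2: "at_edge (q, B) t = at_edge (A, B) (\<beta> + t * (1 - \<beta>))" for t by (simp add: at_edge_def q_def algebra_simps)
show "x \<in> seg (A, p) \<longleftrightarrow> (\<exists>s. 0 \<le> s \<and> s \<le> \<alpha> \<and> x = at_edge (A, B) s)"
proof
 assume "x \<in> seg (A, p)"
 then obtain t where "0 \<le> t" "t \<le> 1" "x = at_edge (A, B) (t * \<alpha>)" using in_seg_iff 1 by metis
 moreover from this have "0 \<le> t * \<alpha>" "t * \<alpha> \<le> \<alpha>" using ab by (auto simp: mult_left_le_one_le)
 ultimately show "\<exists>s. 0 \<le> s \<and> s \<le> \<alpha> \<and> x = at_edge (A, B) s" by blast
next
 assume "\<exists>s. 0 \<le> s \<and> s \<le> \<alpha> \<and> x = at_edge (A, B) s"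
 then obtain s where s: "0 \<le> s" "s \<le> \<alpha>" "x = at_edge (A, B) s" by blast
 thus "x \<in> seg (A, p)" unfolding in_seg_iff 1 using ab by (intro exI[of _ "s / \<alpha>"]) auto
qed
show "x \<in> seg (q, B) \<longleftrightarrow> (\<exists>s. \<beta> \<le> s \<and> s \<le> 1 \<and> x = at_edge (A, B) s)"
proof
 assume "x \<in> seg (q, B)"
 then obtain t where t: "0 \<le> t" "t \<le> 1" "x = at_edge (A, B) (\<beta> + t * (1 - \<beta>))" using in_seg_iff 2 by metis
 moreover have "0 \<le> t * (1 - \<beta>)" "t * (1 - \<beta>) \<le> 1 * (1 - \<beta>)" using t ab by (intro mult_nonneg_nonneg mult_right_mono; simp)+
 ultimately show "\<exists>s. \<beta> \<le> s \<and> s \<le> 1 \<and> x = at_edge (A, B) s" by (intro exI[of _ "\<beta> + t * (1 - \<beta>)"]) simp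
next
 assume "\<exists>s. \<beta> \<le> s \<and> s \<le> 1 \<and> x = at_edge (A, B) s"
 then obtain s where s: "\<beta> \<le> s" "s \<le> 1" "x = at_edge (A, B) s" by blast
 thus "x \<in> seg (q, B)" unfolding in_seg_iff 2 using ab by (intro exI[of _ "(s - \<beta>) / (1 - \<beta>)"]) auto
qed
qed

lemma seg_subs: "seg (A, p) \<subseteq> seg (A, B)" "seg (q, B) \<subseteq> seg (A, B)" "seg (A, p) \<subseteq> D" "seg (q, B) \<subseteq> D"
proof -
show 1: "seg (A, p) \<subseteq> seg (A, B)" "seg (q, B) \<subseteq> seg (A, B)"
 using p_edge ends_in_seg[of "(A, B)"] by (simp_all add: seg_def closed_segment_subset)
thus "seg (A, p) \<subseteq> D" "seg (q, B) \<subseteq> D" using seg_lk[OF AB] by blast+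
qed

lemma at_inj: "at_edge (A, B) s = at_edge (A, B) t \<longleftrightarrow> s = t"
using at_edge_inj[OF R AB] by metis

lemma not_in: "q \<notin> seg (A, p)" "p \<notin> seg (q, B)" "B \<notin> seg (A, p)" "A \<notin> seg (q, B)" "seg (A, p) \<inter> seg (q, B) = {}"
proof -
have A: "A = at_edge (A, B) 0" and B: "B = at_edge (A, B) 1" by simp_all
show "q \<notin> seg (A, p)" unfolding seg_Ap q_def at_inj using ab by auto
show "p \<notin> seg (q, B)" unfolding seg_qB p_def at_inj using ab by auto
show "B \<notin> seg (A, p)" by (subst B) (use ab in \<open>auto simp: seg_Ap at_inj simp del: at_edge_01\<close>)
show "A \<notin> seg (q, B)" by (subst A) (use ab in \<open>auto simp: seg_qB at_inj simp del: at_edge_01\<close>)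
have "\<not> (x \<in> seg (A, p) \<and> x \<in> seg (q, B))" for x
 unfolding seg_Ap seg_qB using ab at_inj by (metis less_le_not_le order_trans)
thus "seg (A, p) \<inter> seg (q, B) = {}" by blast
qed

text \<open>No other edge meets the open base, since edges meet only in end points; so the exchange
  of edges removes exactly the open base.\<close>

lemma lk_detour: "D' = (D - open_segment p q) \<union> F"
proof -
have 1: "seg (A, B) - open_segment p q = seg (A, p) \<union> seg (q, B)"
proof (intro set_eqI iffI)
 fix x assume x: "x \<in> seg (A, B) - open_segment p q"
 obtain s where s: "0 \<le> s" "s \<le> 1" "x = at_edge (A, B) s" using x in_seg_iff by blast
 show "x \<in> seg (A, p) \<union> seg (q, B)"
 proof (cases "x \<in> bs")
  case True
  hence "x = p \<or> x = q" using x by (auto simp: open_segment_def)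
  thus ?thesis by (auto simp: seg_def)
 next
  case False
  hence "s < \<alpha> \<or> \<beta> < s" using s(3) bs_iff by (metis not_le)
  thus ?thesis
  proof
   assume "s < \<alpha>" hence "x \<in> seg (A, p)" unfolding seg_Ap using s by (intro exI[of _ s]) simp
   thus ?thesis by blast
  next
   assume "\<beta> < s" hence "x \<in> seg (q, B)" unfolding seg_qB using s by (intro exI[of _ s]) simp
   thus ?thesis by blast
  qed
 qed
next
 fix x assume x: "x \<in> seg (A, p) \<union> seg (q, B)"
 have "x \<notin> open_segment p q"
 proof
  assume o: "x \<in> open_segment p q"
  then obtain s where s: "\<alpha> \<le> s" "s \<le> \<beta>" "x = at_edge (A, B) s" using bs_iff[of x] by (auto simp: open_segment_def)
  have "s ~= \<alpha>" "s ~= \<beta>" using o s by (auto simp: open_segment_def p_def q_def)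
  thus False using x s unfolding Un_iff seg_Ap seg_qB s(3) at_inj by auto
 qed
 thus "x \<in> seg (A, B) - open_segment p q" using x seg_subs by blast
qed
have 2: "seg f \<inter> open_segment p q = {}" if f: "f \<in> E" "f ~= (A, B)" for f
proof -
 have "\<not> (x \<in> seg f \<and> x \<in> open_segment p q)" for x
 proof
  assume x: "x \<in> seg f \<and> x \<in> open_segment p q"
  hence "x \<in> bs" by (simp add: open_segment_def)
  then obtain s where s: "\<alpha> \<le> s" "s \<le> \<beta>" "x = at_edge (A, B) s" using bs_iff by blast
  have "x \<in> ends (A, B)" using gen_seg[OF R f(1) AB f(2)] x \<open>x \<in> bs\<close> bs_sub by blast
  hence "x = at_edge (A, B) 0 \<or> x = at_edge (A, B) 1" unfolding at_edge_01 by (metis insertE singletonD)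
  thus False unfolding s(3) at_inj using s ab by auto
 qed
 thus ?thesis by blast
qed
define X where "X = (\<Union>f\<in>E - {(A, B)}. seg f)"
have "D' = X \<union> (seg (A, p) \<union> seg (q, B)) \<union> F"
 unfolding E'_def detour_def lk_def F_def X_def by (simp add: UN_Un seg_def Un_ac)
moreover have "D = X \<union> seg (A, B)" unfolding lk_def X_def using AB by blast
moreover have "X \<inter> open_segment p q = {}" using 2 unfolding X_def by blast
ultimately show ?thesis unfolding 1[symmetric] by blast
qed

end

lemma proj_segment: "x \<in> cseg a b ==> proj x \<in> cseg (proj a) (proj b)"
unfolding closed_segment_def by auto

context finger
begin

lemma F_edges: "x \<in> seg (p, r) \<or> x \<in> seg (r, q) \<longleftrightarrow> x \<in> F"
by (auto simp: F_def seg_def)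

lemma edges_E':
 assumes "e \<in> E'"
 obtains "e \<in> E" "e ~= (A, B)" | "e = (A, p)" | "e = (q, B)" | "e = (p, r)" | "e = (r, q)"
using assms unfolding E'_def detour_def by blast

text \<open>Off the new sides every new edge is part of an old one and has its direction up to a
  positive factor. Transversality of the old crossings is inherited through this.\<close>

lemma base_edge:
 assumes "e \<in> E'" "x \<in> seg e" "x \<notin> F"
 obtains f s where "f \<in> E" "x \<in> seg f" "s > 0" "dir e = s *. dir f"
using assms(1)
proof (cases rule: edges_E')
case 1 thus ?thesis using that[of e 1] assms by simp
next
case 2
have "dir (A, p) = \<alpha> *. dir (A, B)" by (simp add: dir_def p_def proj_at_edge)
moreover have "x \<in> seg (A, B)" using seg_subs assms 2 by blast
ultimately show ?thesis using that[OF AB, of \<alpha>] ab 2 by simp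
next
case 3
have "dir (q, B) = (1 - \<beta>) *. dir (A, B)" by (simp add: dir_def q_def proj_at_edge algebra_simps)
moreover have "x \<in> seg (A, B)" using seg_subs assms 3 by blast
ultimately show ?thesis using that[OF AB, of "1 - \<beta>"] ab 3 by simp
next
case 4 thus ?thesis using assms F_edges by blast
next
case 5 thus ?thesis using assms F_edges by blast
qed

lemma V': "fst ` E' \<subseteq> fst ` E \<union> {p, r, q}"
unfolding E'_def detour_def using AB by force

lemma p_seg: assumes "f \<in> E" "f ~= (A, B)" shows "p \<notin> seg f" "q \<notin> seg f"
using gen_seg[OF R assms(1) AB assms(2)] p_edge ends_V[OF R AB] by (metis insertE singletonD)+

lemma corner: "x \<in> seg (p, r) ==> x \<in> seg (r, q) ==> x = r"
proof -
assume "x \<in> seg (p, r)" "x \<in> seg (r, q)"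
hence x: "x \<in> cseg p r" "x \<in> cseg q r" by (simp_all add: seg_def closed_segment_commute)
have "proj x \<in> cseg P Z" "proj x \<in> cseg Q Z"
 using proj_segment[OF x(1)] proj_segment[OF x(2)] by (simp_all add: P_def Q_def proj_r)
hence "proj x = Z" using side_iff eq_vertex(3)[OF nd] by blast
moreover have "x \<in> F" using x(1) by (simp add: F_def)
ultimately show ?thesis using F_inj[OF _ F_ends(3)] proj_r by metis
qed

lemma not_F_seg: "q \<notin> seg (p, r)" "p \<notin> seg (r, q)"
proof -
show "q \<notin> seg (p, r)" using corner[of q] pq_ne r_D p_edge by (auto simp: seg_def)
show "p \<notin> seg (r, q)" using corner[of p] pq_ne r_D p_edge by (auto simp: seg_def)
qed

lemma meet_E': assumes e: "e \<in> E'" "f \<in> E'" "e ~= f" shows "seg e \<inter> seg f \<subseteq> ends e \<inter> ends f"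
proof -
define S where "S e f \<longleftrightarrow> seg e \<inter> seg f \<subseteq> ends e \<inter> ends f" for e f
have sym: "S e f ==> S f e" for e f unfolding S_def by blast
have s1: "S f (A, p)" if f: "f \<in> E" "f ~= (A, B)" for f
 unfolding S_def
proof
 fix x assume x: "x \<in> seg f \<inter> seg (A, p)"
 hence "x \<in> ends f" "x \<in> ends (A, B)" using gen_seg[OF R f(1) AB f(2)] seg_subs by blast+
 moreover have "x ~= B" using x not_in(3) by blast
 ultimately show "x \<in> ends f \<inter> ends (A, p)" by auto
qed
have s2: "S f (q, B)" if f: "f \<in> E" "f ~= (A, B)" for f
 unfolding S_def
proof
 fix x assume x: "x \<in> seg f \<inter> seg (q, B)"
 hence "x \<in> ends f" "x \<in> ends (A, B)" using gen_seg[OF R f(1) AB f(2)] seg_subs by blast+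
 moreover have "x ~= A" using x not_in(4) by blast
 ultimately show "x \<in> ends f \<inter> ends (q, B)" by auto
qed
have s3: "S f g" if f: "f \<in> E" "f ~= (A, B)" and g: "seg g \<subseteq> F" for f g
proof -
 have "x \<notin> seg g" if "x \<in> seg f" for x
  using F_D[of x] p_seg[OF f] g that seg_lk[OF f(1) that] by blast
 thus ?thesis unfolding S_def by blast
qed
have gF: "seg (p, r) \<subseteq> F" "seg (r, q) \<subseteq> F" by (auto simp: seg_def F_def)
have s4: "S (A, p) (p, r)" unfolding S_def
proof
 fix x assume x: "x \<in> seg (A, p) \<inter> seg (p, r)"
 hence "x = p \<or> x = q" using F_D[of x] seg_subs gF by blast
 hence "x = p" using x not_in by blast
 thus "x \<in> ends (A, p) \<inter> ends (p, r)" by simp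
qed
have s5: "S (A, p) (r, q)" unfolding S_def
proof
 fix x assume x: "x \<in> seg (A, p) \<inter> seg (r, q)"
 hence "x = p \<or> x = q" using F_D[of x] seg_subs gF by blast
 hence False using x not_in not_F_seg by blast
 thus "x \<in> ends (A, p) \<inter> ends (r, q)" by simp
qed
have s6: "S (q, B) (r, q)" unfolding S_def
proof
 fix x assume x: "x \<in> seg (q, B) \<inter> seg (r, q)"
 hence "x = p \<or> x = q" using F_D[of x] seg_subs gF by blast
 hence "x = q" using x not_in by blast
 thus "x \<in> ends (q, B) \<inter> ends (r, q)" by simp
qed
have s7: "S (q, B) (p, r)" unfolding S_def
proof
 fix x assume x: "x \<in> seg (q, B) \<inter> seg (p, r)"
 hence "x = p \<or> x = q" using F_D[of x] seg_subs gF by blast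
 hence False using x not_in not_F_seg by blast
 thus "x \<in> ends (q, B) \<inter> ends (p, r)" by simp
qed
have s8: "S (p, r) (r, q)" unfolding S_def using corner by (auto intro!: subsetI)
have s9: "S (A, p) (q, B)" unfolding S_def using not_in(5) by blast
have s0: "S f g" if "f \<in> E" "g \<in> E" "f ~= g" for f g unfolding S_def using gen_seg[OF R that] by blast
note all = s1 s2 s3[OF _ _ gF(1)] s3[OF _ _ gF(2)] s4 s5 s6 s7 s8 s9 s0
have "S e f"
 using e(1)
proof (cases rule: edges_E')
 case 1 show ?thesis using e(2) by (cases rule: edges_E') (use 1 e(3) all in \<open>simp_all\<close>)
next
 case 2 show ?thesis using e(2) by (cases rule: edges_E') (use 2 e(3) all all[THEN sym] in \<open>simp_all\<close>)
next
 case 3 show ?thesis using e(2) by (cases rule: edges_E') (use 3 e(3) all all[THEN sym] in \<open>simp_all\<close>)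
next
 case 4 show ?thesis using e(2) by (cases rule: edges_E') (use 4 e(3) all all[THEN sym] in \<open>simp_all\<close>)
next
 case 5 show ?thesis using e(2) by (cases rule: edges_E') (use 5 e(3) all all[THEN sym] in \<open>simp_all\<close>)
qed
thus ?thesis by (simp add: S_def)
qed

lemma D'_cases: "x \<in> D' ==> x \<in> F \<or> (x \<in> D \<and> x \<notin> F \<and> x \<notin> bs)"
using lk_detour F_ends by (auto simp: open_segment_def)

lemma D'_iff: "x \<in> D' \<longleftrightarrow> x \<in> F \<or> (x \<in> D \<and> x \<notin> bs)"
unfolding lk_detour using F_ends by (auto simp: open_segment_def)

text \<open>The only new coincidences in the projection: an old strand passes below a new side, away
  from the corners and from all vertices.\<close>

lemma mixed:
 assumes "a \<in> D" "a \<notin> F" "a \<notin> bs" "b \<in> F" "proj a = proj b"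
 shows "proj a \<in> sides" "a ~= p" "a ~= q" "b \<notin> D" "height a < height b" "b ~= p" "b ~= q" "b ~= r" "a \<notin> fst ` E"
proof -
show s: "proj a \<in> sides" using F_plane(1)[OF assms(4)] assms(5) by simp
show n: "a ~= p" "a ~= q" using assms(2) F_ends by blast+
note o = over_side[OF assms(1) s n]
show "b \<notin> D" "height a < height b" using o(6)[OF assms(4)] assms(5) by simp_all
show "b ~= p" "b ~= q" using \<open>b \<notin> D\<close> p_edge by blast+
show "b ~= r" using o(3) assms(5) proj_r by auto
show "a \<notin> fst ` E" by (rule o(2))
qed

text \<open>The new crossings involve one point of \<open>F\<close> and one old point, and the
  assumptions \<open>side\<close>, \<open>trP\<close>, \<open>trQ\<close> of \<open>finger\<close>
  are general position for exactly these. The old crossings inherit it.\<close>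

lemma gen_E': "gen E'"
unfolding gen_def
proof (intro conjI ballI impI)
fix e f assume "e \<in> E'" "f \<in> E'" "e ~= f"
thus "seg e \<inter> seg f \<subseteq> ends e \<inter> ends f" by (rule meet_E')
next
fix a b x assume abx: "a \<in> D'" "b \<in> D'" "x \<in> D'" "proj a = proj b \<and> proj b = proj x"
show "a = b \<or> b = x \<or> a = x"
proof (rule ccontr)
 assume n: "\<not> (a = b \<or> b = x \<or> a = x)"
 \<comment> \<open>A triple with points on and off \<open>F\<close> would contain two old points
   over one point of a side, against \<open>side\<close>.\<close>
 have "\<not> (u \<in> F \<and> v \<in> D \<and> v \<notin> F \<and> v \<notin> bs \<and> w \<in> D' \<and> w ~= u \<and> w ~= v \<and> proj u = proj v \<and> proj w = proj v)" for u v w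
 proof
  assume h: "u \<in> F \<and> v \<in> D \<and> v \<notin> F \<and> v \<notin> bs \<and> w \<in> D' \<and> w ~= u \<and> w ~= v \<and> proj u = proj v \<and> proj w = proj v"
  have "w \<notin> F" using F_inj[of u w] h by auto
  hence "w \<in> D" using h D'_iff by blast
  moreover have "proj v \<in> sides" "v ~= p" "v ~= q" using mixed[of v u] h by auto
  ultimately show False using over_side(4)[of v w] h by auto
 qed
 thus False using abx n D'_cases F_inj gen_triple[OF R, of a b x] by metis
qed
next
fix a b assume ab: "a \<in> D'" "b \<in> D'" "a ~= b \<and> proj a = proj b"
have key: "v \<notin> fst ` E' \<and> w \<notin> fst ` E'" if vw: "v \<in> D'" "w \<in> D'" "v ~= w" "proj v = proj w" "v \<notin> F" for v w
proof -
 have v: "v \<in> D" "v \<notin> bs" using vw D'_iff by blast+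
 have vp: "v \<notin> {p, r, q}" using vw(5) F_ends by blast
 show ?thesis
 proof (cases "w \<in> F")
  case True
  have m: "w \<notin> D" "w ~= p" "w ~= q" "w ~= r" "v \<notin> fst ` E" using mixed[OF v(1) vw(5) v(2) True vw(4)] by blast+
  have "w \<notin> fst ` E" using m(1) seg_lk ends_in_seg(1) by (metis imageE)
  thus ?thesis using m vp V' by blast
 next
  case False
  hence w: "w \<in> D" using vw D'_iff by blast
  have "w \<notin> {p, r, q}" using False F_ends by blast
  thus ?thesis using gen_cross[OF R v(1) w vw(3,4)] vp V' by blast
 qed
qed
have nF: "a \<notin> F \<or> b \<notin> F" using F_inj ab by blast
show "a \<notin> fst ` E'" "b \<notin> fst ` E'" using key[of a b] key[of b a] ab nF by auto
have tr: "cr (dir e) (dir f) ~= 0" if vw: "v \<in> D'" "v ~= w" "proj v = proj w" "v \<notin> F" "e \<in> E'" "f \<in> E'" "v \<in> seg e" "w \<in> seg f" for v w e f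
proof -
 have v: "v \<in> D" "v \<notin> bs" using vw D'_iff by blast+
 obtain e' s where e': "e' \<in> E" "v \<in> seg e'" "s > 0" "dir e = s *. dir e'" using base_edge[OF vw(5,7,4)] by blast
 show ?thesis
 proof (cases "w \<in> F")
  case True
  note m = mixed[OF v(1) vw(4) v(2) True vw(3)]
  have "f = (p, r) \<or> f = (r, q)" using vw(6)
  proof (cases rule: edges_E')
   case 1 thus ?thesis using m(4) seg_lk vw(8) by blast
  qed (use m(4) seg_subs vw(8) in blast)+
  thus ?thesis
  proof
   assume f: "f = (p, r)"
   have d: "dir f = Z - P" by (simp add: f dir_def proj_r P_def)
   have "proj w \<in> cseg P Z" using vw(8) proj_segment[of w p r] by (simp add: f seg_def P_def proj_r)
   hence "cr (dir e') (Z - P) ~= 0" using trP[OF e'(1,2)] m(2) vw(3) by simp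
   thus ?thesis using e' d by simp
  next
   assume f: "f = (r, q)"
   have d: "dir f = - (Z - Q)" by (simp add: f dir_def proj_r Q_def)
   have "proj w \<in> cseg Q Z" using vw(8) proj_segment[of w r q] by (simp add: f seg_def Q_def proj_r closed_segment_commute)
   hence "cr (dir e') (Z - Q) ~= 0" using trQ[OF e'(1,2)] m(3) vw(3) by simp
   thus ?thesis using e'(3) unfolding e'(4) d cr_simps by simp
  qed
 next
  case False
  obtain f' s' where f': "f' \<in> E" "w \<in> seg f'" "s' > 0" "dir f = s' *. dir f'" using base_edge[OF vw(6,8) False] by blast
  have "cr (dir e') (dir f') ~= 0" using gen_trans[OF R vw(2,3) e'(1) f'(1) e'(2) f'(2)] .
  thus ?thesis using e' f' by simp
 qed
qed
fix e f assume ef: "e \<in> E'" "f \<in> E'" "a \<in> seg e \<and> b \<in> seg f"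
show "cr (dir e) (dir f) ~= 0"
proof (cases "a \<in> F")
 case False thus ?thesis using tr[of a b e f] ab ef by blast
next
 case True
 hence "cr (dir f) (dir e) ~= 0" using tr[of b a f e] ab ef nF by auto
 thus ?thesis using cr_swap[of "dir e" "dir f"] by simp
qed
qed

lemma reg_E': "reg E'"
proof -
have "distinct [p, r, q]" using pq_ne r_D p_edge by auto
moreover have "r \<notin> fst ` E" using r_D seg_lk ends_in_seg(1) by (metis imageE)
ultimately show ?thesis unfolding E'_def using reg_detour[OF R AB _ p_edge(5) _ p_edge(6) gen_E'[unfolded E'_def]] by blast
qed

text \<open>\<open>below\<close> says that the solid triangle meets the link only in the base, as a
  Delta-move requires.\<close>

lemma equiv_E': "link_equiv D D'"
proof (rule delta_link_equiv)
have "\<not> collinear {p, q, r}"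
proof
 assume "collinear {p, q, r}"
 then obtain u where u: "\<And>x y. x \<in> {p, q, r} ==> y \<in> {p, q, r} ==> \<exists>c. x - y = c *. u" unfolding collinear_def by blast
 obtain a where a: "q - p = a *. u" using u[of q p] by blast
 obtain b where b: "r - p = b *. u" using u[of r p] by blast
 have "Q - P = proj (q - p)" "Z - P = proj (r - p)" by (simp_all add: P_def Q_def proj_r)
 hence "Q - P = a *. proj u" "Z - P = b *. proj u" unfolding a b by simp_all
 thus False using nd by simp
qed
moreover have "D \<inter> convex hull {p, q, r} = bs"
proof
 show "bs \<subseteq> D \<inter> convex hull {p, q, r}"
  using bs_sub hull_mono[of "{p, q}" "{p, q, r}"] by (auto simp: segment_convex_hull)
 show "D \<inter> convex hull {p, q, r} \<subseteq> bs"
 proof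
  fix x assume x: "x \<in> D \<inter> convex hull {p, q, r}"
  then obtain a b g where c: "0 \<le> a" "0 \<le> b" "0 \<le> g" "a + b + g = 1" "x = a *. p + b *. q + g *. r"
   unfolding convex_hull_3 by blast
  have "proj x = a *. P + b *. Q + g *. Z" by (simp add: c(5) P_def Q_def proj_r)
  hence bb: "bp x = a" "bq x = b" "bz x = g" using bof[OF c(4)] by auto
  hence "proj x \<in> tri P Q Z" using c by (simp add: tri_def)
  moreover have "height x = plane x" unfolding plane_def bb by (simp add: c(5) proj_r)
  ultimately show "x \<in> bs" using below[of x] x unfolding plane_def by auto
 qed
qed
ultimately show "delta_move D D'" unfolding delta_move_def lk_detour F_def Un_assoc by blast
qed

lemma vertices_E': "x \<notin> F ==> x \<in> fst ` E' \<longleftrightarrow> x \<in> fst ` E"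
proof -
assume x: "x \<notin> F"
have "x \<in> fst ` E'" if "x \<in> fst ` E"
proof -
 obtain f where f: "f \<in> E" "fst f = x" using \<open>x \<in> fst ` E\<close> by blast
 show ?thesis
 proof (cases "f = (A, B)")
  case True
  have "(A, p) \<in> E'" unfolding E'_def detour_def by blast
  thus ?thesis using f True by (metis fst_conv image_eqI)
 next
  case False
  hence "f \<in> E'" using f by (simp add: E'_def detour_def)
  thus ?thesis using f by blast
 qed
qed
thus ?thesis using V' x F_ends by blast
qed

end

section \<open>Fingers: the reflected colouring\<close>

context finger
begin

lemma k_bs: "x \<in> bs ==> c x = k"
unfolding k_def by (rule pcol_const[OF col, of bs]) (use bs_sub top in auto)

text \<open>By \<open>top\<close> no strand passes over the base, so a strand that meets it in the
  projection passes under it.\<close>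

lemma ov_base:
 assumes "x \<in> D" "x \<notin> bs" "proj x \<in> cseg P Q"
 obtains w where "w \<in> bs" "w ~= p" "w ~= q" "ov D x w"
proof -
obtain w where w: "w \<in> bs" "proj w = proj x" using bs_over assms(3) by blast
have wD: "w \<in> D" using w bs_sub by blast
have "w ~= p" "w ~= q" using simp_p[OF assms(1)] simp_q[OF assms(1)] w assms(2) unfolding P_def Q_def by metis+
moreover have "\<not> height w < height x"
proof
 assume "height w < height x"
 hence "ov D w x" using w(2) wD assms(1) by (simp add: ov_def)
 thus False using top[OF w(1)] unfolding under_ov by blast
qed
moreover have "height w ~= height x" using w assms(2) pt_eq_iff by metis
ultimately show ?thesis using that w wD assms(1) unfolding ov_def by auto
qed

lemma ov_base_unique: "x \<in> D ==> x \<notin> bs ==> proj x \<in> cseg P Q ==> ov D x w ==> w \<in> bs \<and> w ~= p \<and> w ~= q"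
using ov_base ov_unique[OF R] by metis

lemma base_not_side: "x \<in> D ==> proj x \<in> cseg P Q ==> proj x \<in> sides ==> x = p \<or> x = q"
unfolding Un_iff side_iff using eq_vertex[OF nd] simp_p simp_q by blast

text \<open>With the base the crossings under it disappear, and \<open>top\<close> excludes
  crossings over it. The second alternative lists the new crossings, under the sides.\<close>

lemma ov_D':
 "ov D' u w \<longleftrightarrow> (ov D u w \<and> u \<notin> bs \<and> w \<notin> bs) \<or> (w \<in> F \<and> w \<notin> D \<and> u \<in> D \<and> u \<notin> bs \<and> u \<notin> F \<and> proj u \<in> sides \<and> proj w = proj u)"
proof
assume o: "ov D' u w"
hence h: "proj w = proj u" "height u < height w" "u \<in> D'" "w \<in> D'" by (auto simp: ov_def)
show "(ov D u w \<and> u \<notin> bs \<and> w \<notin> bs) \<or> (w \<in> F \<and> w \<notin> D \<and> u \<in> D \<and> u \<notin> bs \<and> u \<notin> F \<and> proj u \<in> sides \<and> proj w = proj u)"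
proof (cases "u \<in> F")
 case True
 hence "w \<notin> F" using F_inj[of w u] h by auto
 hence "w \<in> D" "w \<notin> bs" using h D'_iff by blast+
 hence "height w < height u" using mixed(5)[of w u] True h \<open>w \<notin> F\<close> by auto
 thus ?thesis using h by simp
next
 case False
 hence u: "u \<in> D" "u \<notin> bs" using h D'_iff by blast+
 show ?thesis
 proof (cases "w \<in> F")
  case True thus ?thesis using mixed[OF u(1) False u(2) True] h u False by auto
 next
  case F: False
  hence "w \<in> D" "w \<notin> bs" using h D'_iff by blast+
  thus ?thesis using u h by (simp add: ov_def)
 qed
qed
next
assume "(ov D u w \<and> u \<notin> bs \<and> w \<notin> bs) \<or> (w \<in> F \<and> w \<notin> D \<and> u \<in> D \<and> u \<notin> bs \<and> u \<notin> F \<and> proj u \<in> sides \<and> proj w = proj u)"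
thus "ov D' u w"
proof
 assume "ov D u w \<and> u \<notin> bs \<and> w \<notin> bs" thus ?thesis by (simp add: ov_def D'_iff)
next
 assume a: "w \<in> F \<and> w \<notin> D \<and> u \<in> D \<and> u \<notin> bs \<and> u \<notin> F \<and> proj u \<in> sides \<and> proj w = proj u"
 hence "height u < height w" using mixed(5)[of u w] by simp
 thus ?thesis using a by (simp add: ov_def D'_iff)
qed
qed

text \<open>By general position a point under a side is the only old point there, so it becomes an
  under point only through the move.\<close>

lemma side_under: "u \<in> D ==> u \<notin> bs ==> u \<notin> F ==> proj u \<in> sides ==> u \<notin> under_points D \<and> (\<exists>w\<in>F. ov D' u w)"
proof -
assume u: "u \<in> D" "u \<notin> bs" "u \<notin> F" "proj u \<in> sides"
obtain w where w: "w \<in> F" "proj w = proj u" using side_F[OF u(4)] by blast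
note m = mixed[OF u(1,3,2) w(1) w(2)[symmetric]]
have "u \<notin> under_points D"
proof
 assume "u \<in> under_points D"
 then obtain z where "ov D u z" unfolding under_ov by blast
 thus False using over_side(4)[OF u(1,4) m(2,3), of z] by (auto simp: ov_def)
qed
moreover have "ov D' u w" unfolding ov_D' using u w m by blast
ultimately show ?thesis using w by blast
qed

definition refl_in :: "pt => int" where
 "refl_in y = (if proj y \<in> itri P Q Z then 2 * k - c y else c y)"

text \<open>A strand under the base had an under point there, where \<open>c\<close> means nothing;
  after the move this is an ordinary point. Its colour is the common limit of \<open>refl_in\<close>
  along both branches, which exists by \<open>base_jump\<close>. Points off the old link get
  \<open>k\<close>, the colour of the new sides.\<close>

definition c' :: "pt => int" where
 "c' x = (if x \<in> F \<or> x \<in> bs \<or> x \<notin> D then k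
  else if proj x \<in> cseg P Q then (SOME a. \<forall>\<^sub>F y in at x within D. refl_in y = a) else refl_in x)"

lemma c'_F: "x \<in> F ==> c' x = k" by (simp add: c'_def)

lemma c'_in: "x \<in> D ==> proj x \<in> itri P Q Z ==> c' x = 2 * k - c x"
using itri_not_side[of "proj x"] F_plane(1)[of x] bs_proj[of x] by (auto simp: c'_def refl_in_def)

lemma c'_out: "x \<in> D ==> proj x \<notin> tri P Q Z ==> c' x = c x"
using F_plane(2)[of x] bs_proj[of x] side_iff(3)[of "proj x"] itri_subset[of P Q Z, THEN subsetD, of "proj x"] by (auto simp: c'_def refl_in_def)

lemma near_D:
 assumes "x \<in> D" "x \<notin> F" "x \<notin> bs"
 shows "\<forall>\<^sub>F y in nhds x. y \<notin> F \<and> y \<notin> bs" "at x within D' = at x within D"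
proof -
have "closed (F \<union> bs)" unfolding F_def by (intro closed_Un) auto
hence "\<forall>\<^sub>F y in nhds x. y \<in> - (F \<union> bs)" using assms by (intro eventually_nhds_in_open open_Compl) auto
thus *: "\<forall>\<^sub>F y in nhds x. y \<notin> F \<and> y \<notin> bs" by eventually_elim auto
show "at x within D' = at x within D"
 by (rule eventually_within_cong) (use * in \<open>eventually_elim, simp add: D'_iff\<close>)
qed

lemma near_proj: "open S ==> proj x \<in> S ==> \<forall>\<^sub>F y in nhds x. proj y \<in> S"
proof -
assume S: "open S" "proj x \<in> S"
have "open (proj -` S)" using S(1) continuous_on_proj[OF continuous_on_id] by (simp add: open_vimage)
hence "\<forall>\<^sub>F y in nhds x. y \<in> proj -` S" using S(2) by (intro eventually_nhds_in_open) auto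
thus ?thesis by simp
qed

lemma at_mono: "\<forall>\<^sub>F y in nhds x. T y ==> \<forall>\<^sub>F y in at x within S. T y \<and> y \<in> S \<and> y ~= x"
unfolding eventually_at_filter by (auto elim: eventually_mono)

lemma c'_near_in:
 assumes "x \<in> D" "proj x \<in> itri P Q Z" shows "\<forall>\<^sub>F y in at x within D. c' y = 2 * k - c y"
using at_mono[OF near_proj[OF open_itri assms(2)], of D] by eventually_elim (use c'_in in blast)

lemma c'_near_out:
 assumes "x \<in> D" "proj x \<notin> tri P Q Z" shows "\<forall>\<^sub>F y in at x within D. c' y = c y"
proof -
have "\<forall>\<^sub>F y in nhds x. proj y \<in> - tri P Q Z" using near_proj[OF open_Compl[OF closed_tri]] assms(2) by simp
from at_mono[OF this, of D] show ?thesis by eventually_elim (use c'_out in blast)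
qed

lemma bary_line: "bary P' Q' R' (proj (x + t *. v)) = bary P' Q' R' (proj x) + t * (cr (proj v) (Q' - R') / cr (Q' - P') (R' - P'))"
by (simp only: proj_simps bary_move)

lemma bary_cont: "((\<lambda>t. bary P' Q' R' (proj (x + t *. v))) \<longlongrightarrow> bary P' Q' R' (proj x)) (at 0 within S)"
proof -
have "((\<lambda>t. b + t * K) \<longlongrightarrow> b) (at 0 within S)" for b K :: real by (auto intro!: tendsto_eq_intros)
thus ?thesis unfolding bary_line .
qed

text \<open>\<open>f1\<close> is the coordinate that vanishes at \<open>x\<close>, and
  \<open>L\<close> its slope in direction \<open>v\<close>. The other two stay positive near
  \<open>x\<close>, so the sign of \<open>t * L\<close> alone decides between inside and
  outside.\<close>

lemma across:
 fixes f1 f2 f3 :: "real \<times> real => real"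
 assumes "f1 (proj x) = 0" "f2 (proj x) > 0" "f3 (proj x) > 0"
 and f1: "\<And>t. f1 (proj (x + t *. v)) = t * L" and L: "L ~= 0"
 and lim: "((\<lambda>t. f2 (proj (x + t *. v))) \<longlongrightarrow> f2 (proj x)) (at 0)" "((\<lambda>t. f3 (proj (x + t *. v))) \<longlongrightarrow> f3 (proj x)) (at 0)"
 and T: "\<And>y. proj y \<in> tri P Q Z \<longleftrightarrow> 0 \<le> f1 (proj y) \<and> 0 \<le> f2 (proj y) \<and> 0 \<le> f3 (proj y)"
  "\<And>y. proj y \<in> itri P Q Z \<longleftrightarrow> 0 < f1 (proj y) \<and> 0 < f2 (proj y) \<and> 0 < f3 (proj y)"
 shows "\<forall>\<^sub>F t in at 0. if 0 < t * L then proj (x + t *. v) \<in> itri P Q Z else proj (x + t *. v) \<notin> tri P Q Z"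
proof -
have "\<forall>\<^sub>F t in at 0. 0 < f2 (proj (x + t *. v))" "\<forall>\<^sub>F t in at 0. 0 < f3 (proj (x + t *. v))"
 using order_tendstoD(1)[OF lim(1) assms(2)] order_tendstoD(1)[OF lim(2) assms(3)] by auto
moreover have "\<forall>\<^sub>F t in at (0::real). t ~= 0" by (simp add: eventually_at_filter)
ultimately show ?thesis
proof eventually_elim
 case (elim t)
 have "t * L ~= 0" using elim L by simp
 thus ?case unfolding T f1 using elim by auto
qed
qed

text \<open>Corners are excluded, so just one coordinate vanishes at \<open>x\<close>; its slope is
  nonzero because the strand is transversal to the side.\<close>

lemma across_sides:
 assumes x: "x \<in> D" "proj x \<in> sides" "x ~= p" "x ~= q" and e: "e \<in> E" "x \<in> seg e"
 obtains L where "L ~= 0" "\<forall>\<^sub>F t in at 0. if 0 < t * L then proj (x + t *. (snd e - fst e)) \<in> itri P Q Z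
  else proj (x + t *. (snd e - fst e)) \<notin> tri P Q Z"
proof -
note o = over_side[OF x]
have np: "proj x ~= P" "proj x ~= Q" using simp_p[OF x(1)] simp_q[OF x(1)] x(3,4) by blast+
have pv: "proj (snd e - fst e) = dir e" by (simp add: dir_def)
consider "proj x \<in> cseg P Z" | "proj x \<in> cseg Q Z" using x(2) by blast
thus ?thesis
proof cases
 case 1
 hence b: "bq x = 0" "0 \<le> bp x" "0 \<le> bz x" unfolding side_iff tri_def by auto
 have "bp x ~= 0" "bz x ~= 0" using eq_vertex[OF nd, of "proj x"] b(1) np o(3) by auto
 hence b': "0 < bp x" "0 < bz x" using b by auto
 let ?L = "cr (dir e) (Z - P) / cr (Z - Q) (P - Q)"
 have L: "?L ~= 0" using trP[OF e 1 x(3)] nd unfolding cr_cycle(1)[of Z Q P] by simp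
 show ?thesis
 proof (rule that[OF L])
  show "\<forall>\<^sub>F t in at 0. if 0 < t * ?L then proj (x + t *. (snd e - fst e)) \<in> itri P Q Z else proj (x + t *. (snd e - fst e)) \<notin> tri P Q Z"
  proof (rule across[where ?f1.0="bary Q Z P", OF b(1) b' _ L bary_cont bary_cont])
   show "bary Q Z P (proj (x + t *. (snd e - fst e))) = t * ?L" for t by (simp only: bary_line b(1) pv add_0)
  qed (auto simp: tri_def itri_def)
 qed
next
 case 2
 hence b: "bp x = 0" "0 \<le> bq x" "0 \<le> bz x" unfolding side_iff tri_def by auto
 have "bq x ~= 0" "bz x ~= 0" using eq_vertex[OF nd, of "proj x"] b(1) np o(3) by auto
 hence b': "0 < bq x" "0 < bz x" using b by auto
 let ?L = "cr (dir e) (Q - Z) / cr (Q - P) (Z - P)"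
 have "cr (dir e) (Q - Z) = - cr (dir e) (Z - Q)" by simp
 hence L: "?L ~= 0" using trQ[OF e 2 x(4)] nd by (simp del: cr_simps)
 show ?thesis
 proof (rule that[OF L])
  show "\<forall>\<^sub>F t in at 0. if 0 < t * ?L then proj (x + t *. (snd e - fst e)) \<in> itri P Q Z else proj (x + t *. (snd e - fst e)) \<notin> tri P Q Z"
  proof (rule across[where ?f1.0="bary P Q Z", OF b(1) b' _ L bary_cont bary_cont])
   show "bary P Q Z (proj (x + t *. (snd e - fst e))) = t * ?L" for t by (simp only: bary_line b(1) pv add_0)
  qed (auto simp: tri_def itri_def)
 qed
qed
qed

text \<open>On entering the triangle below a side of colour \<open>k\<close>, a strand changes from
  \<open>c x\<close> to \<open>2 * k - c x\<close>. Which direction leads inside depends on the sign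
  of \<open>L\<close>; hence the disjunction.\<close>

lemma side_jump:
 assumes x: "x \<in> D" "x \<notin> bs" "x \<notin> F" "proj x \<in> sides"
 shows "jump D' c' x k (c x) \<or> jump D' c' x k (2 * k - c x)"
proof -
have np: "x ~= p" "x ~= q" using x F_ends by auto
note o = over_side[OF x(1,4) np]
obtain e where e: "e \<in> E" "x \<in> seg e" using x(1) lkE by blast
define v where "v = snd e - fst e"
have v: "v ~= 0" using edge_vec_nz[OF R e(1)] by (simp add: v_def)
note aw = at_within_edge[OF R e o(2), folded v_def]
obtain L where L: "L ~= 0" "\<forall>\<^sub>F t in at 0. if 0 < t * L then proj (x + t *. v) \<in> itri P Q Z else proj (x + t *. v) \<notin> tri P Q Z"
 using across_sides[OF x(1,4) np e] unfolding v_def by blast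
have "x \<notin> under_points D" using side_under x by blast
hence "\<forall>\<^sub>F y in at x within D. c y = c x \<and> y \<in> D"
 using col x(1) unfolding pcol_def by (auto simp: eventually_conj_iff eventually_at_filter)
hence "\<forall>\<^sub>F t in at 0. c (x + t *. v) = c x \<and> x + t *. v \<in> D" unfolding aw eventually_filtermap .
hence ev: "\<forall>\<^sub>F t in at 0. c' (x + t *. v) = (if 0 < t * L then 2 * k - c x else c x)"
 using L(2) by eventually_elim (use c'_in c'_out in \<open>auto split: if_splits\<close>)
have "\<forall>\<^sub>F t in at_right 0. c' (x + t *. v) = (if 0 < t * L then 2 * k - c x else c x)" using ev by (simp add: eventually_at_split)
moreover have "\<forall>\<^sub>F t in at_right 0. c' (x + (- t) *. v) = (if 0 < (- t) * L then 2 * k - c x else c x)"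
 using ev unfolding eventually_at_split at_left_minus eventually_filtermap by simp
ultimately have "\<forall>\<^sub>F t in at_right 0. if L > 0 then c' (x + t *. v) = 2 * k - c x \<and> c' (x - t *. v) = c x
  else c' (x + t *. v) = c x \<and> c' (x - t *. v) = 2 * k - c x"
 using eventually_at_right_less
 by eventually_elim (use L(1) in \<open>auto simp: zero_less_mult_iff mult_less_0_iff split: if_splits\<close>)
hence "\<forall>\<^sub>F t in at_right 0. c' (x + t *. v) = a \<and> c' (x - t *. v) = 2 * k - a"
 if "a = (if L > 0 then 2 * k - c x else c x)" for a by eventually_elim (auto simp: that)
hence "jump D' c' x k (if L > 0 then 2 * k - c x else c x)"
 unfolding jump_def near_D(2)[OF x(1,3,2)] using v aw by blast
thus ?thesis by (auto split: if_splits)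
qed

text \<open>The branches under the base are coloured \<open>a\<close> and \<open>2 * k - a\<close>,
  and exactly one of them is reflected. This makes the two colours equal, so the strand has constant
  colour once the base is gone.\<close>

lemma base_jump:
 assumes x: "x \<in> D" "x \<notin> bs" "proj x \<in> cseg P Q" and J: "jump D c x k a"
 shows "c' x = a \<or> c' x = 2 * k - a" "\<forall>\<^sub>F y in at x within D. c' y = c' x"
proof -
obtain w where w: "w \<in> bs" "w ~= p" "w ~= q" "ov D x w" using ov_base[OF x] .
have xF: "x \<notin> F" using F_D x p_edge by (metis ends_in_segment)
have pw: "proj x = proj w" using w(4) by (simp add: ov_def)
have np: "proj x ~= P" "proj x ~= Q" using simp_p simp_q x ends_in_segment by metis+
obtain e where e: "e \<in> E" "x \<in> seg e" using x(1) lkE by blast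
have nv: "x \<notin> fst ` E" using under_nonvertex[OF R] w(4) unfolding under_ov by blast
have "x ~= w" using w(1) x(2) by blast
hence tr: "cr (dir e) (dir (A, B)) ~= 0" using gen_trans[OF R _ pw e(1) AB e(2)] w(1) bs_sub by blast
obtain v where v: "v ~= 0" "at x within D = along x v"
  "\<forall>\<^sub>F t in at_right 0. c (x + t *. v) = a \<and> c (x - t *. v) = 2 * k - a"
 using J unfolding jump_def by blast
note aw = at_within_edge[OF R e nv]
have "\<exists>s. v = s *. (snd e - fst e)"
 by (rule filtermap_line_within[OF aw v(2)]) (unfold aw, auto simp: eventually_filtermap)
then obtain s where s: "v = s *. (snd e - fst e)" by blast
hence sv: "proj v = s *. dir e" "s ~= 0" using v(1) by (auto simp: dir_def)
have b: "bz x = 0" "0 \<le> bp x" "0 \<le> bq x" using x(3) unfolding side_iff tri_def by auto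
have "bp x ~= 0" "bq x ~= 0" using eq_vertex[OF nd, of "proj x"] b(1) np by auto
hence b': "0 < bp x" "0 < bq x" using b by auto
define L where "L = cr (proj v) (P - Q) / cr (P - Z) (Q - Z)"
have "P - Q = - ((\<beta> - \<alpha>) *. dir (A, B))" using PQ_diff by (metis minus_diff_eq)
hence L: "L ~= 0" using tr sv ab nd unfolding L_def cr_cycle(2)[of P Z Q] sv(1) by (simp del: cr_simps(2,6))
have "\<forall>\<^sub>F t in at 0. if 0 < t * L then proj (x + t *. v) \<in> itri P Q Z else proj (x + t *. v) \<notin> tri P Q Z"
proof (rule across[where ?f1.0="bary Z P Q", OF b(1) b' _ L bary_cont bary_cont])
 show "bary Z P Q (proj (x + t *. v)) = t * L" for t by (simp only: bary_line b(1) L_def add_0)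
qed (auto simp: tri_def itri_def)
hence in_out: "\<forall>\<^sub>F t in at 0. refl_in (x + t *. v) = (if 0 < t * L then 2 * k - c (x + t *. v) else c (x + t *. v))"
 by eventually_elim (metis itri_subset refl_in_def subsetD)
have r: "\<forall>\<^sub>F t in at_right 0. c (x + t *. v) = (if t > 0 then a else 2 * k - a)"
 using v(3) eventually_at_right_less by eventually_elim auto
have "\<forall>\<^sub>F t in at_right 0. c (x + (- t) *. v) = (if - t > 0 then a else 2 * k - a)"
 using v(3) eventually_at_right_less[of "0::real"] by eventually_elim auto
hence "\<forall>\<^sub>F t in at 0. c (x + t *. v) = (if t > 0 then a else 2 * k - a)"
 using r unfolding eventually_at_split at_left_minus eventually_filtermap by simp
moreover have "\<forall>\<^sub>F t in at (0::real). t ~= 0" by (simp add: eventually_at_filter)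
ultimately have "\<forall>\<^sub>F t in at 0. refl_in (x + t *. v) = (if L > 0 then 2 * k - a else a)"
 using in_out by eventually_elim (use L in \<open>auto simp: zero_less_mult_iff mult_less_0_iff split: if_splits\<close>)
hence ev: "\<forall>\<^sub>F y in at x within D. refl_in y = (if L > 0 then 2 * k - a else a)" unfolding v(2) eventually_filtermap .
have some: "(SOME b. \<forall>\<^sub>F y in at x within D. refl_in y = b) = (if L > 0 then 2 * k - a else a)"
proof (rule some_equality[where P="\<lambda>b. \<forall>\<^sub>F y in at x within D. refl_in y = b", OF ev])
 fix b assume "\<forall>\<^sub>F y in at x within D. refl_in y = b"
 with ev have "\<forall>\<^sub>F y in at x within D. b = (if L > 0 then 2 * k - a else a)" by eventually_elim simp
 thus "b = (if L > 0 then 2 * k - a else a)" using at_lk_neq_bot[OF R x(1)] by (simp add: eventually_const)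
qed
have cx: "c' x = (if L > 0 then 2 * k - a else a)" using xF x some by (simp add: c'_def)
thus "c' x = a \<or> c' x = 2 * k - a" by simp
have "\<forall>\<^sub>F y in at x within D. y \<in> D \<and> (y \<notin> F \<and> y \<notin> bs)" using at_mono[OF near_D(1)[OF x(1) xF x(2)], of D] by eventually_elim auto
moreover have "\<forall>\<^sub>F y in at x within D. proj y \<notin> cseg P Q"
proof -
 have "\<forall>\<^sub>F t in at 0. bary Z P Q (proj (x + t *. v)) ~= 0"
  using \<open>\<forall>\<^sub>F t in at (0::real). t ~= 0\<close> by eventually_elim (simp add: bary_line b(1) L_def[symmetric] L del: proj_simps cr_simps)
 hence "\<forall>\<^sub>F y in at x within D. bary Z P Q (proj y) ~= 0" unfolding v(2) eventually_filtermap .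
 thus ?thesis by eventually_elim (use side_iff(3) in blast)
qed
ultimately have "\<forall>\<^sub>F y in at x within D. c' y = refl_in y" by eventually_elim (simp add: c'_def)
thus "\<forall>\<^sub>F y in at x within D. c' y = c' x" using ev by eventually_elim (simp add: cx)
qed

text \<open>Reflection in \<open>k\<close> carries the relation \<open>a + a' = 2 * m\<close> over
  to the reflected colours.\<close>

lemma jump_in: "jump D c u m a ==> u \<in> D ==> u \<notin> F ==> u \<notin> bs ==> proj u \<in> itri P Q Z ==> jump D' c' u (2 * k - m) (2 * k - a)"
 and jump_out: "jump D c u m a ==> u \<in> D ==> u \<notin> F ==> u \<notin> bs ==> proj u \<notin> tri P Q Z ==> jump D' c' u m a"
proof -
assume J: "jump D c u m a" and u: "u \<in> D" "u \<notin> F" "u \<notin> bs"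
obtain v where v: "v ~= 0" "at u within D = along u v"
  "\<forall>\<^sub>F t in at_right 0. c (u + t *. v) = a \<and> c (u - t *. v) = 2 * m - a"
 using J unfolding jump_def by blast
have tr: "\<forall>\<^sub>F t in at_right 0. c' (u + t *. v) = f (c (u + t *. v)) \<and> c' (u - t *. v) = f (c (u - t *. v))"
 if f: "\<forall>\<^sub>F y in at u within D. c' y = f (c y)" for f
proof -
 have *: "\<forall>\<^sub>F t in at 0. c' (u + t *. v) = f (c (u + t *. v))" using f unfolding v(2) eventually_filtermap .
 hence "\<forall>\<^sub>F t in at_right 0. c' (u + (- t) *. v) = f (c (u + (- t) *. v))"
  unfolding eventually_at_split at_left_minus eventually_filtermap by simp
 moreover have "\<forall>\<^sub>F t in at_right 0. c' (u + t *. v) = f (c (u + t *. v))" using * by (simp add: eventually_at_split)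
 ultimately show ?thesis by eventually_elim simp
qed
note at' = near_D(2)[OF u]
show "proj u \<in> itri P Q Z ==> jump D' c' u (2 * k - m) (2 * k - a)"
proof -
 assume "proj u \<in> itri P Q Z"
 from tr[OF c'_near_in[OF u(1) this]] v(3)
 have "\<forall>\<^sub>F t in at_right 0. c' (u + t *. v) = 2 * k - a \<and> c' (u - t *. v) = 2 * (2 * k - m) - (2 * k - a)"
  by eventually_elim simp
 thus ?thesis unfolding jump_def at' using v(1,2) by blast
qed
show "proj u \<notin> tri P Q Z ==> jump D' c' u m a"
proof -
 assume "proj u \<notin> tri P Q Z"
 from tr[OF c'_near_out[OF u(1) this]] v(3)
 have "\<forall>\<^sub>F t in at_right 0. c' (u + t *. v) = a \<and> c' (u - t *. v) = 2 * m - a"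
  by eventually_elim simp
 thus ?thesis unfolding jump_def at' using v(1,2) by blast
qed
qed

text \<open>The critical points are \<open>p\<close> and \<open>q\<close>, where the sides meet the
  rest of the edge \<open>(A, B)\<close>. That edge projects to the line of the base, hence it is
  not reflected and near these points keeps colour \<open>k\<close>.\<close>

lemma near_F:
 assumes x: "x \<in> F" shows "\<forall>\<^sub>F y in at x within D'. c' y = k"
proof (cases "x \<in> D")
case False
have "\<forall>\<^sub>F y in nhds x. y \<in> - D" by (rule eventually_nhds_in_open) (use closed_lk[OF R] False in auto)
from at_mono[OF this, of D'] show ?thesis by eventually_elim (use D'_iff c'_F in blast)
next
case True
hence pq: "x = p \<or> x = q" using F_D x by blast
have nv: "x \<notin> fst ` E" "x \<in> seg (A, B)" "x \<in> bs" using pq p_edge by auto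
have "\<forall>\<^sub>F y in at x within D. c y = c x" using col True top[OF nv(3)] unfolding pcol_def by blast
hence "\<forall>\<^sub>F y in nhds x. y ~= x --> y \<in> D --> c y = c x" by (simp add: eventually_at_filter)
hence "\<forall>\<^sub>F y in nhds x. y \<in> D' --> c' y = k" using star_near[OF R True]
proof eventually_elim
 case (elim y)
 show ?case
 proof
  assume y: "y \<in> D'"
  show "c' y = k"
  proof (cases "y \<in> F \<or> y \<in> bs \<or> y \<notin> D")
   case True thus ?thesis by (auto simp: c'_def)
  next
   case False
   then obtain e where e: "e \<in> E" "x \<in> seg e" "y \<in> seg e" using elim by blast
   hence "e = (A, B)" using nonvertex_edge[OF R \<open>x \<in> D\<close> nv(1)] nv(2) AB by blast
   hence bz: "bz y = 0" using edge_bz e by blast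
   have "proj y \<notin> cseg P Q"
   proof
    assume "proj y \<in> cseg P Q"
    then obtain w where w: "w \<in> bs" "proj w = proj y" using bs_over by blast
    hence "w = y" using seg_proj_inj[OF R AB] e(3) \<open>e = (A, B)\<close> bs_sub by blast
    thus False using w False by blast
   qed
   moreover have "proj y \<notin> itri P Q Z" using bz by (simp add: itri_def)
   ultimately have "c' y = c y" using False by (simp add: c'_def refl_in_def)
   also have "\<dots> = c x" using elim False F_ends by (metis x)
   finally show ?thesis using k_bs nv(3) by simp
  qed
 qed
qed
thus ?thesis unfolding eventually_at_filter by eventually_elim blast
qed

text \<open>A crossing of the new diagram is an old one outside the triangle, an old one that is
  reflected with both its strands, or a new one under a side.\<close>

theorem pcol_D': "pcol D' c'"
unfolding pcol_def
proof (intro conjI ballI allI impI)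
fix x assume x: "x \<in> vis D'"
show "\<forall>\<^sub>F y in at x within D'. c' y = c' x"
proof (cases "x \<in> F")
 case True thus ?thesis using near_F c'_F by simp
next
 case False
 hence xD: "x \<in> D" "x \<notin> bs" using x D'_iff by blast+
 note at' = near_D(2)[OF xD(1) False xD(2)]
 show ?thesis
 proof (cases "proj x \<in> cseg P Q")
  case True
  obtain w where w: "w \<in> bs" "w ~= p" "w ~= q" "ov D x w" using ov_base[OF xD True] .
  obtain a where "jump D c x k a" using col w(4) k_bs[OF w(1)] unfolding pcol_def by metis
  from base_jump(2)[OF xD True this] show ?thesis unfolding at' .
 next
  case nb: False
  have ns: "proj x \<notin> sides" using side_under[OF xD False] x unfolding under_ov by blast
  have xU: "x \<notin> under_points D"
  proof
   assume "x \<in> under_points D"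
   then obtain w where w: "ov D x w" unfolding under_ov by blast
   hence "w \<notin> bs" using nb bs_proj[of w] by (auto simp: ov_def)
   hence "ov D' x w" unfolding ov_D' using w xD by blast
   thus False using x unfolding under_ov by blast
  qed
  have ev: "\<forall>\<^sub>F y in at x within D. c y = c x" using col xD(1) xU unfolding pcol_def by blast
  show ?thesis unfolding at'
  proof (cases "proj x \<in> itri P Q Z")
   case True
   from ev c'_near_in[OF xD(1) True] show "\<forall>\<^sub>F y in at x within D. c' y = c' x"
    by eventually_elim (use c'_in[OF xD(1) True] in simp)
  next
   case False
   hence T: "proj x \<notin> tri P Q Z" using tri_cases ns nb by blast
   from ev c'_near_out[OF xD(1) T] show "\<forall>\<^sub>F y in at x within D. c' y = c' x"
    by eventually_elim (use c'_out[OF xD(1) T] in simp)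
  qed
 qed
qed
next
fix u w assume "ov D' u w"
then consider "ov D u w" "u \<notin> bs" "w \<notin> bs" | "w \<in> F" "w \<notin> D" "u \<in> D" "u \<notin> bs" "u \<notin> F" "proj u \<in> sides" "proj w = proj u"
 unfolding ov_D' by blast
thus "\<exists>a. jump D' c' u (c' w) a"
proof cases
 case 1
 have uw: "u \<in> D" "w \<in> D" "proj w = proj u" "height u < height w" using 1 by (auto simp: ov_def)
 obtain a where a: "jump D c u (c w) a" using col 1(1) unfolding pcol_def by blast
 have uF: "u \<notin> F" using F_D[of u] uw 1(2) by auto
 have nb: "proj u \<notin> cseg P Q" using ov_base_unique[OF uw(1) 1(2) _ 1(1)] 1(3) by blast
 have ns: "proj u \<notin> sides" using side_under[OF uw(1) 1(2) uF] 1(1) unfolding under_ov by blast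
 show ?thesis
 proof (cases "proj u \<in> itri P Q Z")
  case True
  hence "c' w = 2 * k - c w" using c'_in[OF uw(2)] uw(3) by simp
  thus ?thesis using jump_in[OF a uw(1) uF 1(2) True] by auto
 next
  case False
  hence T: "proj u \<notin> tri P Q Z" using tri_cases ns nb by blast
  hence "c' w = c w" using c'_out[OF uw(2)] uw(3) by simp
  thus ?thesis using jump_out[OF a uw(1) uF 1(2) T] by auto
 qed
next
 case 2
 thus ?thesis using side_jump[of u] c'_F by auto
qed
qed

end

section \<open>Existence of fingers in general position\<close>

lemma below_exists:
 assumes R: "reg E" and AB: "(A, B) \<in> E" and ab: "0 < \<alpha>" "\<alpha> < \<beta>" "\<beta> < 1"
 and p: "p = at_edge (A, B) \<alpha>" and q: "q = at_edge (A, B) \<beta>"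
 and nd: "cr (proj q - proj p) (Z - proj p) ~= 0"
 and top: "\<And>x. x \<in> cseg p q ==> x \<notin> und E \<and> x \<notin> fst ` E"
 shows "\<exists>H. \<forall>y\<in>lk E. proj y \<in> tri (proj p) (proj q) Z --> y \<in> cseg p q \<or>
   height y < bary (proj p) (proj q) Z (proj y) * height p + bary (proj q) Z (proj p) (proj y) * height q + bary Z (proj p) (proj q) (proj y) * H"
proof -
define P Q where "P = proj p" and "Q = proj q"
define g where "g y = height y - bary P Q Z (proj y) * height p - bary Q Z P (proj y) * height q" for y
define bz where "bz y = bary Z P Q (proj y)" for y
have nd': "cr (Q - P) (Z - P) ~= 0" using nd by (simp add: P_def Q_def del: cr_simps)
have over: "\<exists>w\<in>cseg p q. proj w = proj y \<and> height w = height y - g y"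
 if y: "proj y \<in> tri P Q Z" "bz y = 0" for y
proof -
 define t where "t = bary Q Z P (proj y)"
 have s: "bary P Q Z (proj y) = 1 - t" using bary_sum[OF nd', of "proj y"] y(2) by (simp add: t_def bz_def)
 have "proj y = (1 - t) *. P + t *. Q" using bary_comb[OF nd', of "proj y"] y(2) s by (simp add: t_def bz_def)
 moreover have "0 \<le> t" "t \<le> 1" using y(1) s by (auto simp: tri_def t_def)
 ultimately have "(1 - t) *. p + t *. q \<in> cseg p q" "proj ((1 - t) *. p + t *. q) = proj y"
  unfolding closed_segment_def by (auto simp: P_def Q_def)
 moreover have "height ((1 - t) *. p + t *. q) = height y - g y" unfolding g_def s t_def[symmetric] by simp
 ultimately show ?thesis by blast
qed
have bsE: "cseg p q \<subseteq> seg (A, B)"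
proof -
 have "p \<in> seg (A, B)" "q \<in> seg (A, B)" using ab by (auto simp: p q seg_at_edge)
 thus ?thesis by (simp add: seg_def closed_segment_subset)
qed
define S where "S = (\<Union>e\<in>E - {(A, B)}. seg e)"
\<comment> \<open>The points of other edges over the triangle that are not below the plane with
  \<open>H = 0\<close>. On this compact set \<open>bz\<close> is positive: a point over the base
  would lie on or above the base, against \<open>top\<close>. So a large \<open>H\<close> lifts the
  plane above all of them.\<close>
define K where "K = S \<inter> ((\<lambda>y. proj y) -` tri P Q Z \<inter> g -` {0..})"
have bz0: "bz y > 0" if y: "y \<in> K" for y
proof (rule ccontr)
 assume "\<not> bz y > 0"
 hence "bz y = 0" "proj y \<in> tri P Q Z" "0 \<le> g y" using y by (auto simp: K_def tri_def bz_def)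
 then obtain w where w: "w \<in> cseg p q" "proj w = proj y" "height w = height y - g y" "0 \<le> g y" using over by blast
 obtain e where e: "e \<in> E" "e ~= (A, B)" "y \<in> seg e" using y unfolding K_def S_def by blast
 have wD: "w \<in> lk E" "y \<in> lk E" using w(1) bsE seg_lk[OF AB] seg_lk[OF e(1,3)] by blast+
 have "\<not> height w < height y"
 proof
  assume "height w < height y"
  hence "ov (lk E) w y" using w(2) wD by (simp add: ov_def)
  thus False using top[OF w(1)] unfolding under_ov by blast
 qed
 hence "w = y" using w(2,3,4) pt_eq_iff[of w y] by simp
 hence "y \<in> ends (A, B)" using gen_seg[OF R AB e(1) e(2)[symmetric]] w(1) bsE e(3) by blast
 thus False using top[OF w(1)] \<open>w = y\<close> ends_V[OF R AB] by auto
qed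
have cS: "compact S" unfolding S_def seg_def using reg_finite[OF R] by (intro compact_UN) auto
have "closed ((\<lambda>y. proj y) -` tri P Q Z \<inter> g -` {0..})"
 unfolding g_def by (intro closed_Int closed_vimage closed_tri closed_atLeast continuous_intros)
hence cK: "compact K" unfolding K_def by (rule compact_Int_closed[OF cS])
have "\<exists>H\<ge>0. \<forall>y\<in>K. g y < bz y * H"
proof (cases "K = {}")
 case True thus ?thesis by (intro exI[of _ 0]) simp
next
 case False
 have "\<exists>y\<in>K. \<forall>y'\<in>K. bz y \<le> bz y'" unfolding bz_def by (rule continuous_attains_inf[OF cK False]) (intro continuous_intros)
 then obtain y0 where y0: "y0 \<in> K" "\<And>y. y \<in> K ==> bz y0 \<le> bz y" by blast
 have "\<exists>y\<in>K. \<forall>y'\<in>K. g y' \<le> g y" unfolding g_def by (rule continuous_attains_sup[OF cK False]) (intro continuous_intros)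
 then obtain y1 where y1: "y1 \<in> K" "\<And>y. y \<in> K ==> g y \<le> g y1" by blast
 define H where "H = (g y1 + 1) / bz y0"
 have H0: "0 \<le> H" using bz0[OF y0(1)] y1(1) by (auto simp: H_def K_def)
 have "g y < bz y * H" if y: "y \<in> K" for y
 proof -
  have "g y < bz y0 * H" using y1(2)[OF y] bz0[OF y0(1)] by (simp add: H_def)
  also have "\<dots> \<le> bz y * H" using y0(2)[OF y] H0 by (rule mult_right_mono)
  finally show ?thesis .
 qed
 thus ?thesis using H0 by blast
qed
then obtain H where H: "H \<ge> 0" "\<And>y. y \<in> K ==> g y < bz y * H" by blast
have "y \<in> cseg p q \<or> g y < bz y * H" if y: "y \<in> lk E" "proj y \<in> tri P Q Z" for y
proof (cases "y \<in> S")
 case True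
 show ?thesis
 proof (cases "g y < 0")
  case neg: True
  have "0 \<le> bz y * H" using H(1) y(2) by (auto simp: tri_def bz_def)
  thus ?thesis using neg by simp
 next
  case False thus ?thesis using H(2)[of y] True y(2) by (simp add: K_def)
 qed
next
 case False
 hence yAB: "y \<in> seg (A, B)" using y(1) unfolding S_def lk_def by blast
 then obtain s where s: "y = at_edge (A, B) s" using in_seg_iff by blast
 have yP: "proj y = P + ((s - \<alpha>) / (\<beta> - \<alpha>)) *. (Q - P)" using ab
  by (simp add: s P_def Q_def p q proj_at_edge scaleR_left_diff_distrib[symmetric] divide_simps) (simp add: algebra_simps)
 have "cr (Q - P) (P - Q) = 0" by (simp add: cr_def algebra_simps)
 hence "bz y = 0" unfolding bz_def yP bary_move using bary_vertices[OF nd'] by (simp del: cr_simps)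
 then obtain w where w: "w \<in> cseg p q" "proj w = proj y" using over y(2) by blast
 hence "w = y" using seg_proj_inj[OF R AB _ yAB] bsE by blast
 thus ?thesis using w by simp
qed
thus ?thesis unfolding P_def[symmetric] Q_def[symmetric] g_def bz_def by (intro exI[of _ H]) force
qed

text \<open>The parabola \<open>t \<mapsto> (t, t\<^sup>2)\<close> meets each line in at most two points.\<close>

lemma avoid_lines:
 assumes "finite F" "\<And>a d. (a, d) \<in> F ==> d ~= 0" "\<forall>\<^sub>F z in nhds z0. G z"
 shows "\<exists>z. G z \<and> (\<forall>(a, d)\<in>F. cr (z - a) d ~= 0)"
proof -
define \<phi> where "\<phi> t = z0 + (t, t\<^sup>2)" for t :: real
have "finite {t. cr (\<phi> t - fst l) (snd l) = 0}" if l: "l \<in> F" for l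
proof -
 obtain a d where ad: "l = (a, d)" by (cases l)
 have "cr (\<phi> t - fst l) (snd l) = poly [:cr (z0 - a) d, snd d, - fst d:] t" for t
  by (simp add: \<phi>_def ad cr_def algebra_simps power2_eq_square)
 moreover have "[:cr (z0 - a) d, snd d, - fst d:] ~= 0" using assms(2)[of a d] l ad by (auto simp: prod_eq_iff)
 ultimately show ?thesis by (simp only: poly_roots_finite simp_thms not_False_eq_True)
qed
define U where "U = (\<Union>l\<in>F. {t. cr (\<phi> t - fst l) (snd l) = 0})"
have fin: "finite U" using \<open>\<And>l. l \<in> F ==> finite {t. cr (\<phi> t - fst l) (snd l) = 0}\<close> assms(1) by (simp add: U_def)
have "(\<phi> \<longlongrightarrow> z0) (at_right 0)" unfolding \<phi>_def by (auto intro!: tendsto_eq_intros simp: zero_prod_def)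
hence "\<forall>\<^sub>F t in at_right 0. G (\<phi> t)" using assms(3) by (metis eventually_compose_filterlim)
then obtain b where b: "b > 0" "\<And>t. 0 < t ==> t < b ==> G (\<phi> t)" unfolding eventually_at_right_field by auto
have "infinite {0<..<b}" using b(1) by (simp add: infinite_Ioo)
hence "\<not> {0<..<b} \<subseteq> U" using finite_subset[OF _ fin] by blast
then obtain t where t: "t \<in> {0<..<b}" "t \<notin> U" by blast
show ?thesis by (rule exI[of _ "\<phi> t"]) (use t b(2) in \<open>auto simp: U_def\<close>)
qed

text \<open>\<open>w\<close> is not parallel to both \<open>Z - a\<close> and \<open>d\<close>, so
  the expression is a nonzero polynomial of degree at most 1 in \<open>s\<close>. This chooses the
  feet of a finger after its apex \<open>Z\<close>.\<close>

lemma avoid_params: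
 fixes a d Z :: "real \<times> real"
 assumes "finite W" "\<And>w. w \<in> W ==> w ~= 0" "cr (Z - a) d ~= 0" "l < u"
 shows "\<exists>s. l < s \<and> s < u \<and> (\<forall>w\<in>W. cr w (Z - (a + s *. d)) ~= 0)"
proof -
have "finite {s. cr w (Z - (a + s *. d)) = 0}" if w: "w \<in> W" for w
proof -
 have "cr w (Z - (a + s *. d)) = poly [:cr w (Z - a), - cr w d:] s" for s by (simp add: algebra_simps)
 moreover have "[:cr w (Z - a), - cr w d:] ~= 0"
 proof
  assume "[:cr w (Z - a), - cr w d:] = 0"
  hence z: "cr (Z - a) w = 0" "cr d w = 0" using cr_swap[of w] by (auto simp del: cr_simps)
  obtain s1 s2 where "Z - a = s1 *. w" "d = s2 *. w" using z cr_eq0_iff[OF assms(2)[OF w]] by blast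
  thus False using assms(3) by (simp del: cr_simps(2))
 qed
 ultimately show ?thesis by (simp only: poly_roots_finite simp_thms not_False_eq_True)
qed
hence fin: "finite (\<Union>w\<in>W. {s. cr w (Z - (a + s *. d)) = 0})" using assms(1) by blast
have "infinite {l<..<u}" using assms(4) by (simp add: infinite_Ioo)
hence "\<not> {l<..<u} \<subseteq> (\<Union>w\<in>W. {s. cr w (Z - (a + s *. d)) = 0})" using finite_subset[OF _ fin] by metis
hence "\<exists>s. s \<in> {l<..<u} \<and> s \<notin> (\<Union>w\<in>W. {s. cr w (Z - (a + s *. d)) = 0})" by blast
thus ?thesis by (auto simp del: cr_simps)
qed

text \<open>Moving the feet outwards keeps a point inside, so \<open>z\<close> can be placed under
  the triangle before the feet are finally chosen.\<close>

lemma itri_mono: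
 assumes nd: "cr (Q - P) (Z - P) ~= 0" and nd0: "cr (Q0 - P0) (Z - P0) ~= 0"
 and "P0 \<in> open_segment P Q" "Q0 \<in> open_segment P Q" "z \<in> itri P0 Q0 Z"
 shows "z \<in> itri P Q Z"
proof -
obtain u where u: "0 < u" "u < 1" "P0 = (1 - u) *. P + u *. Q" using assms(3) by (auto simp: in_segment)
obtain v where v: "0 < v" "v < 1" "Q0 = (1 - v) *. P + v *. Q" using assms(4) by (auto simp: in_segment)
define a b g where "a = bary P0 Q0 Z z" and "b = bary Q0 Z P0 z" and "g = bary Z P0 Q0 z"
have pos: "0 < a" "0 < b" "0 < g" using assms(5) by (auto simp: itri_def a_def b_def g_def)
have s: "a + b + g = 1" using bary_sum[OF nd0] by (simp add: a_def b_def g_def)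
have z: "z = a *. P0 + b *. Q0 + g *. Z" using bary_comb[OF nd0] by (simp add: a_def b_def g_def)
have z': "z = (a * (1 - u) + b * (1 - v)) *. P + (a * u + b * v) *. Q + g *. Z"
 unfolding z u(3) v(3) by (simp add: algebra_simps)
have s': "(a * (1 - u) + b * (1 - v)) + (a * u + b * v) + g = 1" using s by (simp add: algebra_simps)
have "0 < a * (1 - u) + b * (1 - v)" "0 < a * u + b * v" using pos u v by (auto intro!: add_pos_pos mult_pos_pos)
thus ?thesis using bary_of[OF nd s'] pos(3) unfolding z'[symmetric] itri_def by simp
qed

text \<open>The choices depend on each other in this order: a piece of edge around \<open>x0\<close>
  free of vertices and under points, the apex \<open>Z\<close> near \<open>z\<close> off finitely
  many lines, the feet \<open>P\<close>, \<open>Q\<close> in general position as seen from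
  \<open>Z\<close>, and the height \<open>H\<close>. The finite sets \<open>Fp\<close>,
  \<open>Fv\<close>, \<open>Fl\<close> are further points, directions and lines that the caller
  wants avoided.\<close>

theorem finger_exists:
 assumes R: "reg E" and col: "pcol (lk E) c" and AB: "(A, B) \<in> E"
 and x0: "x0 \<in> seg (A, B)" "x0 \<notin> fst ` E" "x0 \<notin> und E"
 and z: "cr (z - proj A) (dir (A, B)) ~= 0" and eta: "\<eta> > 0"
 and fin: "finite Fp" "finite Fv" "finite Fl" "\<And>a d. (a, d) \<in> Fl ==> d ~= 0"
 obtains \<alpha> \<beta> Z H p q r P Q where "finger E c A B \<alpha> \<beta> Z H p q r P Q"
 "\<And>x. x \<in> tri P Q Z ==> \<exists>y\<in>cseg (proj x0) z. dist x y < \<eta>" "z \<in> itri P Q Z"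
 "x0 \<in> cseg p q" "x0 ~= p" "x0 ~= q" "cseg p q \<subseteq> ball x0 \<eta>"
 "(cseg P Z \<union> cseg Q Z) \<inter> Fp = {}"
 "\<And>v. v \<in> Fv ==> v ~= 0 ==> cr v (Z - P) ~= 0 \<and> cr v (Z - Q) ~= 0"
 "\<And>a d. (a, d) \<in> Fl ==> cr (Z - a) d ~= 0"
proof -
define e where "e = (A, B)"
define dbl where "dbl = {x \<in> lk E. \<exists>y\<in>lk E. y ~= x \<and> proj y = proj x}"
define d where "d = dir e"
have fdbl: "finite dbl" unfolding dbl_def by (rule finite_double[OF R])
obtain s0 where s0: "0 < s0" "s0 < 1" "x0 = at_edge e s0" using nonvertex_param[OF R AB x0(1,2)] unfolding e_def by blast
have eb: "\<forall>\<^sub>F y in nhds (proj x0). y \<in> ball (proj x0) \<eta>" by (rule eventually_nhds_in_open) (use eta in auto)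
have cont: "continuous_on UNIV (at_edge e)" unfolding at_edge_def by (intro continuous_intros)
have "\<forall>\<^sub>F x in nhds x0. x \<in> ball x0 \<eta> - (und E \<union> fst ` E)"
proof (rule eventually_nhds_in_open)
 have "finite (und E \<union> fst ` E)" using finite_under[OF R] reg_finite[OF R] by simp
 thus "open (ball x0 \<eta> - (und E \<union> fst ` E))" by (intro open_Diff open_ball finite_imp_closed)
qed (use x0 eta in auto)
moreover have "(at_edge e \<longlongrightarrow> x0) (nhds s0)" using cont s0(3) by (auto simp: continuous_on_eq_continuous_at continuous_at tendsto_at_iff_tendsto_nhds)
ultimately have "\<forall>\<^sub>F s in nhds s0. at_edge e s \<in> ball x0 \<eta> - (und E \<union> fst ` E)" by (rule eventually_compose_filterlim)
moreover have "((\<lambda>s. proj (at_edge e s)) \<longlongrightarrow> proj x0) (nhds s0)" by (intro tendsto_proj) fact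
hence "\<forall>\<^sub>F s in nhds s0. proj (at_edge e s) \<in> ball (proj x0) \<eta>" by (rule eventually_compose_filterlim[OF eb])
moreover have "\<forall>\<^sub>F s in nhds s0. s \<in> {0<..<1}" by (rule eventually_nhds_in_open) (use s0 in auto)
ultimately have "\<forall>\<^sub>F s in nhds s0. at_edge e s \<in> ball x0 \<eta> \<and> at_edge e s \<notin> und E \<and> at_edge e s \<notin> fst ` E \<and> dist (proj (at_edge e s)) (proj x0) < \<eta> \<and> 0 < s \<and> s < 1"
 by eventually_elim (auto simp: dist_commute)
then obtain \<delta> where \<delta>: "\<delta> > 0" "\<And>s. \<bar>s - s0\<bar> < \<delta> ==> at_edge e s \<in> ball x0 \<eta> \<and> at_edge e s \<notin> und E \<and> at_edge e s \<notin> fst ` E \<and> dist (proj (at_edge e s)) (proj x0) < \<eta> \<and> 0 < s \<and> s < 1"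
 unfolding eventually_nhds_metric dist_real_def by blast
define P0 Q0 where "P0 = proj (at_edge e (s0 - \<delta>/2))" and "Q0 = proj (at_edge e (s0 + \<delta>/2))"
have PQ0: "P0 = proj x0 - (\<delta>/2) *. d" "Q0 = proj x0 + (\<delta>/2) *. d"
 unfolding P0_def Q0_def s0(3) proj_at_edge d_def by (simp_all add: algebra_simps)
have px0: "proj x0 = proj A + s0 *. d" by (simp add: s0(3) proj_at_edge d_def e_def)
\<comment> \<open>\<open>Z0\<close> lies beyond \<open>z\<close> as seen from \<open>x0\<close>, by
  less than \<open>\<eta>\<close>, so that \<open>z\<close> is in the interior of the triangle.
  Adding 1 avoids a zero denominator.\<close>
define \<tau> where "\<tau> = \<eta> / (2 * (norm (z - proj x0) + 1))"
have tau: "\<tau> > 0" using eta by (auto simp: \<tau>_def add_nonneg_pos)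
define Z0 where "Z0 = z + \<tau> *. (z - proj x0)"
have dZ0: "dist Z0 z < \<eta>"
proof -
 have "dist Z0 z = \<eta> * (norm (z - proj x0) / (2 * (norm (z - proj x0) + 1)))" using tau eta by (simp add: Z0_def dist_norm \<tau>_def)
 also have "\<dots> < \<eta> * 1"
 proof (rule mult_strict_left_mono[OF _ eta])
  show "norm (z - proj x0) / (2 * (norm (z - proj x0) + 1)) < 1" by (simp add: divide_less_eq add_nonneg_pos)
 qed
 finally show ?thesis by simp
qed
have crz: "cr (z - proj x0) d ~= 0" using z by (simp add: px0 d_def e_def)
have nd0: "cr (Q0 - P0) (Z0 - P0) ~= 0"
proof -
 have 1: "Q0 - P0 = \<delta> *. d" by (simp add: PQ0 scaleR_add_left[symmetric])
 have 2: "Z0 - P0 = (1 + \<tau>) *. (z - proj x0) + (\<delta>/2) *. d" by (simp add: Z0_def PQ0 algebra_simps)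
 have "cr (Q0 - P0) (Z0 - P0) = \<delta> * ((1 + \<tau>) * cr d (z - proj x0))" unfolding 1 2 by (simp add: algebra_simps)
 thus ?thesis using crz cr_swap[of d "z - proj x0"] \<delta>(1) tau by simp
qed
have zi: "z \<in> itri P0 Q0 Z0"
proof -
 define l where "l = 1 / (1 + \<tau>)"
 have l: "0 < l" "l < 1" "l * (1 + \<tau>) = 1" using tau by (auto simp: l_def)
 have "z = proj x0 + (l * (1 + \<tau>)) *. (z - proj x0)" using l(3) by simp
 also have "\<dots> = ((1 - l) / 2) *. P0 + ((1 - l) / 2) *. Q0 + l *. Z0"
  by (simp add: PQ0 Z0_def algebra_simps scaleR_half_double[symmetric] flip: scaleR_add_left)
 finally have ze: "z = ((1 - l) / 2) *. P0 + ((1 - l) / 2) *. Q0 + l *. Z0" .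
 have "(1 - l) / 2 + (1 - l) / 2 + l = 1" by (simp add: field_simps)
 from bary_of[OF nd0 this, folded ze] show ?thesis using l by (simp add: itri_def)
qed
have ev: "\<forall>\<^sub>F Z in nhds Z0. z \<in> itri P0 Q0 Z \<and> cr (Q0 - P0) (Z - P0) ~= 0 \<and> dist Z z < \<eta>"
proof -
 have crt: "((\<lambda>Z. cr (f Z) (g Z)) \<longlongrightarrow> cr (f Z0) (g Z0)) (nhds Z0)" if "(f \<longlongrightarrow> f Z0) (nhds Z0)" "(g \<longlongrightarrow> g Z0) (nhds Z0)" for f g :: "real \<times> real => real \<times> real"
  unfolding cr_def by (intro tendsto_intros that)
 have id: "((\<lambda>Z. Z) \<longlongrightarrow> Z0) (nhds Z0)" by (simp add: filterlim_def)
 have c1: "((\<lambda>Z. cr (Q0 - P0) (Z - P0)) \<longlongrightarrow> cr (Q0 - P0) (Z0 - P0)) (nhds Z0)" by (intro crt tendsto_intros id)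
 have c2: "((\<lambda>Z. bary P0 Q0 Z z) \<longlongrightarrow> bary P0 Q0 Z0 z) (nhds Z0)" unfolding bary_def
  by (intro tendsto_divide crt tendsto_intros id nd0)
 have c3: "((\<lambda>Z. bary Q0 Z P0 z) \<longlongrightarrow> bary Q0 Z0 P0 z) (nhds Z0)" unfolding bary_def
  using nd0 cr_cycle(1)[of Z0 Q0 P0] by (intro tendsto_divide crt tendsto_intros id) (simp del: cr_simps)
 have c4: "((\<lambda>Z. bary Z P0 Q0 z) \<longlongrightarrow> bary Z0 P0 Q0 z) (nhds Z0)" unfolding bary_def
  using nd0 cr_cycle(2)[of P0 Z0 Q0] by (intro tendsto_divide crt tendsto_intros id) (simp del: cr_simps)
 have "\<forall>\<^sub>F Z in nhds Z0. cr (Q0 - P0) (Z - P0) ~= 0" by (rule tendsto_imp_eventually_ne[OF c1 nd0])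
 moreover have "\<forall>\<^sub>F Z in nhds Z0. 0 < bary P0 Q0 Z z" "\<forall>\<^sub>F Z in nhds Z0. 0 < bary Q0 Z P0 z" "\<forall>\<^sub>F Z in nhds Z0. 0 < bary Z P0 Q0 z"
  using zi order_tendstoD(1)[OF c2] order_tendstoD(1)[OF c3] order_tendstoD(1)[OF c4] by (auto simp: itri_def)
 moreover have "\<forall>\<^sub>F Z in nhds Z0. Z \<in> ball z \<eta>" by (rule eventually_nhds_in_open) (use dZ0 in \<open>auto simp: dist_commute\<close>)
 ultimately show ?thesis by eventually_elim (auto simp: itri_def dist_commute)
qed
define Fp' where "Fp' = Fp \<union> proj ` (fst ` E \<union> dbl)"
define Fv' where "Fv' = {v \<in> Fv \<union> dir ` E. v ~= 0}"
\<comment> \<open>The lines of the edges keep \<open>Z\<close> off the diagram; the horizontal lines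
  through the points of \<open>Fp'\<close> keep it off these points.\<close>
define Fl' where "Fl' = Fl \<union> (\<lambda>e. (proj (fst e), dir e)) ` E \<union> (\<lambda>a. (a, (1, 0))) ` Fp'"
have finp: "finite Fp'" "finite Fv'" "finite Fl'" using fin fdbl reg_finite[OF R] by (auto simp: Fp'_def Fv'_def Fl'_def)
have "\<exists>Z. (z \<in> itri P0 Q0 Z \<and> cr (Q0 - P0) (Z - P0) ~= 0 \<and> dist Z z < \<eta>) \<and> (\<forall>(a, d)\<in>Fl'. cr (Z - a) d ~= 0)"
proof (rule avoid_lines[OF finp(3) _ ev])
 fix a d' assume "(a, d') \<in> Fl'"
 hence "(a, d') \<in> Fl \<or> d' \<in> dir ` E \<or> d' = (1, 0)" unfolding Fl'_def by blast
 moreover have "0 \<notin> dir ` E" using dir_nz[OF R] by (metis imageE)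
 ultimately show "d' ~= 0" using fin(4)[of a d'] by (auto simp: zero_prod_def)
qed
then obtain Z where Z: "z \<in> itri P0 Q0 Z" "cr (Q0 - P0) (Z - P0) ~= 0" "dist Z z < \<eta>" "\<And>a d. (a, d) \<in> Fl' ==> cr (Z - a) d ~= 0" by blast
have ZA: "cr (Z - proj A) d ~= 0"
proof (rule Z(4))
 show "(proj A, d) \<in> Fl'" unfolding Fl'_def d_def e_def by (intro UnI1 UnI2 image_eqI[OF _ AB]) simp
qed
have Zp: "Z \<notin> Fp'" using Z(4)[of Z "(1, 0)"] unfolding Fl'_def by auto
have ZD: "proj x ~= Z" if x: "x \<in> lk E" for x
proof
 assume pz: "proj x = Z"
 obtain f where f: "f \<in> E" "x \<in> seg f" using x lkE by blast
 obtain s where "x = at_edge f s" using f(2) in_seg_iff by blast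
 hence "Z = proj (fst f) + s *. dir f" using pz proj_at_edge by metis
 hence "Z - proj (fst f) = s *. dir f" by simp
 hence "cr (Z - proj (fst f)) (dir f) = 0" by (simp del: cr_simps(2))
 moreover have "(proj (fst f), dir f) \<in> Fl'" using f by (simp add: Fl'_def)
 ultimately show False using Z(4) by blast
qed
\<comment> \<open>A side that is not parallel to \<open>b - Z\<close> misses the point
  \<open>b\<close>.\<close>
define W where "W = Fv' \<union> (\<lambda>b. b - Z) ` Fp'"
have W: "finite W" "\<And>w. w \<in> W ==> w ~= 0" using finp Zp by (auto simp: W_def Fv'_def)
obtain \<alpha> where al: "s0 - \<delta> < \<alpha>" "\<alpha> < s0 - \<delta>/2" "\<And>w. w \<in> W ==> cr w (Z - (proj A + \<alpha> *. d)) ~= 0"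
 using avoid_params[OF W ZA, of "s0 - \<delta>" "s0 - \<delta>/2"] \<delta>(1) by auto
obtain \<beta> where be: "s0 + \<delta>/2 < \<beta>" "\<beta> < s0 + \<delta>" "\<And>w. w \<in> W ==> cr w (Z - (proj A + \<beta> *. d)) ~= 0"
 using avoid_params[OF W ZA, of "s0 + \<delta>/2" "s0 + \<delta>"] \<delta>(1) by auto
define p q where "p = at_edge e \<alpha>" and "q = at_edge e \<beta>"
define P Q where "P = proj p" and "Q = proj q"
have PQ: "P = proj A + \<alpha> *. d" "Q = proj A + \<beta> *. d" by (simp_all add: P_def Q_def p_def q_def proj_at_edge d_def e_def)
have dl: "\<bar>s - s0\<bar> < \<delta>" if "\<alpha> \<le> s" "s \<le> \<beta>" for s using that al be by auto
have ab: "0 < \<alpha>" "\<alpha> < \<beta>" "\<beta> < 1" using \<delta>(1) \<delta>(2)[of \<alpha>] \<delta>(2)[of \<beta>] al be by auto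
have bs: "\<exists>s. \<alpha> \<le> s \<and> s \<le> \<beta> \<and> x = at_edge e s" if xs: "x \<in> cseg p q" for x
proof -
 obtain t where t: "0 \<le> t" "t \<le> 1" "x = (1 - t) *. p + t *. q" using xs by (auto simp: closed_segment_def)
 have "x = at_edge e (\<alpha> + t * (\<beta> - \<alpha>))" unfolding t(3) p_def q_def at_edge_def by (simp add: algebra_simps)
 moreover have "t * (\<beta> - \<alpha>) \<le> 1 * (\<beta> - \<alpha>)" "0 \<le> t * (\<beta> - \<alpha>)" using t ab by (intro mult_right_mono mult_nonneg_nonneg; simp)+
 ultimately show ?thesis by (intro exI[of _ "\<alpha> + t * (\<beta> - \<alpha>)"]) simp
qed
have nd: "cr (Q - P) (Z - P) ~= 0"
proof -
 have 1: "Q - P = (\<beta> - \<alpha>) *. d" by (simp add: PQ algebra_simps)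
 have 2: "Z - P = (Z - proj A) - \<alpha> *. d" by (simp add: PQ)
 have "cr (Q - P) (Z - P) = (\<beta> - \<alpha>) * cr d (Z - proj A)" unfolding 1 2 by (simp add: algebra_simps)
 thus ?thesis using ZA ab cr_swap[of d "Z - proj A"] by simp
qed
have top: "x \<notin> und E \<and> x \<notin> fst ` E" if "x \<in> cseg p q" for x
proof -
 obtain s where s: "\<alpha> \<le> s" "s \<le> \<beta>" "x = at_edge e s" using bs[OF \<open>x \<in> cseg p q\<close>] by blast
 show ?thesis using \<delta>(2)[OF dl[OF s(1,2)]] s(3) by simp
qed
obtain H where H: "\<And>y. y\<in>lk E ==> proj y \<in> tri P Q Z ==> y \<in> cseg p q \<or>
   height y < bary P Q Z (proj y) * height p + bary Q Z P (proj y) * height q + bary Z P Q (proj y) * H"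
 using below_exists[OF R AB ab p_def[unfolded e_def] q_def[unfolded e_def] nd[unfolded P_def Q_def] top] unfolding P_def Q_def by blast
have notin: "b \<notin> cseg P Z" if b: "b ~= Z" "cr (b - Z) (Z - P) ~= 0" for b P
proof
 assume "b \<in> cseg P Z"
 then obtain t where "b = (1 - t) *. P + t *. Z" by (auto simp: closed_segment_def)
 hence "b - Z = (t - 1) *. (Z - P)" by (simp add: algebra_simps)
 hence "cr (b - Z) (Z - P) = 0" by (simp del: cr_simps(2,6))
 thus False using b(2) by simp
qed
have off: "b \<notin> cseg P Z \<union> cseg Q Z" if b: "b \<in> Fp'" for b
proof -
 have "b - Z \<in> W" "b ~= Z" using b Zp by (auto simp: W_def)
 thus ?thesis using notin[of b] al(3) be(3) unfolding PQ by blast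
qed
have nov: "x \<notin> fst ` E \<and> x \<notin> dbl" if "proj x \<in> cseg P Z \<union> cseg Q Z" for x
 using off[of "proj x"] that unfolding Fp'_def by blast
have vv: "cr v (Z - P) ~= 0 \<and> cr v (Z - Q) ~= 0" if "v \<in> Fv \<union> dir ` E" "v ~= 0" for v
 using al(3)[of v] be(3)[of v] that unfolding W_def Fv'_def PQ by blast
show ?thesis
proof (rule that)
 show "finger E c A B \<alpha> \<beta> Z H p q (fst Z, snd Z, H) P Q"
 proof
  show "y = p" if "y \<in> lk E" "proj y = P" for y
  proof -
   have "p \<in> lk E" using seg_lk[OF AB] ab by (auto simp: p_def e_def seg_at_edge)
   thus ?thesis using nov[of p] that by (auto simp: dbl_def P_def)
  qed
  show "y = q" if "y \<in> lk E" "proj y = Q" for y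
  proof -
   have "q \<in> lk E" using seg_lk[OF AB] ab by (auto simp: q_def e_def seg_at_edge)
   thus ?thesis using nov[of q] that by (auto simp: dbl_def Q_def)
  qed
  show "x \<notin> fst ` E \<and> proj x ~= Z \<and> simple E x"
   if "x \<in> lk E" "proj x \<in> cseg P Z \<union> cseg Q Z" for x
   using nov[OF that(2)] ZD[OF that(1)] that(1) unfolding dbl_def by blast
  show "cr (dir e') (Z - P) ~= 0" "cr (dir e') (Z - Q) ~= 0" if "e' \<in> E" for e'
   using vv[of "dir e'"] that dir_nz[OF R that] by auto
 qed (use R col AB ab p_def q_def P_def Q_def top ZA H in \<open>auto simp: e_def d_def\<close>)
 show "\<exists>y\<in>cseg (proj x0) z. dist x y < \<eta>" if x: "x \<in> tri P Q Z" for x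
 proof -
  define a b g where "a = bary P Q Z x" and "b = bary Q Z P x" and "g = bary Z P Q x"
  have pos: "0 \<le> a" "0 \<le> b" "0 \<le> g" using x by (auto simp: tri_def a_def b_def g_def)
  have s: "a + b + g = 1" using bary_sum[OF nd] by (simp add: a_def b_def g_def)
  have xe: "x = a *. P + b *. Q + g *. Z" using bary_comb[OF nd] by (simp add: a_def b_def g_def)
  define y where "y = (1 - g) *. proj x0 + g *. z"
  have "y \<in> cseg (proj x0) z" unfolding y_def closed_segment_def using pos s by force
  moreover have "dist x y < \<eta>"
  proof -
   have g1: "1 - g = a + b" using s by simp
   have "x - y = a *. (P - proj x0) + b *. (Q - proj x0) + g *. (Z - z)" unfolding xe y_def g1 by (simp add: algebra_simps)
   hence "norm (x - y) \<le> a * norm (P - proj x0) + b * norm (Q - proj x0) + g * norm (Z - z)"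
    using pos by (smt (verit, best) norm_scaleR norm_triangle_ineq abs_of_nonneg)
   also have "\<dots> < \<eta>"
   proof -
    define m where "m = max (norm (P - proj x0)) (max (norm (Q - proj x0)) (norm (Z - z)))"
    have "norm (P - proj x0) < \<eta>" "norm (Q - proj x0) < \<eta>"
     using \<delta>(2)[OF dl[of \<alpha>]] \<delta>(2)[OF dl[of \<beta>]] ab by (auto simp: P_def Q_def p_def q_def dist_norm)
    hence "m < \<eta>" using Z(3) by (simp add: m_def dist_norm)
    have "a * norm (P - proj x0) + b * norm (Q - proj x0) + g * norm (Z - z) \<le> a * m + b * m + g * m"
     using pos by (intro add_mono mult_left_mono) (auto simp: m_def)
    also have "\<dots> = m" using s by (simp add: distrib_right[symmetric])
    finally show ?thesis using \<open>m < \<eta>\<close> by simp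
   qed
   finally show ?thesis by (simp add: dist_norm)
  qed
  ultimately show ?thesis by blast
 qed
 show "z \<in> itri P Q Z"
 proof (rule itri_mono[OF nd Z(2) _ _ Z(1)])
  have "at_edge e s \<in> open_segment p q \<and> proj (at_edge e s) \<in> open_segment P Q" if s: "\<alpha> < s" "s < \<beta>" for s
  proof -
   define t where "t = (s - \<alpha>) / (\<beta> - \<alpha>)"
   have t: "0 < t" "t < 1" using s by (auto simp: t_def)
   have st: "s = \<alpha> + t * (\<beta> - \<alpha>)" using s by (simp add: t_def)
   have "at_edge e s = (1 - t) *. p + t *. q" unfolding st p_def q_def at_edge_def by (simp add: algebra_simps)
   moreover have "P ~= Q" "p ~= q" using nd by (auto simp: P_def Q_def)
   ultimately show ?thesis using t unfolding in_segment P_def Q_def by auto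
  qed
  note os = this
  show "P0 \<in> open_segment P Q" "Q0 \<in> open_segment P Q" unfolding P0_def Q0_def using os al be \<delta>(1) by auto
 qed
 show "x0 \<in> cseg p q"
 proof -
  define t where "t = (s0 - \<alpha>) / (\<beta> - \<alpha>)"
  have t: "0 \<le> t" "t \<le> 1" using al be \<delta>(1) by (auto simp: t_def)
  have st: "s0 = \<alpha> + t * (\<beta> - \<alpha>)" using ab by (simp add: t_def)
  have "x0 = (1 - t) *. p + t *. q" unfolding s0(3) p_def q_def at_edge_def by (subst st) (simp add: algebra_simps)
  thus ?thesis unfolding closed_segment_def using t by blast
 qed
 show "x0 ~= p" "x0 ~= q" unfolding s0(3) p_def q_def e_def using at_edge_inj[OF R AB] al be \<delta>(1) by (metis add_less_same_cancel1 half_gt_zero less_asym less_irrefl diff_less_eq order_less_trans e_def less_add_same_cancel1)+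
 show "cseg p q \<subseteq> ball x0 \<eta>"
 proof
  fix x assume "x \<in> cseg p q"
  then obtain s where s: "\<alpha> \<le> s" "s \<le> \<beta>" "x = at_edge e s" using bs by blast
  show "x \<in> ball x0 \<eta>" using \<delta>(2)[OF dl[OF s(1,2)]] s(3) by simp
 qed
 show "(cseg P Z \<union> cseg Q Z) \<inter> Fp = {}" using off by (auto simp: Fp'_def)
 show "cr v (Z - P) ~= 0 \<and> cr v (Z - Q) ~= 0" if "v \<in> Fv" "v ~= 0" for v using vv[of v] that by blast
 show "cr (Z - a) d' ~= 0" if "(a, d') \<in> Fl" for a d' using Z(4)[of a d'] that by (simp add: Fl'_def)
qed
qed

section \<open>Obstacles to removing the largest colour\<close>

lemma thin:
 assumes R: "reg E" and S: "compact S" and P: "\<And>x. x \<in> lk E ==> proj x \<in> S ==> \<forall>\<^sub>F y in nhds x. y \<in> lk E --> Pr y"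
 shows "\<exists>\<eta>>0. \<forall>y\<in>lk E. (\<exists>s\<in>S. dist (proj y) s < \<eta>) --> Pr y"
proof -
\<comment> \<open>The closure of the bad set is compact and its projection misses \<open>S\<close>,
  so it has positive distance from \<open>S\<close>. In this way local conditions along a path bound
  the width of a finger.\<close>
define B where "B = {y \<in> lk E. \<not> Pr y}"
have "closure B \<subseteq> lk E" using closure_minimal[OF _ closed_lk[OF R], of B] by (auto simp: B_def)
hence "compact (closure B)" using compact_Int_closed[OF compact_lk[OF R] closed_closure[of B]] by (simp add: inf.absorb2)
hence cB: "compact (proj ` closure B)" by (intro compact_continuous_image continuous_intros)
have "proj ` closure B \<inter> S = {}"
proof -
 have "proj x \<notin> S" if x: "x \<in> closure B" for x
 proof
  assume s: "proj x \<in> S"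
  have "x \<in> lk E" using x \<open>closure B \<subseteq> lk E\<close> by blast
  from P[OF this s] obtain U where U: "open U" "x \<in> U" "\<And>y. y \<in> U ==> y \<in> lk E ==> Pr y" unfolding eventually_nhds by blast
  hence "U \<inter> B ~= {}" using x closure_iff_nhds_not_empty[of x B] by blast
  thus False using U(3) by (auto simp: B_def)
 qed
 thus ?thesis by blast
qed
then obtain d where d: "d > 0" "\<And>x y. x \<in> proj ` closure B ==> y \<in> S ==> d \<le> dist x y"
 using separate_compact_closed[OF cB compact_imp_closed[OF S]] by blast
show ?thesis
proof (intro exI conjI ballI impI)
 fix y assume y: "y \<in> lk E" "\<exists>s\<in>S. dist (proj y) s < d"
 show "Pr y"
 proof (rule ccontr)
  assume "\<not> Pr y"
  hence "y \<in> B" using y(1) by (simp add: B_def)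
  hence "y \<in> closure B" using closure_subset[of B] by blast
  hence "proj y \<in> proj ` closure B" by blast
  thus False using d(2) y(2) by (metis not_le)
 qed
qed (use d in simp)
qed

text \<open>The direction \<open>v\<close> in \<open>jump\<close> may be replaced by
  \<open>- v\<close>, so \<open>a\<close> is determined only up to exchange with
  \<open>2 * k - a\<close>.\<close>

lemma jump_sym: assumes "jump D c u k a" shows "jump D c u k (2 * k - a)"
proof -
obtain v where v: "v ~= 0" "at u within D = along u v"
 "\<forall>\<^sub>F t in at_right 0. c (u + t *. v) = a \<and> c (u - t *. v) = 2 * k - a"
 using assms unfolding jump_def by blast
have fm: "along u v = along u (- v)"
 using filtermap_filtermap[of "\<lambda>t. u + t *. v" uminus "at (0::real)"] filtermap_at_minus[of "0::real"] by simp
have ev: "\<forall>\<^sub>F t in at_right 0. c (u + t *. (- v)) = 2 * k - a \<and> c (u - t *. (- v)) = 2 * k - (2 * k - a)"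
 using v(3) by eventually_elim auto
have "- v ~= 0" using v(1) by simp
thus ?thesis unfolding jump_def using trans[OF v(2) fm] ev by blast
qed

lemma jump_unique: assumes "jump D c u k a" "jump D c u k b" shows "b = a \<or> b = 2 * k - a"
using frequently_ex[OF frequently_eventually_conj[OF jump_at(2)[OF assms(2)] jump_at(1)[OF assms(1)]]] by blast

definition range_in :: "(pt \<times> pt) set => (pt => int) => int => int => bool" where
 "range_in E c m M \<longleftrightarrow> (\<forall>x\<in>vis (lk E). m \<le> c x \<and> c x \<le> M)"

text \<open>The obstacles to removing the maximal colour \<open>M\<close>: vertices and over points of colour \<open>M\<close>,
 and under points at which a strand of colour \<open>M\<close> ends (\<open>far\<close> if the over strand is not \<open>M - d\<close>).\<close>

definition tops :: "(pt \<times> pt) set => (pt => int) => int => pt set" where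
 "tops E c M = {x \<in> vis (lk E). c x = M \<and> (x \<in> fst ` E \<or> (\<exists>u. ov (lk E) u x))}"

definition germs :: "(pt \<times> pt) set => (pt => int) => int => pt set" where
 "germs E c M = {u. \<exists>w. ov (lk E) u w \<and> jump (lk E) c u (c w) M}"

definition far :: "int => (pt \<times> pt) set => (pt => int) => int => pt set" where
 "far d E c M = {u. \<exists>w. ov (lk E) u w \<and> jump (lk E) c u (c w) M \<and> c w ~= M - d}"

text \<open>One step of the reduction, with everything that has to survive it. \<open>germs\<close>
  is not included: laying a strand of colour \<open>M - d\<close> over one of colour
  \<open>M\<close> creates germs, and these are treated after the other obstacles.\<close>

definition good :: "int => int => int => (pt \<times> pt) set => (pt => int) => (pt \<times> pt) set => (pt => int) => bool" where
 "good d m M E c E1 c1 \<longleftrightarrow> reg E1 \<and> pcol (lk E1) c1 \<and> link_equiv (lk E) (lk E1) \<and> range_in E1 c1 m M \<and>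
  tops E1 c1 M \<subseteq> tops E c M \<and> far d E1 c1 M \<subseteq> far d E c M \<and> xdif (lk E1) c1 d"

lemma good_refl: "reg E ==> pcol (lk E) c ==> range_in E c m M ==> xdif (lk E) c d ==> good d m M E c E c"
by (simp add: good_def link_equiv_refl)

lemma good_trans: "good d m M E c E1 c1 ==> good d m M E1 c1 E2 c2 ==> good d m M E c E2 c2"
unfolding good_def using link_equiv_trans by blast

text \<open>The move takes place over the region \<open>S\<close> of the plane, so a situation
  prepared elsewhere is still there afterwards.\<close>

definition agree :: "(real \<times> real) set => (pt \<times> pt) set => (pt => int) => (pt \<times> pt) set => (pt => int) => bool" where
 "agree S E c E1 c1 \<longleftrightarrow> (\<forall>x. proj x \<notin> S --> (x \<in> lk E1 \<longleftrightarrow> x \<in> lk E) \<and> (x \<in> fst ` E1 \<longleftrightarrow> x \<in> fst ` E) \<and>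
  (x \<in> lk E --> c1 x = c x))"

lemma agree_mono: "agree S E c E1 c1 ==> S \<subseteq> S' ==> agree S' E c E1 c1"
unfolding agree_def by blast

lemma agree_trans: "agree S E c E1 c1 ==> agree S E1 c1 E2 c2 ==> agree S E c E2 c2"
unfolding agree_def by metis

lemma agree_refl: "agree S E c E c" by (simp add: agree_def)

lemma agree_ov: "agree S E c E1 c1 ==> proj u \<notin> S ==> ov (lk E1) u w \<longleftrightarrow> ov (lk E) u w"
unfolding agree_def ov_def by metis

lemma agree_under: "agree S E c E1 c1 ==> proj u \<notin> S ==> u \<in> und E1 \<longleftrightarrow> u \<in> und E"
unfolding under_ov using agree_ov by simp

context finger
begin

lemma agree_E': "agree (tri P Q Z) E c E' c'"
unfolding agree_def
proof (intro allI impI)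
fix x assume x: "proj x \<notin> tri P Q Z"
hence F: "x \<notin> F" "x \<notin> bs" using F_plane(2) bs_proj side_iff(3) by blast+
show "(x \<in> D' \<longleftrightarrow> x \<in> D) \<and> (x \<in> fst ` E' \<longleftrightarrow> x \<in> fst ` E) \<and> (x \<in> D --> c' x = c x)"
 using D'_iff F vertices_E'[OF F(1)] c'_out x by blast
qed

lemma vis_out:
 assumes x: "x \<in> vis D'" "x \<notin> F" "proj x \<notin> cseg P Q"
 shows "x \<in> vis D" "x \<notin> bs" "proj x \<notin> sides"
proof -
have xD: "x \<in> D" "x \<notin> bs" using x D'_iff by blast+
thus "x \<notin> bs" by blast
show "proj x \<notin> sides" using side_under[OF xD x(2)] x(1) unfolding under_ov by blast
have "x \<notin> under_points D"
proof
 assume "x \<in> under_points D"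
 then obtain w where w: "ov D x w" unfolding under_ov by blast
 hence "w \<notin> bs" using x(3) bs_proj[of w] by (auto simp: ov_def)
 hence "ov D' x w" unfolding ov_D' using w xD by blast
 thus False using x unfolding under_ov by blast
qed
thus "x \<in> vis D" using xD by blast
qed

text \<open>The last case is a former under point of the base; its new colour is one of its two old
  branch colours.\<close>

lemma vis_D':
 assumes x: "x \<in> vis D'"
 obtains "x \<in> F" "c' x = k"
 | "x \<notin> F" "x \<notin> bs" "x \<in> vis D" "proj x \<notin> tri P Q Z" "c' x = c x"
 | "x \<notin> F" "x \<notin> bs" "x \<in> vis D" "proj x \<in> itri P Q Z" "c' x = 2 * k - c x"
 | w where "x \<notin> F" "x \<notin> bs" "proj x \<in> cseg P Q" "w \<in> bs" "w ~= p" "w ~= q" "ov D x w" "jump D c x k (c' x)"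
proof (cases "x \<in> F")
case True thus ?thesis using that(1) c'_F by blast
next
case F: False
hence xD: "x \<in> D" "x \<notin> bs" using x D'_iff by blast+
show ?thesis
proof (cases "proj x \<in> cseg P Q")
 case True
 obtain w where w: "w \<in> bs" "w ~= p" "w ~= q" "ov D x w" using ov_base[OF xD True] .
 obtain a where a: "jump D c x k a" using col w(4) k_bs[OF w(1)] unfolding pcol_def by metis
 have "jump D c x k (c' x)" using base_jump(1)[OF xD True a] a jump_sym[OF a] by auto
 thus ?thesis using that(4) F xD True w by blast
next
 case False
 note v = vis_out[OF x F False]
 show ?thesis
 proof (cases "proj x \<in> itri P Q Z")
  case True thus ?thesis using that(3) F v c'_in[OF xD(1)] by blast
 next
  case o: False
  hence "proj x \<notin> tri P Q Z" using tri_cases v(3) False by blast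
  thus ?thesis using that(2) F v c'_out[OF xD(1)] by blast
 qed
qed
qed

lemma ov_D'_cases:
 assumes "ov D' u w"
 obtains "ov D u w" "u \<notin> bs" "w \<notin> bs" "u \<notin> F" "proj u \<in> itri P Q Z" "c' w = 2 * k - c w"
 "\<And>a. jump D c u (c w) a ==> jump D' c' u (c' w) (2 * k - a)"
| "ov D u w" "u \<notin> bs" "w \<notin> bs" "u \<notin> F" "proj u \<notin> tri P Q Z" "c' w = c w" "\<And>a. jump D c u (c w) a ==> jump D' c' u (c' w) a"
| "w \<in> F" "w \<notin> D" "u \<in> D" "u \<notin> bs" "u \<notin> F" "proj u \<in> sides" "u \<notin> under_points D" "c' w = k"
 "jump D' c' u k (c u)"
using assms unfolding ov_D'
proof (elim disjE conjE)
assume 1: "ov D u w" "u \<notin> bs" "w \<notin> bs"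
have uw: "u \<in> D" "w \<in> D" "proj w = proj u" "height u < height w" using 1 by (auto simp: ov_def)
have uF: "u \<notin> F" using F_D[of u] uw 1(2) by auto
have nb: "proj u \<notin> cseg P Q" using ov_base_unique[OF uw(1) 1(2) _ 1(1)] 1(3) by blast
have ns: "proj u \<notin> sides" using side_under[OF uw(1) 1(2) uF] 1(1) unfolding under_ov by blast
show thesis
proof (cases "proj u \<in> itri P Q Z")
 case True
 hence "c' w = 2 * k - c w" using c'_in[OF uw(2)] uw(3) by simp
 thus ?thesis using that(1) 1 uF True jump_in[OF _ uw(1) uF 1(2) True] by metis
next
 case False
 hence T: "proj u \<notin> tri P Q Z" using tri_cases ns nb by blast
 hence "c' w = c w" using c'_out[OF uw(2)] uw(3) by simp
 thus ?thesis using that(2) 1 uF T jump_out[OF _ uw(1) uF 1(2) T] by metis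
qed
next
assume 2: "w \<in> F" "w \<notin> D" "u \<in> D" "u \<notin> bs" "u \<notin> F" "proj u \<in> sides" "proj w = proj u"
have "jump D' c' u k (c u)" using side_jump[OF 2(3,4,5,6)] jump_sym[of D' c' u k "2 * k - c u"] by auto
thus thesis using that(3) 2 side_under[OF 2(3,4,5,6)] c'_F by blast
qed

text \<open>Hypothesis \<open>inside\<close>: nothing below the triangle is reflected to \<open>M\<close>, or everything
there is an isolated interior point of an edge.\<close>

lemma tops_E':
 assumes kM: "k ~= M"
 and inside: "(\<forall>y\<in>vis D. proj y \<in> itri P Q Z --> 2 * k - c y ~= M) \<or>
   (\<forall>y\<in>D. proj y \<in> itri P Q Z --> y \<notin> fst ` E \<and> (\<forall>y'\<in>D. proj y' = proj y --> y' = y))"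
 shows "tops E' c' M \<subseteq> {x \<in> tops E c M. proj x \<notin> tri P Q Z}"
proof
fix x assume x: "x \<in> tops E' c' M"
hence xv: "x \<in> vis D'" and xM: "c' x = M" and sp: "x \<in> fst ` E' \<or> (\<exists>u. ov D' u x)" by (auto simp: tops_def)
from xv show "x \<in> {x \<in> tops E c M. proj x \<notin> tri P Q Z}"
proof (cases rule: vis_D')
 case 1 thus ?thesis using kM xM by simp
next
 case 2
 have "x \<in> fst ` E \<or> (\<exists>u. ov D u x)" using sp vertices_E'[OF 2(1)] 2(1) unfolding ov_D' by blast
 thus ?thesis using 2 xM by (simp add: tops_def)
next
 case 3
 have "x \<in> fst ` E \<or> (\<exists>u. ov D u x)" using sp vertices_E'[OF 3(1)] 3(1) unfolding ov_D' by blast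
 hence "\<not> (x \<notin> fst ` E \<and> (\<forall>y'\<in>D. proj y' = proj x --> y' = x))" unfolding ov_def by fastforce
 thus ?thesis using inside 3 xM by auto
next
 case (4 w)
 have "x \<notin> fst ` E" using under_nonvertex[OF R] 4(7) unfolding under_ov by blast
 hence "x \<notin> fst ` E'" using vertices_E'[OF 4(1)] by blast
 then obtain u where u: "ov D u x" using sp 4(1) unfolding ov_D' by blast
 thus ?thesis using ov_not_under[OF R u] 4(7) unfolding under_ov by blast
qed
qed

text \<open>A crossing below the triangle cannot become a germ: it would have a strand reflected to
  \<open>M\<close>, and \<open>inside\<close> allows this only if nothing below the triangle is a
  crossing. What remains is old and untouched, or lies under a side.\<close>

lemma germs_E':
 assumes u: "ov D' u w" "jump D' c' u (c' w) M"
 and inside: "(\<forall>y\<in>vis D. proj y \<in> itri P Q Z --> 2 * k - c y ~= M) \<or>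
   (\<forall>y\<in>D. proj y \<in> itri P Q Z --> y \<notin> fst ` E \<and> (\<forall>y'\<in>D. proj y' = proj y --> y' = y))"
 shows "(ov D u w \<and> jump D c u (c w) M \<and> proj u \<notin> tri P Q Z \<and> c' w = c w) \<or>
  (u \<in> D \<and> u \<notin> bs \<and> proj u \<in> sides \<and> c' w = k \<and> (c u = M \<or> 2 * k - c u = M))"
using u(1)
proof (cases rule: ov_D'_cases)
case 1
obtain a where a: "jump D c u (c w) a" using col 1(1) unfolding pcol_def by blast
have "M = 2 * k - a \<or> M = 2 * c' w - (2 * k - a)" using jump_unique[OF 1(7)[OF a] u(2)] .
hence M: "a = 2 * k - M \<or> 2 * c w - a = 2 * k - M" using 1(6) by auto
have uD: "u \<in> D" using 1(1) by (simp add: ov_def)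
have "\<exists>\<^sub>F y in at u within D. c y = 2 * k - M" using M jump_at(2,3)[OF a] by metis
from frequently_eventually_conj[OF this eventually_conj[OF eventually_vis[OF R uD] at_mono[OF near_proj[OF open_itri 1(5)], of D]]]
have "\<exists>y. c y = 2 * k - M \<and> y \<in> vis D \<and> proj y \<in> itri P Q Z" using frequently_ex by fast
hence "\<not> (\<forall>y\<in>vis D. proj y \<in> itri P Q Z --> 2 * k - c y ~= M)" by force
moreover have "\<not> (\<forall>y'\<in>D. proj y' = proj u --> y' = u)" using 1(1) unfolding ov_def by blast
ultimately show ?thesis using inside uD 1(5) by blast
next
case 2
obtain a where a: "jump D c u (c w) a" using col 2(1) unfolding pcol_def by blast
have "M = a \<or> M = 2 * c' w - a" using jump_unique[OF 2(7)[OF a] u(2)] .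
hence "jump D c u (c w) M" using a jump_sym[OF a] 2(6) by auto
thus ?thesis using 2 by blast
next
case 3
have "M = c u \<or> M = 2 * k - c u" using jump_unique[OF 3(9)] u(2) 3(8) by simp
thus ?thesis using 3 by auto
qed

lemma range_E':
 assumes r: "range_in E c m M" and i: "\<And>y. y \<in> vis D ==> proj y \<in> tri P Q Z ==> m \<le> 2 * k - c y \<and> 2 * k - c y \<le> M"
 shows "range_in E' c' m M"
unfolding range_in_def
proof
have pv: "p \<in> vis D" using p_edge top by simp
fix x assume "x \<in> vis D'"
thus "m \<le> c' x \<and> c' x \<le> M"
proof (cases rule: vis_D')
 case 1 thus ?thesis using r pv unfolding range_in_def k_def by auto
next
 case 2 thus ?thesis using r unfolding range_in_def by auto
next
 case 3 thus ?thesis using i[of x] itri_subset[of P Q Z, THEN subsetD, of "proj x"] by simp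
next
 case (4 w)
 have "c w = k" using k_bs 4(4) by simp
 hence "c' x \<in> c ` vis D" using jump_colors(1)[OF R 4(7)] 4(8) by simp
 thus ?thesis using r unfolding range_in_def by auto
qed
qed

text \<open>Reflection preserves differences, so a crossing of difference \<open>d\<close> is lost
  only together with an over point on the base, which \<open>e\<close> excludes.\<close>

lemma xdif_E':
 assumes x: "xdif D c d" and e: "\<And>u w a. ov D u w ==> w \<in> bs ==> jump D c u k a ==> \<bar>a - k\<bar> ~= d"
 shows "xdif D' c' d"
proof -
obtain u w a where u: "ov D u w" "jump D c u (c w) a" "\<bar>a - c w\<bar> = d" using x unfolding xdif_def by blast
have "w \<notin> bs"
proof
 assume w: "w \<in> bs"
 show False using e[OF u(1) w, of a] u(2,3) unfolding k_bs[OF w] by simp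
qed
moreover have "u \<notin> bs" using top u(1) unfolding under_ov by blast
ultimately have o: "ov D' u w" unfolding ov_D' using u(1) by blast
thus ?thesis
proof (cases rule: ov_D'_cases)
 case 1
 have "\<bar>(2 * k - a) - c' w\<bar> = d" using 1(6) u(3) by auto
 thus ?thesis unfolding xdif_def using o 1(7)[OF u(2)] by blast
next
 case 2 thus ?thesis unfolding xdif_def using o u by metis
next
 case 3 thus ?thesis using u(1) by (auto simp: ov_def)
qed
qed

text \<open>\<open>sd\<close> concerns the new crossings: with over colour \<open>k = M - d\<close>
  they are never \<open>far\<close>, so \<open>M\<close> may occur under the sides; for any other
  \<open>k\<close> neither branch may be \<open>M\<close>.\<close>

theorem good_E':
 assumes r: "range_in E c m M" and x: "xdif D c d"
 and i: "\<And>y. y \<in> vis D ==> proj y \<in> tri P Q Z ==> m \<le> 2 * k - c y \<and> 2 * k - c y \<le> M"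
 and kM: "k ~= M"
 and inside: "(\<forall>y\<in>vis D. proj y \<in> itri P Q Z --> 2 * k - c y ~= M) \<or>
   (\<forall>y\<in>D. proj y \<in> itri P Q Z --> y \<notin> fst ` E \<and> (\<forall>y'\<in>D. proj y' = proj y --> y' = y))"
 and sd: "k = M - d \<or> (\<forall>y\<in>vis D. proj y \<in> sides --> c y ~= M \<and> 2 * k - c y ~= M)"
 and e: "\<And>u w a. ov D u w ==> w \<in> bs ==> jump D c u k a ==> \<bar>a - k\<bar> ~= d"
 shows "good d m M E c E' c'" "tops E' c' M \<subseteq> {x \<in> tops E c M. proj x \<notin> tri P Q Z}"
 "far d E' c' M \<subseteq> {x \<in> far d E c M. proj x \<notin> tri P Q Z}"
 "\<forall>y\<in>vis D. proj y \<in> sides --> c y ~= M \<and> 2 * k - c y ~= M ==> germs E' c' M \<subseteq> {x \<in> germs E c M. proj x \<notin> tri P Q Z}"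
proof -
have uv: "u \<in> vis D" if "u \<in> D" "u \<notin> bs" "proj u \<in> sides" for u
 using side_under[OF that(1,2) _ that(3)] F_D[OF that(1)] that by auto
show t: "tops E' c' M \<subseteq> {x \<in> tops E c M. proj x \<notin> tri P Q Z}" by (rule tops_E'[OF kM inside])
show f: "far d E' c' M \<subseteq> {x \<in> far d E c M. proj x \<notin> tri P Q Z}"
proof
 fix u assume "u \<in> far d E' c' M"
 then obtain w where w: "ov D' u w" "jump D' c' u (c' w) M" "c' w ~= M - d" unfolding far_def by blast
 from germs_E'[OF w(1,2) inside] show "u \<in> {x \<in> far d E c M. proj x \<notin> tri P Q Z}"
 proof
  assume "ov D u w \<and> jump D c u (c w) M \<and> proj u \<notin> tri P Q Z \<and> c' w = c w"
  hence h: "ov D u w" "jump D c u (c w) M" "proj u \<notin> tri P Q Z" "c' w = c w" by blast+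
  have "c w ~= M - d" using w(3) h(4) by simp
  hence "u \<in> far d E c M" unfolding far_def mem_Collect_eq using h(1,2) by (intro exI[of _ w]) simp
  thus ?thesis using h(3) by simp
 next
  assume "u \<in> D \<and> u \<notin> bs \<and> proj u \<in> sides \<and> c' w = k \<and> (c u = M \<or> 2 * k - c u = M)"
  hence h: "u \<in> D" "u \<notin> bs" "proj u \<in> sides" "c' w = k" "c u = M \<or> 2 * k - c u = M" by blast+
  have "k ~= M - d" using h(4) w(3) by simp
  hence False using sd uv[OF h(1-3)] h(3,5) by blast
  thus ?thesis ..
 qed
qed
show "\<forall>y\<in>vis D. proj y \<in> sides --> c y ~= M \<and> 2 * k - c y ~= M ==> germs E' c' M \<subseteq> {x \<in> germs E c M. proj x \<notin> tri P Q Z}"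
proof
 fix u assume h: "\<forall>y\<in>vis D. proj y \<in> sides --> c y ~= M \<and> 2 * k - c y ~= M" "u \<in> germs E' c' M"
 then obtain w where w: "ov D' u w" "jump D' c' u (c' w) M" unfolding germs_def by blast
 from germs_E'[OF w inside] show "u \<in> {x \<in> germs E c M. proj x \<notin> tri P Q Z}"
 proof
  assume "ov D u w \<and> jump D c u (c w) M \<and> proj u \<notin> tri P Q Z \<and> c' w = c w"
  hence h': "ov D u w" "jump D c u (c w) M" "proj u \<notin> tri P Q Z" by blast+
  hence "u \<in> germs E c M" unfolding germs_def by blast
  thus ?thesis using h'(3) by simp
 next
  assume "u \<in> D \<and> u \<notin> bs \<and> proj u \<in> sides \<and> c' w = k \<and> (c u = M \<or> 2 * k - c u = M)"
  hence h': "u \<in> D" "u \<notin> bs" "proj u \<in> sides" "c u = M \<or> 2 * k - c u = M" by blast+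
  hence False using h(1) uv[OF h'(1-3)] by blast
  thus ?thesis ..
 qed
qed
have rr: "range_in E' c' m M" by (rule range_E'[OF r]) (use i in blast)
have xx: "xdif D' c' d" by (rule xdif_E'[OF x]) (use e in blast)
have tt: "tops E' c' M \<subseteq> tops E c M" "far d E' c' M \<subseteq> far d E c M" using t f by auto
show "good d m M E c E' c'" unfolding good_def by (intro conjI reg_E' pcol_D' equiv_E' rr tt xx)
qed

end

section \<open>How rays and strands leave a triangle\<close>

lemma first_exit:
 fixes g :: "real => real \<times> real"
 assumes "continuous_on {0..1} g" "open I" "g 0 \<in> I" "g 1 \<notin> I"
 obtains t where "0 < t" "t \<le> 1" "g t \<notin> I" "\<And>s. 0 \<le> s ==> s < t ==> g s \<in> I" "g t \<in> closure I"
proof -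
define S where "S = {0..1} \<inter> g -` (- I)"
have "closed S" unfolding S_def using assms(1,2) by (intro continuous_closed_preimage) auto
hence "compact S" by (metis S_def compact_Int_closed compact_Icc inf.absorb_iff2 inf_le1)
moreover have "1 \<in> S" using assms(4) by (simp add: S_def)
ultimately obtain t where t: "t \<in> S" "\<And>s. s \<in> S ==> t \<le> s" using compact_attains_inf[of S] by blast
have t0: "0 < t" "t \<le> 1" using t(1) assms(3) by (auto simp: S_def order_less_le)
have before: "g s \<in> I" if "0 \<le> s" "s < t" for s using t(2)[of s] that t0 by (auto simp: S_def)
have "continuous_on {0..t} g" by (rule continuous_on_subset[OF assms(1)]) (use t0 in auto)
hence lim: "(g \<longlongrightarrow> g t) (at t within {0..t})" using t0 by (auto simp: continuous_on_def)
have "g t \<in> closure I"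
proof (rule Lim_in_closed_set[OF closed_closure _ _ lim])
 show "\<forall>\<^sub>F s in at t within {0..t}. g s \<in> closure I"
  unfolding eventually_at_filter by (rule always_eventually) (use before closure_subset[of I] in force)
 have "{0..t} ~= {z}" for z using t0 by (metis atLeastAtMost_singleton_iff less_irrefl)
 hence "t islimpt {0..t}" using connected_imp_perfect[OF connected_Icc, of 0 t t] t0 by auto
 thus "at t within {0..t} ~= bot" by (simp add: trivial_limit_within)
qed
moreover have "g t \<notin> I" using t(1) by (simp add: S_def)
ultimately show ?thesis using that[of t] t0 before by blast
qed

context finger
begin

text \<open>The three coordinates are affine along the ray and the third one grows from 0. So the
  ray stays inside until one of the other two vanishes, which happens on a side, and it never
  returns.\<close>

lemma ray_through:
 assumes x0: "x0 \<in> bs" "x0 ~= p" "x0 ~= q" and z: "proj x0 + u \<in> itri P Q Z"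
 obtains s1 where "1 < s1" "\<And>s. 0 < s ==> s < s1 ==> proj x0 + s *. u \<in> itri P Q Z" "proj x0 + s1 *. u \<in> sides"
 "\<And>s. s < 0 \<or> s1 < s ==> proj x0 + s *. u \<notin> tri P Q Z"
proof -
define b1 where "b1 s = bary P Q Z (proj x0 + s *. u)" for s
define b2 where "b2 s = bary Q Z P (proj x0 + s *. u)" for s
define b3 where "b3 s = bary Z P Q (proj x0 + s *. u)" for s
obtain L1 L2 L3 where L: "\<And>s. b1 s = b1 0 + s * L1" "\<And>s. b2 s = b2 0 + s * L2" "\<And>s. b3 s = b3 0 + s * L3"
 unfolding b1_def b2_def b3_def bary_move by (metis add_0_right mult_zero_left)
have sum: "b1 s + b2 s + b3 s = 1" for s unfolding b1_def b2_def b3_def by (rule bsum)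
have xD: "x0 \<in> D" using x0 bs_sub by blast
have cl: "proj x0 \<in> cseg P Q" using bs_proj x0 by blast
have b30: "b3 0 = 0" using cl unfolding side_iff by (simp add: b3_def)
have nz: "b1 0 ~= 0" "b2 0 ~= 0"
 using eq_vertex[OF nd, of "proj x0"] b30 simp_p[OF xD] simp_q[OF xD] x0(2,3) by (auto simp: b1_def b2_def b3_def)
have b0: "0 < b1 0" "0 < b2 0" using cl nz unfolding side_iff tri_def by (auto simp: b1_def b2_def)
have at1: "0 < b1 1" "0 < b2 1" "0 < b3 1" using z by (auto simp: itri_def b1_def b2_def b3_def)
have L3: "0 < L3" using L(3)[of 1] b30 at1 by simp
\<comment> \<open>At \<open>1 / L3\<close> the third coordinate is 1, so the other two have sum 0
  and their minimum is at most 0.\<close>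
have "\<exists>s1\<ge>1. s1 \<le> 1 / L3 \<and> min (b1 s1) (b2 s1) = 0"
proof (rule IVT2')
 have "b1 (1 / L3) + b2 (1 / L3) = 0" using sum[of "1 / L3"] L(3)[of "1 / L3"] b30 L3 by simp
 thus "min (b1 (1 / L3)) (b2 (1 / L3)) \<le> 0" by linarith
 show "0 \<le> min (b1 1) (b2 1)" using at1 by simp
 have "b1 1 + b2 1 = 1 - L3" using sum[of 1] L(3)[of 1] b30 by simp
 hence "L3 < 1" using at1 by simp
 thus "1 \<le> 1 / L3" using L3 by simp
 show "continuous_on {1..1 / L3} (\<lambda>s. min (b1 s) (b2 s))" unfolding b1_def b2_def by (intro continuous_intros)
qed
then obtain s1 where s1: "1 \<le> s1" "min (b1 s1) (b2 s1) = 0" by blast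
have s1': "1 < s1" using s1 at1 by (cases "s1 = 1") auto
have b3p: "0 < b3 s \<longleftrightarrow> 0 < s" for s using L(3)[of s] b30 L3 by (simp add: zero_less_mult_iff)
have pos: "0 < b s" if "\<And>s. b s = b 0 + s * l" "0 < b 0" "0 \<le> b s1" "0 < s" "s < s1" for b :: "real => real" and l s
proof (cases "0 \<le> l")
 case True thus ?thesis using that(1)[of s] that(2,4) by (simp add: add_pos_nonneg)
next
 case False
 hence "s1 * l < s * l" using that(5) by simp
 thus ?thesis using that(1)[of s] that(1)[of s1] that(3) by simp
qed
have neg: "b s < 0" if "\<And>s. b s = b 0 + s * l" "0 < b 0" "b s1 = 0" "s1 < s" for b :: "real => real" and l s
proof -
 have "s1 * l < 0" using that(1)[of s1] that(2,3) by simp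
 hence "l < 0" using s1' by (simp add: mult_less_0_iff)
 hence "s * l < s1 * l" using that(4) by simp
 thus ?thesis using that(1)[of s] that(1)[of s1] that(3) by simp
qed
have ge: "0 \<le> b1 s1" "0 \<le> b2 s1" "b1 s1 = 0 \<or> b2 s1 = 0" using s1(2) by (auto simp: min_def split: if_splits)
show ?thesis
proof (rule that[OF s1'])
 show "proj x0 + s *. u \<in> itri P Q Z" if "0 < s" "s < s1" for s
  using pos[OF L(1) b0(1) ge(1) that] pos[OF L(2) b0(2) ge(2) that] b3p[of s] that by (simp add: itri_def b1_def b2_def b3_def)
 show "proj x0 + s1 *. u \<in> sides"
  using ge b3p[of s1] s1' unfolding Un_iff side_iff tri_def by (auto simp: b1_def b2_def b3_def)
 show "proj x0 + s *. u \<notin> tri P Q Z" if "s < 0 \<or> s1 < s" for s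
  using that
 proof
  assume "s < 0"
  hence "b3 s < 0" using L(3)[of s] b30 L3 by (simp add: mult_less_0_iff)
  thus ?thesis by (auto simp: tri_def b3_def)
 next
  assume s: "s1 < s"
  have "b1 s < 0 \<or> b2 s < 0" using ge(3) neg[OF L(1) b0(1) _ s] neg[OF L(2) b0(2) _ s] by blast
  thus ?thesis by (auto simp: tri_def b1_def b2_def)
 qed
qed
qed

lemma closure_itri: "closure (itri P Q Z) \<subseteq> tri P Q Z"
by (rule closure_minimal[OF itri_subset closed_tri])

text \<open>A strand below the triangle has to leave it through one of the sides.\<close>

lemma exit_xdif:
 assumes y: "y \<in> D" "proj y \<in> itri P Q Z"
 and iso: "\<And>x. x \<in> D ==> proj x \<in> tri P Q Z ==> x \<notin> fst ` E \<and> (\<forall>x'\<in>D. proj x' = proj x --> x' = x)"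
 shows "xdif D' c' \<bar>c y - k\<bar>"
proof -
obtain e where e: "e \<in> E" "y \<in> seg e" using y(1) lkE by blast
\<comment> \<open>No vertex lies below the triangle, so on the way to this one the edge has to leave
  it.\<close>
define v where "v = fst e"
have v: "v \<in> seg e" "v \<in> D" "v \<in> fst ` E" using e seg_lk by (auto simp: v_def)
have nAB: "e ~= (A, B)" using edge_bz[of y] e(2) y(2) by (auto simp: itri_def)
define g where "g t = proj ((1 - t) *. y + t *. v)" for t
have g1: "g 1 \<notin> itri P Q Z" using iso[OF v(2)] v(3) itri_subset[of P Q Z, THEN subsetD, of "proj v"] by (simp add: g_def) blast
have gc: "continuous_on {0..1} g" unfolding g_def by (intro continuous_intros)
have g0: "g 0 \<in> itri P Q Z" using y(2) by (simp add: g_def)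
obtain t where t: "0 < t" "t \<le> 1" "g t \<notin> itri P Q Z" "\<And>s. 0 \<le> s ==> s < t ==> g s \<in> itri P Q Z" "g t \<in> closure (itri P Q Z)"
 using first_exit[OF gc open_itri g0 g1] by blast
define x where "x = (1 - t) *. y + t *. v"
have sub: "cseg y x \<subseteq> seg e"
proof -
 have "x \<in> cseg y v" unfolding x_def closed_segment_def using t by force
 hence "x \<in> seg e" using e(2) v(1) unfolding seg_def by (meson closed_segment_subset convex_closed_segment subsetD)
 thus ?thesis using e(2) by (simp add: seg_def closed_segment_subset)
qed
have xD: "x \<in> D" "x \<in> seg e" using sub seg_lk[OF e(1)] ends_in_segment(2)[of y x] by blast+
have xT: "proj x \<in> tri P Q Z" "proj x \<notin> itri P Q Z" using t(3,5) closure_itri by (auto simp: g_def x_def)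
have inT: "proj w \<in> tri P Q Z" if w: "w \<in> cseg y x" for w
proof -
 obtain s where s: "0 \<le> s" "s \<le> 1" "w = (1 - s) *. y + s *. x" using w by (auto simp: closed_segment_def)
 have "w = (1 - s * t) *. y + (s * t) *. v" unfolding s(3) x_def by (simp add: algebra_simps)
 hence gw: "proj w = g (s * t)" by (simp add: g_def)
 show ?thesis
 proof (cases "s = 1")
  case True thus ?thesis using s(3) xT by simp
 next
  case False thus ?thesis unfolding gw using t s itri_subset[of P Q Z] by (intro subsetD[OF itri_subset] t(4)) auto
 qed
qed
have xn: "x \<notin> fst ` E" using iso[OF xD(1) xT(1)] by blast
have nb: "x \<notin> seg (A, B)" using gen_seg[OF R e(1) AB nAB xD(2)] xn ends_V[OF R AB] by auto
hence "x \<notin> bs" using bs_sub by blast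
have "proj x \<notin> cseg P Q"
proof
 assume "proj x \<in> cseg P Q"
 then obtain w where w: "w \<in> bs" "proj w = proj x" using bs_over by blast
 hence "w = x" using iso[OF xD(1) xT(1)] bs_sub by blast
 thus False using w \<open>x \<notin> bs\<close> by blast
qed
hence xs: "proj x \<in> sides" using tri_cases xT by blast
have xF: "x \<notin> F" using F_D[OF xD(1)] nb p_edge by blast
have sv: "cseg y x \<subseteq> vis D"
proof
 fix w assume w: "w \<in> cseg y x"
 hence wD: "w \<in> D" using sub seg_lk[OF e(1)] by blast
 have "w \<notin> under_points D"
 proof
  assume "w \<in> under_points D"
  then obtain z where "ov D w z" unfolding under_ov by blast
  thus False using iso[OF wD inT[OF w]] unfolding ov_def by (metis less_irrefl)
 qed
 thus "w \<in> vis D" using wD by simp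
qed
have "c y = c x" by (rule pcol_const[OF col connected_segment(1) sv]) simp_all
moreover obtain w where w: "w \<in> F" "ov D' x w" using side_under[OF xD(1) \<open>x \<notin> bs\<close> xF xs] by blast
moreover have "jump D' c' x k (c x)" using side_jump[OF xD(1) \<open>x \<notin> bs\<close> xF xs] jump_sym[of D' c' x k "2 * k - c x"] by auto
ultimately show ?thesis unfolding xdif_def using c'_F[OF w(1)] by metis
qed

end

section \<open>Hurwitz moves on the colours along a ray\<close>

definition clean :: "(pt \<times> pt) set => real \<times> real => real \<times> real => real => bool" where
 "clean E Y w \<tau> \<longleftrightarrow> w ~= 0 \<and> (\<forall>x\<in>lk E. \<forall>t. 0 < t --> t < \<tau> --> proj x = Y + t *. w -->
  x \<notin> fst ` E \<and> simple E x \<and> (\<forall>e\<in>E. x \<in> seg e --> cr (dir e) w ~= 0))"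

definition hits :: "(pt \<times> pt) set => real \<times> real => real \<times> real => real => real set" where
 "hits E Y w \<tau> = {t. 0 < t \<and> t < \<tau> \<and> (\<exists>x\<in>lk E. proj x = Y + t *. w)}"

definition hcol :: "(pt \<times> pt) set => (pt => int) => real \<times> real => real \<times> real => real => int => bool" where
 "hcol E c Y w t k \<longleftrightarrow> (\<exists>x\<in>lk E. proj x = Y + t *. w \<and> c x = k)"

text \<open>A strip along the ray from parameter \<open>l\<close> on. With \<open>l > 0\<close> and
  small \<open>\<eta>\<close>, moves inside it leave the surroundings of the start \<open>Y\<close>
  alone.\<close>

definition nb :: "real \<times> real => real \<times> real => real => real => real => (real \<times> real) set" where
 "nb Y w l \<tau> \<eta> = {P. \<exists>t. l \<le> t \<and> t \<le> \<tau> \<and> dist P (Y + t *. w) < \<eta>}"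

lemma cleanD:
 assumes "clean E Y w \<tau>" "x \<in> lk E" "0 < t" "t < \<tau>" "proj x = Y + t *. w"
 shows "x \<notin> fst ` E" "\<And>y. y \<in> lk E ==> proj y = proj x ==> y = x" "\<And>e. e \<in> E ==> x \<in> seg e ==> cr (dir e) w ~= 0"
 "x \<notin> und E"
proof -
show "x \<notin> fst ` E" "\<And>y. y \<in> lk E ==> proj y = proj x ==> y = x" "\<And>e. e \<in> E ==> x \<in> seg e ==> cr (dir e) w ~= 0"
 using assms unfolding clean_def by blast+
thus "x \<notin> und E" unfolding under_ov ov_def by fastforce
qed

text \<open>Both points lie on the edge and on the line of the ray, and two transversal lines meet
  only once.\<close>

lemma hits_same_edge:
 assumes "clean E Y w \<tau>" "e \<in> E" "x \<in> seg e" "x' \<in> seg e" "0 < t" "t < \<tau>" "proj x = Y + t *. w" "proj x' = Y + t' *. w"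
 shows "t' = t"
proof -
have c: "cr (dir e) w ~= 0" using cleanD(3)[OF assms(1) seg_lk[OF assms(2,3)] assms(5-7) assms(2,3)] .
obtain s s' where s: "x = at_edge e s" "x' = at_edge e s'" using assms(3,4) in_seg_iff by blast
have "(s' - s) *. dir e = proj x' - proj x" unfolding s proj_at_edge by (simp add: algebra_simps)
also have "\<dots> = (t' - t) *. w" unfolding assms(7,8) by (simp add: algebra_simps)
finally have "cr (dir e) ((s' - s) *. dir e) = cr (dir e) ((t' - t) *. w)" by simp
thus ?thesis using c by simp
qed

lemma finite_hits: assumes R: "reg E" and c: "clean E Y w \<tau>" shows "finite (hits E Y w \<tau>)"
proof -
have "finite {t. 0 < t \<and> t < \<tau> \<and> (\<exists>x\<in>seg e. proj x = Y + t *. w)}" (is "finite ?S") if e: "e \<in> E" for e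
proof -
 have "t' = t" if "t \<in> ?S" "t' \<in> ?S" for t t' using that hits_same_edge[OF c e] by blast
 hence "?S \<subseteq> {SOME t. t \<in> ?S}" by (metis (no_types, lifting) singletonI someI_ex subsetI)
 thus ?thesis using finite_subset by blast
qed
hence "finite (\<Union>e\<in>E. {t. 0 < t \<and> t < \<tau> \<and> (\<exists>x\<in>seg e. proj x = Y + t *. w)})" using reg_finite[OF R] by blast
moreover have "hits E Y w \<tau> \<subseteq> (\<Union>e\<in>E. {t. 0 < t \<and> t < \<tau> \<and> (\<exists>x\<in>seg e. proj x = Y + t *. w)})"
 unfolding hits_def lk_def by blast
ultimately show ?thesis using finite_subset by blast
qed

lemma isolated_near:
 assumes R: "reg E" and x: "x \<in> lk E" "x \<notin> fst ` E" "\<And>y. y \<in> lk E ==> proj y = proj x ==> y = x"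
 shows "\<forall>\<^sub>F y in nhds x. y \<in> lk E --> y \<notin> fst ` E \<and> simple E y"
proof -
have "finite (fst ` E \<union> {x \<in> lk E. \<exists>y\<in>lk E. y ~= x \<and> proj y = proj x})" using finite_double[OF R] reg_finite[OF R] by simp
hence "\<forall>\<^sub>F y in nhds x. y \<in> - (fst ` E \<union> {x \<in> lk E. \<exists>y\<in>lk E. y ~= x \<and> proj y = proj x})"
 by (intro eventually_nhds_in_open open_Compl finite_imp_closed) (use x in auto)
thus ?thesis by eventually_elim blast
qed

lemma color_near:
 assumes "pcol (lk E) c" "x \<in> vis (lk E)" shows "\<forall>\<^sub>F y in nhds x. y \<in> lk E --> c y = c x"
proof -
have "\<forall>\<^sub>F y in at x within lk E. c y = c x" using assms unfolding pcol_def by blast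
thus ?thesis unfolding eventually_at_filter by eventually_elim auto
qed

lemma dist_ray: "dist (Y + t *. w) (Y + s *. w) = \<bar>t - s\<bar> * norm (w :: real \<times> real)"
proof -
have "(Y + t *. w) - (Y + s *. w) = (t - s) *. w" by (simp add: algebra_simps)
thus ?thesis by (simp only: dist_norm norm_scaleR)
qed

lemma ray_segment: "cseg (Y + a *. w) (Y + b *. w) = (\<lambda>t. Y + t *. w) ` cseg a (b :: real)"
for Y w :: "real \<times> real"
proof -
have "(1 - u) *. (Y + a *. w) + u *. (Y + b *. w) = Y + ((1 - u) * a + u * b) *. w" for u
 by (simp add: algebra_simps)
thus ?thesis unfolding closed_segment_def by (auto simp: image_iff)
qed

text \<open>A finger is pushed along the ray from the strand at parameter \<open>a\<close> past the adjacent
strand at parameter \<open>h\<close>; this is a Hurwitz move on the colours met by the ray.\<close>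

lemma ray_step:
 assumes R: "reg E" and col: "pcol (lk E) c" and cl: "clean E Y w \<tau>"
 and a: "a \<in> hits E Y w \<tau>" "hcol E c Y w a k" and h: "h \<in> hits E Y w \<tau>" "hcol E c Y w h \<kappa>" and ah: "a ~= h"
 and btwn: "\<forall>t\<in>hits E Y w \<tau>. \<not> (min a h < t \<and> t < max a h)"
 and l: "0 < l" "l < a" "l < h" and eta: "\<eta> > 0"
 obtains E1 c1 z where "reg E1" "pcol (lk E1) c1" "link_equiv (lk E) (lk E1)" "xdif (lk E1) c1 \<bar>\<kappa> - k\<bar>"
 "agree (nb Y w l \<tau> \<eta>) E c E1 c1" "clean E1 Y w \<tau>" "hits E1 Y w \<tau> = hits E Y w \<tau> - {a} \<union> {z}"
 "l < z" "z < \<tau>" "z \<notin> hits E Y w \<tau>" "if a < h then h < z else z < h"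
 "\<forall>t\<in>hits E Y w \<tau>. \<not> (min h z < t \<and> t < max h z)"
 "hcol E1 c1 Y w z k" "hcol E1 c1 Y w h (2 * k - \<kappa>)"
 "\<forall>t\<in>hits E Y w \<tau>. \<forall>b. t ~= a --> t ~= h --> hcol E c Y w t b --> hcol E1 c1 Y w t b"
 "\<forall>d m M. range_in E c m M \<and> xdif (lk E) c d \<and> \<bar>\<kappa> - k\<bar> = d \<and> k ~= M \<and> m \<le> 2 * k - \<kappa> \<and> 2 * k - \<kappa> \<le> M --> good d m M E c E1 c1"
proof -
let ?H = "hits E Y w \<tau>"
have btw: "\<not> (min a h < t \<and> t < max a h)" if "t \<in> ?H" for t using btwn that by blast
let ?r = "\<lambda>t. Y + t *. w"
have w0: "w ~= 0" using cl by (simp add: clean_def)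
have fH: "finite ?H" by (rule finite_hits[OF R cl])
have at: "0 < a" "a < \<tau>" and ht: "0 < h" "h < \<tau>" using a(1) h(1) by (auto simp: hits_def)
obtain xa where xa: "xa \<in> lk E" "proj xa = ?r a" "c xa = k" using a(2) by (auto simp: hcol_def)
obtain xh where xh: "xh \<in> lk E" "proj xh = ?r h" "c xh = \<kappa>" using h(2) by (auto simp: hcol_def)
note ca = cleanD[OF cl xa(1) at xa(2)] and ch = cleanD[OF cl xh(1) ht xh(2)]
obtain e where e: "e \<in> E" "xa \<in> seg e" using xa(1) lkE by blast
obtain A B where AB: "e = (A, B)" by (cases e)
obtain \<epsilon>0 where e0: "\<epsilon>0 > 0" "\<And>t. t \<in> ?H ==> t ~= h ==> \<epsilon>0 \<le> \<bar>t - h\<bar>"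
 using finite_set_avoid[OF fH, of h] by (auto simp: dist_real_def abs_minus_commute)
\<comment> \<open>Around \<open>h\<close> there is no other hit within \<open>\<epsilon>\<close>,
  and this interval lies between \<open>l\<close> and \<open>\<tau>\<close>.\<close>
define \<epsilon> where "\<epsilon> = min \<epsilon>0 (min (\<tau> - h) (h - l))"
have ep: "\<epsilon> > 0" "\<epsilon> \<le> \<epsilon>0" "h + \<epsilon> \<le> \<tau>" "l \<le> h - \<epsilon>" using e0(1) ht l by (auto simp: \<epsilon>_def)
have iso: "t = h" if "t \<in> ?H" "\<bar>t - h\<bar> < \<epsilon>" for t using e0(2)[OF that(1)] that(2) ep(2) by force
have eah: "\<epsilon> \<le> \<bar>a - h\<bar>" using e0(2)[OF a(1) ah] ep(2) by simp
\<comment> \<open>The finger aims at \<open>z0\<close>, just beyond \<open>h\<close> as seen from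
  \<open>a\<close>.\<close>
define \<sigma> where "\<sigma> = (if a < h then 1 else (- 1 :: real))"
define z0 where "z0 = h + \<sigma> * (\<epsilon> / 2)"
have z0H: "t = a \<or> t = h" if t: "t \<in> ?H" "t \<in> cseg a z0" for t
proof (cases "\<bar>t - h\<bar> < \<epsilon>")
 case True thus ?thesis using iso t by blast
next
 case False
 hence "min a h \<le> t \<and> t < max a h \<or> min a h < t \<and> t \<le> max a h"
  using t(2) ah ep(1) unfolding closed_segment_eq_real_ivl z0_def \<sigma>_def by (auto split: if_splits)
 thus ?thesis using btw[OF t(1)] by (auto simp: min_def max_def split: if_splits)
qed
have z0r: "l < z0" "z0 < \<tau>" using ep l unfolding z0_def \<sigma>_def by (auto split: if_splits)
have z0a: "z0 ~= a" using ah ep(1) unfolding z0_def \<sigma>_def by (auto split: if_splits)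
define S where "S = cseg (?r a) (?r z0)"
define Pr where "Pr y \<longleftrightarrow> (y \<notin> fst ` E \<and> simple E y) \<and> (c y = k \<or> c y = \<kappa>)" for y
have over: "x = xa \<or> x = xh" if x: "x \<in> lk E" "proj x \<in> S" for x
proof -
 obtain t where t: "t \<in> cseg a z0" "proj x = ?r t" using x(2) unfolding S_def ray_segment by blast
 have "0 < t" "t < \<tau>" using t(1) at z0r l unfolding closed_segment_eq_real_ivl by (auto split: if_splits)
 hence "t \<in> ?H" using x(1) t(2) by (auto simp: hits_def)
 hence "t = a \<or> t = h" using z0H t(1) by blast
 thus ?thesis using ca(2)[of x] ch(2)[of x] x(1) t(2) xa(2) xh(2) by metis
qed
have near: "\<forall>\<^sub>F y in nhds x. y \<in> lk E --> Pr y" if x: "x \<in> lk E" "proj x \<in> S" for x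
proof -
 have "x \<notin> fst ` E \<and> simple E x \<and> x \<in> vis (lk E) \<and> (c x = k \<or> c x = \<kappa>)"
  using over[OF x]
 proof
  assume "x = xa" show ?thesis unfolding \<open>x = xa\<close> using ca(1,2,4) xa(1,3) by blast
 next
  assume "x = xh" show ?thesis unfolding \<open>x = xh\<close> using ch(1,2,4) xh(1,3) by blast
 qed
 hence xx: "x \<notin> fst ` E" "\<And>y. y \<in> lk E ==> proj y = proj x ==> y = x" "x \<in> vis (lk E)" "c x = k \<or> c x = \<kappa>" by blast+
 have "\<forall>\<^sub>F y in nhds x. y \<in> lk E --> y \<notin> fst ` E \<and> simple E y"
  by (rule isolated_near[OF R x(1) xx(1)]) (rule xx(2))
 thus ?thesis using color_near[OF col xx(3)]
  by eventually_elim (use xx(4) in \<open>auto simp: Pr_def\<close>)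
qed
have "compact S" by (simp add: S_def)
from thin[OF R this near] obtain \<eta>1 where e1: "\<eta>1 > 0" "\<And>y s. y \<in> lk E ==> s \<in> S ==> dist (proj y) s < \<eta>1 ==> Pr y" by blast
\<comment> \<open>The last bound makes the finger end less than \<open>\<epsilon> / 2\<close> beyond
  \<open>z0\<close>, before any further hit.\<close>
define \<eta>' where "\<eta>' = min \<eta> (min \<eta>1 (norm w * (\<epsilon> / 2)))"
have e': "\<eta>' > 0" "\<eta>' \<le> \<eta>" "\<eta>' \<le> \<eta>1" "\<eta>' \<le> norm w * (\<epsilon> / 2)" using eta e1(1) w0 ep(1) by (auto simp: \<eta>'_def)
have crz: "cr (?r z0 - proj A) (dir (A, B)) ~= 0"
proof -
 obtain s where "xa = at_edge e s" using e(2) in_seg_iff by blast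
 hence "proj xa = proj A + s *. dir (A, B)" by (simp add: proj_at_edge AB)
 hence "?r z0 - proj A = (z0 - a) *. w + s *. dir (A, B)" using xa(2) by (simp add: algebra_simps)
 hence "cr (?r z0 - proj A) (dir (A, B)) = (z0 - a) * cr w (dir (A, B))" by (simp only: cr_simps mult_zero_right add_0_right)
 thus ?thesis using ca(3)[OF e] z0a cr_swap[of w "dir e"] by (simp add: AB)
qed
obtain \<alpha> \<beta> Z HH p q r P Q where fi: "finger E c A B \<alpha> \<beta> Z HH p q r P Q"
 and T: "\<And>x. x \<in> tri P Q Z ==> \<exists>y\<in>cseg (proj xa) (?r z0). dist x y < \<eta>'" and zi: "?r z0 \<in> itri P Q Z"
 and b: "xa \<in> cseg p q" "xa ~= p" "xa ~= q"
 and Fp: "(cseg P Z \<union> cseg Q Z) \<inter> ?r ` ?H = {}"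
 and Fv: "\<And>v. v \<in> {w} ==> v ~= 0 ==> cr v (Z - P) ~= 0 \<and> cr v (Z - Q) ~= 0"
 and Fl: "\<And>a d. (a, d) \<in> {(Y, w)} ==> cr (Z - a) d ~= 0"
 by (rule finger_exists[OF R col e(1)[unfolded AB] e(2)[unfolded AB] ca(1,4) crz e'(1), where Fp="?r ` ?H" and Fv="{w}" and Fl="{(Y, w)}"])
  (use fH w0 in auto)
interpret f: finger E c A B \<alpha> \<beta> Z HH p q r P Q by (rule fi)
have k: "f.k = k" using f.k_bs[OF b(1)] xa(3) by simp
have inT: "Pr y" if y: "y \<in> lk E" "proj y \<in> tri P Q Z" for y
proof -
 obtain s where "s \<in> S" "dist (proj y) s < \<eta>'" using T[OF y(2)] unfolding S_def xa(2) by blast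
 thus ?thesis using e1(2)[OF y(1), of s] e'(3) by simp
qed
define u where "u = (z0 - a) *. w"
have pu: "proj xa + s *. u = ?r (a + s * (z0 - a))" for s by (simp add: xa(2) u_def algebra_simps)
have "proj xa + u \<in> itri P Q Z" using zi pu[of 1] by simp
from f.ray_through[OF b this] obtain s1 where s1: "1 < s1" "\<And>s. 0 < s ==> s < s1 ==> ?r (a + s * (z0 - a)) \<in> itri P Q Z"
 "?r (a + s1 * (z0 - a)) \<in> f.sides" "\<And>s. s < 0 \<or> s1 < s ==> ?r (a + s * (z0 - a)) \<notin> tri P Q Z" unfolding pu by blast
\<comment> \<open>Where the ray emerges from under the finger: the strand of colour \<open>k\<close>
  is now met here instead of at \<open>a\<close>, where the base has been removed.\<close>
define z where "z = a + s1 * (z0 - a)"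
have par: "t = a + ((t - a) / (z0 - a)) * (z0 - a)" for t using z0a by simp
have zs: "?r z \<in> f.sides" using s1(3) by (simp add: z_def)
have zT: "?r z \<in> tri P Q Z" using zs f.side_iff by blast
have zclose: "\<bar>z - z0\<bar> < \<epsilon> / 2"
proof -
 obtain t where t: "t \<in> cseg a z0" "dist (?r z) (?r t) < \<eta>'"
  using T[OF zT] unfolding xa(2) ray_segment by blast
 have "\<bar>z - t\<bar> * norm w < (\<epsilon> / 2) * norm w" using t(2) e'(4) unfolding dist_ray by (simp add: mult.commute)
 hence zt: "\<bar>z - t\<bar> < \<epsilon> / 2" using w0 by simp
 have zz: "z - z0 = (s1 - 1) * (z0 - a)" by (simp add: z_def algebra_simps)
 have "0 \<le> (s1 - 1) * ((z0 - a) * (z0 - a))" using s1(1) by (intro mult_nonneg_nonneg[OF _ zero_le_square]) simp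
 hence "0 \<le> (z - z0) * (z0 - a)" unfolding zz by (simp only: mult.assoc)
 hence "\<bar>z - z0\<bar> \<le> \<bar>z - t\<bar>"
 proof (cases "a < z0")
  case True
  hence "z0 \<le> z" "t \<le> z0" using \<open>0 \<le> (z - z0) * (z0 - a)\<close> t(1) by (auto simp: zero_le_mult_iff closed_segment_eq_real_ivl)
  thus ?thesis by simp
 next
  case False
  hence "z \<le> z0" "z0 \<le> t" using \<open>0 \<le> (z - z0) * (z0 - a)\<close> t(1) z0a by (auto simp: zero_le_mult_iff closed_segment_eq_real_ivl split: if_splits)
  thus ?thesis by simp
 qed
 thus ?thesis using zt by simp
qed
have zdir: "if a < h then z0 < z else z < z0"
proof -
 have zz: "z - z0 = (s1 - 1) * (z0 - a)" by (simp add: z_def algebra_simps)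
 have "if a < h then z0 - a > 0 else z0 - a < 0" using ah eah ep(1) unfolding z0_def \<sigma>_def by (auto split: if_splits)
 moreover have "0 < z0 - a ==> 0 < z - z0" "z0 - a < 0 ==> z - z0 < 0" unfolding zz using s1(1) by (simp_all add: mult_pos_neg)
 ultimately show ?thesis by (auto split: if_splits)
qed
have zh: "\<bar>z - h\<bar> < \<epsilon>" "if a < h then h < z else z < h"
 using zclose zdir ep(1) unfolding z0_def \<sigma>_def by (auto simp: abs_if split: if_splits)
have zr: "l < z" "z < \<tau>" "0 < z" using zh(1) ep l(1) by auto
have zH: "z \<notin> ?H" using Fp zs by blast
have side_z: "t = z" if "?r t \<in> f.sides" "t ~= a" for t
proof -
 define s where "s = (t - a) / (z0 - a)"
 have st: "t = a + s * (z0 - a)" using par[of t] by (simp add: s_def)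
 have "?r t \<in> tri P Q Z" "?r t \<notin> itri P Q Z" using that(1) f.side_iff f.itri_not_side by blast+
 hence "\<not> (s < 0 \<or> s1 < s)" "\<not> (0 < s \<and> s < s1)" using s1(2,4)[of s] st by auto
 moreover have "s ~= 0" using that(2) st by auto
 ultimately have "s = s1" by linarith
 thus ?thesis using st by (simp add: z_def)
qed
have a_side: "?r a \<notin> f.sides" using f.base_not_side[OF xa(1) f.bs_proj[OF b(1)]] b(2,3) xa(2) by auto
have outT: "?r t \<notin> tri P Q Z" if t: "t \<in> ?H" "t ~= a" "t ~= h" for t
proof
 assume T': "?r t \<in> tri P Q Z"
 define s where "s = (t - a) / (z0 - a)"
 have st: "t = a + s * (z0 - a)" using par[of t] by (simp add: s_def)
 have "\<not> (s < 0 \<or> s1 < s)" using s1(4)[of s] T' st by auto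
 moreover have "s ~= 0" "s ~= s1" using t(1,2) st zH by (auto simp: z_def)
 ultimately have s: "0 < s" "s < s1" by auto
 have "t \<in> cseg a z"
  unfolding closed_segment_def by (simp, rule exI[of _ "s / s1"]) (use s in \<open>simp add: st z_def field_simps\<close>)
 moreover have "\<epsilon> \<le> \<bar>t - h\<bar>" using iso[OF t(1)] t(3) by force
 ultimately have "min a h < t \<and> t < max a h"
  using zh t(2) ep(1) ah unfolding closed_segment_eq_real_ivl by (auto simp: abs_if split: if_splits)
 thus False using btw[OF t(1)] by blast
qed
have hT: "?r h \<in> itri P Q Z"
proof -
 define s where "s = (h - a) / (z0 - a)"
 have st: "h = a + s * (z0 - a)" using par[of h] by (simp add: s_def)
 have "0 < s \<and> s < 1" using ah ep(1) unfolding s_def z0_def \<sigma>_def by (auto simp: zero_less_divide_iff divide_less_eq_1 split: if_splits)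
 thus ?thesis using s1(1) s1(2)[of s] st by simp
qed
have nbs: "x \<notin> f.bs" if "x \<in> lk E" "proj x = ?r t" "0 < t" "t < \<tau>" "t ~= a" for x t
proof
 assume "x \<in> f.bs"
 hence "x \<in> seg (A, B)" using f.bs_sub by blast
 thus False using hits_same_edge[OF cl e(1)[unfolded AB] e(2)[unfolded AB] _ at xa(2) that(2)] that(5) by blast
qed
have F_old: "x \<notin> f.F" if "x \<in> lk E" "proj x = ?r t" "0 < t" "t < \<tau>" for x t
proof
 assume "x \<in> f.F"
 hence s: "?r t \<in> f.sides" using f.F_plane(1) that(2) by metis
 have "t \<in> ?H" using that by (auto simp: hits_def)
 thus False using s Fp by blast
qed
have Hits: "hits f.E' Y w \<tau> = ?H - {a} \<union> {z}"
proof (intro set_eqI iffI)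
 fix t assume t: "t \<in> hits f.E' Y w \<tau>"
 then obtain x where x: "x \<in> lk f.E'" "proj x = ?r t" and tr: "0 < t" "t < \<tau>" by (auto simp: hits_def)
 show "t \<in> ?H - {a} \<union> {z}"
 proof (cases "x \<in> f.F")
  case True
  hence "?r t \<in> f.sides" using f.F_plane(1) x(2) by metis
  thus ?thesis using side_z a_side by blast
 next
  case False
  hence xD: "x \<in> lk E" "x \<notin> f.bs" using x(1) f.D'_iff by blast+
  hence "t ~= a" using ca(2)[of x] x(2) xa(2) b(1) by metis
  thus ?thesis using xD x tr by (auto simp: hits_def)
 qed
next
 fix t assume "t \<in> ?H - {a} \<union> {z}"
 then consider "t \<in> ?H" "t ~= a" | "t = z" by blast
 thus "t \<in> hits f.E' Y w \<tau>"
 proof cases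
  case 1
  then obtain x where x: "x \<in> lk E" "proj x = ?r t" "0 < t" "t < \<tau>" by (auto simp: hits_def)
  hence "x \<in> lk f.E'" using nbs[OF x 1(2)] f.D'_iff by blast
  thus ?thesis using x by (auto simp: hits_def)
 next
  case 2
  obtain x where "x \<in> f.F" "proj x = ?r z" using f.side_F[OF zs] by blast
  hence "x \<in> lk f.E'" "proj x = ?r z" using f.D'_iff by blast+
  thus ?thesis using zr 2 unfolding hits_def by blast
 qed
qed
have hz: "hcol f.E' f.c' Y w z k"
proof -
 obtain x where x: "x \<in> f.F" "proj x = ?r z" using f.side_F[OF zs] by blast
 thus ?thesis unfolding hcol_def using f.D'_iff f.c'_F[OF x(1)] k by blast
qed
have hh: "hcol f.E' f.c' Y w h (2 * k - \<kappa>)"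
proof -
 have "xh \<in> lk f.E'" using nbs[OF xh(1,2) ht ah[symmetric]] xh(1) f.D'_iff by blast
 moreover have "f.c' xh = 2 * k - \<kappa>" using f.c'_in[OF xh(1)] hT xh k by simp
 ultimately show ?thesis unfolding hcol_def using xh(2) by blast
qed
have ho: "hcol f.E' f.c' Y w t b'" if t: "t \<in> ?H" "t ~= a" "t ~= h" "hcol E c Y w t b'" for t b'
proof -
 obtain x where x: "x \<in> lk E" "proj x = ?r t" "c x = b'" using t(4) by (auto simp: hcol_def)
 have tr: "0 < t" "t < \<tau>" using t(1) by (auto simp: hits_def)
 have "x \<in> lk f.E'" using nbs[OF x(1,2) tr t(2)] x(1) f.D'_iff by blast
 moreover have "f.c' x = b'" using f.c'_out[OF x(1)] outT[OF t(1-3)] x by simp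
 ultimately show ?thesis unfolding hcol_def using x(2) by blast
qed
have clean': "clean f.E' Y w \<tau>"
 unfolding clean_def
proof (intro conjI ballI allI impI w0)
 fix x t assume x: "x \<in> lk f.E'" and tr: "0 < t" "t < \<tau>" and px: "proj x = ?r t"
 have F_case: "x \<notin> lk E" "t = z" if xF: "x \<in> f.F"
 proof -
  show "x \<notin> lk E" using F_old[OF _ px tr] xF by blast
  have "?r t \<in> f.sides" using f.F_plane(1)[OF xF] px by simp
  thus "t = z" using side_z a_side by blast
 qed
 have D_case: "x \<in> lk E" "x \<notin> f.bs" if "x \<notin> f.F" using x that f.D'_iff by blast+
 show "x \<notin> fst ` f.E'"
 proof (cases "x \<in> f.F")
  case False thus ?thesis using f.vertices_E'[OF False] cleanD(1)[OF cl D_case(1)[OF False] tr px] by simp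
 next
  case True
  have "x ~= p" "x ~= q" using F_case(1)[OF True] f.p_edge by blast+
  moreover have "x ~= r"
  proof
   assume "x = r"
   hence "Z - Y = t *. w" using px f.proj_r by simp
   hence "cr (Z - Y) w = 0" by (simp only: cr_simps mult_zero_right)
   thus False using Fl by blast
  qed
  moreover have "x \<notin> fst ` E" using F_case(1)[OF True] seg_lk ends_in_seg(1) by (metis imageE)
  ultimately show ?thesis using f.V' by blast
 qed
 show "y = x" if y: "y \<in> lk f.E'" "proj y = proj x" for y
 proof (cases "x \<in> f.F")
  case True
  have "y \<in> f.F"
  proof (rule ccontr)
   assume "y \<notin> f.F"
   hence "y \<in> lk E" using y(1) f.D'_iff by blast
   hence "t \<in> ?H" unfolding hits_def mem_Collect_eq using y(2) px tr by (intro conjI bexI[of _ y]) simp_all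
   thus False using F_case(2)[OF True] zH by simp
  qed
  thus ?thesis using f.F_inj True y(2) by blast
 next
  case False
  have xH: "t \<in> ?H" using D_case(1)[OF False] px tr unfolding hits_def by blast
  have "y \<notin> f.F"
  proof
   assume "y \<in> f.F"
   hence "?r t \<in> f.sides" using f.F_plane(1) y(2) px by metis
   thus False using xH Fp by blast
  qed
  hence "y \<in> lk E" using y(1) f.D'_iff by blast
  thus ?thesis using cleanD(2)[OF cl D_case(1)[OF False] tr px] y(2) by blast
 qed
 show "cr (dir e') w ~= 0" if e': "e' \<in> f.E'" "x \<in> seg e'" for e'
 proof (cases "x \<in> f.F")
  case False
  obtain g s where g: "g \<in> E" "x \<in> seg g" "s > 0" "dir e' = s *. dir g" using f.base_edge[OF e' False] by blast
  thus ?thesis using cleanD(3)[OF cl D_case(1)[OF False] tr px g(1,2)] by simp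
 next
  case True
  have nD: "x \<notin> lk E" by (rule F_case(1)[OF True])
  have "cr w (Z - P) ~= 0" "cr w (Z - Q) ~= 0" using Fv w0 by auto
  hence c2: "cr (Z - P) w ~= 0" "cr (Z - Q) w ~= 0" using cr_swap[of w] by (metis neg_equal_0_iff_equal)+
  from e'(1) show ?thesis
  proof (cases rule: f.edges_E')
   case 1 thus ?thesis using nD seg_lk e'(2) by blast
  next
   case 2 thus ?thesis using nD f.seg_subs e'(2) by blast
  next
   case 3 thus ?thesis using nD f.seg_subs e'(2) by blast
  next
   case 4
   hence "dir e' = Z - P" by (simp add: dir_def f.proj_r f.P_def)
   thus ?thesis using c2 by simp
  next
   case 5
   hence "dir e' = - (Z - Q)" by (simp add: dir_def f.proj_r f.Q_def)
   thus ?thesis using c2(2) by (simp only: cr_simps(4) neg_equal_0_iff_equal not_False_eq_True)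
  qed
 qed
qed
have ag: "agree (nb Y w l \<tau> \<eta>) E c f.E' f.c'"
proof (rule agree_mono[OF f.agree_E'])
 show "tri P Q Z \<subseteq> nb Y w l \<tau> \<eta>"
 proof
  fix x assume "x \<in> tri P Q Z"
  then obtain t where t: "t \<in> cseg a z0" "dist x (?r t) < \<eta>'" using T unfolding xa(2) ray_segment by blast
  have "l \<le> t" "t \<le> \<tau>" using t(1) l(2) at z0r unfolding closed_segment_eq_real_ivl by (auto split: if_splits)
  thus "x \<in> nb Y w l \<tau> \<eta>" unfolding nb_def using t(2) e'(2) by fastforce
 qed
qed
have xd: "xdif (lk f.E') f.c' \<bar>\<kappa> - k\<bar>"
 using f.exit_xdif[OF xh(1)] hT xh(2,3) inT k unfolding Pr_def by simp
have gd: "good d m M E c f.E' f.c'"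
 if H: "range_in E c m M" "xdif (lk E) c d" "\<bar>\<kappa> - k\<bar> = d" "k ~= M" "m \<le> 2 * k - \<kappa>" "2 * k - \<kappa> \<le> M" for d m M
proof (rule f.good_E'(1)[OF H(1,2)])
 have "xa \<in> vis (lk E)" "xh \<in> vis (lk E)" using xa(1) xh(1) ca(4) ch(4) by simp_all
 hence km: "m \<le> k" "k \<le> M" "\<kappa> \<le> M" using H(1) xa(3) xh(3) unfolding range_in_def by auto
 show "m \<le> 2 * f.k - c y \<and> 2 * f.k - c y \<le> M" if "y \<in> vis (lk E)" "proj y \<in> tri P Q Z" for y
  using inT[of y] that H(5,6) km unfolding Pr_def k by auto
 show "f.k ~= M" using H(4) k by simp
 show "(\<forall>y\<in>vis (lk E). proj y \<in> itri P Q Z --> 2 * f.k - c y ~= M) \<or>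
   (\<forall>y\<in>lk E. proj y \<in> itri P Q Z --> y \<notin> fst ` E \<and> simple E y)"
  using inT itri_subset unfolding Pr_def by blast
 \<comment> \<open>\<open>k\<close> and \<open>\<kappa>\<close> are at most \<open>M\<close> and
   differ by \<open>d\<close>; if \<open>k\<close> is not \<open>M - d\<close>, then neither
   \<open>\<kappa>\<close> nor its reflection is \<open>M\<close>.\<close>
 show "f.k = M - d \<or> (\<forall>y\<in>vis (lk E). proj y \<in> f.sides --> c y ~= M \<and> 2 * f.k - c y ~= M)"
 proof (cases "k = M - d")
  case True thus ?thesis using k by simp
 next
  case False
  have "c y ~= M \<and> 2 * k - c y ~= M" if "y \<in> vis (lk E)" "proj y \<in> f.sides" for y
  proof -
   have "c y = k \<or> c y = \<kappa>" using inT[of y] that f.side_iff unfolding Pr_def by blast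
   thus ?thesis using False H(3,4) km by (auto simp: abs_if split: if_splits)
  qed
  thus ?thesis unfolding k by blast
 qed
 show "\<bar>b' - f.k\<bar> ~= d" if "ov (lk E) u' w'" "w' \<in> f.bs" for u' w' b'
 proof -
  have wD: "w' \<in> lk E" "proj w' \<in> tri P Q Z" using that f.bs_sub f.bs_proj f.side_iff(3) by blast+
  have "u' = w'" using inT[OF wD] that(1) unfolding Pr_def ov_def by metis
  thus ?thesis using that(1) by (simp add: ov_def)
 qed
qed
show ?thesis
proof (rule that[OF f.reg_E' f.pcol_D' f.equiv_E' xd ag clean' Hits zr(1,2) zH zh(2) _ hz hh])
 have "\<not> (min h z < t \<and> t < max h z)" if t: "t \<in> ?H" for t using iso[OF t] zh(1) by (auto simp: min_def max_def split: if_splits)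
 thus "\<forall>t\<in>?H. \<not> (min h z < t \<and> t < max h z)" by blast
qed (use ho gd in blast)+
qed

section \<open>Bringing a strand of prescribed colour along a ray\<close>

locale reduction =
 fixes d m M :: int and L :: "pt set"
 assumes d0: "0 < d" and mM: "m + 4 * d \<le> M"
 and minD: "\<And>E c n. reg E ==> pcol (lk E) c ==> link_equiv L (lk E) ==> xdif (lk E) c n ==> 0 < n ==> d \<le> n"
begin

definition St :: "(pt \<times> pt) set => (pt => int) => bool" where
 "St E c \<longleftrightarrow> reg E \<and> pcol (lk E) c \<and> link_equiv L (lk E) \<and> range_in E c m M \<and> xdif (lk E) c d"

abbreviation "mv \<equiv> good d m M"

lemma St_mv: "St E c ==> mv E c E1 c1 ==> St E1 c1"
unfolding St_def good_def using link_equiv_trans by blast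

lemma mv_refl: "St E c ==> mv E c E c"
unfolding St_def by (blast intro: good_refl)

lemma hcol_range:
 assumes "St E c" "clean E Y w \<tau>" "t \<in> hits E Y w \<tau>" "hcol E c Y w t k" shows "m \<le> k \<and> k \<le> M"
proof -
obtain x where x: "x \<in> lk E" "proj x = Y + t *. w" "c x = k" using assms(4) by (auto simp: hcol_def)
have "0 < t" "t < \<tau>" using assms(3) by (auto simp: hits_def)
hence "x \<in> vis (lk E)" using cleanD(4)[OF assms(2) x(1) _ _ x(2)] x(1) by blast
thus ?thesis using assms(1) x(3) unfolding St_def range_in_def by blast
qed

lemma hcol_unique: "clean E Y w \<tau> ==> t \<in> hits E Y w \<tau> ==> hcol E c Y w t k ==> hcol E c Y w t k' ==> k = k'"
unfolding hcol_def hits_def using cleanD(2) by (metis (no_types, lifting) mem_Collect_eq)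

lemma hcol_exists: "t \<in> hits E Y w \<tau> ==> \<exists>k. hcol E c Y w t k"
unfolding hits_def hcol_def by blast

text \<open>The vehicle of the transport: Hurwitz moves between these two adjacent strands shift
  their colours by multiples of \<open>\<delta>\<close> and concern no other strand met by the
  ray.\<close>

definition pair :: "(pt \<times> pt) set => (pt => int) => real \<times> real => real \<times> real => real => real => real => int => int => bool" where
 "pair E c Y w \<tau> a b \<alpha> \<delta> \<longleftrightarrow> a \<in> hits E Y w \<tau> \<and> b \<in> hits E Y w \<tau> \<and> a < b \<and> (\<forall>t\<in>hits E Y w \<tau>. \<not> (a < t \<and> t < b)) \<and>
  hcol E c Y w a \<alpha> \<and> hcol E c Y w b (\<alpha> + \<delta>)"

text \<open>The strands in front of the pair keep their places and colours, so the transport can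
  continue with the next of them.\<close>

definition climbs :: "real \<times> real => real \<times> real => real => real => real => (pt \<times> pt) set => (pt => int) => real => (pt \<times> pt) set => (pt => int) => real => bool" where
 "climbs Y w \<tau> l \<eta> E c a E1 c1 a1 \<longleftrightarrow> mv E c E1 c1 \<and> clean E1 Y w \<tau> \<and> agree (nb Y w l \<tau> \<eta>) E c E1 c1 \<and>
  (\<forall>t\<in>hits E1 Y w \<tau>. l < t) \<and> {t\<in>hits E1 Y w \<tau>. t < a1} = {t\<in>hits E Y w \<tau>. t < a} \<and>
  (\<forall>t\<in>hits E Y w \<tau>. \<forall>k. t < a --> hcol E c Y w t k --> hcol E1 c1 Y w t k)"

lemma climbs_trans:
 assumes "climbs Y w \<tau> l \<eta> E c a E1 c1 a1" "climbs Y w \<tau> l \<eta> E1 c1 a1 E2 c2 a2"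
 shows "climbs Y w \<tau> l \<eta> E c a E2 c2 a2"
proof -
note 1 = assms(1)[unfolded climbs_def] and 2 = assms(2)[unfolded climbs_def]
have m: "mv E c E2 c2" by (rule good_trans[OF conjunct1[OF 1] conjunct1[OF 2]])
have g: "agree (nb Y w l \<tau> \<eta>) E c E2 c2" by (rule agree_trans[OF conjunct1[OF conjunct2[OF conjunct2[OF 1]]] conjunct1[OF conjunct2[OF conjunct2[OF 2]]]])
have e: "{t\<in>hits E1 Y w \<tau>. t < a1} = {t\<in>hits E Y w \<tau>. t < a}" using 1 by blast
have "hcol E2 c2 Y w t k" if t: "t \<in> hits E Y w \<tau>" "t < a" "hcol E c Y w t k" for t k
proof -
 have "t \<in> hits E1 Y w \<tau>" "t < a1" using e t(1,2) by blast+
 moreover have "hcol E1 c1 Y w t k" using 1 t by blast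
 ultimately show ?thesis using 2 by blast
qed
thus ?thesis unfolding climbs_def using 2 m g e by simp
qed

text \<open>The two Hurwitz moves. If the far strand is pushed past the near one, the colours become
  \<open>\<alpha> + \<delta>\<close>, \<open>\<alpha> + 2 * \<delta>\<close>; if the near one is
  pushed past the far one, they become \<open>\<alpha> - \<delta>\<close>, \<open>\<alpha>\<close>.
  Both keep the difference \<open>\<delta>\<close>.\<close>

lemma climb_step:
 assumes S: "St E c" and cl: "clean E Y w \<tau>" and p: "pair E c Y w \<tau> a b \<alpha> \<delta>" and dd: "\<bar>\<delta>\<bar> = d"
 and l: "0 < l" "\<forall>t\<in>hits E Y w \<tau>. l < t" and eta: "\<eta> > 0"
 and \<alpha>': "\<alpha>' = \<alpha> + \<delta> \<and> m \<le> \<alpha> + 2 * \<delta> \<and> \<alpha> + 2 * \<delta> \<le> M \<and> \<alpha> + \<delta> ~= M \<or> \<alpha>' = \<alpha> - \<delta> \<and> m \<le> \<alpha> - \<delta> \<and> \<alpha> - \<delta> \<le> M \<and> \<alpha> ~= M"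
 shows "\<exists>E1 c1 a1 b1. climbs Y w \<tau> l \<eta> E c a E1 c1 a1 \<and> pair E1 c1 Y w \<tau> a1 b1 \<alpha>' \<delta>"
using \<alpha>'
proof
have R: "reg E" "pcol (lk E) c" "range_in E c m M" "xdif (lk E) c d" using S by (auto simp: St_def)
have ab: "a \<in> hits E Y w \<tau>" "b \<in> hits E Y w \<tau>" "a < b" "\<And>t. t \<in> hits E Y w \<tau> ==> \<not> (a < t \<and> t < b)"
  "hcol E c Y w a \<alpha>" "hcol E c Y w b (\<alpha> + \<delta>)" using p by (auto simp: pair_def)
have lab: "l < a" "l < b" using l(2) ab by auto
{
 assume h: "\<alpha>' = \<alpha> + \<delta> \<and> m \<le> \<alpha> + 2 * \<delta> \<and> \<alpha> + 2 * \<delta> \<le> M \<and> \<alpha> + \<delta> ~= M"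
 have btw: "\<forall>t\<in>hits E Y w \<tau>. \<not> (min b a < t \<and> t < max b a)" using ab(4,3) by (simp add: min_def max_def)
 have ba: "b ~= a" using ab(3) by simp
 obtain E1 c1 z where z: "agree (nb Y w l \<tau> \<eta>) E c E1 c1" "clean E1 Y w \<tau>" "hits E1 Y w \<tau> = hits E Y w \<tau> - {b} \<union> {z}"
  "l < z" "z \<notin> hits E Y w \<tau>" "if b < a then a < z else z < a"
  "\<forall>t\<in>hits E Y w \<tau>. \<not> (min a z < t \<and> t < max a z)"
  "hcol E1 c1 Y w z (\<alpha> + \<delta>)" "hcol E1 c1 Y w a (2 * (\<alpha> + \<delta>) - \<alpha>)"
  "\<forall>t\<in>hits E Y w \<tau>. \<forall>k. t ~= b --> t ~= a --> hcol E c Y w t k --> hcol E1 c1 Y w t k"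
  "\<forall>d m M. range_in E c m M \<and> xdif (lk E) c d \<and> \<bar>\<alpha> - (\<alpha> + \<delta>)\<bar> = d \<and> \<alpha> + \<delta> ~= M \<and> m \<le> 2 * (\<alpha> + \<delta>) - \<alpha> \<and> 2 * (\<alpha> + \<delta>) - \<alpha> \<le> M --> good d m M E c E1 c1"
  by (rule ray_step[OF R(1,2) cl ab(2,6) ab(1,5) ba btw l(1) lab(2,1) eta])
 have za: "z < a" using z(6) ab(3) by auto
 have no: "\<not> (z < t \<and> t < a)" if "t \<in> hits E Y w \<tau>" for t using bspec[OF z(7) that] za by (simp add: min_def max_def)
 have "mv E c E1 c1" using z(11) R(3,4) h dd by (simp add: algebra_simps abs_minus_commute)
 moreover have "{t\<in>hits E1 Y w \<tau>. t < z} = {t\<in>hits E Y w \<tau>. t < a}"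
  unfolding z(3) using no za ab(3) z(5) by (auto simp: not_less) (metis less_le order.strict_trans)+
 ultimately have "climbs Y w \<tau> l \<eta> E c a E1 c1 z" unfolding climbs_def using z(1,2,4,10) z(3) l(2) ab(3) by auto
 moreover have "pair E1 c1 Y w \<tau> z a \<alpha>' \<delta>" unfolding pair_def z(3) using z(8,9) h za ab(1,3) no by (auto simp: algebra_simps)
 ultimately show ?thesis by blast
}
{
 assume h: "\<alpha>' = \<alpha> - \<delta> \<and> m \<le> \<alpha> - \<delta> \<and> \<alpha> - \<delta> \<le> M \<and> \<alpha> ~= M"
 have btw: "\<forall>t\<in>hits E Y w \<tau>. \<not> (min a b < t \<and> t < max a b)" using ab(4,3) by (simp add: min_def max_def)
 have ba: "a ~= b" using ab(3) by simp
 obtain E1 c1 z where z: "agree (nb Y w l \<tau> \<eta>) E c E1 c1" "clean E1 Y w \<tau>" "hits E1 Y w \<tau> = hits E Y w \<tau> - {a} \<union> {z}"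
  "l < z" "z \<notin> hits E Y w \<tau>" "if a < b then b < z else z < b"
  "\<forall>t\<in>hits E Y w \<tau>. \<not> (min b z < t \<and> t < max b z)"
  "hcol E1 c1 Y w z \<alpha>" "hcol E1 c1 Y w b (2 * \<alpha> - (\<alpha> + \<delta>))"
  "\<forall>t\<in>hits E Y w \<tau>. \<forall>k. t ~= a --> t ~= b --> hcol E c Y w t k --> hcol E1 c1 Y w t k"
  "\<forall>d m M. range_in E c m M \<and> xdif (lk E) c d \<and> \<bar>(\<alpha> + \<delta>) - \<alpha>\<bar> = d \<and> \<alpha> ~= M \<and> m \<le> 2 * \<alpha> - (\<alpha> + \<delta>) \<and> 2 * \<alpha> - (\<alpha> + \<delta>) \<le> M --> good d m M E c E1 c1"
  by (rule ray_step[OF R(1,2) cl ab(1,5) ab(2,6) ba btw l(1) lab eta])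
 have za: "b < z" using z(6) ab(3) by auto
 have no: "\<not> (b < t \<and> t < z)" if "t \<in> hits E Y w \<tau>" for t using bspec[OF z(7) that] za by (simp add: min_def max_def)
 have "mv E c E1 c1" using z(11) R(3,4) h dd by (simp add: algebra_simps abs_minus_commute)
 moreover have "{t\<in>hits E1 Y w \<tau>. t < b} = {t\<in>hits E Y w \<tau>. t < a}"
  unfolding z(3) using ab(3,4) za by (auto simp: not_less) (metis less_le order.strict_trans)+
 ultimately have "climbs Y w \<tau> l \<eta> E c a E1 c1 b" unfolding climbs_def using z(1,2,4,10) z(3) l(2) ab(3) by auto
 moreover have "pair E1 c1 Y w \<tau> b z \<alpha>' \<delta>" unfolding pair_def z(3) using z(8,9) h za ab(2,3) no by (auto simp: algebra_simps)
 ultimately show ?thesis by blast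
}
qed

lemma pair_range: "St E c ==> clean E Y w \<tau> ==> pair E c Y w \<tau> a b \<alpha> \<delta> ==> m \<le> \<alpha> \<and> \<alpha> \<le> M \<and> m \<le> \<alpha> + \<delta> \<and> \<alpha> + \<delta> \<le> M"
unfolding pair_def using hcol_range by blast

text \<open>The pair runs through the progression with step \<open>\<delta>\<close> until it is
  \<open>v\<close>, \<open>v + \<delta>\<close>. As \<open>v\<close> has distance at least
  \<open>d\<close> from both ends, all colours on the way are in the range.\<close>

lemma climb:
 assumes "St E c" "clean E Y w \<tau>" "pair E c Y w \<tau> a b \<alpha> \<delta>" "\<bar>\<delta>\<bar> = d"
 and "0 < l" "\<forall>t\<in>hits E Y w \<tau>. l < t" "\<eta> > 0"
 and "v = \<alpha> + \<delta> * int n \<or> v = \<alpha> - \<delta> * int n" "m + d \<le> v" "v \<le> M - d"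
 shows "\<exists>E1 c1 a1 b1. climbs Y w \<tau> l \<eta> E c a E1 c1 a1 \<and> pair E1 c1 Y w \<tau> a1 b1 v \<delta>"
using assms
proof (induction n arbitrary: E c a b \<alpha>)
case 0
have "climbs Y w \<tau> l \<eta> E c a E c a" unfolding climbs_def using 0 by (intro conjI mv_refl agree_refl) auto
thus ?case using 0 by auto
next
case (Suc n)
note rg = pair_range[OF Suc.prems(1-3)]
have pos: "0 \<le> d * int n" using d0 by simp
define \<alpha>' where "\<alpha>' = (if v = \<alpha> + \<delta> * int (Suc n) then \<alpha> + \<delta> else \<alpha> - \<delta>)"
have v: "v = \<alpha>' + \<delta> * int n \<or> v = \<alpha>' - \<delta> * int n"
 using Suc.prems(8) unfolding \<alpha>'_def by (auto simp: algebra_simps split: if_splits)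
have dc: "\<delta> = d \<or> \<delta> = - d" using Suc.prems(4) by auto
have ar: "\<delta> * int n = d * int n \<or> \<delta> * int n = - (d * int n)" "\<delta> * int (Suc n) = \<delta> + \<delta> * int n" using dc by (auto simp: algebra_simps)
have "0 \<le> \<delta> * int n \<longleftrightarrow> 0 < \<delta> \<or> int n = 0" using dc d0 by (auto simp: zero_le_mult_iff)
have st: "\<alpha>' = \<alpha> + \<delta> \<and> m \<le> \<alpha> + 2 * \<delta> \<and> \<alpha> + 2 * \<delta> \<le> M \<and> \<alpha> + \<delta> ~= M \<or> \<alpha>' = \<alpha> - \<delta> \<and> m \<le> \<alpha> - \<delta> \<and> \<alpha> - \<delta> \<le> M \<and> \<alpha> ~= M"
proof -
 define X where "X = \<delta> * int n"
 have X: "\<delta> = d \<and> 0 \<le> X \<or> \<delta> = - d \<and> X \<le> 0" using pos dc by (auto simp: X_def)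
 have V: "v = \<alpha> + (\<delta> + X) \<or> v ~= \<alpha> + (\<delta> + X) \<and> v = \<alpha> - (\<delta> + X)" using Suc.prems(8) ar(2) by (auto simp: X_def)
 show ?thesis unfolding \<alpha>'_def ar(2) X_def[symmetric] using V X rg Suc.prems(9,10) d0 by (elim disjE) simp_all
qed
obtain E1 c1 a1 b1 where s: "climbs Y w \<tau> l \<eta> E c a E1 c1 a1" "pair E1 c1 Y w \<tau> a1 b1 \<alpha>' \<delta>"
 using climb_step[OF Suc.prems(1-7) st] by blast
have "St E1 c1" using St_mv[OF Suc.prems(1)] s(1) by (simp add: climbs_def)
moreover have "clean E1 Y w \<tau>" "\<forall>t\<in>hits E1 Y w \<tau>. l < t" using s(1) by (simp_all add: climbs_def)
ultimately obtain E2 c2 a2 b2 where "climbs Y w \<tau> l \<eta> E1 c1 a1 E2 c2 a2" "pair E2 c2 Y w \<tau> a2 b2 v \<delta>"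
 using Suc.IH[OF _ _ s(2) Suc.prems(4,5) _ Suc.prems(7) v Suc.prems(9,10)] by blast
thus ?case using climbs_trans[OF s(1)] by blast
qed

lemma dvd_steps: assumes "\<bar>\<delta>\<bar> = d" "d dvd v - \<alpha>" shows "\<exists>n. v = \<alpha> + \<delta> * int n \<or> v = \<alpha> - \<delta> * int n"
proof -
have "\<delta> dvd v - \<alpha>" using assms by (metis abs_dvd_iff)
then obtain j where j: "v - \<alpha> = \<delta> * j" by (auto elim: dvdE)
show ?thesis
proof (cases "0 \<le> j")
 case True thus ?thesis using j by (intro exI[of _ "nat j"]) simp
next
 case False thus ?thesis using j by (intro exI[of _ "nat (- j)"]) simp
qed
qed

text \<open>Induction on the number of strands in front of the pair. For the next one, of colour
  \<open>\<gamma>\<close>, the pair climbs to a colour \<open>v'\<close> with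
  \<open>v' ~= \<gamma>\<close> and \<open>\<bar>v' - \<gamma>\<bar> \<le> d\<close>. A crossing of
  these two strands would have this difference, so minimality makes it equal to \<open>d\<close>,
  and the two strands form a pair nearer to \<open>Y\<close>. When no strand is left in front, the
  pair climbs to \<open>v\<close>.\<close>

lemma fetch:
 assumes "St E c" "clean E Y w \<tau>" "pair E c Y w \<tau> a b \<alpha> \<delta>" "\<bar>\<delta>\<bar> = d"
 and l: "0 < l" and "\<forall>t\<in>hits E Y w \<tau>. l < t" and eta: "\<eta> > 0"
 and "\<And>t \<gamma>. t \<in> hits E Y w \<tau> ==> t < a ==> hcol E c Y w t \<gamma> ==> d dvd \<gamma> - \<alpha> \<or> m + 2 * d \<le> \<gamma> \<and> \<gamma> \<le> M - 2 * d"
 and v: "m + d \<le> v" "v \<le> M - d" and "d dvd v - \<alpha>"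
 shows "\<exists>E1 c1 a1. mv E c E1 c1 \<and> clean E1 Y w \<tau> \<and> agree (nb Y w l \<tau> \<eta>) E c E1 c1 \<and>
  a1 \<in> hits E1 Y w \<tau> \<and> (\<forall>t\<in>hits E1 Y w \<tau>. a1 \<le> t) \<and> hcol E1 c1 Y w a1 v"
using assms
proof (induction "card {t\<in>hits E Y w \<tau>. t < a}" arbitrary: E c a b \<alpha> \<delta> rule: less_induct)
case less
note S = less.prems(1) and cl = less.prems(2) and p = less.prems(3) and dd = less.prems(4) and lh = less.prems(6) and cg = less.prems(8)
have fin: "finite {t\<in>hits E Y w \<tau>. t < a}" using finite_hits[OF _ cl] S by (simp add: St_def)
show ?case
proof (cases "{t\<in>hits E Y w \<tau>. t < a} = {}")
 case True
 obtain n where n: "v = \<alpha> + \<delta> * int n \<or> v = \<alpha> - \<delta> * int n" using dvd_steps[OF dd less.prems(11)] by blast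
 obtain E1 c1 a1 b1 where 1: "climbs Y w \<tau> l \<eta> E c a E1 c1 a1" "pair E1 c1 Y w \<tau> a1 b1 v \<delta>"
  using climb[OF S cl p dd l lh eta n v] by blast
 have "{t\<in>hits E1 Y w \<tau>. t < a1} = {}" using 1(1) True by (simp add: climbs_def)
 hence "\<forall>t\<in>hits E1 Y w \<tau>. a1 \<le> t" by (simp add: not_less)
 thus ?thesis using 1 unfolding climbs_def pair_def by blast
next
 case False
 define e where "e = Max {t\<in>hits E Y w \<tau>. t < a}"
 have eM: "e \<in> {t\<in>hits E Y w \<tau>. t < a}" "\<And>t. t \<in> {t\<in>hits E Y w \<tau>. t < a} ==> t \<le> e"
  unfolding e_def using Max_in[OF fin False] Max_ge[OF fin] by blast+
 have e: "e \<in> hits E Y w \<tau>" "e < a" "\<And>t. t \<in> hits E Y w \<tau> ==> t < a ==> t \<le> e" using eM by auto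
 obtain \<gamma> where \<gamma>: "hcol E c Y w e \<gamma>" using hcol_exists[OF e(1)] by blast
 have gr: "m \<le> \<gamma>" "\<gamma> \<le> M" using hcol_range[OF S cl e(1) \<gamma>] by auto
 \<comment> \<open>For \<open>\<gamma>\<close> congruent to \<open>\<alpha>\<close>, one of its two
   neighbours in the progression keeps distance \<open>d\<close> from both ends, as the span is at
   least \<open>4 * d\<close>. Otherwise the next smaller colour of the class is taken, for which
   the margin \<open>2 * d\<close> is there; minimality refutes this case afterwards.\<close>
 have "\<exists>v'. d dvd v' - \<alpha> \<and> m + d \<le> v' \<and> v' \<le> M - d \<and> \<bar>v' - \<gamma>\<bar> \<le> d \<and> v' ~= \<gamma>"
 proof (cases "d dvd \<gamma> - \<alpha>")
  case True
  show ?thesis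
  proof (cases "\<gamma> + d \<le> M - d")
   case True
   thus ?thesis using \<open>d dvd \<gamma> - \<alpha>\<close> gr d0 by (intro exI[of _ "\<gamma> + d"]) (simp add: dvd_add_left_iff[of d d, simplified] diff_add_eq[symmetric])
  next
   case False
   have "d dvd (\<gamma> - \<alpha>) - d" using \<open>d dvd \<gamma> - \<alpha>\<close> by simp
   hence "d dvd (\<gamma> - d) - \<alpha>" by (simp add: algebra_simps)
   thus ?thesis using False gr mM d0 by (intro exI[of _ "\<gamma> - d"]) auto
  qed
 next
  case False
  define r where "r = (\<gamma> - \<alpha>) mod d"
  have r: "0 < r" "r < d" using False d0 by (simp_all add: r_def dvd_eq_mod_eq_0 order_less_le[of 0])
  have "d dvd (\<gamma> - \<alpha>) - r" by (simp add: r_def)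
  hence "d dvd (\<gamma> - r) - \<alpha>" by (simp add: algebra_simps)
  moreover have "m + 2 * d \<le> \<gamma>" "\<gamma> \<le> M - 2 * d" using cg[OF e(1,2) \<gamma>] False by auto
  ultimately show ?thesis using r by (intro exI[of _ "\<gamma> - r"]) auto
 qed
 then obtain v' where v': "d dvd v' - \<alpha>" "m + d \<le> v'" "v' \<le> M - d" "\<bar>v' - \<gamma>\<bar> \<le> d" "v' ~= \<gamma>" by blast
 obtain n where n: "v' = \<alpha> + \<delta> * int n \<or> v' = \<alpha> - \<delta> * int n" using dvd_steps[OF dd v'(1)] by blast
 obtain E1 c1 a1 b1 where 1: "climbs Y w \<tau> l \<eta> E c a E1 c1 a1" "pair E1 c1 Y w \<tau> a1 b1 v' \<delta>"
  using climb[OF S cl p dd l lh eta n v'(2,3)] by blast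
 have c1: "mv E c E1 c1" "clean E1 Y w \<tau>" "agree (nb Y w l \<tau> \<eta>) E c E1 c1" "\<forall>t\<in>hits E1 Y w \<tau>. l < t"
  "{t\<in>hits E1 Y w \<tau>. t < a1} = {t\<in>hits E Y w \<tau>. t < a}"
  "\<And>t k. t\<in>hits E Y w \<tau> ==> t < a ==> hcol E c Y w t k ==> hcol E1 c1 Y w t k" using 1(1) unfolding climbs_def by blast+
 have S1: "St E1 c1" by (rule St_mv[OF S c1(1)])
 have a1: "a1 \<in> hits E1 Y w \<tau>" "hcol E1 c1 Y w a1 v'" using 1(2) by (simp_all add: pair_def)
 have e1: "e \<in> hits E1 Y w \<tau>" "e < a1" "hcol E1 c1 Y w e \<gamma>" using c1(5,6) e(1,2) \<gamma> by blast+
 have low: "t \<in> hits E Y w \<tau> \<and> t < a" if "t \<in> hits E1 Y w \<tau>" "t < a1" for t using c1(5) that by blast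
 have no: "\<not> (e < t \<and> t < a1)" if "t \<in> hits E1 Y w \<tau>" for t using low[OF that] e(3) by fastforce
 have eq: "\<bar>v' - \<gamma>\<bar> = d"
 proof -
  have btw: "\<forall>t\<in>hits E1 Y w \<tau>. \<not> (min a1 e < t \<and> t < max a1 e)" using no e1(2) by (simp add: min_def max_def)
  have ne: "a1 ~= e" using e1(2) by simp
  have R1: "reg E1" "pcol (lk E1) c1" "link_equiv L (lk E1)" using S1 by (auto simp: St_def)
  have ll: "l < a1" "l < e" using c1(4) a1 e1 by auto
  \<comment> \<open>This finger is only a test: it shows that the difference
    \<open>\<bar>\<gamma> - v'\<bar>\<close> occurs at a crossing, and is then discarded.\<close>
  obtain E2 c2 where "reg E2" "pcol (lk E2) c2" "link_equiv (lk E1) (lk E2)" "xdif (lk E2) c2 \<bar>\<gamma> - v'\<bar>"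
   by (rule ray_step[OF R1(1,2) c1(2) a1 e1(1,3) ne btw l ll eta])
  hence "d \<le> \<bar>\<gamma> - v'\<bar>" using v'(5) by (intro minD[of E2 c2]) (auto intro: link_equiv_trans[OF R1(3)])
  thus ?thesis using v'(4) by (simp add: abs_minus_commute)
 qed
 have dg: "d dvd \<gamma> - v'" using eq by (metis abs_minus_commute dvd_abs_iff dvd_refl)
 have ga: "d dvd \<gamma> - \<alpha>" using dvd_add[OF dg v'(1)] by simp
 have p1: "pair E1 c1 Y w \<tau> e a1 \<gamma> (v' - \<gamma>)" unfolding pair_def using e1 a1 no by simp
 have sub: "{t\<in>hits E1 Y w \<tau>. t < e} \<subset> {t\<in>hits E Y w \<tau>. t < a}"
 proof -
  have "e \<in> {t\<in>hits E Y w \<tau>. t < a}" "e \<notin> {t\<in>hits E1 Y w \<tau>. t < e}" using e(1,2) by simp_all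
  moreover have "{t\<in>hits E1 Y w \<tau>. t < e} \<subseteq> {t\<in>hits E Y w \<tau>. t < a}" using low e1(2) by force
  ultimately show ?thesis by blast
 qed
 have "\<exists>E2 c2 a2. mv E1 c1 E2 c2 \<and> clean E2 Y w \<tau> \<and> agree (nb Y w l \<tau> \<eta>) E1 c1 E2 c2 \<and>
   a2 \<in> hits E2 Y w \<tau> \<and> (\<forall>t\<in>hits E2 Y w \<tau>. a2 \<le> t) \<and> hcol E2 c2 Y w a2 v"
 proof (rule less.hyps[OF psubset_card_mono[OF fin sub] S1 c1(2) p1 eq l c1(4) eta _ v])
  fix t \<kappa> assume t: "t \<in> hits E1 Y w \<tau>" "t < e" "hcol E1 c1 Y w t \<kappa>"
  have t': "t \<in> hits E Y w \<tau>" "t < a" using low[of t] t(1,2) e1(2) by auto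
  obtain k where k: "hcol E c Y w t k" using hcol_exists[OF t'(1)] by blast
  have "k = \<kappa>" using hcol_unique[OF c1(2) t(1) c1(6)[OF t' k] t(3)] .
  moreover have "d dvd \<kappa> - \<gamma>" if "d dvd \<kappa> - \<alpha>" using dvd_diff[OF that ga] by simp
  ultimately show "d dvd \<kappa> - \<gamma> \<or> m + 2 * d \<le> \<kappa> \<and> \<kappa> \<le> M - 2 * d" using cg[OF t' k] by blast
 next
  show "d dvd v - \<gamma>" using dvd_diff[OF less.prems(11) ga] by simp
 qed
 thus ?thesis using good_trans[OF c1(1)] agree_trans[OF c1(3)] by blast
qed
qed

end

section \<open>A strand of prescribed colour beside a given point\<close>

lemma cr_both_zero: assumes "cr W n ~= 0" "cr v W = 0" "cr v n = 0" shows "v = 0"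
proof -
have "n ~= 0" using assms(1) by auto
then obtain s where s: "v = s *. n" using assms(3) cr_eq0_iff by blast
hence "s * cr n W = 0" using assms(2) by simp
hence "s = 0" using assms(1) cr_swap[of W n] by auto
thus ?thesis using s by simp
qed

lemma finite_affine_zeros: "finite {s :: real. a + s * b = 0}" if "a ~= 0 \<or> b ~= 0"
proof (cases "b = 0")
case False
have "{s. a + s * b = 0} \<subseteq> {- a / b}" using False by (auto simp: field_simps add_eq_0_iff)
thus ?thesis using finite_subset by blast
qed (use that in auto)

lemma eventually_avoid: assumes "finite (S :: real set)" shows "\<forall>\<^sub>F s in at a. s \<notin> S"
proof -
have "\<forall>\<^sub>F s in nhds a. s \<in> - (S - {a})" by (rule eventually_nhds_in_open[OF open_Compl[OF finite_imp_closed]]) (use assms in simp_all)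
thus ?thesis unfolding eventually_at_filter by eventually_elim auto
qed

text \<open>In a direction transversal to all edges only finitely many points lie on lines of edges,
  and \<open>Y\<close> is taken before the first of them. The sign of the direction decides on which
  side of the line through \<open>X\<close> along \<open>g\<close> it lies.\<close>

lemma free_near:
 assumes R: "reg E" and g: "g ~= 0" "b ~= 0"
 obtains Y where "Y ~= X" "\<And>y. y \<in> lk E ==> proj y \<in> cseg X Y ==> proj y = X"
 "\<And>e. e \<in> E ==> cr (Y - proj (fst e)) (dir e) ~= 0" "\<And>e. e \<in> E ==> cr (Y - X) (dir e) ~= 0" "0 < cr (Y - X) g * b"
proof -
define FL where "FL = (\<lambda>e. (0 :: real \<times> real, dir e)) ` E \<union> {(0, g)}"
have "\<exists>v. True \<and> (\<forall>(a, d)\<in>FL. cr (v - a) d ~= 0)"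
 by (rule avoid_lines[where ?z0.0 = 0]) (use reg_finite[OF R] dir_nz[OF R] g in \<open>auto simp: FL_def\<close>)
then obtain v0 where "\<forall>(a, d)\<in>FL. cr (v0 - a) d ~= 0" by (elim exE conjE) blast
hence v0': "cr (v0 - a) d ~= 0" if "(a, d) \<in> FL" for a d using that by blast
define v where "v = (if 0 < cr v0 g * b then v0 else - v0)"
have vE: "cr v (dir e) ~= 0" if "e \<in> E" for e using v0'[of 0 "dir e"] that by (simp add: FL_def v_def)
have "cr v0 g * b ~= 0" using v0'[of 0 g] g(2) by (simp add: FL_def)
moreover have "cr (- v0) g * b = - (cr v0 g * b)" by simp
ultimately have vg: "0 < cr v g * b" unfolding v_def by (smt (verit))
obtain e0 where "e0 \<in> E" using reg_verts(1)[OF R] by blast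
hence v0: "v ~= 0" using vE[of e0] by auto
define B where "B = (\<Union>e\<in>E. {t. cr (X - proj (fst e)) (dir e) + t * cr v (dir e) = 0})"
have B: "t \<in> B" if "e \<in> E" "cr (X + t *. v - proj (fst e)) (dir e) = 0" for t e
 using that unfolding B_def by (auto simp: algebra_simps)
have "finite B" unfolding B_def using reg_finite[OF R] finite_affine_zeros vE by blast
then obtain t0 where t0: "t0 > 0" "\<And>t. t \<in> B ==> t ~= 0 ==> t0 \<le> \<bar>t\<bar>"
 using finite_set_avoid[of B 0] by (auto simp: dist_real_def)
define Y where "Y = X + (t0 / 2) *. v"
show ?thesis
proof (rule that[of Y])
 show "Y ~= X" using v0 t0(1) by (simp add: Y_def)
 show "cr (Y - X) (dir e) ~= 0" if "e \<in> E" for e using vE[OF that] t0(1) by (simp add: Y_def)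
 show "0 < cr (Y - X) g * b" using mult_pos_pos[OF half_gt_zero[OF t0(1)] vg] by (simp add: Y_def)
 show "cr (Y - proj (fst e)) (dir e) ~= 0" if "e \<in> E" for e
  using B[OF that, of "t0 / 2"] t0(1) t0(2)[of "t0 / 2"] unfolding Y_def by auto
 show "proj y = X" if y: "y \<in> lk E" "proj y \<in> cseg X Y" for y
 proof -
  obtain s where s: "0 \<le> s" "s \<le> 1" "proj y = (1 - s) *. X + s *. Y" using y(2) unfolding closed_segment_def by blast
  have py: "proj y = X + (s * (t0 / 2)) *. v" unfolding s(3) Y_def by (simp add: algebra_simps)
  obtain e where e: "e \<in> E" "y \<in> seg e" using y(1) lkE by blast
  obtain \<sigma> where "y = at_edge e \<sigma>" using e(2) in_seg_iff by blast
  hence "proj y = proj (fst e) + \<sigma> *. dir e" by (simp add: proj_at_edge)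
  hence "cr (proj y - proj (fst e)) (dir e) = 0" by simp
  hence b: "s * (t0 / 2) \<in> B" using B[OF e(1)] py by metis
  have "s * (t0 / 2) \<le> 1 * (t0 / 2)" using s t0(1) by (intro mult_right_mono) auto
  hence "\<bar>s * (t0 / 2)\<bar> < t0" using s(1) t0(1) by simp
  hence "s * (t0 / 2) = 0" using t0(2)[OF b] by force
  thus ?thesis using py by simp
 qed
qed
qed

text \<open>The ray must avoid the finitely many directions to vertices and crossings and those of
  the edges. As \<open>W\<close> and \<open>n\<close> are independent, each of them excludes at most
  one \<open>s\<close>.\<close>

lemma clean_generic:
 assumes R: "reg E" and Y: "Y \<notin> proj ` lk E" and Wn: "cr W n ~= 0" and V: "finite V" "0 \<notin> V"
 shows "\<exists>S. finite S \<and> (\<forall>s. s \<notin> S --> clean E Y (W + s *. n) \<tau> \<and> (\<forall>v\<in>V. cr v (W + s *. n) ~= 0))"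
proof -
define B where "B = fst ` E \<union> {x \<in> lk E. \<exists>y\<in>lk E. y ~= x \<and> proj y = proj x}"
define U where "U = (\<lambda>b. proj b - Y) ` B \<union> dir ` E \<union> V"
have BD: "B \<subseteq> lk E" unfolding B_def using seg_lk ends_in_seg(1) by blast
have fU: "finite U" using finite_double[OF R] reg_finite[OF R] V(1) by (simp add: U_def B_def)
have U0: "v ~= 0" if "v \<in> U" for v using that BD Y V(2) dir_nz[OF R] unfolding U_def by auto
define S where "S = (\<Union>v\<in>U. {s. cr v W + s * cr v n = 0})"
have fS: "finite S" unfolding S_def
 by (intro finite_UN_I[OF fU] finite_affine_zeros) (use cr_both_zero[OF Wn] U0 in blast)
show ?thesis
proof (rule exI[of _ S], intro conjI fS allI impI)
 fix s assume s: "s \<notin> S"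
 let ?w = "W + s *. n"
 have nz: "cr v ?w ~= 0" if "v \<in> U" for v using s that unfolding S_def by auto
 show "\<forall>v\<in>V. cr v ?w ~= 0" using nz by (simp add: U_def)
 have "?w ~= 0"
 proof
  assume "?w = 0"
  hence "cr ?w n = 0" by simp
  thus False using Wn by simp
 qed
 thus "clean E Y ?w \<tau>" unfolding clean_def
 proof (intro conjI ballI allI impI)
  fix x t assume x: "x \<in> lk E" "proj x = Y + t *. ?w"
  have "x \<notin> B"
  proof
   assume "x \<in> B"
   hence "proj x - Y \<in> U" by (simp add: U_def)
   thus False using nz[of "proj x - Y"] x(2) by (simp add: cr_swap[of n W])
  qed
  thus "x \<notin> fst ` E" "\<And>y. y \<in> lk E ==> proj y = proj x ==> y = x" using x(1) unfolding B_def by blast+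
 next
  show "cr (dir e) ?w ~= 0" if "e \<in> E" for e using nz[of "dir e"] that by (simp add: U_def)
 qed
qed
qed

lemma near_edge:
 assumes R: "reg E" and x: "x \<in> lk E" "x \<notin> fst ` E" and e: "e \<in> E" "x \<in> seg e"
 shows "\<forall>\<^sub>F y in nhds x. y \<in> lk E --> y \<in> seg e \<and> (\<forall>f\<in>E. y \<in> seg f --> f = e)"
proof -
have "closed (\<Union>f\<in>E - {e}. seg f)" using reg_finite[OF R] by (intro closed_UN) (auto simp: seg_def)
moreover have "x \<notin> (\<Union>f\<in>E - {e}. seg f)" using nonvertex_edge[OF R x] e by blast
ultimately have "\<forall>\<^sub>F y in nhds x. y \<in> - (\<Union>f\<in>E - {e}. seg f)" by (intro eventually_nhds_in_open open_Compl) simp_all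
thus ?thesis by eventually_elim (auto simp: lk_def)
qed

lemma jump_near:
 assumes "jump (lk E) c u k a" shows "\<forall>\<^sub>F y in nhds u. y \<in> lk E --> y = u \<or> c y = a \<or> c y = 2 * k - a"
using jump_at(1)[OF assms] unfolding eventually_at_filter by eventually_elim auto

text \<open>Only \<open>u\<close> and \<open>w\<close> lie over this point of the plane, so near it
  there are only their two strands.\<close>

lemma near_crossing:
 assumes R: "reg E" and col: "pcol (lk E) c" and o: "ov (lk E) u w" and J: "jump (lk E) c u (c w) a"
 and e: "e \<in> E" "u \<in> seg e" "f \<in> E" "w \<in> seg f"
 shows "\<exists>\<epsilon>>0. \<forall>y\<in>lk E. dist (proj y) (proj u) < \<epsilon> -->
 (y \<in> seg e \<or> y \<in> seg f) \<and> (y \<in> seg e --> y = u \<or> \<bar>c y - c w\<bar> = \<bar>a - c w\<bar>) \<and> (y \<in> seg f --> c y = c w)"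
proof -
define Pr where "Pr y \<longleftrightarrow> (y \<in> seg e \<or> y \<in> seg f) \<and> (y \<in> seg e --> y = u \<or> \<bar>c y - c w\<bar> = \<bar>a - c w\<bar>) \<and> (y \<in> seg f --> c y = c w)" for y
have ow: "u \<in> lk E" "w \<in> lk E" "proj w = proj u" "u ~= w" using o by (auto simp: ov_def)
have nv: "u \<notin> fst ` E" "w \<notin> fst ` E" using gen_cross[OF R ow(1,2,4)] ow(3) by auto
have ef: "e ~= f" using seg_proj_inj[OF R e(1,2), of w] e(4) ow by metis
have "\<forall>\<^sub>F y in nhds x. y \<in> lk E --> Pr y" if x: "x \<in> lk E" "proj x \<in> {proj u}" for x
proof -
 have "x = u \<or> x = w" using gen_triple[OF R x(1) ow(1,2)] x(2) ow(3,4) by (metis singletonD)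
 thus ?thesis
 proof
  assume "x = u"
  show ?thesis unfolding \<open>x = u\<close> using near_edge[OF R ow(1) nv(1) e(1,2)] jump_near[OF J]
   by eventually_elim (use e(3) ef in \<open>auto simp: Pr_def abs_if\<close>)
 next
  assume "x = w"
  have "w \<in> vis (lk E)" using ov_not_under[OF R o] ow(2) by blast
  from color_near[OF col this] near_edge[OF R ow(2) nv(2) e(3,4)] show ?thesis unfolding \<open>x = w\<close>
   by eventually_elim (use e(1) ef in \<open>auto simp: Pr_def\<close>)
 qed
qed
from thin[OF R compact_sing this] obtain \<eta> where "\<eta> > 0" "\<And>y. y \<in> lk E ==> dist (proj y) (proj u) < \<eta> ==> Pr y" by blast
thus ?thesis unfolding Pr_def by blast
qed

context reduction
begin

text \<open>A ray aimed just beside the crossing meets its two strands one after the other. Their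
  colours are the over colour and one of the under colours, which differ by
  \<open>d\<close>.\<close>

lemma pair_ray:
 assumes R: "reg E" and col: "pcol (lk E) c" and o: "ov (lk E) u w" and J: "jump (lk E) c u (c w) a" "\<bar>a - c w\<bar> = d"
 and Y: "Y \<notin> proj ` lk E" "\<And>e. e \<in> E ==> cr (Y - proj (fst e)) (dir e) ~= 0" and V: "finite V" "0 \<notin> V"
 obtains W a' b' \<alpha> \<delta> where "clean E Y W 2" "pair E c Y W 2 a' b' \<alpha> \<delta>" "\<bar>\<delta>\<bar> = d" "d dvd \<alpha> - c w" "\<And>v. v \<in> V ==> cr v W ~= 0"
proof -
have ow: "u \<in> lk E" "w \<in> lk E" "proj w = proj u" "u ~= w" using o by (auto simp: ov_def)
have nv: "u \<notin> fst ` E" "w \<notin> fst ` E" using gen_cross[OF R ow(1,2,4)] ow(3) by auto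
obtain e f where e: "e \<in> E" "u \<in> seg e" "f \<in> E" "w \<in> seg f" using ow(1,2) lkE by metis
obtain \<sigma> where s1: "0 < \<sigma>" "\<sigma> < 1" "u = at_edge e \<sigma>" using nonvertex_param[OF R e(1,2) nv(1)] by blast
obtain \<rho> where s2: "0 < \<rho>" "\<rho> < 1" "w = at_edge f \<rho>" using nonvertex_param[OF R e(3,4) nv(2)] by blast
define G d1 d2 where "G = proj u" and "d1 = dir e" and "d2 = dir f"
have G1: "G = proj (fst e) + \<sigma> *. d1" and G2: "G = proj (fst f) + \<rho> *. d2"
 using proj_at_edge[of e \<sigma>] proj_at_edge[of f \<rho>] s1(3) s2(3) ow(3) by (simp_all add: G_def d1_def d2_def)
have d12: "cr d1 d2 ~= 0" using gen_trans[OF R ow(4) _ e(1,3,2,4)] ow(3) by (simp add: d1_def d2_def)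
define W0 where "W0 = G - Y"
have c1: "cr W0 d1 ~= 0" and c2: "cr W0 d2 ~= 0"
 using Y(2)[OF e(1)] apply (simp add: W0_def G1 d1_def)
 using Y(2)[OF e(3)] by (simp add: W0_def G2 d2_def)
\<comment> \<open>The ray hits the over edge at parameter 1, in \<open>G + s *. d2\<close>, and the
  line of the under edge at \<open>t1 s\<close>, which tends to 1 as \<open>s\<close> tends to 0.
  For small \<open>s\<close> both are below the bound 2 of the ray.\<close>
define Ws where "Ws s = W0 + s *. d2" for s
define t1 where "t1 s = cr W0 d1 / (cr W0 d1 + s * cr d2 d1)" for s
define p1 where "p1 s = Y + t1 s *. Ws s" for s
obtain \<epsilon> where ep: "\<epsilon> > 0" "\<And>y. y \<in> lk E ==> dist (proj y) G < \<epsilon> ==>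
  (y \<in> seg e \<or> y \<in> seg f) \<and> (y \<in> seg e --> y = u \<or> \<bar>c y - c w\<bar> = d) \<and> (y \<in> seg f --> c y = c w)"
 using near_crossing[OF R col o J(1) e] unfolding J(2) G_def by blast
obtain S where S: "finite S" "\<And>s. s \<notin> S ==> clean E Y (Ws s) 2 \<and> (\<forall>v\<in>V. cr v (Ws s) ~= 0)"
 using clean_generic[OF R Y(1) c2 V, of 2] unfolding Ws_def by blast
have Wl: "(Ws \<longlongrightarrow> W0) (at 0)" unfolding Ws_def by (auto intro!: tendsto_eq_intros)
have tl: "(t1 \<longlongrightarrow> 1) (at 0)" unfolding t1_def by (rule tendsto_eq_intros refl | use c1 in simp)+
have pl: "(p1 \<longlongrightarrow> G) (at 0)" unfolding p1_def by (rule tendsto_eq_intros refl tl Wl | simp add: W0_def)+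
have ql: "((\<lambda>s. G + s *. d2) \<longlongrightarrow> G) (at 0)" by (auto intro!: tendsto_eq_intros)
define \<mu> where "\<mu> = min \<epsilon> (norm d1 * min \<sigma> (1 - \<sigma>))"
have d10: "norm d1 > 0" using d12 by auto
hence mu: "\<mu> > 0" "\<mu> \<le> \<epsilon>" "\<mu> \<le> norm d1 * min \<sigma> (1 - \<sigma>)" using ep(1) s1(1,2) by (auto simp: \<mu>_def)
have "\<forall>\<^sub>F s in at 0. s \<notin> S \<and> s ~= 0 \<and> dist (t1 s) 1 < 1 \<and> dist (p1 s) G < \<mu> \<and> dist (G + s *. d2) G < \<epsilon> \<and> dist s 0 < min \<rho> (1 - \<rho>)"
 by (intro eventually_conj eventually_avoid[OF S(1)] tendstoD[OF tl zero_less_one] tendstoD[OF pl mu(1)] tendstoD[OF ql ep(1)]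
  tendstoD[OF tendsto_ident_at] eventually_neq_at_within) (use s2(1,2) in simp)
from eventually_happens'[OF at_neq_bot this] obtain s where s: "s \<notin> S" "s ~= 0" "dist (t1 s) 1 < 1" "dist (p1 s) G < \<mu>"
 "dist (G + s *. d2) G < \<epsilon>" "dist s 0 < min \<rho> (1 - \<rho>)" by blast
define W t where "W = Ws s" and "t = t1 s"
have cl: "clean E Y W 2" and cV: "\<And>v. v \<in> V ==> cr v W ~= 0" using S(2)[OF s(1)] by (auto simp: W_def)
have Wd: "W = W0 + s *. d2" by (simp add: W_def Ws_def)
have t: "0 < t" "t < 2" using s(3) by (auto simp: t_def dist_real_def)
have den: "cr W d1 = cr W0 d1 + s * cr d2 d1" by (simp add: Wd)
have "cr d1 W ~= 0" using cleanD(3)[OF cl]  t by (metis c1 cr_simps(11) cr_swap den div_by_0 less_irrefl neg_equal_0_iff_equal t1_def t_def)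
hence "cr W d1 ~= 0" using cr_swap[of W d1] by simp
hence tW: "t * cr W d1 = cr W0 d1" by (simp add: t_def t1_def den)
have t1': "t ~= 1"
proof
 assume "t = 1"
 hence "s * cr d2 d1 = 0" using tW den by simp
 thus False using s(2) d12 cr_swap[of d2 d1] by simp
qed
have "cr (Y + t *. W - G) d1 = t * cr W d1 - cr W0 d1" by (simp add: W0_def)
hence "cr (Y + t *. W - G) d1 = 0" using tW by simp
then obtain \<tau> where tau: "Y + t *. W - G = \<tau> *. d1" using cr_eq0_iff[of d1 "Y + t *. W - G"] d10 by (metis norm_zero less_irrefl)
have p1: "p1 s = Y + t *. W" by (simp add: p1_def t_def W_def)
have "\<bar>\<tau>\<bar> * norm d1 < norm d1 * min \<sigma> (1 - \<sigma>)" using s(4) mu(3) unfolding p1 dist_norm tau by simp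
hence tr: "0 \<le> \<sigma> + \<tau>" "\<sigma> + \<tau> \<le> 1" using d10 by (auto simp: mult.commute abs_if min_def split: if_splits)
define x1 x2 where "x1 = at_edge e (\<sigma> + \<tau>)" and "x2 = at_edge f (\<rho> + s)"
have x1: "x1 \<in> seg e" "x1 \<in> lk E" "proj x1 = Y + t *. W"
proof -
 show "x1 \<in> seg e" unfolding x1_def in_seg_iff using tr by blast
 thus "x1 \<in> lk E" using seg_lk e(1) by blast
 have "proj x1 = G + \<tau> *. d1" unfolding x1_def proj_at_edge G1 d1_def[symmetric] by (simp add: algebra_simps)
 thus "proj x1 = Y + t *. W" using tau by (simp add: algebra_simps)
qed
have x2: "x2 \<in> seg f" "x2 \<in> lk E" "proj x2 = Y + 1 *. W"
proof -
 have "0 \<le> \<rho> + s" "\<rho> + s \<le> 1" using s(6) by (auto simp: dist_real_def)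
 thus "x2 \<in> seg f" unfolding x2_def in_seg_iff by blast
 thus "x2 \<in> lk E" using seg_lk e(3) by blast
 show "proj x2 = Y + 1 *. W" unfolding x2_def proj_at_edge d2_def[symmetric] Wd W0_def G2 by (simp add: algebra_simps)
qed
have q2: "Y + 1 *. W = G + s *. d2" by (simp add: Wd W0_def)
have cx2: "c x2 = c w" using ep(2)[OF x2(2)] x2(1) s(5) unfolding x2(3) q2 by blast
have "x1 ~= u"
proof
 assume h: "x1 = u"
 have "w = x1" using cleanD(2)[OF cl x1(2) t x1(3), of w] ow(2,3) h by simp
 thus False using h ow(4) by simp
qed
hence cx1: "\<bar>c x1 - c w\<bar> = d" using ep(2)[OF x1(2)] x1(1) s(4) mu(2) unfolding x1(3) p1 by force
have hx: "t \<in> hits E Y W 2" "1 \<in> hits E Y W 2" "hcol E c Y W t (c x1)" "hcol E c Y W 1 (c w)"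
proof -
 show "t \<in> hits E Y W 2" unfolding hits_def using t x1 by blast
 show "1 \<in> hits E Y W 2" unfolding hits_def mem_Collect_eq using x2(2,3) by (intro conjI bexI[of _ x2]) simp_all
 show "hcol E c Y W t (c x1)" "hcol E c Y W 1 (c w)" unfolding hcol_def using x1(2,3) x2(2,3) cx2 by blast+
qed
have btw: "\<not> (min t 1 < r \<and> r < max t 1)" if r: "r \<in> hits E Y W 2" for r
proof
 assume m: "min t 1 < r \<and> r < max t 1"
 obtain y where y: "y \<in> lk E" "proj y = Y + r *. W" "0 < r" "r < 2" using r by (auto simp: hits_def)
 have "r \<in> cseg t 1" using m by (auto simp: closed_segment_eq_real_ivl)
 hence "proj y \<in> cseg (Y + t *. W) (Y + 1 *. W)" unfolding ray_segment y(2) by blast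
 moreover have "Y + t *. W \<in> ball G \<epsilon>" "Y + 1 *. W \<in> ball G \<epsilon>" using s(4,5) mu(2) unfolding p1 q2 by (auto simp: dist_commute)
 ultimately have "proj y \<in> ball G \<epsilon>" using closed_segment_subset[OF _ _ convex_ball] by blast
 hence "y \<in> seg e \<or> y \<in> seg f" using ep(2)[OF y(1)] by (simp add: dist_commute)
 thus False
 proof
  assume "y \<in> seg e"
  thus False using hits_same_edge[OF cl e(1) x1(1) _ t x1(3) y(2)] m by (auto simp: min_def max_def split: if_splits)
 next
  assume "y \<in> seg f"
  thus False using hits_same_edge[OF cl e(3) x2(1) _ _ _ x2(3) y(2)] m by (auto simp: min_def max_def split: if_splits)
 qed
qed
show ?thesis
proof (cases "t < 1")
 case True
 have "pair E c Y W 2 t 1 (c x1) (c w - c x1)" unfolding pair_def using True hx btw by (auto simp: min_def max_def)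
 moreover have "d dvd c x1 - c w" using cx1 by (metis dvd_abs_iff dvd_refl)
 ultimately show ?thesis using that[OF cl _ _ _ cV, of t 1 "c x1" "c w - c x1"] cx1 by (simp add: abs_minus_commute)
next
 case False
 hence "pair E c Y W 2 1 t (c w) (c x1 - c w)" unfolding pair_def using t1' hx btw by (auto simp: min_def max_def)
 thus ?thesis using that[OF cl _ _ _ cV, of 1 t "c w" "c x1 - c w"] cx1 by simp
qed
qed

end

lemma cr_scale_self: "x = s *. v ==> cr x v = 0" by simp

text \<open>Combines \<open>finger_exists\<close> with \<open>thin\<close>: a condition that holds
  near the segment from \<open>x0\<close> to \<open>z\<close> holds for everything under a
  sufficiently narrow finger.\<close>

lemma finger_along:
 assumes R: "reg E" and col: "pcol (lk E) c" and AB: "(A, B) \<in> E"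
 and x0: "x0 \<in> seg (A, B)" "x0 \<notin> fst ` E" "x0 \<notin> und E"
 and z: "cr (z - proj A) (dir (A, B)) ~= 0" and eta: "\<eta> > 0"
 and fin: "finite Fv" "finite Fl" "\<forall>l\<in>Fl. snd l ~= 0"
 and near: "\<forall>x\<in>lk E. proj x \<in> cseg (proj x0) z --> (\<forall>\<^sub>F y in nhds x. y \<in> lk E --> Pr y)"
 obtains \<alpha> \<beta> Z H p q r P Q where "finger E c A B \<alpha> \<beta> Z H p q r P Q" "c p = c x0"
 "\<And>x. x \<in> tri P Q Z ==> \<exists>y\<in>cseg (proj x0) z. dist x y < \<eta>"
 "\<And>y. y \<in> lk E ==> proj y \<in> tri P Q Z ==> Pr y"
 "\<And>s. 0 < s ==> s \<le> 1 ==> proj x0 + s *. (z - proj x0) \<in> itri P Q Z"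
 "\<And>s. s < 0 ==> proj x0 + s *. (z - proj x0) \<notin> tri P Q Z"
 "x0 \<in> cseg p q"
 "\<And>v. v \<in> Fv ==> v ~= 0 ==> cr v (Z - P) ~= 0 \<and> cr v (Z - Q) ~= 0"
 "\<And>a d. (a, d) \<in> Fl ==> cr (Z - a) d ~= 0"
proof -
obtain \<eta>1 where e1: "\<eta>1 > 0" "\<And>y s. y \<in> lk E ==> s \<in> cseg (proj x0) z ==> dist (proj y) s < \<eta>1 ==> Pr y"
 using thin[OF R compact_segment near[rule_format]] by blast
have e: "min \<eta> \<eta>1 > 0" using eta e1(1) by simp
obtain \<alpha> \<beta> Z H p q r P Q where f: "finger E c A B \<alpha> \<beta> Z H p q r P Q"
 and T: "\<And>x. x \<in> tri P Q Z ==> \<exists>y\<in>cseg (proj x0) z. dist x y < min \<eta> \<eta>1" and zi: "z \<in> itri P Q Z"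
 and b: "x0 \<in> cseg p q" "x0 ~= p" "x0 ~= q" "cseg p q \<subseteq> ball x0 (min \<eta> \<eta>1)"
 and "(cseg P Z \<union> cseg Q Z) \<inter> {} = {}"
 and Fv: "\<And>v. v \<in> Fv ==> v ~= 0 ==> cr v (Z - P) ~= 0 \<and> cr v (Z - Q) ~= 0"
 and Fl: "\<And>a d. (a, d) \<in> Fl ==> cr (Z - a) d ~= 0"
 by (rule finger_exists[OF R col AB x0 z e finite.emptyI fin(1,2)]) (use fin(3) in force, blast)
interpret f: finger E c A B \<alpha> \<beta> Z H p q r P Q by (rule f)
have "proj x0 + (z - proj x0) \<in> itri P Q Z" using zi by simp
from f.ray_through[OF b(1-3) this] obtain s1 where s1: "1 < s1"
 "\<And>s. 0 < s ==> s < s1 ==> proj x0 + s *. (z - proj x0) \<in> itri P Q Z"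
 "proj x0 + s1 *. (z - proj x0) \<in> f.sides" "\<And>s. s < 0 \<or> s1 < s ==> proj x0 + s *. (z - proj x0) \<notin> tri P Q Z" by blast
show ?thesis
proof (rule that[OF f])
 show "c p = c x0" using f.k_bs[OF b(1)] by (simp add: f.k_def)
 show "\<exists>y\<in>cseg (proj x0) z. dist x y < \<eta>" if "x \<in> tri P Q Z" for x using T[OF that] by auto
 show "Pr y" if y: "y \<in> lk E" "proj y \<in> tri P Q Z" for y
 proof -
  obtain s where "s \<in> cseg (proj x0) z" "dist (proj y) s < min \<eta> \<eta>1" using T[OF y(2)] by blast
  thus ?thesis using e1(2)[OF y(1), of s] by simp
 qed
 show "proj x0 + s *. (z - proj x0) \<in> itri P Q Z" if "0 < s" "s \<le> 1" for s using s1(1,2) that by simp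
 show "proj x0 + s *. (z - proj x0) \<notin> tri P Q Z" if "s < 0" for s using s1(4) that by simp
qed (fact b(1) Fv Fl)+
qed

text \<open>From a simple point \<open>x0\<close> of a strand of colour \<open>k\<close> one sees the point \<open>X\<close> of the plane.\<close>

definition reach :: "(pt \<times> pt) set => (pt => int) => real \<times> real => pt => int => bool" where
 "reach E c X x0 k \<longleftrightarrow> x0 \<in> lk E \<and> x0 \<notin> fst ` E \<and> simple E x0 \<and> c x0 = k \<and>
  (\<forall>y\<in>lk E. proj y \<in> cseg (proj x0) X --> y = x0 \<or> proj y = X) \<and>
  (\<forall>e\<in>E. x0 \<in> seg e --> cr (X - proj (fst e)) (dir e) ~= 0)"

lemma isolated_color_near:
 assumes R: "reg E" and col: "pcol (lk E) c" and x: "x \<in> lk E" "x \<notin> fst ` E" "\<And>y. y \<in> lk E ==> proj y = proj x ==> y = x"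
 shows "\<forall>\<^sub>F y in nhds x. y \<in> lk E --> (y \<notin> fst ` E \<and> simple E y) \<and> c y = c x"
proof -
have v: "x \<in> vis (lk E)" using x unfolding under_ov ov_def by fastforce
have "\<forall>\<^sub>F y in nhds x. y \<in> lk E --> y \<notin> fst ` E \<and> simple E y"
 by (rule isolated_near[OF R x(1,2)]) (rule x(3))
thus ?thesis using color_near[OF col v] by eventually_elim blast
qed

text \<open>An empty finger lets a strand see \<open>X\<close> along another segment that ends at \<open>X\<close>.\<close>

lemma hook:
 assumes R: "reg E" and col: "pcol (lk E) c" and rc: "reach E c Y x1 k" and Y: "Y \<notin> proj ` lk E"
 and XY: "\<And>y. y \<in> lk E ==> proj y \<in> cseg X Y ==> proj y = X" and tr: "cr (X - Y) (Y - proj x1) ~= 0"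
 and rg: "range_in E c m M" and xd: "xdif (lk E) c d" and kM: "k ~= M" and eta: "0 < \<eta>"
 shows "\<exists>E1 c1 x0 T \<rho>. good d m M E c E1 c1 \<and> germs E1 c1 M \<subseteq> germs E c M \<and> reach E1 c1 X x0 k \<and>
 0 < \<rho> \<and> proj x0 - X = \<rho> *. (Y - X) \<and> closed T \<and> X \<notin> T \<and> agree T E c E1 c1 \<and>
 (\<forall>x\<in>T. \<exists>s\<in>cseg (proj x1) Y. dist x s < \<eta>)"
proof -
have x1: "x1 \<in> lk E" "x1 \<notin> fst ` E" "\<And>y. y \<in> lk E ==> proj y = proj x1 ==> y = x1" "c x1 = k"
 "\<And>y. y \<in> lk E ==> proj y \<in> cseg (proj x1) Y ==> y = x1"
 "\<And>e. e \<in> E ==> x1 \<in> seg e ==> cr (Y - proj (fst e)) (dir e) ~= 0" using rc Y unfolding reach_def by blast+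
have v1: "x1 \<in> vis (lk E)" using x1(1,3) unfolding under_ov ov_def by fastforce
obtain A B where AB: "(A, B) \<in> E" "x1 \<in> seg (A, B)" using x1(1) lkE by (metis surj_pair)
have XS: "X \<notin> cseg (proj x1) Y"
proof
 assume "X \<in> cseg (proj x1) Y"
 then obtain s where "X = (1 - s) *. proj x1 + s *. Y" unfolding closed_segment_def by blast
 hence "X - Y = (s - 1) *. (Y - proj x1)" by (simp add: algebra_simps)
 thus False using tr cr_scale_self by blast
qed
obtain \<epsilon>0 where e0: "\<epsilon>0 > 0" "\<And>s. s \<in> cseg (proj x1) Y ==> \<epsilon>0 \<le> dist X s"
 using separate_point_closed[OF closed_segment XS] by blast
define Pr where "Pr y \<longleftrightarrow> (y \<notin> fst ` E \<and> simple E y) \<and> c y = k" for y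
have "\<forall>\<^sub>F y in nhds x1. y \<in> lk E --> Pr y"
 using isolated_color_near[OF R col x1(1,2)] x1(3) unfolding Pr_def x1(4) by blast
hence near: "\<forall>x\<in>lk E. proj x \<in> cseg (proj x1) Y --> (\<forall>\<^sub>F y in nhds x. y \<in> lk E --> Pr y)" using x1(5) by blast
have v1': "x1 \<notin> und E" using v1 by blast
have XYn: "X - Y ~= 0" using tr by auto
have em: "0 < min \<epsilon>0 \<eta>" using e0(1) eta by simp
have fv: "finite {X - Y}" "finite {(X, X - Y)}" and nz: "\<forall>l\<in>{(X, X - Y)}. snd l ~= 0" using XYn by simp_all
obtain \<alpha> \<beta> Z H p q r P Q where f: "finger E c A B \<alpha> \<beta> Z H p q r P Q" "c p = c x1"
 and T: "\<And>x. x \<in> tri P Q Z ==> \<exists>y\<in>cseg (proj x1) Y. dist x y < min \<epsilon>0 \<eta>"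
 and Pr: "\<And>y. y \<in> lk E ==> proj y \<in> tri P Q Z ==> Pr y"
 and In: "\<And>s. 0 < s ==> s \<le> 1 ==> proj x1 + s *. (Y - proj x1) \<in> itri P Q Z"
 and "\<And>s. s < 0 ==> proj x1 + s *. (Y - proj x1) \<notin> tri P Q Z"
 and b: "x1 \<in> cseg p q"
 and Fv: "\<And>v. v \<in> {X - Y} ==> v ~= 0 ==> cr v (Z - P) ~= 0 \<and> cr v (Z - Q) ~= 0"
 and Fl: "\<And>a d. (a, d) \<in> {(X, X - Y)} ==> cr (Z - a) d ~= 0"
 by (rule finger_along[OF R col AB x1(2) v1' x1(6)[OF AB, unfolded fst_conv] em fv nz near]) blast
interpret f: finger E c A B \<alpha> \<beta> Z H p q r P Q by (rule f)
have k: "f.k = k" using f(2) x1(4) by (simp add: f.k_def)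
have XT: "X \<notin> tri P Q Z"
proof
 assume "X \<in> tri P Q Z"
 then obtain s where "s \<in> cseg (proj x1) Y" "dist X s < min \<epsilon>0 \<eta>" using T by blast
 thus False using e0(2)[of s] by simp
qed
have YT: "Y \<in> itri P Q Z" using In[of 1] by simp
\<comment> \<open>The finger covers \<open>Y\<close> but not \<open>X\<close>. The segment from
  \<open>Y\<close> to \<open>X\<close> leaves it at parameter \<open>t0\<close> through a side, and
  the point of the new strand above that place is the required \<open>x0\<close>.\<close>
define g where "g t = Y + t *. (X - Y)" for t
have gc: "continuous_on {0..1} g" unfolding g_def by (intro continuous_intros)
have g01: "g 0 \<in> itri P Q Z" "g 1 \<notin> itri P Q Z" using YT XT subsetD[OF itri_subset, of X P Q Z] by (auto simp: g_def)
obtain t0 where t0: "0 < t0" "t0 \<le> 1" "g t0 \<notin> itri P Q Z" "g t0 \<in> closure (itri P Q Z)"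
 using first_exit[OF gc open_itri g01] by blast
have gT: "g t0 \<in> tri P Q Z" using t0(4) f.closure_itri by blast
hence t01: "t0 < 1" using XT t0(2) by (cases "t0 = 1") (auto simp: g_def)
have gseg: "g t \<in> cseg X Y" if "0 \<le> t" "t \<le> 1" for t
 unfolding closed_segment_def by (simp, rule exI[of _ "1 - t"]) (use that in \<open>simp add: g_def algebra_simps\<close>)
have free: "g t ~= proj y" if "y \<in> lk E" "0 \<le> t" "t < 1" for y t
proof
 assume h: "g t = proj y"
 have "proj y = X" by (rule XY[OF that(1)]) (use gseg[of t] that h in simp)
 moreover have "(1 - t) *. (X - Y) = X - g t" by (simp add: g_def algebra_simps)
 ultimately have "(1 - t) *. (X - Y) = 0" using h by simp
 thus False using XYn that(3) by simp
qed
have "g t0 \<notin> cseg P Q" using f.bs_over f.bs_sub free t0(1) t01 by (metis less_imp_le subsetD)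
hence gs: "g t0 \<in> f.sides" using f.tri_cases gT t0(3) by blast
have pos: "0 < b (g t0)" if b: "\<And>t. b (g t) = b (g 0) + t * l" "0 < b (g 0)" "0 \<le> b (g t)" "t0 < t" for b :: "real \<times> real => real" and l t
proof (cases "0 \<le> l")
 case True thus ?thesis using b(1)[of t0] b(2) t0(1) by (simp add: add_pos_nonneg)
next
 case False
 hence "t * l < t0 * l" using b(4) by simp
 thus ?thesis using b(1)[of t] b(1)[of t0] b(3) by simp
qed
have after: "g t \<notin> tri P Q Z" if "t0 < t" for t
proof
 assume h: "g t \<in> tri P Q Z"
 have 1: "bary P' Q' R' (g t) = bary P' Q' R' (g 0) + t * (cr (X - Y) (Q' - R') / cr (Q' - P') (R' - P'))" for P' Q' R' t
  unfolding g_def by (simp only: bary_move scaleR_zero_left add_0_right)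
 have "g t0 \<in> itri P Q Z" using g01(1) h pos[OF 1 _ _ that] unfolding itri_def tri_def by blast
 thus False using t0(3) by blast
qed
obtain x0 where x0: "x0 \<in> f.F" "proj x0 = g t0" using f.side_F[OF gs] by blast
have x0D: "x0 \<notin> lk E" using free[of x0 t0] x0(2) t0(1) t01 by auto
have Xx0: "X - proj x0 = (1 - t0) *. (X - Y)" by (simp add: x0(2) g_def algebra_simps)
have x0r: "x0 ~= r"
proof
 assume "x0 = r"
 hence "Z - X = - (X - proj x0)" using f.proj_r by simp
 hence "Z - X = (t0 - 1) *. (X - Y)" unfolding Xx0 by (simp add: algebra_simps)
 hence "cr (Z - X) (X - Y) = 0" by (rule cr_scale_self)
 thus False using Fl by blast
qed
have reach: "reach f.E' f.c' X x0 k"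
 unfolding reach_def
proof (intro conjI ballI impI)
 show "x0 \<in> lk f.E'" using f.D'_iff x0(1) by blast
 have "x0 \<notin> fst ` E" using x0D seg_lk ends_in_seg(1) by (metis imageE)
 moreover have "x0 ~= p" "x0 ~= q" using x0D f.p_edge by blast+
 ultimately show "x0 \<notin> fst ` f.E'" using f.V' x0r by blast
 show "f.c' x0 = k" using f.c'_F[OF x0(1)] k by simp
 fix y assume y: "y \<in> lk f.E'"
 show "y = x0" if h: "proj y = proj x0"
 proof (cases "y \<in> f.F")
  case True thus ?thesis using f.F_inj x0(1) h by blast
 next
  case False
  hence "y \<in> lk E" using y f.D'_cases by blast
  thus ?thesis using free[of y t0] h x0(2) t0(1) t01 by simp
 qed
 show "y = x0 \<or> proj y = X" if h: "proj y \<in> cseg (proj x0) X"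
 proof -
  obtain s where s: "0 \<le> s" "s \<le> 1" "proj y = (1 - s) *. proj x0 + s *. X" using h unfolding closed_segment_def by blast
  have gy: "proj y = g (t0 + s * (1 - t0))" unfolding s(3) x0(2) g_def by (simp add: algebra_simps)
  have st: "0 \<le> s * (1 - t0)" "s * (1 - t0) \<le> 1 * (1 - t0)" using s t01 by (intro mult_nonneg_nonneg mult_right_mono; simp)+
  show ?thesis
  proof (cases "y \<in> f.F")
   case True
   hence "g (t0 + s * (1 - t0)) \<in> tri P Q Z" using f.F_plane(2) gy by metis
   hence "s * (1 - t0) = 0" using after[of "t0 + s * (1 - t0)"] st by force
   hence "proj y = proj x0" unfolding gy x0(2) by (simp only: add_0_right)
   thus ?thesis using f.F_inj x0(1) True by blast
  next
   case False
   hence "y \<in> lk E" using y f.D'_cases by blast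
   hence "\<not> t0 + s * (1 - t0) < 1" using free[of y "t0 + s * (1 - t0)"] gy st t0(1) by force
   hence "t0 + s * (1 - t0) = 1" using st by simp
   thus ?thesis using gy by (simp add: g_def)
  qed
 qed
next
 fix e assume e: "e \<in> f.E'" "x0 \<in> seg e"
 have "cr (X - Y) (Z - P) ~= 0" "cr (X - Y) (Z - Q) ~= 0" using Fv XYn by auto
 hence c: "cr (X - proj x0) (Z - P) ~= 0" "cr (X - proj x0) (Z - Q) ~= 0"
  unfolding Xx0 using t01 by (simp_all only: cr_simps mult_eq_0_iff) simp_all
 obtain s where "x0 = at_edge e s" using e(2) in_seg_iff by blast
 hence "X - proj (fst e) = (X - proj x0) + s *. dir e" by (simp add: proj_at_edge)
 hence eq: "cr (X - proj (fst e)) (dir e) = cr (X - proj x0) (dir e)" by (simp only: cr_simps mult_zero_right add_0_right)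
 from e(1) have "dir e = Z - P \<or> dir e = - (Z - Q)"
 proof (cases rule: f.edges_E')
  case 1 thus ?thesis using x0D seg_lk e(2) by blast
 next
  case 2 thus ?thesis using x0D f.seg_subs e(2) by blast
 next
  case 3 thus ?thesis using x0D f.seg_subs e(2) by blast
 next
  case 4 thus ?thesis by (simp add: dir_def f.proj_r f.P_def)
 next
  case 5 thus ?thesis by (simp add: dir_def f.proj_r f.Q_def)
 qed
 thus "cr (X - proj (fst e)) (dir e) ~= 0" unfolding eq using c by (elim disjE) (simp_all only: cr_simps(8) neg_equal_0_iff_equal not_False_eq_True)
qed
have c1: "c y = k" if "y \<in> lk E" "proj y \<in> tri P Q Z" for y using Pr[OF that] by (simp add: Pr_def)
have "k \<le> M" "m \<le> k" using rg v1 x1(4) unfolding range_in_def by auto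
hence rng: "m \<le> 2 * f.k - c y \<and> 2 * f.k - c y \<le> M" if "y \<in> vis (lk E)" "proj y \<in> tri P Q Z" for y
 using c1[of y] that k by auto
have ins: "(\<forall>y\<in>vis (lk E). proj y \<in> itri P Q Z --> 2 * f.k - c y ~= M) \<or>
   (\<forall>y\<in>lk E. proj y \<in> itri P Q Z --> y \<notin> fst ` E \<and> simple E y)"
 using Pr itri_subset unfolding Pr_def by blast
have sd: "\<forall>y\<in>vis (lk E). proj y \<in> f.sides --> c y ~= M \<and> 2 * f.k - c y ~= M"
proof (intro ballI impI)
 fix y assume "y \<in> vis (lk E)" "proj y \<in> f.sides"
 hence "c y = k" using c1 f.side_iff by blast
 thus "c y ~= M \<and> 2 * f.k - c y ~= M" using kM k by simp
qed
have xb: "\<bar>a - f.k\<bar> ~= d" if "ov (lk E) u w" "w \<in> f.bs" for u w a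
proof -
 have "w \<in> lk E" "proj w \<in> tri P Q Z" using that(2) f.bs_sub f.bs_proj f.side_iff(3) by blast+
 hence "u = w" using Pr[of w] that(1) unfolding Pr_def ov_def by metis
 thus ?thesis using that(1) by (simp add: ov_def)
qed
have kM': "f.k ~= M" using kM k by simp
have G1: "good d m M E c f.E' f.c'" by (rule f.good_E'(1)[OF rg xd _ kM' ins disjI2[OF sd]]) (use rng xb in blast)+
have "germs f.E' f.c' M \<subseteq> {x \<in> germs E c M. proj x \<notin> tri P Q Z}"
 by (rule f.good_E'(4)[OF rg xd _ kM' ins disjI2[OF sd] _ sd]) (use rng xb in blast)+
hence G4: "germs f.E' f.c' M \<subseteq> germs E c M" by blast
have "proj x0 - X = (1 - t0) *. (Y - X)" by (simp add: x0(2) g_def algebra_simps)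
moreover have "0 < 1 - t0" using t01 by simp
moreover have "\<exists>s\<in>cseg (proj x1) Y. dist x s < \<eta>" if "x \<in> tri P Q Z" for x using T[OF that] by auto
ultimately show ?thesis
 by (intro exI[of _ f.E'] exI[of _ f.c'] exI[of _ x0] exI[of _ "tri P Q Z"] exI[of _ "1 - t0"] conjI ballI G1 G4 reach f.agree_E' closed_tri XT)
qed

context reduction
begin

text \<open>\<open>X\<close> may be a point of the diagram, whose surroundings must stay as they
  are; so the transport ends at an auxiliary point \<open>Y\<close> near \<open>X\<close>, and
  \<open>hook\<close> turns the strand towards \<open>X\<close>. Through \<open>g\<close> and
  \<open>b\<close> the caller prescribes a side of a line through \<open>X\<close>.\<close>

lemma supply_strand:
 assumes S: "St E c" and o: "ov (lk E) u w" and J: "jump (lk E) c u (c w) a" "\<bar>a - c w\<bar> = d"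
 and cg: "\<And>x. x \<in> vis (lk E) ==> d dvd c x - c w \<or> m + 2 * d \<le> c x \<and> c x \<le> M - 2 * d"
 and v: "m + d \<le> v" "v \<le> M - d" "d dvd v - c w" and g: "g ~= 0" "b ~= 0"
 shows "\<exists>E1 c1 x0 \<epsilon>. mv E c E1 c1 \<and> reach E1 c1 X x0 v \<and> 0 < \<epsilon> \<and> agree (- ball X \<epsilon>) E c E1 c1 \<and>
 (\<forall>e\<in>E. cr (proj x0 - X) (dir e) ~= 0) \<and> 0 < cr (proj x0 - X) g * b"
proof -
have R: "reg E" and col: "pcol (lk E) c" using S by (auto simp: St_def)
obtain Y where Y: "Y ~= X" "\<And>y. y \<in> lk E ==> proj y \<in> cseg X Y ==> proj y = X"
 "\<And>e. e \<in> E ==> cr (Y - proj (fst e)) (dir e) ~= 0" "\<And>e. e \<in> E ==> cr (Y - X) (dir e) ~= 0" "0 < cr (Y - X) g * b"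
 by (rule free_near[OF R g]) blast
have YD: "Y \<notin> proj ` lk E" using Y(1,2) by force
have V: "finite {X - Y}" "0 \<notin> {X - Y}" using Y(1) by auto
obtain W a' b' \<alpha> \<delta> where W: "clean E Y W 2" "pair E c Y W 2 a' b' \<alpha> \<delta>" "\<bar>\<delta>\<bar> = d" "d dvd \<alpha> - c w" "\<And>v. v \<in> {X - Y} ==> cr v W ~= 0"
 by (rule pair_ray[OF R col o J YD _ V]) (rule Y(3), assumption, blast)
have XW: "cr (X - Y) W ~= 0" using W(5) by blast
have fh: "finite (hits E Y W 2)" by (rule finite_hits[OF R W(1)])
obtain l0 where l0: "l0 > 0" "\<And>t. t \<in> hits E Y W 2 ==> l0 \<le> t"
 using finite_set_avoid[OF fh, of 0] by (force simp: dist_real_def hits_def)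
define l where "l = l0 / 2"
have l: "0 < l" "\<forall>t\<in>hits E Y W 2. l < t" using l0 unfolding l_def by force+
\<comment> \<open>The part of the ray along which fingers are pushed. It misses the segment from
  \<open>X\<close> to \<open>Y\<close>, since \<open>W\<close> is not parallel to that
  segment.\<close>
define N where "N = (\<lambda>t. Y + t *. W) ` {l..2}"
have "compact N" unfolding N_def by (intro compact_continuous_image continuous_intros) simp
moreover have "N \<inter> cseg X Y = {}"
proof -
 have False if t: "l \<le> t" "Y + t *. W \<in> cseg X Y" for t
 proof -
  obtain s where "Y + t *. W = (1 - s) *. X + s *. Y" using t(2) unfolding closed_segment_def by blast
  hence "t *. W = (1 - s) *. (X - Y)" by (simp add: algebra_simps)
  hence "cr (X - Y) (t *. W) = 0" by (simp only: cr_simps mult_zero_right)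
  thus False using XW t(1) l(1) by simp
 qed
 thus ?thesis unfolding N_def by auto
qed
ultimately have "\<exists>\<delta>'>0. \<forall>x\<in>N. \<forall>y\<in>cseg X Y. \<delta>' \<le> dist x y"
 by (rule separate_compact_closed[OF _ closed_segment])
then obtain \<delta>' where d': "\<delta>' > 0" "\<And>x y. x \<in> N ==> y \<in> cseg X Y ==> \<delta>' \<le> dist x y"
 by blast
define \<eta> where "\<eta> = \<delta>' / 2"
have eta: "\<eta> > 0" using d'(1) by (simp add: \<eta>_def)
have nbK: "x \<notin> nb Y W l 2 \<eta>" if "y \<in> cseg X Y" "dist x y < \<eta>" for x y
proof
 assume "x \<in> nb Y W l 2 \<eta>"
 then obtain t where t: "l \<le> t" "t \<le> 2" "dist x (Y + t *. W) < \<eta>" unfolding nb_def by blast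
 have "\<delta>' \<le> dist (Y + t *. W) y" by (rule d'(2)[OF _ that(1)]) (unfold N_def, rule imageI, use t in simp)
 thus False using t(3) that(2) dist_triangle3[of "Y + t *. W" y x] unfolding \<eta>_def by linarith
qed
have hc: "d dvd \<gamma> - \<alpha> \<or> m + 2 * d \<le> \<gamma> \<and> \<gamma> \<le> M - 2 * d" if t: "t \<in> hits E Y W 2" "hcol E c Y W t \<gamma>" for t \<gamma>
proof -
 obtain x where x: "x \<in> lk E" "proj x = Y + t *. W" "c x = \<gamma>" using t(2) by (auto simp: hcol_def)
 have "0 < t" "t < 2" using t(1) by (auto simp: hits_def)
 hence "x \<in> vis (lk E)" using cleanD(4)[OF W(1) x(1) _ _ x(2)] x(1) by blast
 thus ?thesis using cg[of x] x(3) dvd_diff[OF _ W(4), of "\<gamma> - c w"] by auto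
qed
have va: "d dvd v - \<alpha>" using dvd_diff[OF v(3) W(4)] by simp
have ft: "\<exists>E1 c1 a1. mv E c E1 c1 \<and> clean E1 Y W 2 \<and> agree (nb Y W l 2 \<eta>) E c E1 c1 \<and>
  a1 \<in> hits E1 Y W 2 \<and> (\<forall>t\<in>hits E1 Y W 2. a1 \<le> t) \<and> hcol E1 c1 Y W a1 v"
 by (rule fetch[OF S W(1-3) l eta _ v(1,2) va]) (rule hc)
obtain E1 c1 a1 where 1: "mv E c E1 c1" "clean E1 Y W 2" "agree (nb Y W l 2 \<eta>) E c E1 c1"
  "a1 \<in> hits E1 Y W 2" "\<And>t. t \<in> hits E1 Y W 2 ==> a1 \<le> t" "hcol E1 c1 Y W a1 v"
 using ft by blast
have S1: "reg E1" "pcol (lk E1) c1" "range_in E1 c1 m M" "xdif (lk E1) c1 d" using 1(1) by (auto simp: good_def)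
obtain x1 where x1: "x1 \<in> lk E1" "proj x1 = Y + a1 *. W" "c1 x1 = v" using 1(6) by (auto simp: hcol_def)
have a1: "0 < a1" "a1 < 2" using 1(4) by (auto simp: hits_def)
note cd = cleanD[OF 1(2) x1(1) a1 x1(2)]
have old: "y \<in> lk E" if "y \<in> lk E1" "proj y \<in> cseg X Y" for y
proof -
 have "proj y \<notin> nb Y W l 2 \<eta>" using nbK[OF that(2), of "proj y"] eta by simp
 thus ?thesis using 1(3) that(1) unfolding agree_def by blast
qed
have rc: "reach E1 c1 Y x1 v"
 unfolding reach_def
proof (intro conjI ballI impI x1(1,3) cd(1))
 show "y = x1" if "y \<in> lk E1" "proj y = proj x1" for y using cd(2) that by blast
 show "y = x1 \<or> proj y = Y" if y: "y \<in> lk E1" "proj y \<in> cseg (proj x1) Y" for y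
 proof -
  obtain s where s: "0 \<le> s" "s \<le> 1" "proj y = (1 - s) *. proj x1 + s *. Y" using y(2) unfolding closed_segment_def by blast
  have py: "proj y = Y + ((1 - s) * a1) *. W" unfolding s(3) x1(2) by (simp add: algebra_simps)
  have r: "0 \<le> (1 - s) * a1" "(1 - s) * a1 \<le> 1 * a1" using s a1 by (intro mult_nonneg_nonneg mult_right_mono; simp)+
  show ?thesis
  proof (cases "(1 - s) * a1 = 0")
   case True thus ?thesis using py by simp
  next
   case False
   hence "(1 - s) * a1 \<in> hits E1 Y W 2" unfolding hits_def mem_Collect_eq using False py y(1) r a1 by (intro conjI bexI[of _ y]) linarith+
   hence "(1 - s) * a1 = a1" using 1(5) r by force
   hence "proj y = proj x1" using py x1(2) by simp
   thus ?thesis using cd(2) y(1) by blast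
  qed
 qed
 show "cr (Y - proj (fst e)) (dir e) ~= 0" if e: "e \<in> E1" "x1 \<in> seg e" for e
 proof -
  obtain s where "x1 = at_edge e s" using e(2) in_seg_iff by blast
  hence "proj x1 = proj (fst e) + s *. dir e" by (simp add: proj_at_edge)
  hence "Y - proj (fst e) = s *. dir e - a1 *. W" using x1(2) by (simp add: algebra_simps)
  hence "cr (Y - proj (fst e)) (dir e) = - (a1 * cr W (dir e))" by simp
  thus ?thesis using cd(3)[OF e] a1 cr_swap[of W "dir e"] by simp
 qed
qed
have Y1: "Y \<notin> proj ` lk E1"
proof
 assume "Y \<in> proj ` lk E1"
 then obtain y where "y \<in> lk E1" "proj y = Y" by blast
 thus False using old[of y] YD by auto
qed
have XY1: "\<And>y. y \<in> lk E1 ==> proj y \<in> cseg X Y ==> proj y = X" using old Y(2) by blast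
have "Y - proj x1 = - (a1 *. W)" by (simp add: x1(2))
hence tr: "cr (X - Y) (Y - proj x1) ~= 0" using XW a1(1) by (simp only: cr_simps) simp
have vM: "v ~= M" using v(2) d0 by simp
obtain E2 c2 x0 T \<rho> where 2: "mv E1 c1 E2 c2" "reach E2 c2 X x0 v" "0 < \<rho>" "proj x0 - X = \<rho> *. (Y - X)"
 "closed T" "X \<notin> T" "agree T E1 c1 E2 c2"
 using hook[OF S1(1,2) rc Y1 XY1 tr S1(3,4) vM zero_less_one] by blast
obtain \<epsilon> where ep: "0 < \<epsilon>" "\<And>x. x \<in> T ==> \<epsilon> \<le> dist X x" using separate_point_closed[OF 2(5,6)] by blast
have "agree (- ball X (min \<epsilon> \<eta>)) E c E1 c1"
 by (rule agree_mono[OF 1(3)]) (use nbK[of X] in \<open>auto simp: dist_commute\<close>)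
moreover have "agree (- ball X (min \<epsilon> \<eta>)) E1 c1 E2 c2" by (rule agree_mono[OF 2(7)]) (use ep(2) in force)
ultimately have "agree (- ball X (min \<epsilon> \<eta>)) E c E2 c2" by (rule agree_trans)
moreover have "\<forall>e\<in>E. cr (proj x0 - X) (dir e) ~= 0" unfolding 2(4) using Y(4) 2(3) by (simp only: cr_simps(3)) simp
moreover have "0 < cr (proj x0 - X) g * b" unfolding 2(4) using Y(5) 2(3) by (simp only: cr_simps(3) mult.assoc mult_pos_pos)
moreover have "mv E c E2 c2" by (rule good_trans[OF 1(1) 2(1)])
moreover have "0 < min \<epsilon> \<eta>" using ep(1) eta by simp
ultimately show ?thesis using 2(2) by blast
qed

end

section \<open>Pushing a strand over a point or along another strand\<close>

lemma line_dir:
 assumes R: "reg E" and e: "e \<in> E" "x \<in> seg e" "x \<notin> fst ` E" and v: "at x within lk E = along x v" "v ~= 0"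
 shows "\<exists>s. s ~= 0 \<and> proj v = s *. dir e"
proof -
note aw = at_within_edge[OF R e]
have "\<forall>\<^sub>F y in at x within lk E. \<exists>t. y = x + t *. (snd e - fst e)"
 unfolding aw eventually_filtermap by (rule always_eventually) blast
from filtermap_line_within[OF aw v(1) this] obtain s where s: "v = s *. (snd e - fst e)" by blast
have "proj v = s *. dir e" using s by (simp add: dir_def)
moreover have "s ~= 0" using s v(2) by auto
ultimately show ?thesis by blast
qed

lemma line_near:
 assumes "at u within lk E = along u v" "\<delta> > 0"
 shows "\<forall>\<^sub>F y in nhds u. y \<in> lk E --> (\<exists>t. \<bar>t\<bar> < \<delta> \<and> y = u + t *. v)"
proof -
have "\<forall>\<^sub>F t in at (0 :: real). \<bar>t\<bar> < \<delta>" using assms(2) by (auto simp: eventually_at dist_real_def)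
hence "\<forall>\<^sub>F y in at u within lk E. \<exists>t. \<bar>t\<bar> < \<delta> \<and> y = u + t *. v"
 unfolding assms(1) eventually_filtermap by eventually_elim blast
thus ?thesis unfolding eventually_at_filter
proof eventually_elim
 case (elim y)
 have "y = u ==> \<bar>0\<bar> < \<delta> \<and> y = u + 0 *. v" using assms(2) by simp
 thus ?case using elim by blast
qed
qed

lemma strand_param:
 assumes R: "reg E" and v: "at u within lk E = along u v"
 obtains \<delta> where "\<delta> > 0" "\<And>t. t ~= 0 ==> \<bar>t\<bar> < \<delta> ==> u + t *. v \<in> lk E \<and> u + t *. v \<notin> fst ` E \<and>
  simple E (u + t *. v)"
proof -
define B where "B = fst ` E \<union> {x \<in> lk E. \<exists>y\<in>lk E. y ~= x \<and> proj y = proj x}"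
have "finite B" using finite_double[OF R] reg_finite[OF R] by (simp add: B_def)
hence "\<forall>\<^sub>F y in nhds u. y \<in> - (B - {u})" by (intro eventually_nhds_in_open open_Compl finite_imp_closed) auto
hence "\<forall>\<^sub>F y in at u within lk E. y \<in> lk E \<and> y \<notin> B" unfolding eventually_at_filter by eventually_elim auto
hence "\<forall>\<^sub>F t in at (0 :: real). u + t *. v \<in> lk E \<and> u + t *. v \<notin> B" unfolding v eventually_filtermap .
then obtain \<delta> where d: "\<delta> > 0" "\<And>t. t ~= 0 ==> \<bar>t\<bar> < \<delta> ==> u + t *. v \<in> lk E \<and> u + t *. v \<notin> B"
 unfolding eventually_at dist_real_def by auto
show ?thesis using that[OF d(1)] d(2) unfolding B_def by blast
qed

lemma simple_vis: "x \<in> lk E ==> simple E x ==> x \<in> vis (lk E)"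
unfolding under_ov ov_def by fastforce

text \<open>The point \<open>x0\<close>, which sees the crossing \<open>u\<close>, also sees the points on the part of the under
strand on its own side of the over strand.\<close>

lemma reach_shift:
 assumes R: "reg E" and rc: "reach E c (proj u) x0 k" and o: "ov (lk E) u w"
 and v: "at u within lk E = along u v"
 and g: "\<forall>\<^sub>F y in nhds w. y \<in> lk E --> (\<exists>s. proj y = proj u + s *. g)"
 and cv: "cr (proj x0 - proj u) (proj v) ~= 0" and cg: "0 < cr (proj x0 - proj u) g * cr (proj v) g"
 shows "\<forall>\<^sub>F t in at_right 0. reach E c (proj (u + t *. v)) x0 k"
proof -
define X pv where "X = proj u" and "pv = proj v"
have x0: "x0 \<in> lk E" "x0 \<notin> fst ` E" "\<And>y. y \<in> lk E ==> proj y = proj x0 ==> y = x0" "c x0 = k"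
 "\<And>y. y \<in> lk E ==> proj y \<in> cseg (proj x0) X ==> y = x0 \<or> proj y = X"
 "\<And>e. e \<in> E ==> x0 \<in> seg e ==> cr (X - proj (fst e)) (dir e) ~= 0" using rc unfolding reach_def X_def by blast+
have ow: "u \<in> lk E" "w \<in> lk E" "proj w = proj u" "u ~= w" using o by (auto simp: ov_def)
obtain e where e: "e \<in> E" "x0 \<in> seg e" using x0(1) lkE by blast
have eu: "e' = e" if "e' \<in> E" "x0 \<in> seg e'" for e' using nonvertex_edge[OF R x0(1,2)] e that by blast
define Pr where "Pr y \<longleftrightarrow> y \<in> seg e \<or> (\<exists>s. y = u + s *. v) \<or> (\<exists>s. proj y = X + s *. g)" for y
have near: "\<forall>\<^sub>F y in nhds x. y \<in> lk E --> Pr y" if x: "x \<in> lk E" "proj x \<in> cseg (proj x0) X" for x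
proof -
 consider "x = x0" | "x = u" | "x = w" using x0(5)[OF x] gen_triple[OF R x(1) ow(1,2)] ow(3,4) unfolding X_def by metis
 thus ?thesis
 proof cases
  case 1 show ?thesis unfolding 1 using near_edge[OF R x0(1,2) e] by eventually_elim (auto simp: Pr_def)
 next
  case 2 show ?thesis unfolding 2 using line_near[OF v zero_less_one] by eventually_elim (auto simp: Pr_def)
 next
  case 3 show ?thesis unfolding 3 using g by eventually_elim (auto simp: Pr_def X_def)
 qed
qed
obtain \<eta> where eta: "\<eta> > 0" "\<And>y s. y \<in> lk E ==> s \<in> cseg (proj x0) X ==> dist (proj y) s < \<eta> ==> Pr y"
 using thin[OF R compact_segment near] by blast
have "((\<lambda>t. cr (X + t *. pv - proj (fst e)) (dir e)) \<longlongrightarrow> cr (X + 0 *. pv - proj (fst e)) (dir e)) (at_right 0)"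
 unfolding cr_def by (intro tendsto_intros)
hence l: "((\<lambda>t. cr (X + t *. pv - proj (fst e)) (dir e)) \<longlongrightarrow> cr (X - proj (fst e)) (dir e)) (at_right 0)" by simp
have ev1: "\<forall>\<^sub>F t in at_right 0. cr (X + t *. pv - proj (fst e)) (dir e) ~= 0"
 by (rule tendsto_imp_eventually_ne[OF l x0(6)[OF e]])
have "((\<lambda>t. t * norm pv) \<longlongrightarrow> 0 * norm pv) (at_right 0)" by (intro tendsto_intros)
hence ev2: "\<forall>\<^sub>F t in at_right 0. t * norm pv < \<eta>" using eta(1) by (auto dest: order_tendstoD(2))
show ?thesis using ev1 ev2 eventually_at_right_less[of "0::real"]
proof eventually_elim
 case (elim t)
 define Xt where "Xt = X + t *. pv"
 have "proj (u + t *. v) = Xt" by (simp add: Xt_def X_def pv_def)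
 show ?case unfolding \<open>proj (u + t *. v) = Xt\<close> reach_def
 proof (intro conjI ballI impI x0(1,2,4))
  show "y = x0" if "y \<in> lk E" "proj y = proj x0" for y using x0(3) that by blast
  show "cr (Xt - proj (fst e')) (dir e') ~= 0" if "e' \<in> E" "x0 \<in> seg e'" for e'
   using elim(1) eu[OF that] by (simp add: Xt_def)
  show "y = x0 \<or> proj y = Xt" if y: "y \<in> lk E" "proj y \<in> cseg (proj x0) Xt" for y
  proof -
   obtain r where r: "0 \<le> r" "r \<le> 1" "proj y = (1 - r) *. proj x0 + r *. Xt" using y(2) unfolding closed_segment_def by blast
   define s where "s = (1 - r) *. proj x0 + r *. X"
   have s: "s \<in> cseg (proj x0) X" unfolding s_def closed_segment_def using r by blast
   have "proj y - s = (r * t) *. pv" unfolding r(3) s_def Xt_def by (simp add: algebra_simps)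
   hence "dist (proj y) s = r * (t * norm pv)" unfolding dist_norm using r elim(3) by simp
   also have "\<dots> \<le> 1 * (t * norm pv)" using r elim(3) by (intro mult_right_mono) auto
   finally have "Pr y" using eta(2)[OF y(1) s] elim(2) by simp
   then consider (a) "y \<in> seg e" | (b) q where "y = u + q *. v" | (c) q where "proj y = X + q *. g" unfolding Pr_def by blast
   thus ?thesis
   proof cases
    case a
    obtain p q where "y = at_edge e p" "x0 = at_edge e q" using a e(2) in_seg_iff by metis
    hence pq: "proj y = proj (fst e) + p *. dir e" "proj x0 = proj (fst e) + q *. dir e" by (simp_all add: proj_at_edge)
    have "r *. (Xt - proj (fst e)) = (p - (1 - r) * q) *. dir e" using r(3) unfolding pq by (simp add: algebra_simps)
    hence "cr (r *. (Xt - proj (fst e))) (dir e) = 0" by (rule cr_scale_self)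
    hence "r = 0" using elim(1) unfolding Xt_def by (simp only: cr_simps(3)) simp
    thus ?thesis using x0(3)[OF y(1)] r(3) by simp
   next
    case (b q)
    have "proj y = X + q *. pv" by (simp add: b X_def pv_def)
    hence "(1 - r) *. (proj x0 - X) = (q - r * t) *. pv" using r(3) unfolding Xt_def by (simp add: algebra_simps)
    hence "cr ((1 - r) *. (proj x0 - X)) pv = 0" by (rule cr_scale_self)
    hence "r = 1" using cv unfolding X_def pv_def by (simp only: cr_simps(3)) simp
    thus ?thesis using r(3) by simp
   next
    \<comment> \<open>\<open>x0\<close> and the shifted point are strictly on the same side of the
      line of the over strand, so no point between them is on it.\<close>
    case (c q)
    define A B where "A = cr (proj x0 - X) g" and "B = cr pv g"
    have "(1 - r) *. (proj x0 - X) + (r * t) *. pv = q *. g" using r(3) c unfolding Xt_def by (simp add: algebra_simps)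
    hence "cr ((1 - r) *. (proj x0 - X) + (r * t) *. pv) g = 0" by (rule cr_scale_self)
    hence "(1 - r) * A + r * t * B = 0" unfolding A_def B_def by (simp only: cr_simps(1,3))
    hence z: "(1 - r) * (A * B) + r * t * (B * B) = 0" by (metis distrib_right mult.assoc mult_zero_left)
    have AB: "0 < A * B" using cg by (simp add: A_def B_def X_def pv_def)
    have nn: "0 \<le> (1 - r) * (A * B)" "0 \<le> r * t * (B * B)"
     using r AB elim(3) by (simp_all only: mult_nonneg_nonneg[of "1 - r" "A * B"] mult_nonneg_nonneg[of "r * t" "B * B"] zero_le_square mult_nonneg_nonneg[of r t] less_imp_le diff_ge_0_iff_ge)
    hence "(1 - r) * (A * B) = 0" "r * t * (B * B) = 0" using z by linarith+
    hence "r = 1" "r = 0" using AB elim(3) by auto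
    thus ?thesis by simp
   qed
  qed
 qed
qed
qed

lemma ov_same: "reg E ==> ov (lk E) u w ==> ov (lk E) u' w ==> u = u'"
using gen_triple[of E u u' w] unfolding ov_def by (metis less_irrefl)

text \<open>The over strand at \<open>y0\<close> is pushed along the under strand, towards \<open>y0 + t1 v\<close>.\<close>

lemma edge_push:
 assumes R: "reg E" and col: "pcol (lk E) c" and rg: "range_in E c m M" and xd: "xdif (lk E) c d"
 and o: "ov (lk E) y0 w" and v: "at y0 within lk E = along y0 v" "v ~= 0" and t1: "0 < t1"
 and k: "c w ~= M" and dif: "\<And>a. jump (lk E) c y0 (c w) a ==> \<bar>a - c w\<bar> ~= d"
 and near: "\<And>x. x \<in> lk E ==> proj x \<in> cseg (proj y0) (proj (y0 + t1 *. v)) ==>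
  \<forall>\<^sub>F y in nhds x. y \<in> lk E --> y \<in> vis (lk E) --> (\<exists>t<0. y = y0 + t *. v) \<or>
   m \<le> 2 * c w - c y \<and> 2 * c w - c y < M \<and> (c y ~= M \<or> (\<exists>t. 0 < t \<and> t \<le> t1 \<and> y = y0 + t *. v))"
 shows "\<exists>E1 c1. good d m M E c E1 c1 \<and> far d E1 c1 M \<subseteq> far d E c M - {y0 + t *. v |t. 0 \<le> t \<and> t \<le> t1} \<and>
 germs E1 c1 M \<subseteq> germs E c M - {y0 + t *. v |t. 0 \<le> t \<and> t \<le> t1}"
proof -
have ow: "y0 \<in> lk E" "w \<in> lk E" "proj w = proj y0" "y0 ~= w" using o by (auto simp: ov_def)
have nv: "y0 \<notin> fst ` E" "w \<notin> fst ` E" using gen_cross[OF R ow(1,2,4)] ow(3) by auto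
have wu: "w \<notin> und E" by (rule ov_not_under[OF R o])
obtain e where e: "e \<in> E" "y0 \<in> seg e" using ow(1) lkE by blast
obtain A B where AB: "(A, B) \<in> E" "w \<in> seg (A, B)" using ow(2) lkE by (metis surj_pair)
obtain s where s: "s ~= 0" "proj v = s *. dir e" using line_dir[OF R e nv(1) v] by blast
have "cr (dir e) (dir (A, B)) ~= 0" using gen_trans[OF R ow(4) _ e(1) AB(1) e(2) AB(2)] ow(3) by simp
hence cvf: "cr (proj v) (dir (A, B)) ~= 0" using s by simp
define z where "z = proj (y0 + t1 *. v)"
have zw: "z = proj w + t1 *. proj v" by (simp add: z_def ow(3))
obtain \<sigma> where sg: "w = at_edge (A, B) \<sigma>" using AB(2) in_seg_iff by blast
hence pw: "proj w = proj A + \<sigma> *. dir (A, B)" by (simp add: proj_at_edge)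
have zoff: "cr (z - proj A) (dir (A, B)) ~= 0" unfolding zw pw using cvf t1 by simp
have only: "x = w" if x: "x \<in> seg (A, B)" "proj x \<in> cseg (proj w) z" for x
proof -
 obtain r where r: "proj x = (1 - r) *. proj w + r *. z" using x(2) unfolding closed_segment_def by blast
 obtain q where "x = at_edge (A, B) q" using x(1) in_seg_iff by blast
 hence "proj x = proj A + q *. dir (A, B)" by (simp add: proj_at_edge)
 hence "(r * t1) *. proj v = (q - \<sigma>) *. dir (A, B)" using r unfolding zw pw by (simp add: algebra_simps)
 hence "cr ((r * t1) *. proj v) (dir (A, B)) = 0" by (rule cr_scale_self)
 hence "r = 0" using cvf t1 by simp
 hence "proj x = proj w" using r by simp
 thus ?thesis using seg_proj_inj[OF R AB(1) x(1) AB(2)] by blast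
qed
\<comment> \<open>Points of the strand with \<open>t < 0\<close> lie behind the base, outside the
  triangle. Colour \<open>M\<close> is tolerated only on the piece strictly inside, where it is
  reflected. The second condition makes \<open>w\<close> the only over point on the base.\<close>
define Pr where "Pr y \<longleftrightarrow> (y \<in> vis (lk E) --> (\<exists>t<0. y = y0 + t *. v) \<or>
   m \<le> 2 * c w - c y \<and> 2 * c w - c y < M \<and> (c y ~= M \<or> (\<exists>t. 0 < t \<and> t \<le> t1 \<and> y = y0 + t *. v))) \<and>
  (y \<in> seg (A, B) --> y = w \<or> (\<forall>u. \<not> ov (lk E) u y))" for y
have nr: "\<forall>x\<in>lk E. proj x \<in> cseg (proj w) z --> (\<forall>\<^sub>F y in nhds x. y \<in> lk E --> Pr y)"
proof (intro ballI impI)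
 fix x assume x: "x \<in> lk E" "proj x \<in> cseg (proj w) z"
 have "\<forall>\<^sub>F y in nhds x. y \<in> seg (A, B) --> y = w \<or> (\<forall>u. \<not> ov (lk E) u y)"
 proof (cases "x = w")
  case True
  have "\<forall>\<^sub>F y in nhds w. y \<in> - ({x \<in> lk E. \<exists>y\<in>lk E. y ~= x \<and> proj y = proj x} - {w})"
   using finite_double[OF R] by (intro eventually_nhds_in_open open_Compl finite_imp_closed) auto
  thus ?thesis unfolding True
  proof eventually_elim
   case (elim y)
   have "y \<in> {x \<in> lk E. \<exists>y\<in>lk E. y ~= x \<and> proj y = proj x}" if "ov (lk E) u y" for u
    unfolding mem_Collect_eq using that unfolding ov_def by (metis less_irrefl)
   thus ?case using elim by blast
  qed
 next
  case False
  hence "x \<notin> seg (A, B)" using only x(2) by blast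
  hence "\<forall>\<^sub>F y in nhds x. y \<in> - seg (A, B)" by (intro eventually_nhds_in_open open_Compl) (simp_all add: seg_def)
  thus ?thesis by eventually_elim blast
 qed
 moreover have "proj x \<in> cseg (proj y0) (proj (y0 + t1 *. v))" using x(2) unfolding z_def ow(3) .
 note near[OF x(1) this]
 ultimately show "\<forall>\<^sub>F y in nhds x. y \<in> lk E --> Pr y" unfolding Pr_def by eventually_elim blast
qed
have fe: "finite ({} :: (real \<times> real) set)" "finite ({} :: ((real \<times> real) \<times> (real \<times> real)) set)" "\<forall>l\<in>{} :: ((real \<times> real) \<times> (real \<times> real)) set. snd l ~= 0" by simp_all
obtain \<alpha> \<beta> Z H p q r P Q where f: "finger E c A B \<alpha> \<beta> Z H p q r P Q" "c p = c w"
 and T: "\<And>x. x \<in> tri P Q Z ==> \<exists>y\<in>cseg (proj w) z. dist x y < 1"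
 and Pr: "\<And>y. y \<in> lk E ==> proj y \<in> tri P Q Z ==> Pr y"
 and In: "\<And>s. 0 < s ==> s \<le> 1 ==> proj w + s *. (z - proj w) \<in> itri P Q Z"
 and Out: "\<And>s. s < 0 ==> proj w + s *. (z - proj w) \<notin> tri P Q Z"
 and b: "w \<in> cseg p q"
 by (rule finger_along[OF R col AB nv(2) wu zoff zero_less_one fe nr]) blast
interpret f: finger E c A B \<alpha> \<beta> Z H p q r P Q by (rule f)
have k': "f.k = c w" using f(2) by (simp add: f.k_def)
have pt: "proj w + s *. (z - proj w) = proj (y0 + (s * t1) *. v)" for s by (simp add: zw ow(3))
have pin: "proj (y0 + t *. v) \<in> itri P Q Z" if "0 < t" "t \<le> t1" for t using In[of "t / t1"] pt[of "t / t1"] that t1 by simp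
have pout: "proj (y0 + t *. v) \<notin> tri P Q Z" if "t < 0" for t using Out[of "t / t1"] pt[of "t / t1"] that t1 by (simp add: divide_neg_pos)
have pT: "proj (y0 + t *. v) \<in> tri P Q Z" if "0 \<le> t" "t \<le> t1" for t
proof (cases "t = 0")
 case True
 thus ?thesis using f.bs_proj[OF b] f.side_iff(3)[of "proj y0"] ow(3) by simp
next
 case False thus ?thesis using pin[of t] that itri_subset[THEN subsetD, of _ P Q Z] by simp
qed
have C: "m \<le> 2 * c w - c y \<and> 2 * c w - c y < M \<and> (c y ~= M \<or> proj y \<in> itri P Q Z)" if y: "y \<in> vis (lk E)" "proj y \<in> tri P Q Z" for y
 using Pr[of y] y pout pin unfolding Pr_def by blast
have i: "m \<le> 2 * f.k - c y \<and> 2 * f.k - c y \<le> M" if "y \<in> vis (lk E)" "proj y \<in> tri P Q Z" for y using C[OF that] k' by simp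
have ins: "\<forall>y\<in>vis (lk E). proj y \<in> itri P Q Z --> 2 * f.k - c y ~= M"
 using C itri_subset[THEN subsetD, of _ P Q Z] k' by fastforce
have sd: "\<forall>y\<in>vis (lk E). proj y \<in> f.sides --> c y ~= M \<and> 2 * f.k - c y ~= M"
proof (intro ballI impI)
 fix y assume y: "y \<in> vis (lk E)" "proj y \<in> f.sides"
 hence "proj y \<in> tri P Q Z" "proj y \<notin> itri P Q Z" using f.side_iff f.itri_not_side by blast+
 thus "c y ~= M \<and> 2 * f.k - c y ~= M" using C[OF y(1)] k' by auto
qed
have xb: "\<bar>a - f.k\<bar> ~= d" if j: "ov (lk E) u w'" "w' \<in> f.bs" "jump (lk E) c u f.k a" for u w' a
proof -
 have "w' \<in> lk E" "proj w' \<in> tri P Q Z" "w' \<in> seg (A, B)" using j(2) f.bs_sub f.bs_proj f.side_iff(3) by blast+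
 hence "w' = w" using Pr[of w'] j(1) unfolding Pr_def by blast
 hence "u = y0" using ov_same[OF R _ o] j(1) by blast
 thus ?thesis using dif j(3) k' by metis
qed
have kM: "f.k ~= M" using k k' by simp
have G1: "good d m M E c f.E' f.c'" by (rule f.good_E'(1)[OF rg xd _ kM disjI1[OF ins] disjI2[OF sd]]) (use i xb in blast)+
have G3: "far d f.E' f.c' M \<subseteq> {x \<in> far d E c M. proj x \<notin> tri P Q Z}"
 by (rule f.good_E'(3)[OF rg xd _ kM disjI1[OF ins] disjI2[OF sd]]) (use i xb in blast)+
have G4: "germs f.E' f.c' M \<subseteq> {x \<in> germs E c M. proj x \<notin> tri P Q Z}"
 by (rule f.good_E'(4)[OF rg xd _ kM disjI1[OF ins] disjI2[OF sd] _ sd]) (use i xb in blast)+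
have "{x \<in> U. proj x \<notin> tri P Q Z} \<subseteq> U - {y0 + t *. v |t. 0 \<le> t \<and> t \<le> t1}" for U using pT by blast
thus ?thesis using G1 G3 G4 by (meson order_trans)
qed

text \<open>The finger by which a strand that sees \<open>X\<close> covers \<open>X\<close>.
  \<open>Q'\<close> describes what lies below it besides the pushed edge, and \<open>U\<close> is a
  closed set that it must not reach.\<close>

lemma reach_finger:
 assumes R: "reg E" and col: "pcol (lk E) c" and rc: "reach E c X x0 k"
 and Q: "\<And>x. x \<in> lk E ==> proj x = X ==> \<forall>\<^sub>F y in nhds x. y \<in> lk E --> Q' y"
 and U: "closed U" "U \<inter> cseg (proj x0) X = {}"
 obtains A B \<alpha> \<beta> Z H p q r P Q where "finger E c A B \<alpha> \<beta> Z H p q r P Q" "c p = k"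
 "\<And>y. y \<in> lk E ==> proj y \<in> tri P Q Z ==> y \<in> seg (A, B) \<and> c y = k \<and> y \<notin> fst ` E \<and> simple E y \<or> y \<notin> seg (A, B) \<and> Q' y"
 "X \<in> itri P Q Z" "tri P Q Z \<inter> U = {}"
proof -
have x0: "x0 \<in> lk E" "x0 \<notin> fst ` E" "\<And>y. y \<in> lk E ==> proj y = proj x0 ==> y = x0" "c x0 = k"
 "\<And>y. y \<in> lk E ==> proj y \<in> cseg (proj x0) X ==> y = x0 \<or> proj y = X"
 "\<And>e. e \<in> E ==> x0 \<in> seg e ==> cr (X - proj (fst e)) (dir e) ~= 0" using rc unfolding reach_def by blast+
have v0: "x0 \<notin> und E" using simple_vis[OF x0(1)] x0(3) by blast
obtain A B where AB: "(A, B) \<in> E" "x0 \<in> seg (A, B)" using x0(1) lkE by (metis surj_pair)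
have off: "cr (X - proj A) (dir (A, B)) ~= 0" using x0(6)[OF AB] by simp
have Xn: "proj x ~= X" if xs: "x \<in> seg (A, B)" for x
proof -
 obtain q where "x = at_edge (A, B) q" using xs in_seg_iff by blast
 hence "proj x - proj A = q *. dir (A, B)" by (simp add: proj_at_edge)
 hence "cr (proj x - proj A) (dir (A, B)) = 0" by (rule cr_scale_self)
 thus ?thesis using off by blast
qed
obtain \<eta> where eta: "\<eta> > 0" "\<And>x y. x \<in> cseg (proj x0) X ==> y \<in> U ==> \<eta> \<le> dist x y"
 using separate_compact_closed[OF compact_segment U(1), of "proj x0" X] U(2) by blast
define Pr where "Pr y \<longleftrightarrow> y \<in> seg (A, B) \<and> c y = k \<and> y \<notin> fst ` E \<and> simple E y \<or> y \<notin> seg (A, B) \<and> Q' y" for y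
have near: "\<forall>x\<in>lk E. proj x \<in> cseg (proj x0) X --> (\<forall>\<^sub>F y in nhds x. y \<in> lk E --> Pr y)"
proof (intro ballI impI)
 fix x assume x: "x \<in> lk E" "proj x \<in> cseg (proj x0) X"
 show "\<forall>\<^sub>F y in nhds x. y \<in> lk E --> Pr y"
 proof (cases "x = x0")
  case True
  have "\<forall>\<^sub>F y in nhds x0. y \<in> lk E --> (y \<notin> fst ` E \<and> simple E y) \<and> c y = c x0"
   by (rule isolated_color_near[OF R col x0(1,2)]) (rule x0(3))
  thus ?thesis unfolding True using near_edge[OF R x0(1,2) AB] by eventually_elim (use x0(4) in \<open>simp add: Pr_def\<close>)
 next
  case False
  hence X: "proj x = X" using x0(5)[OF x] by blast
  hence "x \<notin> seg (A, B)" using Xn by blast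
  hence "\<forall>\<^sub>F y in nhds x. y \<in> - seg (A, B)" by (intro eventually_nhds_in_open open_Compl) (simp_all add: seg_def)
  thus ?thesis using Q[OF x(1) X] by eventually_elim (simp add: Pr_def)
 qed
qed
have fe: "finite ({} :: (real \<times> real) set)" "finite ({} :: ((real \<times> real) \<times> (real \<times> real)) set)" "\<forall>l\<in>{} :: ((real \<times> real) \<times> (real \<times> real)) set. snd l ~= 0" by simp_all
obtain \<alpha> \<beta> Z H p q r P Q where f: "finger E c A B \<alpha> \<beta> Z H p q r P Q" "c p = c x0"
 and T: "\<And>x. x \<in> tri P Q Z ==> \<exists>y\<in>cseg (proj x0) X. dist x y < \<eta>"
 and Pr: "\<And>y. y \<in> lk E ==> proj y \<in> tri P Q Z ==> Pr y"
 and In: "\<And>s. 0 < s ==> s \<le> 1 ==> proj x0 + s *. (X - proj x0) \<in> itri P Q Z"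
 by (rule finger_along[OF R col AB x0(2) v0 off eta(1) fe near]) blast
have "x \<notin> U" if x: "x \<in> tri P Q Z" for x
proof
 assume "x \<in> U"
 obtain y where "y \<in> cseg (proj x0) X" "dist x y < \<eta>" using T[OF x] by blast
 thus False using eta(2)[of y x] \<open>x \<in> U\<close> by (simp add: dist_commute)
qed
hence TU: "tri P Q Z \<inter> U = {}" by blast
show ?thesis
proof (rule that[OF f(1)])
 show "c p = k" using f(2) x0(4) by simp
 show "X \<in> itri P Q Z" using In[of 1] by simp
 show "y \<in> seg (A, B) \<and> c y = k \<and> y \<notin> fst ` E \<and> simple E y \<or> y \<notin> seg (A, B) \<and> Q' y"
  if "y \<in> lk E" "proj y \<in> tri P Q Z" for y using Pr[OF that] unfolding Pr_def .
qed (rule TU)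
qed

context finger
begin

text \<open>Below such a finger there are only parts of the pushed edge, of colour \<open>k\<close>,
  and points with \<open>Q'\<close>; so the hypotheses of \<open>good_E'\<close> reduce to
  conditions on \<open>Q'\<close>, and nothing crosses under the base.\<close>

lemma poke_good:
 assumes T: "\<And>y. y \<in> D ==> proj y \<in> tri P Q Z ==> y \<in> seg (A, B) \<and> c y = k \<and> y \<notin> fst ` E \<and> (\<forall>y'\<in>D. proj y' = proj y --> y' = y) \<or> y \<notin> seg (A, B) \<and> Q' y"
 and rg: "range_in E c m M" and xd: "xdif D c d" and kM: "k ~= M"
 and Q: "\<And>y. y \<in> vis D ==> Q' y ==> m \<le> 2 * k - c y \<and> 2 * k - c y < M \<and> (k = M - d \<or> c y ~= M)"
 shows "good d m M E c E' c'" "tops E' c' M \<subseteq> {x \<in> tops E c M. proj x \<notin> tri P Q Z}" "far d E' c' M \<subseteq> {x \<in> far d E c M. proj x \<notin> tri P Q Z}"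
 "k ~= M - d ==> germs E' c' M \<subseteq> {x \<in> germs E c M. proj x \<notin> tri P Q Z}" "\<And>u w. w \<in> bs ==> \<not> ov D u w"
proof -
have "p \<in> vis D" using p_edge top by simp
hence "m \<le> k \<and> k \<le> M" using rg unfolding range_in_def k_def by blast
hence km: "m \<le> k" "k < M" using kM by simp_all
have C: "m \<le> 2 * k - c y \<and> 2 * k - c y < M \<and> (k = M - d \<or> c y ~= M)" if y: "y \<in> vis D" "proj y \<in> tri P Q Z" for y
 using T[of y] y Q[of y] km by force
show nov: "\<not> ov D u w" if w: "w \<in> bs" for u w
proof
 assume o: "ov D u w"
 have "w \<in> D" "proj w \<in> tri P Q Z" "w \<in> seg (A, B)" using w bs_sub bs_proj side_iff(3) by blast+
 thus False using T[of w] o unfolding ov_def by (metis less_irrefl)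
qed
have i: "m \<le> 2 * k - c y \<and> 2 * k - c y \<le> M" if "y \<in> vis D" "proj y \<in> tri P Q Z" for y using C[OF that] by simp
have ins: "\<forall>y\<in>vis D. proj y \<in> itri P Q Z --> 2 * k - c y ~= M" using C itri_subset[THEN subsetD, of _ P Q Z] by fastforce
have sd: "k = M - d \<or> (\<forall>y\<in>vis D. proj y \<in> sides --> c y ~= M \<and> 2 * k - c y ~= M)"
proof (cases "k = M - d")
 case False
 have "c y ~= M \<and> 2 * k - c y ~= M" if y: "y \<in> vis D" "proj y \<in> sides" for y
 proof -
  have "proj y \<in> tri P Q Z" using y(2) side_iff by blast
  thus ?thesis using C[OF y(1)] False by auto
 qed
 thus ?thesis by blast
qed simp
show "good d m M E c E' c'" by (rule good_E'(1)[OF rg xd _ kM disjI1[OF ins] sd]) (use i nov in blast)+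
show "tops E' c' M \<subseteq> {x \<in> tops E c M. proj x \<notin> tri P Q Z}" by (rule good_E'(2)[OF rg xd _ kM disjI1[OF ins] sd]) (use i nov in blast)+
show "far d E' c' M \<subseteq> {x \<in> far d E c M. proj x \<notin> tri P Q Z}" by (rule good_E'(3)[OF rg xd _ kM disjI1[OF ins] sd]) (use i nov in blast)+
show "germs E' c' M \<subseteq> {x \<in> germs E c M. proj x \<notin> tri P Q Z}" if "k ~= M - d"
 by (rule good_E'(4)[OF rg xd _ kM disjI1[OF ins] sd]) (use i nov sd that in blast)+
qed

text \<open>Since nothing passes under the base, no former under point becomes visible; a visible
  point is new, of colour \<open>k\<close>, or an old one that is unchanged or reflected.\<close>

lemma near_poke:
 assumes x: "x \<in> D'" and nov: "\<And>u w. w \<in> bs ==> \<not> ov D u w"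
 and N: "x \<in> D ==> x \<notin> F ==> x \<notin> bs ==> \<forall>\<^sub>F y in nhds x. y \<in> D --> N' y"
 shows "\<forall>\<^sub>F y in nhds x. y \<in> D' --> y \<in> vis D' --> c' y = k \<or>
 N' y \<and> y \<in> vis D \<and> (proj y \<notin> tri P Q Z \<and> c' y = c y \<or> proj y \<in> itri P Q Z \<and> c' y = 2 * k - c y)"
proof (cases "x \<in> F")
case True
have "\<forall>\<^sub>F y in nhds x. y ~= x --> y \<in> D' --> c' y = k" using near_F[OF True] unfolding eventually_at_filter .
thus ?thesis by eventually_elim (use c'_F[OF True] in blast)
next
case False
hence xD: "x \<in> D" "x \<notin> bs" using x D'_iff by blast+
from N[OF xD(1) False xD(2)] near_D(1)[OF xD(1) False xD(2)] show ?thesis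
proof eventually_elim
 case (elim y)
 show ?case
 proof (intro impI)
  assume y: "y \<in> D'" "y \<in> vis D'"
  hence "y \<in> D" using D'_iff elim(2) by blast
  hence N: "N' y" using elim(1) by blast
  show "c' y = k \<or> N' y \<and> y \<in> vis D \<and> (proj y \<notin> tri P Q Z \<and> c' y = c y \<or> proj y \<in> itri P Q Z \<and> c' y = 2 * k - c y)"
   using vis_D'[OF y(2)] N nov by metis
 qed
qed
qed

end

section \<open>Following a strand of the largest colour\<close>

lemma filtermap_line_scale:
 fixes x v :: pt
 assumes s: "s ~= 0" shows "along x (s *. v) = along x v"
proof (rule filter_eqI)
fix G :: "pt => bool"
have 1: "\<forall>\<^sub>F t in at (0::real). H (s * t)" if ev: "\<forall>\<^sub>F t in at (0::real). H t" "s ~= 0" for H and s :: real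
proof -
 obtain d where d: "d > 0" "\<And>t. t ~= 0 ==> \<bar>t\<bar> < d ==> H t" using ev(1) unfolding eventually_at dist_real_def by auto
 have "H (s * t)" if t: "t ~= 0" "\<bar>t\<bar> < d / \<bar>s\<bar>" for t
  using d(2)[of "s * t"] t ev(2) by (simp add: abs_mult field_simps)
 moreover have "0 < d / \<bar>s\<bar>" using d(1) ev(2) by simp
 ultimately show ?thesis unfolding eventually_at dist_real_def by (intro exI[of _ "d / \<bar>s\<bar>"]) simp
qed
show "eventually G (along x (s *. v)) = eventually G (along x v)"
 unfolding eventually_filtermap
 using 1[of "\<lambda>t. G (x + t *. v)" s] 1[of "\<lambda>t. G (x + t *. (s *. v))" "1 / s"] s by (auto simp: mult.commute)
qed

text \<open>Near the point the straight piece lies on one edge, so \<open>v\<close> is a multiple of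
  the direction of that edge.\<close>

lemma at_line:
 assumes R: "reg E" and on: "\<And>t. a < t ==> t < b ==> u + t *. v \<in> lk E" and v: "v ~= 0"
 and t0: "a < t0" "t0 < b" and nv: "u + t0 *. v \<notin> fst ` E"
 shows "at (u + t0 *. v) within lk E = along (u + t0 *. v) v"
proof -
define x where "x = u + t0 *. v"
have xD: "x \<in> lk E" "x \<notin> fst ` E" using on[OF t0] nv by (simp_all add: x_def)
obtain e where e: "e \<in> E" "x \<in> seg e" using xD(1) lkE by blast
have "((\<lambda>t. u + t *. v) \<longlongrightarrow> u + t0 *. v) (at t0)" by (intro tendsto_intros)
hence "\<forall>\<^sub>F t in at t0. u + t *. v \<in> lk E --> u + t *. v \<in> seg e \<and> (\<forall>f\<in>E. u + t *. v \<in> seg f --> f = e)"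
 using eventually_compose_filterlim[OF near_edge[OF R xD e]] unfolding x_def by blast
moreover have "\<forall>\<^sub>F t in at t0. t \<in> {a<..<b}" using t0 by (intro eventually_at_in_open') auto
moreover have "\<forall>\<^sub>F t in at t0. t ~= t0" by (rule eventually_neq_at_within)
ultimately have "\<forall>\<^sub>F t in at t0. u + t *. v \<in> seg e \<and> t ~= t0" by eventually_elim (use on in auto)
from eventually_happens'[OF at_neq_bot this] obtain t where t: "u + t *. v \<in> seg e" "t ~= t0" by blast
obtain p q where pq: "u + t *. v = at_edge e p" "x = at_edge e q" using t(1) e(2) in_seg_iff by metis
have "(u + t *. v) - x = (p - q) *. (snd e - fst e)" unfolding pq at_edge_def by (simp add: algebra_simps)
hence eq: "(t - t0) *. v = (p - q) *. (snd e - fst e)" by (simp add: x_def algebra_simps)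
have "v = ((p - q) / (t - t0)) *. (snd e - fst e)" using arg_cong[OF eq, of "\<lambda>z. (1 / (t - t0)) *. z"] t(2) by simp
moreover from this have "(p - q) / (t - t0) ~= 0" using v by auto
ultimately show ?thesis using at_within_edge[OF R e xD(2)] filtermap_line_scale unfolding x_def by metis
qed

lemma near_set: "open S ==> proj x \<in> S ==> \<forall>\<^sub>F y in nhds x. proj y \<in> S"
by (rule eventually_compose_filterlim[OF eventually_nhds_in_open tendsto_proj[OF filterlim_ident]])

lemma at_rightD: assumes "\<forall>\<^sub>F t in at_right (0 :: real). H t" obtains b where "b > 0" "\<And>t. 0 < t ==> t < b ==> H t"
using assms unfolding eventually_at_right_field by blast

lemma finite_obstacles: "reg E ==> finite (tops E c M)" "reg E ==> finite (germs E c M)" "reg E ==> finite (far d E c M)"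
proof -
assume R: "reg E"
have "tops E c M \<subseteq> fst ` E \<union> {x \<in> lk E. \<exists>y\<in>lk E. y ~= x \<and> proj y = proj x}"
 unfolding tops_def ov_def by (auto simp del: split_paired_All split_paired_Ex) (metis less_irrefl)
thus "finite (tops E c M)" by (rule finite_subset) (use finite_double[OF R] reg_finite[OF R] in simp)
have "germs E c M \<subseteq> und E" "far d E c M \<subseteq> und E" unfolding germs_def far_def under_ov by blast+
thus "finite (germs E c M)" "finite (far d E c M)" using finite_under[OF R] finite_subset by blast+
qed

text \<open>Without \<open>tops\<close> the strand cannot carry colour \<open>M\<close> to the end
  of its edge, as the vertex there would be an obstacle. So it meets an under point before; the
  first one is the germ.\<close>

lemma next_under:
 assumes R: "reg E" and col: "pcol (lk E) c" and x: "x \<in> lk E" "x \<notin> fst ` E"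
 and v: "at x within lk E = along x v" "v ~= 0"
 and M: "\<forall>\<^sub>F t in at_right 0. c (x + t *. v) = M" and top: "tops E c M = {}"
 obtains t2 \<delta> where "0 < t2" "0 < \<delta>" "\<And>t. - \<delta> < t ==> t < t2 + \<delta> ==> x + t *. v \<in> lk E \<and> x + t *. v \<notin> fst ` E"
 "\<And>t. 0 < t ==> t < t2 ==> x + t *. v \<in> vis (lk E) \<and> c (x + t *. v) = M" "x + t2 *. v \<in> germs E c M"
proof -
define pt where "pt t = x + t *. v" for t
obtain e where e: "e \<in> E" "x \<in> seg e" using x(1) lkE by blast
obtain \<sigma> where sg: "0 < \<sigma>" "\<sigma> < 1" "x = at_edge e \<sigma>" using nonvertex_param[OF R e x(2)] by blast
note aw = at_within_edge[OF R e x(2)]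
have "\<forall>\<^sub>F y in at x within lk E. \<exists>t. y = x + t *. (snd e - fst e)"
 unfolding aw eventually_filtermap by (rule always_eventually) blast
from filtermap_line_within[OF aw v(1) this] obtain s where s: "v = s *. (snd e - fst e)" by blast
have s0: "s ~= 0" using s v(2) by auto
have pe: "pt t = at_edge e (\<sigma> + t * s)" for t by (simp add: pt_def sg(3) s at_edge_def algebra_simps)
\<comment> \<open>The parameter at which the line in direction \<open>v\<close> reaches the end of
  the edge.\<close>
define tm where "tm = (if s > 0 then (1 - \<sigma>) / s else - \<sigma> / s)"
define \<delta>0 where "\<delta>0 = min \<sigma> (1 - \<sigma>) / \<bar>s\<bar>"
have tm: "0 < tm" "pt tm \<in> fst ` E"
proof -
 show "0 < tm" using s0 sg by (auto simp: tm_def divide_less_0_iff)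
 have "\<sigma> + tm * s = 1 \<or> \<sigma> + tm * s = 0" using s0 by (simp add: tm_def)
 thus "pt tm \<in> fst ` E" unfolding pe using ends_V[OF R e(1)] by (metis at_edge_01)
qed
have d0: "0 < \<delta>0" using sg s0 by (simp add: \<delta>0_def)
have par: "0 < \<sigma> + t * s \<and> \<sigma> + t * s < 1" if t: "- \<delta>0 < t" "t < tm" for t
proof (cases "t < 0")
 case True
 hence "\<bar>t\<bar> < min \<sigma> (1 - \<sigma>) / \<bar>s\<bar>" using t(1) unfolding \<delta>0_def by linarith
 moreover have "0 < \<bar>s\<bar>" using s0 by simp
 ultimately have "\<bar>t\<bar> * \<bar>s\<bar> < min \<sigma> (1 - \<sigma>)" using pos_less_divide_eq by blast
 hence "\<bar>t * s\<bar> < min \<sigma> (1 - \<sigma>)" by (simp add: abs_mult)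
 thus ?thesis by linarith
next
 case False
 show ?thesis
 proof (cases "s > 0")
  case True
  hence "t * s < 1 - \<sigma>" "0 \<le> t * s" using t(2) False by (simp_all add: tm_def pos_less_divide_eq)
  thus ?thesis using sg by simp
 next
  case s': False
  hence sn: "s < 0" using s0 by simp
  have "t < (- \<sigma>) / s" using t(2) s' unfolding tm_def by (simp only: if_False)
  hence "- \<sigma> < t * s" by (simp only: neg_less_divide_eq[OF sn])
  moreover have "t * s \<le> 0" using False sn by (simp add: mult_nonneg_nonpos)
  ultimately      show ?thesis using sg by simp
 qed
qed
have lkp: "pt t \<in> lk E" "pt t \<notin> fst ` E" if t: "- \<delta>0 < t" "t < tm" for t
proof -
 have i: "pt t \<in> seg e" unfolding pe in_seg_iff using par[OF t] by (intro exI[of _ "\<sigma> + t * s"]) simp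
 thus "pt t \<in> lk E" using seg_lk e(1) by blast
 show "pt t \<notin> fst ` E"
 proof
  assume "pt t \<in> fst ` E"
  then obtain f where f: "f \<in> E" "fst f = pt t" by (metis imageE)
  have "pt t \<in> ends e"
  proof (cases "f = e")
   case True thus ?thesis using f(2) by simp
  next
   case False
   have "pt t \<in> seg f" using f(2) ends_in_seg(1)[of f] by simp
   thus ?thesis using gen_seg[OF R e(1) f(1) False[symmetric] i] by blast
  qed
  hence "at_edge e (\<sigma> + t * s) = at_edge e 0 \<or> at_edge e (\<sigma> + t * s) = at_edge e 1" unfolding pe at_edge_01 by blast
  hence "\<sigma> + t * s = 0 \<or> \<sigma> + t * s = 1" using at_edge_inj[OF R e(1)] by metis
  thus False using par[OF t] by linarith
 qed
qed
obtain b where b: "b > 0" "\<And>t. 0 < t ==> t < b ==> c (pt t) = M" using at_rightD[OF M] unfolding pt_def by metis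
define U where "U = {t. 0 < t \<and> t \<le> tm \<and> pt t \<in> und E}"
have inj: "inj_on pt U" unfolding pt_def using v(2) by (auto intro: inj_onI)
have "pt ` U \<subseteq> und E" by (auto simp: U_def)
hence fU: "finite U" using finite_under[OF R] inj finite_imageD finite_subset by metis
have run: "c (pt t) = M" if t: "0 < t" "t \<le> tm" "\<And>t'. 0 < t' ==> t' \<le> t ==> t' \<notin> U" for t
proof -
 define t' where "t' = min t b / 2"
 have t': "0 < t'" "t' \<le> t" "t' < b" using t(1) b(1) by (auto simp: t'_def)
 have "connected (pt ` {t'..t})" unfolding pt_def by (intro connected_continuous_image continuous_intros) simp
 moreover have "pt ` {t'..t} \<subseteq> vis (lk E)"
 proof
  fix y assume "y \<in> pt ` {t'..t}"
  then obtain r where r: "y = pt r" "t' \<le> r" "r \<le> t" by auto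
  have "y \<in> lk E"
  proof (cases "r = tm")
   case True thus ?thesis using tm(2) seg_lk ends_in_seg(1) r(1) by (metis imageE)
  next
   case False thus ?thesis using lkp(1)[of r] r t t'(1) d0 by simp
  qed
  moreover have "y \<notin> und E" using t(3)[of r] r t' t(2) unfolding U_def by auto
  ultimately show "y \<in> vis (lk E)" by blast
 qed
 ultimately have "c (pt t') = c (pt t)" by (rule pcol_const[OF col]) (use t' in auto)
 thus ?thesis using b(2) t' by simp
qed
have "U ~= {}"
proof
 assume U0: "U = {}"
 have "c (pt tm) = M" using run[of tm] tm(1) U0 by blast
 moreover have "pt tm \<in> vis (lk E)"
 proof -
  have "pt tm \<in> lk E" using tm(2) seg_lk ends_in_seg(1) by (metis imageE)
  moreover have "pt tm \<notin> und E" using under_nonvertex[OF R] tm(2) by blast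
  ultimately show ?thesis by blast
 qed
 ultimately have "pt tm \<in> tops E c M" using tm(2) by (simp add: tops_def)
 thus False using top by blast
qed
then obtain t2 where t2: "t2 \<in> U" "\<And>t. t \<in> U ==> t2 \<le> t" using Min_in[OF fU] Min_le[OF fU] by blast
have u2: "pt t2 \<in> und E" "0 < t2" "t2 \<le> tm" using t2(1) by (auto simp: U_def)
have "t2 ~= tm" using tm(2) under_nonvertex[OF R u2(1)] by blast
hence t2m: "t2 < tm" using u2(3) by simp
have mid: "c (pt t) = M" if t: "0 < t" "t < t2" for t
 by (rule run) (use t t2(2) t2m in force)+
have vis: "pt t \<in> vis (lk E)" if t: "0 < t" "t < t2" for t
proof -
 have "t \<notin> U" using t2(2) t by force
 thus ?thesis using lkp(1)[of t] t t2m d0 by (simp add: U_def)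
qed
obtain w2 where w2: "ov (lk E) (pt t2) w2" using u2(1) unfolding under_ov by blast
obtain a where a: "jump (lk E) c (pt t2) (c w2) a" using col w2 unfolding pcol_def by blast
have "((\<lambda>t. pt t) \<longlongrightarrow> pt t2) (at_left t2)" unfolding pt_def by (intro tendsto_intros)
from eventually_compose_filterlim[OF jump_near[OF a] this]
have "\<forall>\<^sub>F t in at_left t2. pt t \<in> lk E --> pt t = pt t2 \<or> c (pt t) = a \<or> c (pt t) = 2 * c w2 - a" .
moreover have "\<forall>\<^sub>F t in at_left t2. t \<in> {0<..<t2}" using eventually_at_left_real[OF u2(2)] .
ultimately have "\<forall>\<^sub>F t in at_left t2. M = a \<or> M = 2 * c w2 - a"
proof eventually_elim
 case (elim t)
 hence "pt t ~= pt t2" using v(2) by (auto simp: pt_def)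
 thus ?case using elim mid[of t] vis[of t] by auto
qed
hence "M = a \<or> M = 2 * c w2 - a" using eventually_happens'[OF trivial_limit_at_left_real] by blast
hence "jump (lk E) c (pt t2) (c w2) M" using a jump_sym[OF a] by blast
hence g: "pt t2 \<in> germs E c M" unfolding germs_def using w2 by blast
have "0 < min \<delta>0 (tm - t2)" using d0 t2m by simp
thus ?thesis using that[OF u2(2), of "min \<delta>0 (tm - t2)"] lkp mid vis g unfolding pt_def by simp
qed

text \<open>A point of colour \<open>M\<close> that is no obstacle lies inside an edge, and
  following that edge leads to a germ.\<close>

lemma no_top:
 assumes R: "reg E" and col: "pcol (lk E) c" and "tops E c M = {}" "germs E c M = {}" and x: "x \<in> vis (lk E)"
 shows "c x ~= M"
proof
assume M: "c x = M"
have nv: "x \<notin> fst ` E" using assms(3) x M unfolding tops_def by blast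
obtain e where e: "e \<in> E" "x \<in> seg e" using x lkE by blast
note aw = at_within_edge[OF R e nv]
have v0: "snd e - fst e ~= 0" by (rule edge_vec_nz[OF R e(1)])
have "\<forall>\<^sub>F y in at x within lk E. c y = M" using col x M unfolding pcol_def by blast
hence "\<forall>\<^sub>F t in at 0. c (x + t *. (snd e - fst e)) = M" unfolding aw eventually_filtermap .
hence "\<forall>\<^sub>F t in at_right 0. c (x + t *. (snd e - fst e)) = M" by (simp add: eventually_at_split)
moreover have "x \<in> lk E" using x by blast
ultimately show False using next_under[OF R col _ nv aw v0 _ assms(3), of False] assms(4) by (metis empty_iff)
qed

section \<open>The three phases that remove the largest colour\<close>

locale unit_reduction = reduction 1 m M L for m M L
begin

text \<open>All integers are congruent modulo 1, so the congruence conditions of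
  \<open>supply_strand\<close> hold by themselves.\<close>

lemma supply_unit:
 assumes S: "St E c" and v: "m + 1 \<le> v" "v \<le> M - 1" and g: "g ~= 0" "b ~= 0"
 shows "\<exists>E1 c1 x0 \<epsilon>. mv E c E1 c1 \<and> reach E1 c1 X x0 v \<and> 0 < \<epsilon> \<and> agree (- ball X \<epsilon>) E c E1 c1 \<and>
 (\<forall>e\<in>E. cr (proj x0 - X) (dir e) ~= 0) \<and> 0 < cr (proj x0 - X) g * b"
proof -
obtain u w a where "ov (lk E) u w" "jump (lk E) c u (c w) a" "\<bar>a - c w\<bar> = 1" using S unfolding St_def xdif_def by blast
thus ?thesis by (rule supply_strand[OF S]) (use v g in simp_all)
qed

lemma StD: assumes "St E c" shows "reg E" "pcol (lk E) c" "range_in E c m M" "xdif (lk E) c 1"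
using assms by (simp_all add: St_def)

text \<open>A finger of colour \<open>M - 1\<close> over \<open>x\<close> turns the \<open>M\<close>
  there into \<open>M - 2\<close>. If \<open>x\<close> is an over point, the strand below has colour
  \<open>M\<close> on both branches by maximality, so besides the pushed edge only \<open>M\<close>
  lies below the finger.\<close>

lemma phase_A:
 assumes S: "St E c" and x: "x \<in> tops E c M"
 shows "\<exists>E1 c1. mv E c E1 c1 \<and> x \<notin> tops E1 c1 M"
proof -
have g: "(1, 0) ~= (0 :: real \<times> real)" "(1 :: real) ~= 0" by (simp_all add: prod_eq_iff)
have vr: "m + 1 \<le> M - 1" "M - 1 \<le> M - 1" using mM by simp_all
obtain E1 c1 x0 where 1: "mv E c E1 c1" "reach E1 c1 (proj x) x0 (M - 1)" using supply_unit[OF S vr g, of "proj x"] by blast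
show ?thesis
proof (cases "x \<in> tops E1 c1 M")
 case False thus ?thesis using 1(1) by blast
next
 case True
 note D = StD[OF St_mv[OF S 1(1)]]
 have xv: "x \<in> vis (lk E1)" "c1 x = M" using True by (auto simp: tops_def)
 have Q: "\<forall>\<^sub>F y in nhds x'. y \<in> lk E1 --> (y \<in> vis (lk E1) --> c1 y = M)" if x': "x' \<in> lk E1" "proj x' = proj x" for x'
 proof (cases "x' = x")
  case True
  show ?thesis unfolding True using color_near[OF D(2) xv(1)] by eventually_elim (use xv(2) in simp)
 next
  case False
  have "height x' ~= height x" using False x'(2) pt_eq_iff by blast
  moreover have "\<not> height x < height x'" using xv(1) x' unfolding under_ov ov_def by blast
  ultimately have o: "ov (lk E1) x' x" using x' xv(1) by (simp add: ov_def)
  obtain a where a: "jump (lk E1) c1 x' (c1 x) a" using D(2) o unfolding pcol_def by blast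
  have "a \<le> M" "2 * c1 x - a \<le> M" using jump_colors[OF D(1) o a] D(3) unfolding range_in_def by auto
  hence "a = M" using xv(2) by simp
  moreover have "x' \<notin> vis (lk E1)" using o unfolding under_ov by blast
  ultimately show ?thesis using jump_near[OF a] by (auto elim!: eventually_mono simp: xv(2) simp del: split_paired_All)
 qed
 obtain A B \<alpha> \<beta> Z H p q r P Q where f: "finger E1 c1 A B \<alpha> \<beta> Z H p q r P Q" "c1 p = M - 1"
  and T: "\<And>y. y \<in> lk E1 ==> proj y \<in> tri P Q Z ==> y \<in> seg (A, B) \<and> c1 y = M - 1 \<and> y \<notin> fst ` E1 \<and> simple E1 y \<or> y \<notin> seg (A, B) \<and> (y \<in> vis (lk E1) --> c1 y = M)"
  and X: "proj x \<in> itri P Q Z" and "tri P Q Z \<inter> {} = {}"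
  by (rule reach_finger[OF D(1,2) 1(2) _ closed_empty]) (erule (1) Q, simp, blast)
 interpret f: finger E1 c1 A B \<alpha> \<beta> Z H p q r P Q by (rule f)
 have k: "f.k = M - 1" using f(2) by (simp add: f.k_def)
 have kM: "f.k ~= M" using k by simp
 have G: "good 1 m M E1 c1 f.E' f.c'" "tops f.E' f.c' M \<subseteq> {x \<in> tops E1 c1 M. proj x \<notin> tri P Q Z}"
  by (rule f.poke_good[OF _ D(3,4) kM, where Q' = "\<lambda>y. y \<in> vis (lk E1) --> c1 y = M"]; use T k mM in auto)+
 have "proj x \<in> tri P Q Z" using X itri_subset by blast
 hence "x \<notin> tops f.E' f.c' M" using G(2) by blast
 thus ?thesis using good_trans[OF 1(1) G(1)] by blast
qed
qed

end

lemma line_near_at: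
 assumes "reg E" "\<And>t. a < t ==> t < b ==> u + t *. v \<in> lk E" "v ~= 0" "a < t0" "t0 < b" "u + t0 *. v \<notin> fst ` E"
 shows "\<forall>\<^sub>F y in nhds (u + t0 *. v). y \<in> lk E --> (\<exists>t. a < t \<and> t < b \<and> y = u + t *. v)"
proof -
have "min (t0 - a) (b - t0) > 0" using assms(4,5) by simp
moreover have "at (u + t0 *. v) within lk E = along (u + t0 *. v) v"
 by (rule at_line[OF assms(1) _ assms(3-6)]) (rule assms(2))
ultimately have "\<forall>\<^sub>F y in nhds (u + t0 *. v). y \<in> lk E --> (\<exists>t. \<bar>t\<bar> < min (t0 - a) (b - t0) \<and> y = u + t0 *. v + t *. v)"
 using line_near by blast
thus ?thesis
proof eventually_elim
 case (elim y)
 show ?case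
 proof
  assume "y \<in> lk E"
  then obtain r where r: "\<bar>r\<bar> < min (t0 - a) (b - t0)" "y = u + t0 *. v + r *. v" using elim by blast
  have "y = u + (t0 + r) *. v" unfolding r(2) by (simp add: algebra_simps)
  moreover have "a < t0 + r" "t0 + r < b" using r(1) by linarith+
  ultimately show "\<exists>t. a < t \<and> t < b \<and> y = u + t *. v" by blast
 qed
qed
qed

lemma proj_line_segment: "a \<le> b ==> cseg (proj (u + a *. v)) (proj (u + b *. v)) = (\<lambda>t. proj (u + t *. v)) ` {a..b}"
using ray_segment[of "proj u" a "proj v" b] by (simp add: closed_segment_eq_real_ivl)

context unit_reduction
begin

text \<open>A strand of colour \<open>M - 1\<close> is laid over the \<open>M\<close>-coloured strand next to \<open>u\<close>; then the over
strand at \<open>u\<close> is pushed along into the part that has become \<open>M - 2\<close>.\<close>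

lemma phase_B:
 assumes S: "St E c" and top: "tops E c M = {}" and u: "u \<in> far 1 E c M"
 shows "\<exists>E1 c1. mv E c E1 c1 \<and> u \<notin> far 1 E1 c1 M"
proof -
note D0 = StD[OF S]
obtain w where w: "ov (lk E) u w" "jump (lk E) c u (c w) M" using u unfolding far_def by blast
obtain v where v: "v ~= 0" "at u within lk E = along u v" "\<forall>\<^sub>F t in at_right 0. c (u + t *. v) = M \<and> c (u - t *. v) = 2 * c w - M"
 using w(2) unfolding jump_def by blast
have ow: "u \<in> lk E" "w \<in> lk E" "proj w = proj u" "u ~= w" using w(1) by (auto simp: ov_def)
have nv: "u \<notin> fst ` E" "w \<notin> fst ` E" using gen_cross[OF D0(1) ow(1,2,4)] ow(3) by auto
obtain e f where ef: "e \<in> E" "u \<in> seg e" "f \<in> E" "w \<in> seg f" using ow(1,2) lkE by metis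
obtain s where s: "s ~= 0" "proj v = s *. dir e" using line_dir[OF D0(1) ef(1,2) nv(1) v(2,1)] by blast
define g where "g = dir f"
have g0: "g ~= 0" using dir_nz[OF D0(1) ef(3)] by (simp add: g_def)
have b0: "cr (proj v) g ~= 0" using gen_trans[OF D0(1) ow(4) _ ef(1,3,2,4)] ow(3) s by (simp add: g_def)
have gw: "\<forall>\<^sub>F y in nhds w. y \<in> lk E --> (\<exists>s. proj y = proj u + s *. g)"
 using near_edge[OF D0(1) ow(2) nv(2) ef(3,4)]
proof eventually_elim
 case (elim y)
 show ?case
 proof
  assume "y \<in> lk E"
  then obtain p q where "y = at_edge f p" "w = at_edge f q" using elim ef(4) in_seg_iff by metis
  hence "proj y = proj u + (p - q) *. g" using ow(3) proj_at_edge[of f p] proj_at_edge[of f q] unfolding g_def by (simp add: algebra_simps)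
  thus "\<exists>s. proj y = proj u + s *. g" by blast
 qed
qed
have vr: "m + 1 \<le> M - 1" "M - 1 \<le> M - 1" using mM by simp_all
\<comment> \<open>The last condition puts \<open>x0\<close> on that side of the over strand on which
  the branch of colour \<open>M\<close> leaves \<open>u\<close>.\<close>
obtain E1 c1 x0 \<epsilon> where 1: "mv E c E1 c1" "reach E1 c1 (proj u) x0 (M - 1)" "0 < \<epsilon>" "agree (- ball (proj u) \<epsilon>) E c E1 c1"
 "\<And>e. e \<in> E ==> cr (proj x0 - proj u) (dir e) ~= 0" "0 < cr (proj x0 - proj u) g * cr (proj v) g"
 using supply_unit[OF S vr g0 b0, of "proj u"] by blast
show ?thesis
proof (cases "u \<in> far 1 E1 c1 M")
 case False thus ?thesis using 1(1) by blast
next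
 case True
 have S1: "St E1 c1" by (rule St_mv[OF S 1(1)])
 note D = StD[OF S1]
 have top1: "tops E1 c1 M = {}" using 1(1) top unfolding good_def by blast
 have loc: "\<forall>\<^sub>F y in nhds x. proj y \<in> ball (proj u) \<epsilon>" if "proj x = proj u" for x
  by (rule near_set) (use that 1(3) in auto)
 have locu: "\<forall>\<^sub>F y in nhds u. proj y \<in> ball (proj u) \<epsilon>" by (rule loc) simp
 have ag: "x \<in> lk E1 \<longleftrightarrow> x \<in> lk E" "x \<in> lk E ==> c1 x = c x" if "proj x \<in> ball (proj u) \<epsilon>" for x
  using 1(4) that unfolding agree_def by blast+
 have ub: "proj u \<in> ball (proj u) \<epsilon>" using 1(3) by simp
 obtain w' where w': "ov (lk E1) u w'" "jump (lk E1) c1 u (c1 w') M" "c1 w' ~= M - 1" using True unfolding far_def by blast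
 have "ov (lk E) u w'" using agree_ov[OF 1(4), of u w'] w'(1) ub by blast
 hence [simp]: "w' = w" using ov_unique[OF D0(1)] w(1) by blast
 note o = w'(1)[simplified] and J = w'(2)[simplified]
 define k where "k = c1 w"
 have ow1: "u \<in> lk E1" "w \<in> lk E1" using o by (auto simp: ov_def)
 have wv: "w \<in> vis (lk E1)" using ov_not_under[OF D(1) o] ow1 by blast
 \<comment> \<open>\<open>k = M\<close> is excluded by the absence of \<open>tops\<close>,
   \<open>k = M - 1\<close> because \<open>u\<close> is far. The reflection of \<open>M\<close> in
   \<open>k\<close> is the colour of the other branch at \<open>u\<close>, hence in the
   range.\<close>
 have kr: "m \<le> k" "k \<le> M - 2" "m \<le> 2 * k - M"
 proof -
  have "k ~= M"
  proof
   assume "k = M"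
   hence "w \<in> tops E1 c1 M" using wv o unfolding tops_def k_def by blast
   thus False using top1 by blast
  qed
  thus "m \<le> k" "k \<le> M - 2" using D(3) wv w'(3) unfolding range_in_def k_def by force+
  show "m \<le> 2 * k - M" using jump_colors(2)[OF D(1) o J] D(3) unfolding range_in_def k_def by auto
 qed
 have v1: "at u within lk E1 = along u v"
  unfolding v(2)[symmetric] by (rule eventually_within_cong) (use locu in \<open>eventually_elim, simp add: ag(1)\<close>)
 have gw1: "\<forall>\<^sub>F y in nhds w. y \<in> lk E1 --> (\<exists>s. proj y = proj u + s *. g)"
  using gw loc[OF ow(3)] by eventually_elim (use ag(1) in blast)
 have "cr (proj x0 - proj u) (proj v) ~= 0" using 1(5)[OF ef(1)] s by simp
 note rs = reach_shift[OF D(1) 1(2) o v1 gw1 this 1(6)]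
 obtain \<delta> where dl: "\<delta> > 0" "\<And>t. t ~= 0 ==> \<bar>t\<bar> < \<delta> ==> u + t *. v \<in> lk E1 \<and> u + t *. v \<notin> fst ` E1 \<and>
   simple E1 (u + t *. v)" using strand_param[OF D(1) v1] by blast
 have lim: "((\<lambda>t. u + t *. v) \<longlongrightarrow> u + 0 *. v) (at_right 0)" by (intro tendsto_intros)
 have lb: "\<forall>\<^sub>F t in at_right 0. proj (u + t *. v) \<in> ball (proj u) \<epsilon>"
  by (rule eventually_compose_filterlim[OF locu]) (use lim in simp)
 have "\<forall>\<^sub>F t in at_right (0::real). t < \<delta>" using dl(1) by (auto simp: eventually_at_right_field)
 hence "\<forall>\<^sub>F t in at_right 0. t < \<delta> \<and> c1 (u + t *. v) = M \<and> reach E1 c1 (proj (u + t *. v)) x0 (M - 1)"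
  using lb v(3) rs eventually_at_right_less[of "0::real"]
 proof eventually_elim
  case (elim t)
  have "u + t *. v \<in> lk E1" using dl(2)[of t] elim by simp
  thus ?case using elim ag by metis
 qed
 then obtain b where b: "b > 0" "\<And>t. 0 < t ==> t < b ==> t < \<delta> \<and> c1 (u + t *. v) = M \<and> reach E1 c1 (proj (u + t *. v)) x0 (M - 1)"
  by (rule at_rightD) blast
 \<comment> \<open>A point on the branch of colour \<open>M\<close>, so near \<open>u\<close> that
   it is seen from \<open>x0\<close>.\<close>
 define t1 where "t1 = b / 2"
 have t1: "0 < t1" "t1 < b" using b(1) by (simp_all add: t1_def)
 define pt where "pt t = u + t *. v" for t
 have simple: "pt t \<in> lk E1" "pt t \<notin> fst ` E1" "\<And>y. y \<in> lk E1 ==> proj y = proj (pt t) ==> y = pt t" "c1 (pt t) = M" if "0 < t" "t < b" for t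
  using dl(2)[of t] b(2)[OF that] that unfolding pt_def by auto
 have rc: "reach E1 c1 (proj (pt t1)) x0 (M - 1)" using b(2)[OF t1] by (simp add: pt_def)
 have inj: "pt s = pt t \<longleftrightarrow> s = t" for s t using v(1) by (simp add: pt_def)
 have pt0: "pt 0 = u" by (simp add: pt_def)
 have ptv: "pt t1 \<in> vis (lk E1)" using simple_vis[OF simple(1)[OF t1]] simple(3)[OF t1] by blast
 \<comment> \<open>The finger laid over this point must leave the crossing at \<open>u\<close> as it
   is.\<close>
 have U: "closed {proj u}" "{proj u} \<inter> cseg (proj x0) (proj (pt t1)) = {}"
 proof -
  have "proj u \<notin> cseg (proj x0) (proj (pt t1))"
  proof
   assume "proj u \<in> cseg (proj x0) (proj (pt t1))"
   hence "u = x0 \<or> proj u = proj (pt t1)" using rc ow1(1) unfolding reach_def by blast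
   moreover have "u ~= x0" using rc ow1 ow(3,4) unfolding reach_def by metis
   ultimately have "u = pt t1" using simple(3)[OF t1 ow1(1)] by blast
   thus False using inj[of 0 t1] pt0 t1 by simp
  qed
  thus "{proj u} \<inter> cseg (proj x0) (proj (pt t1)) = {}" by blast
 qed simp
 have Q: "\<forall>\<^sub>F y in nhds x. y \<in> lk E1 --> c1 y = M" if x: "x \<in> lk E1" "proj x = proj (pt t1)" for x
  using color_near[OF D(2) ptv] simple(4)[OF t1] simple(3)[OF t1 x] by simp
 obtain A B \<alpha> \<beta> Z H p q r P Q where f: "finger E1 c1 A B \<alpha> \<beta> Z H p q r P Q" "c1 p = M - 1"
  and T: "\<And>y. y \<in> lk E1 ==> proj y \<in> tri P Q Z ==> y \<in> seg (A, B) \<and> c1 y = M - 1 \<and> y \<notin> fst ` E1 \<and> simple E1 y \<or> y \<notin> seg (A, B) \<and> c1 y = M"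
  and X: "proj (pt t1) \<in> itri P Q Z" and uT: "tri P Q Z \<inter> {proj u} = {}"
  by (rule reach_finger[OF D(1,2) rc _ U, where Q' = "\<lambda>y. c1 y = M"]) (erule (1) Q, blast)
 interpret f: finger E1 c1 A B \<alpha> \<beta> Z H p q r P Q by (rule f)
 have fk: "f.k = M - 1" using f(2) by (simp add: f.k_def)
 hence kM: "f.k ~= M" by simp
 have T': "\<And>y. y \<in> lk E1 ==> proj y \<in> tri P Q Z ==> y \<in> seg (A, B) \<and> c1 y = f.k \<and> y \<notin> fst ` E1 \<and> simple E1 y \<or> y \<notin> seg (A, B) \<and> c1 y = M"
  using T unfolding fk .
 have G: "good 1 m M E1 c1 f.E' f.c'" by (rule f.poke_good(1)[OF T' D(3,4) kM]) (use fk mM in auto)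
 have nov: "\<And>u w. w \<in> f.bs ==> \<not> ov (lk E1) u w" by (rule f.poke_good(5)[OF T' D(3,4) kM]) (use fk mM in auto)
 have S2: "St f.E' f.c'" by (rule St_mv[OF S1 G])
 note D2 = StD[OF S2]
 have uT: "proj u \<notin> tri P Q Z" "proj w \<notin> tri P Q Z" using uT ow(3) by auto
 have ub: "u \<notin> f.bs" "u \<notin> f.F" using uT(1) f.bs_proj f.side_iff(3) f.F_plane(2) by blast+
 have o2: "ov (lk f.E') u w" unfolding f.ov_D' using o nov ub by blast
 have cw: "f.c' w = k" using f.c'_out[OF ow1(2) uT(2)] by (simp add: k_def)
 have v2: "at u within lk f.E' = along u v" using f.near_D(2)[OF ow1(1) ub(2,1)] v1 by simp
 have J2: "jump (lk f.E') f.c' u (f.c' w) M" using f.jump_out[OF J ow1(1) ub(2,1) uT(1)] cw by (simp add: k_def)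
 \<comment> \<open>The over strand is pushed as far as the point that the first finger has turned
   into \<open>M - 2\<close>. Below lie only the colours \<open>k\<close>, \<open>M\<close>,
   \<open>M - 1\<close>, \<open>M - 2\<close>, and as \<open>k \<le> M - 2\<close> all are reflected
   below \<open>M\<close>.\<close>
 have "\<exists>E2 c2. good 1 m M f.E' f.c' E2 c2 \<and> far 1 E2 c2 M \<subseteq> far 1 f.E' f.c' M - {u + t *. v |t. 0 \<le> t \<and> t \<le> t1} \<and>
   germs E2 c2 M \<subseteq> germs f.E' f.c' M - {u + t *. v |t. 0 \<le> t \<and> t \<le> t1}"
 proof (rule edge_push[OF D2 o2 v2 v(1) t1(1)])
  show "f.c' w ~= M" using cw kr by simp
  \<comment> \<open>The crossing at \<open>u\<close> disappears; its difference is at least 2, so it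
    is not the one to be kept.\<close>
  show "\<bar>a - f.c' w\<bar> ~= 1" if "jump (lk f.E') f.c' u (f.c' w) a" for a
   using jump_unique[OF that J2] cw kr(2) by auto
  fix x assume x: "x \<in> lk f.E'" "proj x \<in> cseg (proj u) (proj (u + t1 *. v))"
  have "proj x \<in> cseg (proj (u + 0 *. v)) (proj (u + t1 *. v))" using x(2) by simp
  then obtain t where t: "0 \<le> t" "t \<le> t1" "proj x = proj (pt t)"
   unfolding proj_line_segment[OF less_imp_le[OF t1(1)]] pt_def by auto
  define N where "N y \<longleftrightarrow> (\<exists>t. y = pt t \<and> (t \<le> 0 \<or> (t \<le> t1 \<or> proj y \<in> itri P Q Z) \<and> c1 y = M)) \<or> c1 y = k \<and> proj y \<notin> tri P Q Z" for y
  have lkp: "u + t *. v \<in> lk E1" if "- \<delta> < t" "t < \<delta>" for t using dl(2)[of t] that ow1(1) by (cases "t = 0") auto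
  have N: "\<forall>\<^sub>F y in nhds x. y \<in> lk E1 --> N y" if xD: "x \<in> lk E1"
  proof (cases "t = 0")
   case True
   hence "x = u \<or> x = w" using gen_triple[OF D(1) xD ow1] t(3) pt0 ow(3,4) by metis
   thus ?thesis
   proof
    assume "x = u"
    show ?thesis unfolding \<open>x = u\<close> using line_near[OF v1 t1(1)]
    proof eventually_elim
     case (elim y)
     show ?case
     proof
      assume "y \<in> lk E1"
      then obtain r where r: "\<bar>r\<bar> < t1" "y = pt r" using elim unfolding pt_def by blast
      have "r \<le> 0 \<or> r \<le> t1 \<and> c1 y = M" using simple(4)[of r] r t1(2) by force
      thus "N y" unfolding N_def using r(2) by blast
     qed
    qed
   next
    assume "x = w"
    have "\<forall>\<^sub>F y in nhds w. proj y \<in> - tri P Q Z" by (rule near_set[OF open_Compl[OF closed_tri]]) (use uT in simp)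
    thus ?thesis unfolding \<open>x = w\<close> using color_near[OF D(2) wv] by eventually_elim (auto simp: N_def k_def)
   qed
  next
   case False
   hence t0: "0 < t" "t < b" using t t1(2) by auto
   have xt: "x = pt t" using simple(3)[OF t0 xD t(3)] .
   have xv: "x \<in> vis (lk E1)" unfolding xt by (rule simple_vis[OF simple(1)[OF t0]]) (use simple(3)[OF t0] in blast)
   have cn: "\<forall>\<^sub>F y in nhds x. y \<in> lk E1 --> c1 y = M" using color_near[OF D(2) xv] simple(4)[OF t0] xt by simp
   have td: "- \<delta> < t" "t < \<delta>" "- \<delta> < t1" using b(2)[OF t0] t0(1) dl(1) t1(1) by auto
   show ?thesis
   proof (cases "t = t1")
    case True
    have "\<forall>\<^sub>F y in nhds x. proj y \<in> itri P Q Z" by (rule near_set[OF open_itri]) (use X xt True in simp)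
    moreover have "\<forall>\<^sub>F y in nhds (u + t *. v). y \<in> lk E1 --> (\<exists>t. - \<delta> < t \<and> t < \<delta> \<and> y = u + t *. v)"
     by (rule line_near_at[OF D(1) _ v(1) td(1,2)]) (use lkp simple(2)[OF t0] in \<open>simp_all add: pt_def\<close>)
    hence "\<forall>\<^sub>F y in nhds x. y \<in> lk E1 --> (\<exists>t. y = pt t)" unfolding xt pt_def by eventually_elim blast
    ultimately show ?thesis using cn by eventually_elim (auto simp: N_def)
   next
    case False
    hence tt: "- \<delta> < t" "t < t1" using t td by simp_all
    have "t1 < \<delta>" using b(2)[OF t1] by simp
    hence lkp': "u + t *. v \<in> lk E1" if "- \<delta> < t" "t < t1" for t using lkp that by simp
    have "\<forall>\<^sub>F y in nhds (u + t *. v). y \<in> lk E1 --> (\<exists>t. - \<delta> < t \<and> t < t1 \<and> y = u + t *. v)"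
     by (rule line_near_at[OF D(1) _ v(1) tt]) (use lkp' simple(2)[OF t0] in \<open>simp_all add: pt_def\<close>)
    thus ?thesis using cn unfolding xt pt_def[symmetric] by eventually_elim (auto simp: N_def simp del: split_paired_All)
   qed
  qed
  have "\<forall>\<^sub>F y in nhds x. y \<in> lk f.E' --> y \<in> vis (lk f.E') --> f.c' y = f.k \<or>
   N y \<and> y \<in> vis (lk E1) \<and> (proj y \<notin> tri P Q Z \<and> f.c' y = c1 y \<or> proj y \<in> itri P Q Z \<and> f.c' y = 2 * f.k - c1 y)"
   by (rule f.near_poke[OF x(1)]) (use nov N in blast)+
  thus "\<forall>\<^sub>F y in nhds x. y \<in> lk f.E' --> y \<in> vis (lk f.E') --> (\<exists>t<0. y = u + t *. v) \<or>
   m \<le> 2 * f.c' w - f.c' y \<and> 2 * f.c' w - f.c' y < M \<and> (f.c' y ~= M \<or> (\<exists>t. 0 < t \<and> t \<le> t1 \<and> y = u + t *. v))"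
  proof eventually_elim
   case (elim y)
   show ?case
   proof (intro impI)
    assume y: "y \<in> lk f.E'" "y \<in> vis (lk f.E')"
    consider "f.c' y = M - 1" | "N y" "proj y \<notin> tri P Q Z" "f.c' y = c1 y" | "N y" "proj y \<in> itri P Q Z" "f.c' y = 2 * f.k - c1 y"
     using elim y fk by metis
    thus "(\<exists>t<0. y = u + t *. v) \<or>
     m \<le> 2 * f.c' w - f.c' y \<and> 2 * f.c' w - f.c' y < M \<and> (f.c' y ~= M \<or> (\<exists>t. 0 < t \<and> t \<le> t1 \<and> y = u + t *. v))"
    proof cases
     case 1 thus ?thesis using cw kr by simp
    next
     case 2
     have nu: "y ~= u" using y(2) o2 unfolding under_ov by blast
     have "proj y \<notin> itri P Q Z" using 2(2) itri_subset by blast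
     then consider t where "y = pt t" "t \<le> 0" | t where "y = pt t" "0 < t" "t \<le> t1" "c1 y = M" | "c1 y = k" using 2(1) unfolding N_def by (metis not_le)
     thus ?thesis
     proof cases
      case (1 t)
      hence "t < 0" using nu pt0 by (cases "t = 0") auto
      thus ?thesis using 1(1) unfolding pt_def by blast
     next
      case (2 t)
      hence "f.c' y = M" using \<open>f.c' y = c1 y\<close> by simp
      moreover have "\<exists>t. 0 < t \<and> t \<le> t1 \<and> y = u + t *. v" using 2 unfolding pt_def by blast
      ultimately show ?thesis using kr cw by simp
     next
      case 3 thus ?thesis using 2(3) cw kr by simp
     qed
    next
     case 3
     have yT: "proj y \<in> tri P Q Z" using 3(2) itri_subset by blast
     then consider t where "y = pt t" "t < 0" | "y = u" | "c1 y = M" using 3(1) pt0 unfolding N_def by (metis less_eq_real_def)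
     thus ?thesis
     proof cases
      case (1 t) thus ?thesis unfolding pt_def by blast
     next
      case 2 thus ?thesis using yT uT by blast
     next
      case h: 3 thus ?thesis using 3(3) fk cw kr by simp
     qed
    qed
   qed
  qed
 qed
 then obtain E2 c2 where 2: "good 1 m M f.E' f.c' E2 c2" "far 1 E2 c2 M \<subseteq> far 1 f.E' f.c' M - {u + t *. v |t. 0 \<le> t \<and> t \<le> t1}" by blast
 have "u = u + 0 *. v" by simp
 hence "u \<notin> far 1 E2 c2 M" using 2(2) t1(1) by force
 thus ?thesis using good_trans[OF good_trans[OF 1(1) G] 2(1)] by blast
qed
qed

end

lemma transversal_exists: "w ~= 0 ==> \<exists>n. cr n w ~= 0"
by (rule exI[of _ "(snd w, - fst w)"]) (auto simp: cr_def prod_eq_iff sum_squares_eq_zero_iff)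

context unit_reduction
begin

text \<open>With neither \<open>tops\<close> nor \<open>far\<close> points, a piece of colour
  \<open>M\<close> is straight and runs between two under points with over colour
  \<open>M - 1\<close>. Beyond both ends the rule gives \<open>M - 2\<close>.\<close>

lemma germ_piece:
 assumes S: "St E c" and top: "tops E c M = {}" and far: "far 1 E c M = {}" and u: "u \<in> germs E c M"
 obtains v t2 \<delta> w1 w2 where "v ~= 0" "0 < t2" "0 < \<delta>" "\<And>t. - \<delta> < t ==> t < t2 + \<delta> ==> u + t *. v \<in> lk E \<and> u + t *. v \<notin> fst ` E"
 "\<And>t y. - \<delta> < t ==> t < t2 + \<delta> ==> t ~= 0 ==> t ~= t2 ==> y \<in> lk E ==> proj y = proj (u + t *. v) ==> y = u + t *. v"
 "\<And>t. 0 < t ==> t < t2 ==> c (u + t *. v) = M"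
 "\<And>t. - \<delta> < t ==> t < t2 + \<delta> ==> t < 0 \<or> t2 < t ==> c (u + t *. v) = M - 2"
 "ov (lk E) u w1" "c w1 = M - 1" "ov (lk E) (u + t2 *. v) w2" "c w2 = M - 1"
proof -
note D = StD[OF S]
have fw: "c w = M - 1" if "ov (lk E) u w" "jump (lk E) c u (c w) M" for u w using far that unfolding far_def by blast
obtain w1 where w1: "ov (lk E) u w1" "jump (lk E) c u (c w1) M" using u unfolding germs_def by blast
note cw1 = fw[OF w1]
obtain v where v: "v ~= 0" "at u within lk E = along u v" "\<forall>\<^sub>F t in at_right 0. c (u + t *. v) = M \<and> c (u - t *. v) = 2 * c w1 - M"
 using w1(2) unfolding jump_def by blast
define pt where "pt t = u + t *. v" for t
have uD: "u \<in> lk E" "u \<notin> fst ` E" using w1(1) under_nonvertex[OF D(1)] unfolding under_ov ov_def by blast+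
have evM: "\<forall>\<^sub>F t in at_right 0. c (u + t *. v) = M" using v(3) by eventually_elim blast
obtain t2 \<delta>1 where n: "0 < t2" "0 < \<delta>1" "\<And>t. - \<delta>1 < t ==> t < t2 + \<delta>1 ==> pt t \<in> lk E \<and> pt t \<notin> fst ` E"
 "\<And>t. 0 < t ==> t < t2 ==> pt t \<in> vis (lk E) \<and> c (pt t) = M" "pt t2 \<in> germs E c M"
 unfolding pt_def by (rule next_under[OF D(1,2) uD v(2,1) evM top]) blast
obtain w2 where w2: "ov (lk E) (pt t2) w2" "jump (lk E) c (pt t2) (c w2) M" using n(5) unfolding germs_def by blast
note cw2 = fw[OF w2]
have at2: "at (pt t2) within lk E = along (pt t2) v"
 unfolding pt_def by (rule at_line[OF D(1) _ v(1), where a = "- \<delta>1" and b = "t2 + \<delta>1"]) (use n in \<open>simp_all add: pt_def\<close>)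
have p2: "pt t2 + t *. v = pt (t2 + t)" for t by (simp add: pt_def algebra_simps)
obtain \<delta>2 where d2: "\<delta>2 > 0" "\<And>t. t ~= 0 ==> \<bar>t\<bar> < \<delta>2 ==> pt t \<in> lk E \<and> pt t \<notin> fst ` E \<and> simple E (pt t)"
 using strand_param[OF D(1) v(2)] unfolding pt_def by blast
obtain \<delta>3 where d3: "\<delta>3 > 0" "\<And>t. t ~= 0 ==> \<bar>t\<bar> < \<delta>3 ==> pt (t2 + t) \<in> lk E \<and> pt (t2 + t) \<notin> fst ` E \<and> (\<forall>y\<in>lk E. proj y = proj (pt (t2 + t)) --> y = pt (t2 + t))"
 using strand_param[OF D(1) at2] unfolding p2 by blast
obtain b where b: "b > 0" "\<And>t. 0 < t ==> t < b ==> c (u - t *. v) = M - 2"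
proof (rule at_rightD[OF v(3)])
 fix b :: real
 assume h: "b > 0" "\<And>t. 0 < t ==> t < b ==> c (u + t *. v) = M \<and> c (u - t *. v) = 2 * c w1 - M"
 show thesis by (rule that[OF h(1)]) (use h(2) cw1 in simp)
qed
define \<delta>' where "\<delta>' = min \<delta>3 t2"
have d': "\<delta>' > 0" using d3(1) n(1) by (simp add: \<delta>'_def)
have after: "c (pt (t2 + t)) = M - 2" if t: "0 < t" "t < \<delta>'" for t
proof -
 have "\<exists>\<^sub>F y in at (pt t2) within lk E. c y = 2 * c w2 - M" by (rule jump_at(3)[OF w2(2)])
 hence "\<exists>\<^sub>F r in at 0. c (pt (t2 + r)) = M - 2" unfolding at2 frequently_filtermap p2 cw2 by simp
 moreover have "\<forall>\<^sub>F r in at (0::real). r ~= 0 \<and> \<bar>r\<bar> < \<delta>'" using d' unfolding eventually_at dist_real_def by (intro exI[of _ \<delta>']) simp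
 ultimately obtain r where r: "c (pt (t2 + r)) = M - 2" "r ~= 0" "\<bar>r\<bar> < \<delta>'" using frequently_ex[OF frequently_eventually_conj] by blast
 have r0: "0 < r"
 proof (rule ccontr)
  assume "\<not> 0 < r"
  hence "0 < t2 + r" "t2 + r < t2" using r(2,3) by (auto simp: \<delta>'_def)
  thus False using n(4) r(1) by fastforce
 qed
 have "connected ((\<lambda>t. pt (t2 + t)) ` {0<..<\<delta>'})" unfolding pt_def by (intro connected_continuous_image continuous_intros) simp
 moreover have "(\<lambda>t. pt (t2 + t)) ` {0<..<\<delta>'} \<subseteq> vis (lk E)"
 proof
  fix y assume "y \<in> (\<lambda>t. pt (t2 + t)) ` {0<..<\<delta>'}"
  then obtain t where t: "y = pt (t2 + t)" "0 < t" "t < \<delta>'" by auto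
  thus "y \<in> vis (lk E)" using d3(2)[of t] by (intro simple_vis) (auto simp: \<delta>'_def)
 qed
 ultimately have "c (pt (t2 + r)) = c (pt (t2 + t))" by (rule pcol_const[OF D(2)]) (use r0 r(3) t in auto)
 thus ?thesis using r(1) by simp
qed
define \<delta> where "\<delta> = min (min \<delta>1 \<delta>2) (min \<delta>' b)"
have dl: "\<delta> > 0" "\<delta> \<le> \<delta>1" "\<delta> \<le> \<delta>2" "\<delta> \<le> \<delta>'" "\<delta> \<le> b" "\<delta> \<le> \<delta>3" using n(2) d2(1) d' b(1) by (auto simp: \<delta>_def \<delta>'_def)
show ?thesis
proof (rule that[of v t2 \<delta> w1 w2, OF v(1) n(1) dl(1)])
 show "u + t *. v \<in> lk E \<and> u + t *. v \<notin> fst ` E" if "- \<delta> < t" "t < t2 + \<delta>" for t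
  using n(3)[of t] that dl by (simp add: pt_def)
 show "c (u + t *. v) = M" if "0 < t" "t < t2" for t using n(4)[OF that] by (simp add: pt_def)
 show "c (u + t *. v) = M - 2" if "- \<delta> < t" "t < t2 + \<delta>" "t < 0 \<or> t2 < t" for t
  using that(3)
 proof
  assume "t < 0" thus ?thesis using b(2)[of "- t"] that dl by simp
 next
  assume "t2 < t" thus ?thesis using after[of "t - t2"] that dl by (simp add: pt_def)
 qed
 show "y = u + t *. v" if t: "- \<delta> < t" "t < t2 + \<delta>" "t ~= 0" "t ~= t2" and y: "y \<in> lk E" "proj y = proj (u + t *. v)" for t y
 proof -
  consider "t < 0" | "t2 < t" | "0 < t" "t < t2" using t(3,4) by linarith
  thus ?thesis
  proof cases
   case 1 thus ?thesis using d2(2)[of t] t dl y by (simp add: pt_def)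
  next
   case 2 thus ?thesis using d3(2)[of "t - t2"] t dl y by (simp add: pt_def)
  next
   case 3
   have p: "pt t \<in> vis (lk E)" "c (pt t) = M" using n(4)[OF 3] by blast+
   show ?thesis
   proof (rule ccontr)
    assume ne: "y ~= u + t *. v"
    hence "height y ~= height (pt t)" using y(2) pt_eq_iff unfolding pt_def by blast
    moreover have "\<not> height (pt t) < height y" using p(1) y unfolding under_ov ov_def pt_def by blast
    ultimately have "ov (lk E) y (pt t)" using y p(1) unfolding ov_def pt_def by auto
    hence "pt t \<in> tops E c M" using p unfolding tops_def by blast
    thus False using top by blast
   qed
  qed
 qed
qed (use w1(1) cw1 w2(1) cw2 in \<open>simp_all add: pt_def\<close>)
qed

text \<open>A finger of the strand itself, of colour \<open>M - 2\<close> before \<open>u\<close>, is laid over the strand and then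
pushed along it, past both ends of its \<open>M\<close>-coloured piece.\<close>

lemma phase_C:
 assumes S: "St E c" and top: "tops E c M = {}" and far: "far 1 E c M = {}" and u: "u \<in> germs E c M"
 shows "\<exists>E1 c1. mv E c E1 c1 \<and> germs E1 c1 M \<subset> germs E c M"
proof -
note D = StD[OF S]
obtain v t2 \<delta> w1 w2 where v: "v ~= 0" and t2: "0 < t2" and dl: "0 < \<delta>"
 and P1': "\<And>t. - \<delta> < t ==> t < t2 + \<delta> ==> u + t *. v \<in> lk E \<and> u + t *. v \<notin> fst ` E"
 and P2': "\<And>t y. - \<delta> < t ==> t < t2 + \<delta> ==> t ~= 0 ==> t ~= t2 ==> y \<in> lk E ==> proj y = proj (u + t *. v) ==> y = u + t *. v"
 and PM': "\<And>t. 0 < t ==> t < t2 ==> c (u + t *. v) = M"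
 and PL': "\<And>t. - \<delta> < t ==> t < t2 + \<delta> ==> t < 0 \<or> t2 < t ==> c (u + t *. v) = M - 2"
 and w1: "ov (lk E) u w1" "c w1 = M - 1" and w2': "ov (lk E) (u + t2 *. v) w2" "c w2 = M - 1"
 by (rule germ_piece[OF S top far u]) blast
define pt where "pt t = u + t *. v" for t
note P1 = P1'[folded pt_def] and P2 = P2'[folded pt_def] and PM = PM'[folded pt_def] and PL = PL'[folded pt_def] and w2 = w2'[folded pt_def]
have pt0: "pt 0 = u" by (simp add: pt_def)
define pv where "pv = proj v"
\<comment> \<open>Three marks: the finger starts at \<open>- 2 * a\<close>, comes down on the strand
  at \<open>- a\<close>, and is pushed on to \<open>t2 + a\<close>.\<close>
define a where "a = \<delta> / 3"
have a: "0 < a" "3 * a = \<delta>" using dl by (simp_all add: a_def)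
define x1 where "x1 = pt (- (2 * a))"
have x1D: "x1 \<in> lk E" "x1 \<notin> fst ` E" "\<And>y. y \<in> lk E ==> proj y = proj x1 ==> y = x1" "c x1 = M - 2"
 using P1[of "- (2 * a)"] P2[of "- (2 * a)"] PL[of "- (2 * a)"] a t2 by (auto simp: x1_def)
have atl: "at (pt t) within lk E = filtermap (\<lambda>s. pt t + s *. v) (at 0)" if "- \<delta> < t" "t < t2 + \<delta>" for t
 unfolding pt_def by (rule at_line[OF D(1) _ v that]) (use P1' that in blast)+
have dirv: "\<exists>s. s ~= 0 \<and> pv = s *. dir e" if h: "e \<in> E" "x1 \<in> seg e" for e
 unfolding pv_def by (rule line_dir[OF D(1) h x1D(2) _ v]) (use atl[of "- (2 * a)"] a t2 in \<open>simp add: x1_def\<close>)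
obtain e1 where "e1 \<in> E" "x1 \<in> seg e1" using x1D(1) lkE by blast
then obtain s1 where "s1 ~= 0" "pv = s1 *. dir e1" "dir e1 ~= 0" using dirv dir_nz[OF D(1)] by metis
hence pv0: "pv ~= 0" by simp
obtain n where n: "cr n pv ~= 0" using transversal_exists[OF pv0] by blast
have ppt: "proj (pt t) = proj u + t *. pv" for t by (simp add: pt_def pv_def)
have pconv: "(1 - q) *. proj (pt s) + q *. proj (pt t) = proj (pt ((1 - q) * s + q * t))" for q s t
 unfolding ppt by (simp add: algebra_simps)
have pseg: "cseg (proj (pt s)) (proj (pt t)) = (\<lambda>r. proj (pt r)) ` {s..t}" if "s \<le> t" for s t
 unfolding pt_def by (rule proj_line_segment[OF that])
have pdiff: "proj (pt s) - proj (pt t) = (s - t) *. pv" for s t unfolding ppt by (simp add: algebra_simps)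
have off: "q = 0 \<and> s = t" if eq: "proj (pt t) + q *. n = proj (pt s)" for q s t
proof -
 have qn: "q *. n = (s - t) *. pv" using eq unfolding ppt by (simp add: algebra_simps)
 hence "cr (q *. n) pv = 0" by (rule cr_scale_self)
 hence "q = 0" using n by simp
 thus ?thesis using qn pv0 by simp
qed
have nearl: "\<forall>\<^sub>F y in nhds (pt t). y \<in> lk E --> (\<exists>s. - \<delta> < s \<and> s < t2 + \<delta> \<and> y = pt s)" if "- \<delta> < t" "t < t2 + \<delta>" for t
 unfolding pt_def by (rule line_near_at[OF D(1) _ v that]) (use P1' that in blast)+
define K0 where "K0 = cseg (proj x1) (proj (pt (- a)))"
have K0: "\<forall>\<^sub>F y in nhds x. y \<in> lk E --> (\<exists>s. y = pt s)" if x: "x \<in> lk E" "proj x \<in> K0" for x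
proof -
 obtain t where t: "- (2 * a) \<le> t" "t \<le> - a" "proj x = proj (pt t)"
  using x(2) a(1) unfolding K0_def x1_def by (auto simp: pseg)
 have tr: "- \<delta> < t" "t < t2 + \<delta>" "t ~= 0" "t ~= t2" using t a t2 by auto
 have "x = pt t" by (rule P2[OF tr x(1) t(3)])
 thus ?thesis using nearl[OF tr(1,2)] by (auto elim!: eventually_mono simp del: split_paired_All)
qed
have "compact K0" by (simp add: K0_def)
from thin[OF D(1) this K0] obtain \<eta>0 where e0: "\<eta>0 > 0" "\<And>y s. y \<in> lk E ==> s \<in> K0 ==> dist (proj y) s < \<eta>0 ==> \<exists>s. y = pt s" by blast
\<comment> \<open>Small enough that over \<open>K0\<close> no other strand lies between the strand
  and its parallel at offset \<open>r *. n\<close>.\<close>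
define r where "r = \<eta>0 / (norm n + 1)"
have "norm n < norm n + 1" "0 < norm n + 1" by (simp_all add: add_nonneg_pos)
hence r: "0 < r" "r * norm n < \<eta>0" using e0(1) by (simp_all add: r_def field_simps)
define X Y where "X = proj (pt (- a))" and "Y = X + r *. n"
have Xx1: "X - proj x1 = a *. pv" unfolding X_def x1_def pdiff by simp
have line: "q = 0" if z: "z \<in> lk E" "proj z = proj (pt t) + q *. n" "- (2 * a) \<le> t" "t \<le> - a" "0 \<le> q" "q \<le> r" for z t q
proof -
 have "proj (pt t) \<in> K0" unfolding K0_def x1_def using z(3,4) by (simp add: pseg)
 moreover have "q * norm n \<le> r * norm n" using z(6) by (intro mult_right_mono) auto
 hence "dist (proj z) (proj (pt t)) < \<eta>0" using r(2) z(5) unfolding z(2) dist_norm by simp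
 ultimately obtain s where "z = pt s" using e0(2)[OF z(1)] by blast
 thus ?thesis using off[of t q s] z(2) by simp
qed
have segY: "\<exists>q. 0 \<le> q \<and> q \<le> 1 \<and> x = proj (pt (- (2 * a) + q * a)) + (q * r) *. n" if x: "x \<in> cseg (proj x1) Y" for x
proof -
 obtain q where q: "0 \<le> q" "q \<le> 1" "x = (1 - q) *. proj x1 + q *. Y" using x unfolding closed_segment_def by blast
 have "x = ((1 - q) *. proj x1 + q *. X) + (q * r) *. n" unfolding q(3) Y_def by (simp add: algebra_simps)
 moreover have "(1 - q) * (- (2 * a)) + q * (- a) = - (2 * a) + q * a" by (simp add: algebra_simps)
 ultimately have "x = proj (pt (- (2 * a) + q * a)) + (q * r) *. n" unfolding X_def x1_def pconv by (simp only:)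
 thus ?thesis using q(1,2) by blast
qed
have qa: "- (2 * a) \<le> - (2 * a) + q * a \<and> - (2 * a) + q * a \<le> - a \<and> q * r \<le> r \<and> 0 \<le> q * r" if "0 \<le> q" "q \<le> 1" for q
 using mult_right_mono[OF that(2), of a] mult_right_mono[OF that(2), of r] mult_nonneg_nonneg[OF that(1), of a] mult_nonneg_nonneg[OF that(1), of r] a(1) r(1) by simp
have rc: "reach E c Y x1 (M - 2)"
 unfolding reach_def
proof (intro conjI ballI impI x1D(1,2,4))
 show "y = x1" if "y \<in> lk E" "proj y = proj x1" for y using x1D(3) that by blast
 show "y = x1 \<or> proj y = Y" if y: "y \<in> lk E" "proj y \<in> cseg (proj x1) Y" for y
 proof -
  obtain q where q: "0 \<le> q" "q \<le> 1" "proj y = proj (pt (- (2 * a) + q * a)) + (q * r) *. n" using segY[OF y(2)] by blast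
  have "q * r = 0" using line[OF y(1) q(3)] qa[OF q(1,2)] by blast
  hence "proj y = proj x1" using q(3) r(1) by (simp add: x1_def)
  thus ?thesis using x1D(3)[OF y(1)] by blast
 qed
 show "cr (Y - proj (fst e)) (dir e) ~= 0" if e: "e \<in> E" "x1 \<in> seg e" for e
 proof -
  obtain s where s: "s ~= 0" "pv = s *. dir e" using dirv[OF e] by blast
  obtain q where "x1 = at_edge e q" using e(2) in_seg_iff by blast
  hence p: "proj x1 = proj (fst e) + q *. dir e" by (simp add: proj_at_edge)
  have "Y - proj (fst e) = (X - proj x1) + (proj x1 - proj (fst e)) + r *. n" by (simp add: Y_def)
  moreover have "proj x1 - proj (fst e) = q *. dir e" using p by simp
  ultimately have "Y - proj (fst e) = (a * s) *. dir e + q *. dir e + r *. n" unfolding Xx1 s(2) by simp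
  hence "cr (Y - proj (fst e)) (dir e) = r * cr n (dir e)" by simp
  moreover have "cr n (dir e) ~= 0" using n unfolding s(2) by simp
  ultimately show ?thesis using r(1) by simp
 qed
qed
have Yn: "Y \<notin> proj ` lk E"
proof
 assume "Y \<in> proj ` lk E"
 then obtain z where "z \<in> lk E" "proj z = proj (pt (- a)) + r *. n" by (auto simp: Y_def X_def)
 hence "r = 0" using line[of z "- a" r] a(1) r(1) by simp
 thus False using r(1) by simp
qed
have XY: "proj y = X" if y: "y \<in> lk E" "proj y \<in> cseg X Y" for y
proof -
 obtain q where q: "0 \<le> q" "q \<le> 1" "proj y = (1 - q) *. X + q *. Y" using y(2) unfolding closed_segment_def by blast
 have py: "proj y = proj (pt (- a)) + (q * r) *. n" unfolding q(3) Y_def X_def by (simp add: algebra_simps)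
 have "q * r = 0" using line[OF y(1) py] qa[OF q(1,2)] a(1) by simp
 thus ?thesis using py by (simp add: X_def)
qed
have "Y - proj x1 = a *. pv + r *. n" unfolding Xx1[symmetric] Y_def by simp
moreover have "X - Y = (- r) *. n" by (simp add: Y_def)
ultimately have "cr (X - Y) (Y - proj x1) = - r * (a * cr n pv)" by (simp only: cr_simps) simp
hence tr: "cr (X - Y) (Y - proj x1) ~= 0" using r(1) a(1) n by simp
\<comment> \<open>The part of the strand that the hook must leave unchanged.\<close>
define K where "K = cseg (proj (pt (- a))) (proj (pt (t2 + a)))"
have K: "K = (\<lambda>t. proj (pt t)) ` {- a..t2 + a}" unfolding K_def by (rule pseg) (use a(1) t2 in simp)
hence ptK: "proj (pt t) \<in> K" if "- a \<le> t" "t \<le> t2 + a" for t using that by simp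
have "cseg (proj x1) Y \<inter> K = {}"
proof -
 have False if x: "x \<in> cseg (proj x1) Y" "x \<in> K" for x
 proof -
  obtain q where q: "x = proj (pt (- (2 * a) + q * a)) + (q * r) *. n" using segY[OF x(1)] by blast
  obtain t where t: "- a \<le> t" "x = proj (pt t)" using x(2) unfolding K by auto
  have "q * r = 0 \<and> t = - (2 * a) + q * a" using off[of "- (2 * a) + q * a" "q * r" t] q t(2) by metis
  thus False using r(1) t(1) a(1) by simp
 qed
 thus ?thesis by blast
qed
hence "\<exists>\<eta>>0. \<forall>x\<in>cseg (proj x1) Y. \<forall>y\<in>K. \<eta> \<le> dist x y"
 by (intro separate_compact_closed) (simp_all add: K_def)
then obtain \<eta> where eta: "0 < \<eta>" "\<And>x y. x \<in> cseg (proj x1) Y ==> y \<in> K ==> \<eta> \<le> dist x y" by blast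
have kM2: "M - 2 ~= M" by simp
obtain E1 c1 x0 T \<rho> where 1: "good 1 m M E c E1 c1" "germs E1 c1 M \<subseteq> germs E c M" "reach E1 c1 X x0 (M - 2)" "0 < \<rho>"
 "proj x0 - X = \<rho> *. (Y - X)" "closed T" "agree T E c E1 c1" "\<And>x. x \<in> T ==> \<exists>s\<in>cseg (proj x1) Y. dist x s < \<eta>"
 using hook[OF D(1,2) rc Yn XY tr D(3,4) kM2 eta(1)] by blast
have KT: "x \<notin> T" if "x \<in> K" for x
proof
 assume "x \<in> T"
 then obtain s where "s \<in> cseg (proj x1) Y" "dist x s < \<eta>" using 1(8) by blast
 thus False using eta(2)[of s x] that by (simp add: dist_commute)
qed
have S1: "St E1 c1" by (rule St_mv[OF S 1(1)])
note D1 = StD[OF S1]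
have ag: "x \<in> lk E1 \<longleftrightarrow> x \<in> lk E" "x \<in> fst ` E1 \<longleftrightarrow> x \<in> fst ` E" "x \<in> lk E ==> c1 x = c x" if "proj x \<notin> T" for x
 using 1(7) that unfolding agree_def by blast+
have Q1: "pt t \<in> lk E1" "pt t \<notin> fst ` E1" "c1 (pt t) = c (pt t)" if t: "- a \<le> t" "t \<le> t2 + a" for t
 using ag[OF KT[OF ptK[OF t]]] P1[of t] t a by auto
have simple1: "y = pt t" if t: "- a \<le> t" "t \<le> t2 + a" "t ~= 0" "t ~= t2" and y: "y \<in> lk E1" "proj y = proj (pt t)" for y t
proof (rule P2)
 show "y \<in> lk E" using ag(1)[of y] KT[OF ptK[OF t(1,2)]] y by simp
qed (use t a y in auto)
have na: "- a ~= 0" "- a ~= t2" "- a \<le> t2 + a" using a(1) t2 by auto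
have yv: "pt (- a) \<in> vis (lk E1)" using simple_vis[OF Q1(1)[OF order_refl na(3)]] simple1[OF order_refl na(3,1,2)] by blast
have cy: "c1 (pt (- a)) = M - 2" using Q1(3)[OF order_refl na(3)] PL[of "- a"] a t2 by simp
have Q: "\<forall>\<^sub>F y in nhds x. y \<in> lk E1 --> c1 y = M - 2" if x: "x \<in> lk E1" "proj x = X" for x
 using color_near[OF D1(2) yv] cy simple1[OF order_refl na(3,1,2) x(1)] x(2) by (simp add: X_def)
\<comment> \<open>The finger laid over \<open>X\<close> must not reach \<open>u\<close>, so that the
  strand emerges from it before the piece of colour \<open>M\<close> begins.\<close>
define U where "U = cseg (proj (pt 0)) (proj (pt (t2 + a)))"
have U: "closed U" "U \<inter> cseg (proj x0) X = {}"
proof -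
 have False if x: "x \<in> U" "x \<in> cseg (proj x0) X" for x
 proof -
  obtain t where t: "0 \<le> t" "t \<le> t2 + a" "x = proj (pt t)" using x(1) pseg[of 0 "t2 + a"] a(1) t2 unfolding U_def by auto
  have "pt t \<in> lk E1" using Q1(1)[of t] t a(1) by simp
  hence "pt t = x0 \<or> proj (pt t) = X" using 1(3) x(2) t(3) unfolding reach_def by blast
  thus False
  proof
   assume "pt t = x0"
   hence "proj (pt t) - X = (\<rho> * r) *. n" using 1(5) by (simp add: Y_def)
   hence "proj (pt (- a)) + (\<rho> * r) *. n = proj (pt t)" by (simp add: X_def algebra_simps)
   thus False using off[of "- a" "\<rho> * r" t] 1(4) r(1) by simp
  next
   assume "proj (pt t) = X"
   thus False using off[of "- a" 0 t] t(1) a(1) by (simp add: X_def)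
  qed
 qed
 thus "U \<inter> cseg (proj x0) X = {}" by blast
qed (simp add: U_def)
obtain A B \<alpha> \<beta> Z H p q r' P Q' where f: "finger E1 c1 A B \<alpha> \<beta> Z H p q r' P Q'" "c1 p = M - 2"
 and T0: "\<And>y. y \<in> lk E1 ==> proj y \<in> tri P Q' Z ==> y \<in> seg (A, B) \<and> c1 y = M - 2 \<and> y \<notin> fst ` E1 \<and> simple E1 y \<or> y \<notin> seg (A, B) \<and> c1 y = M - 2"
 and Xi: "X \<in> itri P Q' Z" and UT: "tri P Q' Z \<inter> U = {}"
 by (rule reach_finger[OF D1(1,2) 1(3) _ U, where Q' = "\<lambda>y. c1 y = M - 2"]) (erule (1) Q, blast)
interpret f: finger E1 c1 A B \<alpha> \<beta> Z H p q r' P Q' by (rule f)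
have fk: "f.k = M - 2" using f(2) by (simp add: f.k_def)
hence kM: "f.k ~= M" "f.k ~= M - 1" by simp_all
have CT: "c1 y = M - 2" if "y \<in> lk E1" "proj y \<in> tri P Q' Z" for y using T0[OF that] by blast
have T': "\<And>y. y \<in> lk E1 ==> proj y \<in> tri P Q' Z ==> y \<in> seg (A, B) \<and> c1 y = f.k \<and> y \<notin> fst ` E1 \<and> simple E1 y \<or> y \<notin> seg (A, B) \<and> c1 y = M - 2"
 using T0 unfolding fk .
have G: "good 1 m M E1 c1 f.E' f.c'" by (rule f.poke_good(1)[OF T' D1(3,4) kM(1)]) (use fk mM in auto)
have G4: "germs f.E' f.c' M \<subseteq> {x \<in> germs E1 c1 M. proj x \<notin> tri P Q' Z}"
 by (rule f.poke_good(4)[OF T' D1(3,4) kM(1) _ kM(2)]) (use fk mM in auto)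
have nov: "\<And>u w. w \<in> f.bs ==> \<not> ov (lk E1) u w" by (rule f.poke_good(5)[OF T' D1(3,4) kM(1)]) (use fk mM in auto)
have S2: "St f.E' f.c'" by (rule St_mv[OF S1 G])
note D2 = StD[OF S2]
define g where "g s = proj (pt (- a + s * a))" for s
have gc: "continuous_on {0..1} g" unfolding g_def pt_def by (intro continuous_intros)
have "proj u \<in> U" by (simp add: U_def pt0)
hence uT: "proj u \<notin> tri P Q' Z" using UT by blast
have g01: "g 0 \<in> itri P Q' Z" "g 1 \<notin> itri P Q' Z" using Xi uT subsetD[OF itri_subset, of "proj u" P Q' Z] by (auto simp: g_def X_def pt0)
obtain s0 where s0: "0 < s0" "s0 \<le> 1" "g s0 \<notin> itri P Q' Z" "g s0 \<in> closure (itri P Q' Z)"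
 using first_exit[OF gc open_itri g01] by blast
have gT: "g s0 \<in> tri P Q' Z" using s0(4) f.closure_itri by blast
hence s01: "s0 < 1" using uT s0(2) by (cases "s0 = 1") (auto simp: g_def pt0)
\<comment> \<open>The strand emerges here from under the finger. The side above it, of colour
  \<open>M - 2\<close>, is the over strand to be pushed along the piece.\<close>
define \<tau> where "\<tau> = - a + s0 * a"
have ta: "- a < \<tau>" "\<tau> < 0" using s0(1) s01 a(1) by (simp_all add: \<tau>_def)
define y1 where "y1 = pt \<tau>"
have py1: "proj y1 = g s0" by (simp add: y1_def g_def \<tau>_def)
have tr1: "- a \<le> \<tau>" "\<tau> \<le> t2 + a" "\<tau> ~= 0" "\<tau> ~= t2" using ta t2 a(1) by auto
have y1D: "y1 \<in> lk E1" "y1 \<notin> fst ` E1" using Q1[OF tr1(1,2)] by (simp_all add: y1_def)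
have at1: "at y1 within lk E1 = along y1 v"
 unfolding y1_def pt_def by (rule at_line[OF D1(1) _ v, where a = "- a" and b = "t2 + a"])
  (use Q1(1) Q1(2)[OF tr1(1,2)] ta t2 a(1) in \<open>simp_all add: pt_def\<close>)
\<comment> \<open>On the base the strand would coincide with the edge \<open>(A, B)\<close>, and
  \<open>X\<close> would lie on the line of the base and not in the interior of the
  triangle.\<close>
have nPQ: "proj y1 \<notin> cseg P Q'"
proof
 assume h: "proj y1 \<in> cseg P Q'"
 then obtain b where b: "b \<in> f.bs" "proj b = proj y1" using f.bs_over by blast
 hence "b = y1" using simple1[OF tr1, of b] f.bs_sub unfolding y1_def by blast
 hence "y1 \<in> seg (A, B)" using b(1) f.bs_sub by blast
 then obtain s where s: "pv = s *. dir (A, B)" using line_dir[OF D1(1) f.AB _ y1D(2) at1 v] unfolding pv_def by blast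
 have ba: "\<beta> - \<alpha> ~= 0" using f.ab by simp
 define \<mu> where "\<mu> = (- a - \<tau>) * s / (\<beta> - \<alpha>)"
 have "X = proj y1 + (- a - \<tau>) *. pv" by (simp add: X_def y1_def ppt algebra_simps)
 also have "(- a - \<tau>) *. pv = \<mu> *. (Q' - P)" unfolding f.PQ_diff s \<mu>_def using ba by simp
 finally have "bary Z P Q' X = bary Z P Q' (proj y1) + \<mu> * (cr (Q' - P) (P - Q') / cr (P - Z) (Q' - Z))" by (simp only: bary_move)
 moreover have "cr (Q' - P) (P - Q') = 0" by (rule cr_scale_self[of _ "- 1"]) simp
 moreover have "bary Z P Q' (proj y1) = 0" using h f.side_iff(3) by blast
 ultimately show False using Xi by (simp add: itri_def)
qed
hence sides: "proj y1 \<in> f.sides" using f.tri_cases gT s0(3) unfolding py1 by blast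
have yb: "y1 \<notin> f.bs" using nPQ f.bs_proj by blast
hence yF: "y1 \<notin> f.F" using f.F_D[OF y1D(1)] by (metis ends_in_segment)
obtain w where w: "w \<in> f.F" "ov (lk f.E') y1 w" using f.side_under[OF y1D(1) yb yF sides] by blast
have cw: "f.c' w = M - 2" using f.c'_F[OF w(1)] fk by simp
have at2: "at y1 within lk f.E' = along y1 v" using f.near_D(2)[OF y1D(1) yF yb] at1 by simp
\<comment> \<open>Far enough to pass the other end of the piece, at \<open>t2\<close>.\<close>
define t1 where "t1 = t2 + a - \<tau>"
have t1: "0 < t1" using ta t2 a(1) by (simp add: t1_def)
have yt: "y1 + t *. v = pt (\<tau> + t)" for t by (simp add: y1_def pt_def algebra_simps)
\<comment> \<open>Reflection in \<open>M - 2\<close> takes \<open>M\<close>, \<open>M - 1\<close>,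
  \<open>M - 2\<close> to \<open>M - 4\<close>, \<open>M - 3\<close>, \<open>M - 2\<close>; all lie
  in the range, below \<open>M\<close>.\<close>
have "\<exists>E2 c2. good 1 m M f.E' f.c' E2 c2 \<and> far 1 E2 c2 M \<subseteq> far 1 f.E' f.c' M - {y1 + t *. v |t. 0 \<le> t \<and> t \<le> t1} \<and>
  germs E2 c2 M \<subseteq> germs f.E' f.c' M - {y1 + t *. v |t. 0 \<le> t \<and> t \<le> t1}"
proof (rule edge_push[OF D2 w(2) at2 v t1])
 show "f.c' w ~= M" using cw by simp
 \<comment> \<open>At the crossing at \<open>y1\<close> all colours are \<open>M - 2\<close>, so no
   crossing of difference 1 is lost.\<close>
 show "\<bar>b - f.c' w\<bar> ~= 1" if b: "jump (lk f.E') f.c' y1 (f.c' w) b" for b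
 proof -
  have "jump (lk f.E') f.c' y1 f.k f.k" using f.side_jump[OF y1D(1) yb yF sides] CT[OF y1D(1)] gT py1 fk by auto
  hence "b = f.k \<or> b = 2 * f.k - f.k" using jump_unique[OF _ b[unfolded cw fk[symmetric]]] by blast
  thus ?thesis using cw fk by auto
 qed
 fix x assume x: "x \<in> lk f.E'" "proj x \<in> cseg (proj y1) (proj (y1 + t1 *. v))"
 have "proj x \<in> cseg (proj (u + \<tau> *. v)) (proj (u + (t2 + a) *. v))" using x(2) unfolding yt unfolding y1_def t1_def pt_def by simp
 then obtain t where t: "\<tau> \<le> t" "t \<le> t2 + a" "proj x = proj (pt t)" unfolding proj_line_segment[OF tr1(2)] pt_def by auto
 have tK: "- a \<le> t" using t(1) ta(1) by simp
 define N where "N y \<longleftrightarrow> (y \<in> vis (lk E1) --> c1 y = M - 1 \<or> c1 y = M - 2 \<or> c1 y = M \<and> (\<exists>t. 0 < t \<and> t < t2 \<and> y = pt t))" for y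
 have N: "\<forall>\<^sub>F y in nhds x. y \<in> lk E1 --> N y" if xD1: "x \<in> lk E1"
 proof -
  have xT: "proj x \<notin> T" using KT[OF ptK[OF tK t(2)]] t(3) by simp
  have xD: "x \<in> lk E" using ag(1)[OF xT] xD1 by blast
  have ow: "\<forall>\<^sub>F y in nhds x. y \<in> lk E --> c y = M - 1" if h: "x ~= z" "proj x = proj z" "ov (lk E) z w" "c w = M - 1" for z w
  proof -
   have "x = w" using gen_triple[OF D(1) xD, of z w] h unfolding ov_def by (metis less_irrefl)
   moreover have "w \<in> vis (lk E)" using ov_not_under[OF D(1) h(3)] h(3) unfolding ov_def by blast
   ultimately show ?thesis using color_near[OF D(2), of w] h(4) by simp
  qed
  have "\<forall>\<^sub>F y in nhds x. y \<in> lk E --> c y = M - 1 \<or> (\<exists>s. - \<delta> < s \<and> s < t2 + \<delta> \<and> y = pt s)"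
  proof (cases "x = pt t")
   case True
   show ?thesis unfolding True using nearl[of t] tK t(2) a by (auto elim!: eventually_mono simp del: split_paired_All)
  next
   case False
   hence "t = 0 \<or> t = t2" using P2[of t x] tK t(2,3) a xD by force
   hence "\<forall>\<^sub>F y in nhds x. y \<in> lk E --> c y = M - 1" using ow[OF False t(3)] w1 w2 pt0 by metis
   thus ?thesis by eventually_elim blast
  qed
  moreover have "\<forall>\<^sub>F y in nhds x. proj y \<in> - T" by (rule near_set[OF open_Compl[OF 1(6)]]) (use xT in simp)
  ultimately show ?thesis
  proof eventually_elim
   case (elim y)
   show ?case unfolding N_def
   proof (intro impI)
    assume y: "y \<in> lk E1" "y \<in> vis (lk E1)"
    have yT: "proj y \<notin> T" using elim(2) by blast
    have yE: "y \<in> lk E" "c1 y = c y" using ag[OF yT] y(1) by blast+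
    have yv: "y \<notin> und E" using agree_under[OF 1(7) yT] y(2) by blast
    from elim(1) yE(1) consider "c y = M - 1" | s where "- \<delta> < s" "s < t2 + \<delta>" "y = pt s" by blast
    thus "c1 y = M - 1 \<or> c1 y = M - 2 \<or> c1 y = M \<and> (\<exists>t. 0 < t \<and> t < t2 \<and> y = pt t)"
    proof cases
     case 1 thus ?thesis using yE(2) by simp
    next
     case (2 s)
     have "s ~= 0" "s ~= t2" using yv 2(3) w1(1) w2(1) pt0 unfolding under_ov by blast+
     then consider "s < 0 \<or> t2 < s" | "0 < s" "s < t2" by linarith
     thus ?thesis
     proof cases
      case 1 thus ?thesis using PL[OF 2(1,2)] 2(3) yE(2) by simp
     next
      case h: 2 thus ?thesis using PM[OF h] 2(3) yE(2) by auto
     qed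
    qed
   qed
  qed
 qed
 have "\<forall>\<^sub>F y in nhds x. y \<in> lk f.E' --> y \<in> vis (lk f.E') --> f.c' y = f.k \<or>
  N y \<and> y \<in> vis (lk E1) \<and> (proj y \<notin> tri P Q' Z \<and> f.c' y = c1 y \<or> proj y \<in> itri P Q' Z \<and> f.c' y = 2 * f.k - c1 y)"
  by (rule f.near_poke[OF x(1)]) (use nov N in blast)+
 thus "\<forall>\<^sub>F y in nhds x. y \<in> lk f.E' --> y \<in> vis (lk f.E') --> (\<exists>t<0. y = y1 + t *. v) \<or>
  m \<le> 2 * f.c' w - f.c' y \<and> 2 * f.c' w - f.c' y < M \<and> (f.c' y ~= M \<or> (\<exists>t. 0 < t \<and> t \<le> t1 \<and> y = y1 + t *. v))"
 proof eventually_elim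
  case (elim y)
  show ?case
  proof (intro impI)
   assume y: "y \<in> lk f.E'" "y \<in> vis (lk f.E')"
   have "f.c' y = M - 1 \<or> f.c' y = M - 2 \<or> f.c' y = M \<and> (\<exists>t. 0 < t \<and> t < t2 \<and> y = pt t)"
   proof -
    consider "f.c' y = f.k" | "N y" "y \<in> vis (lk E1)" "f.c' y = c1 y" | "y \<in> vis (lk E1)" "proj y \<in> itri P Q' Z" "f.c' y = 2 * f.k - c1 y" using elim y by metis
    thus ?thesis
    proof cases
     case 1 thus ?thesis using fk by simp
    next
     case 2 thus ?thesis unfolding N_def by simp
    next
     case 3
     have "c1 y = M - 2" using CT[of y] 3(1,2) itri_subset by blast
     thus ?thesis using 3(3) fk by simp
    qed
   qed
   thus "(\<exists>t<0. y = y1 + t *. v) \<or>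
    m \<le> 2 * f.c' w - f.c' y \<and> 2 * f.c' w - f.c' y < M \<and> (f.c' y ~= M \<or> (\<exists>t. 0 < t \<and> t \<le> t1 \<and> y = y1 + t *. v))"
   proof (elim disjE conjE exE)
    fix s assume s: "f.c' y = M" "0 < s" "s < t2" "y = pt s"
    have "y = y1 + (s - \<tau>) *. v" unfolding yt using s(4) by simp
    moreover have "0 < s - \<tau>" "s - \<tau> \<le> t1" using s ta a(1) by (simp_all add: t1_def)
    ultimately have "\<exists>t. 0 < t \<and> t \<le> t1 \<and> y = y1 + t *. v" by blast
    thus ?thesis using s(1) cw mM by simp
   qed (use cw mM in simp_all)
  qed
 qed
qed
then obtain E2 c2 where 2: "good 1 m M f.E' f.c' E2 c2" "germs E2 c2 M \<subseteq> germs f.E' f.c' M - {y1 + t *. v |t. 0 \<le> t \<and> t \<le> t1}" by blast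
have "u = y1 + (- \<tau>) *. v" unfolding yt using pt0 by simp
moreover have "0 \<le> - \<tau>" "- \<tau> \<le> t1" using ta t2 a(1) by (simp_all add: t1_def)
ultimately have "u \<in> {y1 + t *. v |t. 0 \<le> t \<and> t \<le> t1}" by blast
hence "germs E2 c2 M \<subset> germs E c M" using 2(2) G4 1(2) u by blast
thus ?thesis using good_trans[OF good_trans[OF 1(1) G] 2(1)] by blast
qed

end

section \<open>Shrinking the range to four consecutive colours\<close>

context unit_reduction
begin

text \<open>\<open>X\<close> is the finite set of obstacles of the current phase, \<open>G\<close>
  what the earlier phases have achieved.\<close>

lemma exhaust_moves:
 assumes "\<And>E c. St E c ==> finite (X E c)"
 and "\<And>E c. St E c ==> G E c ==> X E c ~= {} ==> \<exists>E1 c1. mv E c E1 c1 \<and> G E1 c1 \<and> X E1 c1 \<subset> X E c"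
 and "St E c" "G E c"
 shows "\<exists>E1 c1. mv E c E1 c1 \<and> G E1 c1 \<and> X E1 c1 = {}"
using assms(3,4)
proof (induction "card (X E c)" arbitrary: E c rule: less_induct)
case less
show ?case
proof (cases "X E c = {}")
 case True thus ?thesis using mv_refl[OF less.prems(1)] less.prems(2) by blast
next
 case False
 then obtain E1 c1 where 1: "mv E c E1 c1" "G E1 c1" "X E1 c1 \<subset> X E c" using assms(2)[OF less.prems] by blast
 have "card (X E1 c1) < card (X E c)" by (rule psubset_card_mono[OF assms(1)[OF less.prems(1)] 1(3)])
 then obtain E2 c2 where "mv E1 c1 E2 c2" "G E2 c2" "X E2 c2 = {}" using less.hyps[OF _ St_mv[OF less.prems(1) 1(1)] 1(2)] by blast
 thus ?thesis using good_trans[OF 1(1)] by blast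
qed
qed

text \<open>\<open>tops\<close> and \<open>far\<close> cannot grow under \<open>mv\<close>, so the
  result of a phase survives the next. Germs come last, since laying strands of colour
  \<open>M - 1\<close> over the colour \<open>M\<close> creates some.\<close>

lemma remove_top_color:
 assumes S: "St E c" shows "\<exists>E1 c1. reg E1 \<and> pcol (lk E1) c1 \<and> link_equiv (lk E) (lk E1) \<and> range_in E1 c1 m (M - 1) \<and> xdif (lk E1) c1 1"
proof -
have "\<exists>E1 c1. mv E c E1 c1 \<and> True \<and> tops E1 c1 M = {}"
proof (rule exhaust_moves[where X = "\<lambda>E c. tops E c M" and G = "\<lambda>_ _. True", OF _ _ S])
 fix E c assume h: "St E c" "tops E c M ~= {}"
 then obtain x where x: "x \<in> tops E c M" by blast
 obtain E1 c1 where 1: "mv E c E1 c1" "x \<notin> tops E1 c1 M" using phase_A[OF h(1) x] by blast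
 hence "tops E1 c1 M \<subset> tops E c M" using x unfolding good_def by blast
 thus "\<exists>E1 c1. mv E c E1 c1 \<and> True \<and> tops E1 c1 M \<subset> tops E c M" using 1(1) by blast
qed (auto intro: finite_obstacles StD)
then obtain E1 c1 where 1: "mv E c E1 c1" "tops E1 c1 M = {}" by blast
have "\<exists>E2 c2. mv E1 c1 E2 c2 \<and> tops E2 c2 M = {} \<and> far 1 E2 c2 M = {}"
proof (rule exhaust_moves[where X = "\<lambda>E c. far 1 E c M" and G = "\<lambda>E c. tops E c M = {}", OF _ _ St_mv[OF S 1(1)] 1(2)])
 fix E c assume h: "St E c" "tops E c M = {}" "far 1 E c M ~= {}"
 then obtain x where x: "x \<in> far 1 E c M" by blast
 obtain E1 c1 where 1: "mv E c E1 c1" "x \<notin> far 1 E1 c1 M" using phase_B[OF h(1,2) x] by blast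
 hence "far 1 E1 c1 M \<subset> far 1 E c M" "tops E1 c1 M = {}" using x h(2) unfolding good_def by blast+
 thus "\<exists>E1 c1. mv E c E1 c1 \<and> tops E1 c1 M = {} \<and> far 1 E1 c1 M \<subset> far 1 E c M" using 1(1) by blast
qed (auto intro: finite_obstacles StD)
then obtain E2 c2 where 2: "mv E1 c1 E2 c2" "tops E2 c2 M = {} \<and> far 1 E2 c2 M = {}" by blast
have S2: "St E2 c2" by (rule St_mv[OF St_mv[OF S 1(1)] 2(1)])
have "\<exists>E3 c3. mv E2 c2 E3 c3 \<and> (tops E3 c3 M = {} \<and> far 1 E3 c3 M = {}) \<and> germs E3 c3 M = {}"
proof (rule exhaust_moves[where X = "\<lambda>E c. germs E c M" and G = "\<lambda>E c. tops E c M = {} \<and> far 1 E c M = {}", OF _ _ S2 2(2)])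
 fix E c assume h: "St E c" "tops E c M = {} \<and> far 1 E c M = {}" "germs E c M ~= {}"
 then obtain x where x: "x \<in> germs E c M" by blast
 obtain E1 c1 where 1: "mv E c E1 c1" "germs E1 c1 M \<subset> germs E c M" using phase_C[OF h(1) _ _ x] h(2) by blast
 hence "tops E1 c1 M = {} \<and> far 1 E1 c1 M = {}" using h(2) unfolding good_def by blast
 thus "\<exists>E1 c1. mv E c E1 c1 \<and> (tops E1 c1 M = {} \<and> far 1 E1 c1 M = {}) \<and> germs E1 c1 M \<subset> germs E c M" using 1 by blast
qed (auto intro: finite_obstacles StD)
then obtain E3 c3 where 3: "mv E2 c2 E3 c3" "tops E3 c3 M = {}" "germs E3 c3 M = {}" by blast
have g: "mv E c E3 c3" by (rule good_trans[OF good_trans[OF 1(1) 2(1)] 3(1)])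
note D = StD[OF St_mv[OF S g]]
have "range_in E3 c3 m (M - 1)" unfolding range_in_def
proof
 fix x assume x: "x \<in> vis (lk E3)"
 have "c3 x ~= M" by (rule no_top[OF D(1,2) 3(2,3) x])
 thus "m \<le> c3 x \<and> c3 x \<le> M - 1" using D(3) x unfolding range_in_def by force
qed
thus ?thesis using D(1,2,4) g unfolding good_def by blast
qed

end

text \<open>For \<open>d = 1\<close> minimality of the difference is trivial, so the phases apply as
  long as \<open>M - m\<close> is at least 4, each time lowering \<open>M\<close> by 1.\<close>

lemma reduce_range:
 assumes "reg E" "pcol (lk E) c" "range_in E c m M" "xdif (lk E) c 1"
 shows "\<exists>E1 c1. reg E1 \<and> pcol (lk E1) c1 \<and> link_equiv (lk E) (lk E1) \<and> range_in E1 c1 m (m + 3) \<and> xdif (lk E1) c1 1"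
using assms
proof (induction "nat (M - m)" arbitrary: E c M rule: less_induct)
case less
show ?case
proof (cases "M \<le> m + 3")
 case True
 hence "range_in E c m (m + 3)" using less.prems(3) unfolding range_in_def by force
 thus ?thesis using less.prems link_equiv_refl by blast
next
 case False
 interpret unit_reduction m M "lk E" by unfold_locales (use False in auto)
 have "St E c" unfolding St_def using less.prems link_equiv_refl by blast
 then obtain E1 c1 where 1: "reg E1" "pcol (lk E1) c1" "link_equiv (lk E) (lk E1)" "range_in E1 c1 m (M - 1)" "xdif (lk E1) c1 1"
  using remove_top_color by blast
 have "nat (M - 1 - m) < nat (M - m)" using False by simp
 from less.hyps[OF this 1(1,2,4,5)] show ?thesis using link_equiv_trans[OF 1(3)] by blast
qed
qed

lemma simple_point_near:
 assumes R: "reg E" and col: "pcol (lk E) c" and x: "x \<in> vis (lk E)"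
 shows "\<exists>y. y \<in> lk E \<and> y \<notin> fst ` E \<and> simple E y \<and> c y = c x"
proof -
define B where "B = fst ` E \<union> {x \<in> lk E. \<exists>y\<in>lk E. y ~= x \<and> proj y = proj x}"
have "finite B" using finite_double[OF R] reg_finite[OF R] by (simp add: B_def)
hence "\<forall>\<^sub>F y in nhds x. y \<in> - (B - {x})" by (intro eventually_nhds_in_open open_Compl finite_imp_closed) auto
hence "\<forall>\<^sub>F y in at x within lk E. y \<in> lk E \<and> y \<notin> B" unfolding eventually_at_filter by eventually_elim auto
moreover have "\<forall>\<^sub>F y in at x within lk E. c y = c x" using col x unfolding pcol_def by blast
ultimately have "\<forall>\<^sub>F y in at x within lk E. y \<in> lk E \<and> y \<notin> B \<and> c y = c x" by eventually_elim blast
moreover have "at x within lk E ~= bot" using at_lk_neq_bot[OF R] x by blast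
ultimately have "\<exists>y. y \<in> lk E \<and> y \<notin> B \<and> c y = c x" by (metis (mono_tags, lifting) eventually_happens')
thus ?thesis unfolding B_def by blast
qed

text \<open>If some colour were not congruent to the others modulo \<open>d\<close>, a congruent strand could be
brought to it, which would produce a crossing with a smaller difference.\<close>

lemma colors_congruent:
 assumes R: "reg E" and col: "pcol (lk E) c" and eq: "link_equiv L (lk E)" and d: "0 < d"
 and min: "\<And>E c n. reg E ==> pcol (lk E) c ==> link_equiv L (lk E) ==> xdif (lk E) c n ==> 0 < n ==> d \<le> n"
 and o: "ov (lk E) u w" "jump (lk E) c u (c w) a" "\<bar>a - c w\<bar> = d" and x: "x \<in> vis (lk E)"
 shows "d dvd c x - c w"
proof (rule ccontr)
assume nd: "\<not> d dvd c x - c w"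
define r where "r = (c x - c w) mod d"
have r: "0 < r" "r < d" using nd d by (simp_all add: r_def dvd_eq_mod_eq_0 order_less_le[of 0])
have "d dvd (c x - c w) - r" by (simp add: r_def)
hence vd: "d dvd (c x - r) - c w" by (simp add: algebra_simps)
define lo hi where "lo = Min (c ` vis (lk E))" and "hi = Max (c ` vis (lk E))"
have fin: "finite (c ` vis (lk E))" by (rule finite_colors[OF R col])
have lh: "lo \<le> c y \<and> c y \<le> hi" if "y \<in> vis (lk E)" for y unfolding lo_def hi_def using fin that by simp
\<comment> \<open>The range is enlarged artificially: all colours now have distance at least
  \<open>3 * d\<close> from its ends, so \<open>supply_strand\<close> applies without presupposing
  congruence.\<close>
interpret reduction d "lo - 3 * d" "hi + 3 * d" L
 by unfold_locales (use d lh[OF x] min in \<open>auto simp del: split_paired_All\<close>)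
have S: "St E c" unfolding St_def
proof (intro conjI R col eq)
 show "range_in E c (lo - 3 * d) (hi + 3 * d)" unfolding range_in_def using lh d by force
 show "xdif (lk E) c d" unfolding xdif_def using o by blast
qed
obtain y where y: "y \<in> lk E" "y \<notin> fst ` E" "\<And>y'. y' \<in> lk E ==> proj y' = proj y ==> y' = y" "c y = c x"
 using simple_point_near[OF R col x] by blast
have cg: "d dvd c z - c w \<or> lo - 3 * d + 2 * d \<le> c z \<and> c z \<le> hi + 3 * d - 2 * d" if "z \<in> vis (lk E)" for z
 using lh[OF that] d by simp
have vr: "lo - 3 * d + d \<le> c x - r" "c x - r \<le> hi + 3 * d - d" using lh[OF x] r d by simp_all
have g: "(1, 0) ~= (0 :: real \<times> real)" "(1 :: real) ~= 0" by (simp_all add: prod_eq_iff)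
have "\<exists>E1 c1 x0 \<epsilon>. mv E c E1 c1 \<and> reach E1 c1 (proj y) x0 (c x - r) \<and> 0 < \<epsilon> \<and> agree (- ball (proj y) \<epsilon>) E c E1 c1 \<and>
 (\<forall>e\<in>E. cr (proj x0 - proj y) (dir e) ~= 0) \<and> 0 < cr (proj x0 - proj y) (1, 0) * 1"
 by (rule supply_strand[OF S o _ vr vd g]) (rule cg)
then obtain E1 c1 x0 \<epsilon> where 1: "mv E c E1 c1" "reach E1 c1 (proj y) x0 (c x - r)" "0 < \<epsilon>" "agree (- ball (proj y) \<epsilon>) E c E1 c1"
 by blast
have S1: "reg E1" "pcol (lk E1) c1" "link_equiv L (lk E1)" using St_mv[OF S 1(1)] by (auto simp: St_def)
have ag: "z \<in> lk E1 \<longleftrightarrow> z \<in> lk E" "z \<in> fst ` E1 \<longleftrightarrow> z \<in> fst ` E" "z \<in> lk E ==> c1 z = c z" if z: "proj z = proj y" for z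
proof -
 have "proj z \<notin> - ball (proj y) \<epsilon>" using z 1(3) by simp
 thus "z \<in> lk E1 \<longleftrightarrow> z \<in> lk E" "z \<in> fst ` E1 \<longleftrightarrow> z \<in> fst ` E" "z \<in> lk E ==> c1 z = c z"
  using 1(4) unfolding agree_def by blast+
qed
have y1: "y \<in> lk E1" "y \<notin> fst ` E1" "c1 y = c x" "\<And>y'. y' \<in> lk E1 ==> proj y' = proj y ==> y' = y"
 using ag[OF refl] y(1,2,4) ag(1) y(3) by simp_all
have Q: "\<forall>\<^sub>F z in nhds x'. z \<in> lk E1 --> z \<notin> fst ` E1 \<and> simple E1 z" if x': "x' \<in> lk E1" "proj x' = proj y" for x'
 unfolding y1(4)[OF x'] by (rule isolated_near[OF S1(1) y1(1,2)]) (rule y1(4))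
obtain A B \<alpha> \<beta> Z H p q r' P Q where f: "finger E1 c1 A B \<alpha> \<beta> Z H p q r' P Q" "c1 p = c x - r"
 and T: "\<And>z. z \<in> lk E1 ==> proj z \<in> tri P Q Z ==> z \<in> seg (A, B) \<and> c1 z = c x - r \<and> z \<notin> fst ` E1 \<and> simple E1 z \<or>
  z \<notin> seg (A, B) \<and> z \<notin> fst ` E1 \<and> simple E1 z"
 and yi: "proj y \<in> itri P Q Z" and "tri P Q Z \<inter> {} = {}"
 by (rule reach_finger[OF S1(1,2) 1(2) _ closed_empty, where Q' = "\<lambda>z. z \<notin> fst ` E1 \<and> simple E1 z"]) (erule (1) Q, simp, blast)
interpret f: finger E1 c1 A B \<alpha> \<beta> Z H p q r' P Q by (rule f)
have iso: "z \<notin> fst ` E1 \<and> simple E1 z" if "z \<in> lk E1" "proj z \<in> tri P Q Z" for z using T[OF that] by blast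
\<comment> \<open>The strand of \<open>y\<close> leaves the finger under a side of colour
  \<open>c x - r\<close>, which makes a crossing of difference \<open>r < d\<close>.\<close>
have "xdif (lk f.E') f.c' \<bar>c1 y - f.k\<bar>" by (rule f.exit_xdif[OF y1(1) yi]) (rule iso)
moreover have "\<bar>c1 y - f.k\<bar> = r" using f(2) y1(3) r(1) by (simp add: f.k_def)
ultimately have "xdif (lk f.E') f.c' r" by simp
hence "d \<le> r" by (rule min[OF f.reg_E' f.pcol_D' link_equiv_trans[OF S1(3) f.equiv_E'] _ r(1)])
thus False using r(2) by simp
qed

text \<open>On the colours the division by \<open>d\<close> is exact, so it respects the
  rule.\<close>

lemma rescale:
 assumes R: "reg E" and col: "pcol (lk E) c" and d: "0 < d" and x: "xdif (lk E) c d"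
 and cg: "\<And>x. x \<in> vis (lk E) ==> d dvd c x - c0"
 shows "pcol (lk E) (\<lambda>x. (c x - c0) div d)" "xdif (lk E) (\<lambda>x. (c x - c0) div d) 1"
proof -
let ?c = "\<lambda>x. (c x - c0) div d"
have dv: "\<exists>b. a = c0 + d * b \<and> (a - c0) div d = b" if "a \<in> c ` vis (lk E)" for a
proof -
 have "d dvd a - c0" using cg that by blast
 then obtain b where "a - c0 = d * b" by (auto elim: dvdE)
 thus ?thesis using d by (intro exI[of _ b]) simp
qed
have J: "jump (lk E) ?c u (?c w) ((a - c0) div d)" if o: "ov (lk E) u w" "jump (lk E) c u (c w) a" for u w a
proof -
 obtain b where b: "a = c0 + d * b" "(a - c0) div d = b" using dv jump_colors(1)[OF R o] by blast
 obtain k where k: "c w = c0 + d * k" "?c w = k" using dv jump_colors(3)[OF R o] by blast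
 have "2 * c w - a - c0 = d * (2 * k - b)" unfolding k b(1) by (simp add: algebra_simps)
 hence e: "(2 * c w - a - c0) div d = 2 * ?c w - (a - c0) div d" using d k b by simp
 obtain v where v: "v ~= 0" "at u within lk E = along u v"
  "\<forall>\<^sub>F t in at_right 0. c (u + t *. v) = a \<and> c (u - t *. v) = 2 * c w - a" using o(2) unfolding jump_def by blast
 have "\<forall>\<^sub>F t in at_right 0. ?c (u + t *. v) = (a - c0) div d \<and> ?c (u - t *. v) = 2 * ?c w - (a - c0) div d"
  using v(3) by eventually_elim (use e in simp)
 thus ?thesis unfolding jump_def using v(1,2) by blast
qed
show "pcol (lk E) ?c" unfolding pcol_def
proof (intro conjI ballI allI impI)
 fix x assume "x \<in> vis (lk E)"
 hence "\<forall>\<^sub>F y in at x within lk E. c y = c x" using col unfolding pcol_def by blast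
 thus "\<forall>\<^sub>F y in at x within lk E. ?c y = ?c x" by eventually_elim simp
next
 fix u w assume o: "ov (lk E) u w"
 then obtain a where "jump (lk E) c u (c w) a" using col unfolding pcol_def by blast
 thus "\<exists>a. jump (lk E) ?c u (?c w) a" using J[OF o] by blast
qed
obtain u w a where o: "ov (lk E) u w" "jump (lk E) c u (c w) a" "\<bar>a - c w\<bar> = d" using x unfolding xdif_def by blast
obtain b where b: "a = c0 + d * b" "(a - c0) div d = b" using dv jump_colors(1)[OF R o(1,2)] by blast
obtain k where k: "c w = c0 + d * k" "?c w = k" using dv jump_colors(3)[OF R o(1,2)] by blast
have "d * \<bar>b - k\<bar> = d * 1" using o(3) d unfolding b(1) k(1) by (simp add: abs_mult flip: right_diff_distrib)
hence "\<bar>(a - c0) div d - ?c w\<bar> = 1" using d b(2) k(2) by simp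
thus "xdif (lk E) ?c 1" unfolding xdif_def using J[OF o(1,2)] o(1) by blast
qed

text \<open>A least positive difference exists among all coloured diagrams of \<open>L\<close>,
  since by non-splittability the given colouring has a crossing of positive difference. Dividing by
  it gives difference 1, and the range shrinks to four consecutive integers. The surviving crossing
  of difference 1 keeps the colouring non-trivial, so the lower bound forces all four to
  occur.\<close>

lemma four_colors_suffice:
 assumes R: "reg E" and col: "pcol (lk E) c" and eq: "link_equiv L (lk E)" and ns: "\<not> splittable L"
 and xy: "x \<in> vis (lk E)" "y \<in> vis (lk E)" "c x ~= c y"
 shows "\<exists>E1 c1. reg E1 \<and> pcol (lk E1) c1 \<and> link_equiv L (lk E1) \<and> card (c1 ` vis (lk E1)) = 4"
proof -
have ns': "\<not> splittable (lk E)" if "link_equiv L (lk E)" for E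
 using ns link_equiv_trans[OF that] unfolding splittable_def by blast
define G where "G n \<longleftrightarrow> (\<exists>E c. reg E \<and> pcol (lk E) c \<and> link_equiv L (lk E) \<and> xdif (lk E) c (int n) \<and> 0 < n)" for n
obtain n where "0 < n" "xdif (lk E) c n" using exists_xdif[OF R col ns'[OF eq] xy] by blast
hence "G (nat n)" unfolding G_def using R col eq by (intro exI[of _ E] exI[of _ c]) simp
hence L: "G (LEAST n. G n)" "\<And>n. G n ==> (LEAST n. G n) \<le> n" by (auto intro: LeastI Least_le)
define d where "d = int (LEAST n. G n)"
obtain E0 c0 where 0: "reg E0" "pcol (lk E0) c0" "link_equiv L (lk E0)" "xdif (lk E0) c0 d" "0 < d"
 using L(1) unfolding G_def d_def by auto
have min: "d \<le> n" if "reg E" "pcol (lk E) c" "link_equiv L (lk E)" "xdif (lk E) c n" "0 < n" for E c n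
proof -
 have "G (nat n)" unfolding G_def using that by (intro exI[of _ E] exI[of _ c]) simp
 thus ?thesis using L(2)[of "nat n"] that(5) unfolding d_def by simp
qed
obtain u w a where o: "ov (lk E0) u w" "jump (lk E0) c0 u (c0 w) a" "\<bar>a - c0 w\<bar> = d" using 0(4) unfolding xdif_def by blast
have cg: "d dvd c0 x - c0 w" if "x \<in> vis (lk E0)" for x
 by (rule colors_congruent[OF 0(1,2,3,5) min o that])
define c1 where "c1 x = (c0 x - c0 w) div d" for x
have 1: "pcol (lk E0) c1" "xdif (lk E0) c1 1" unfolding c1_def by (rule rescale[OF 0(1,2,5,4)]; erule cg)+
have "range_in E0 c1 (Min (c1 ` vis (lk E0))) (Max (c1 ` vis (lk E0)))"
 unfolding range_in_def using finite_colors[OF 0(1) 1(1)] by simp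
from reduce_range[OF 0(1) 1(1) this 1(2)] obtain E2 c2 m where 2: "reg E2" "pcol (lk E2) c2" "link_equiv (lk E0) (lk E2)"
 "range_in E2 c2 m (m + 3)" "xdif (lk E2) c2 1" by blast
have e2: "link_equiv L (lk E2)" by (rule link_equiv_trans[OF 0(3) 2(3)])
obtain u' w' a' where o': "ov (lk E2) u' w'" "jump (lk E2) c2 u' (c2 w') a'" "\<bar>a' - c2 w'\<bar> = 1" using 2(5) unfolding xdif_def by blast
obtain x' y' where xy': "x' \<in> vis (lk E2)" "y' \<in> vis (lk E2)" "c2 x' = a'" "c2 y' = c2 w'"
 using jump_colors(1,3)[OF 2(1) o'(1,2)] by (metis imageE)
hence "c2 x' ~= c2 y'" using o'(3) by auto
hence "4 \<le> card (c2 ` vis (lk E2))" by (rule at_least_four_colors[OF 2(1,2) ns'[OF e2] xy'(1,2)])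
moreover have "c2 ` vis (lk E2) \<subseteq> {m..m + 3}" using 2(4) unfolding range_in_def by auto
hence "card (c2 ` vis (lk E2)) \<le> card {m..m + 3}" by (intro card_mono) auto
ultimately show ?thesis using 2(1,2) e2 by (intro exI[of _ E2] exI[of _ c2]) simp
qed

theorem theorem5p4:
  fixes L :: "pt set"
  assumes "polygonal_link L"
    and "\<not> splittable L"
    and "\<exists>D \<gamma>. diagram_of L D \<and> Zcoloring D \<gamma> \<and> card (\<gamma> ` arcs D) = 5"
  shows "mincol_Z L = 4"
proof -
have two: "\<exists>a\<in>A. \<exists>b\<in>A. a ~= b" if "1 < card A" for A :: "int set"
 using that by (metis card_le_Suc0_iff_eq card.infinite not_less One_nat_def zero_less_one not_less_zero)
obtain D \<gamma> where D: "diagram_of L D" "Zcoloring D \<gamma>" "card (\<gamma> ` arcs D) = 5" using assms(3) by blast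
obtain E where E: "reg E" "D = lk E" using D(1) unfolding diagram_of_def regular_link_reg by blast
obtain c where c: "pcol (lk E) c" "c ` vis (lk E) = \<gamma> ` arcs (lk E)" using Zcoloring_pcol[OF E(1) D(2)[unfolded E(2)]] by blast
have "1 < card (c ` vis (lk E))" using c(2) D(3) E(2) by simp
then obtain x y where xy: "x \<in> vis (lk E)" "y \<in> vis (lk E)" "c x ~= c y" using two by blast
have eq: "link_equiv L (lk E)" using D(1) E(2) unfolding diagram_of_def by simp
obtain E1 c1 where 1: "reg E1" "pcol (lk E1) c1" "link_equiv L (lk E1)" "card (c1 ` vis (lk E1)) = 4"
 using four_colors_suffice[OF E(1) c(1) eq assms(2) xy] by blast
obtain \<gamma>1 where g: "Zcoloring (lk E1) \<gamma>1" "\<gamma>1 ` arcs (lk E1) = c1 ` vis (lk E1)" using pcol_Zcoloring[OF 1(1,2)] by blast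
show ?thesis unfolding mincol_Z_def
proof (rule Least_equality)
 have "1 < card (\<gamma>1 ` arcs (lk E1))" using g(2) 1(4) by simp
 hence "nontrivial_coloring (lk E1) \<gamma>1" unfolding nontrivial_coloring_def using two by blast
 moreover have "diagram_of L (lk E1)" unfolding diagram_of_def regular_link_reg using 1(1,3) by blast
 ultimately show "\<exists>D \<gamma>. diagram_of L D \<and> Zcoloring D \<gamma> \<and> nontrivial_coloring D \<gamma> \<and> card (\<gamma> ` arcs D) = 4"
  using g 1(4) by metis
next
 fix n assume "\<exists>D \<gamma>. diagram_of L D \<and> Zcoloring D \<gamma> \<and> nontrivial_coloring D \<gamma> \<and> card (\<gamma> ` arcs D) = n"
 then obtain D \<gamma> where D: "diagram_of L D" "Zcoloring D \<gamma>" "nontrivial_coloring D \<gamma>" "card (\<gamma> ` arcs D) = n" by blast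
 obtain E where E: "reg E" "D = lk E" using D(1) unfolding diagram_of_def regular_link_reg by blast
 obtain c where c: "pcol (lk E) c" "c ` vis (lk E) = \<gamma> ` arcs (lk E)" using Zcoloring_pcol[OF E(1) D(2)[unfolded E(2)]] by blast
 obtain a b where "a \<in> c ` vis (lk E)" "b \<in> c ` vis (lk E)" "a ~= b" using D(3) unfolding nontrivial_coloring_def E(2) c(2) by blast
 then obtain x y where xy: "x \<in> vis (lk E)" "y \<in> vis (lk E)" "c x ~= c y" by blast
 have "link_equiv L (lk E)" using D(1) E(2) unfolding diagram_of_def by simp
 hence "\<not> splittable (lk E)" using assms(2) link_equiv_trans unfolding splittable_def by blast
 thus "4 \<le> n" using at_least_four_colors[OF E(1) c(1) _ xy] c(2) D(4) E(2) by simp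
qed
qed

end
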